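(* Let $\rho^{A_1\ldots A_mE}$ be an $(m+1)$-partite quantum state (finite-dimensional). For each legitimate player $j\in[m]$ let $\mathcal{E}^{(j)}=\{\mathcal{E}^{(j)}_{x_j}\}_{x_j\in\mathcal{X}_j}$ be a quantum instrument, i.e. a finite family of completely positive maps $\mathcal{E}^{(j)}_{x_j}:A_j\to A_j'$ whose sum is trace preserving. Define the classical-quantum state $$\omega^{X_1A_1'\ldots X_mA_m'E}=\sum_{x_1,\ldots,x_m}|x_1\rangle\langle x_1|^{X_1}\otimes\cdots\otimes|x_m\rangle\langle x_m|^{X_m}\otimes(\mathcal{E}^{(1)}_{x_1}\otimes\cdots\otimes\mathcal{E}^{(m)}_{x_m}\otimes\mathrm{id}_E)\rho^{A_1\ldots A_mE}.$$ Let $\mathcal{R}_{\mathrm{cq}}$ be the set of rate tuples $R_{[m]}=(R_1,\ldots,R_m)$ of nonnegative reals such that for every $j\in[m]$ and every $J\subseteq[m]\setminus\{j\}$, $$\sum_{i\in J}R_i\ \ge\ S(X_J\,|\,X_{[m]\setminus J},A_j')_\omega,$$ and let $R^{\mathrm{cq}}_{\mathrm{CO}}=\min_{R_{[m]}\in\mathcal{R}_{\mathrm{cq}}}\sum_{j=1}^m R_j$. Then $$K_{\mathrm{n.i.}}(\rho)\ \ge\ S(X_{[m]}\,|\,E)_\omega-R^{\mathrm{cq}}_{\mathrm{CO}}.$$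
   Context: Notation: $[m]=\{1,\ldots,m\}$; for $J\subseteq[m]$, $X_J=(X_j:j\in J)$. $S$ denotes von Neumann entropy and $S(A|B)_\sigma=S(AB)_\sigma-S(B)_\sigma$ the conditional entropy of a state $\sigma$; classical registers are treated as diagonal quantum systems. $\log$ is base 2. Non-interactive secret key agreement: $m$ legitimate players and an eavesdropper share $n$ copies $\rho^{\otimes n}$, player $j$ holding $A_j^n$ and the eavesdropper $E^n$. A protocol consists of (1) for each player $j$ an instrument $\{\mathcal{E}^{(j)}_{\ell_j}\}_{\ell_j\in\mathcal{L}_j}$ of completely positive maps $A_j^n\to A_j'$ summing to a trace-preserving map, with $|\mathcal{L}_j|\le 2^{nR_j}$ for some constants $R_j$; player $j$ applies it and publicly broadcasts $\ell_j$ (the eavesdropper receives a copy of all messages); (2) for each $j$ and each tuple $\ell_{[m]}$ a POVM $(D^{(j,\ell_{[m]})}_{k_j})_{k_j\in\mathcal{K}}$ on $A_j'$, whose outcome $k_j$ is player $j$'s key. The resulting state is $$\Omega^{K_1\ldots K_mL_{[m]}E^n}=\sum_{k_{[m]},\ell_{[m]}}|k_1\rangle\langle k_1|\otimes\cdots\otimes|k_m\rangle\langle k_m|\otimes|\ell_{[m]}\rangle\langle\ell_{[m]}|\otimes\mathrm{Tr}_{A'_{[m]}}\Big[\big((\textstyle\bigotimes_j\mathcal{E}^{(j)}_{\ell_j})\otimes\mathrm{id}_{E^n}\big)(\rho^{\otimes n})\,\big(\textstyle\bigotimes_j D^{(j,\ell_{[m]})}_{k_j}\otimes\mathbb{1}_{E^n}\big)\Big].$$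 It is an $(n,\varepsilon)$-protocol if $\Pr\{K_1=\cdots=K_m\}\ge1-\varepsilon$ and $\frac12\|\Omega^{K_1L_{[m]}E^n}-u_{K_1}\otimes\tau_0^{L_{[m]}E^n}\|_1\le\varepsilon$ for some fixed state $\tau_0$, where $u_{K_1}=\frac1{|\mathcal{K}|}\sum_{k}|k\rangle\langle k|$. $R$ is achievable if for all $n$ there are $(n,\varepsilon_n)$-protocols with $\varepsilon_n\to0$ and $\frac1n\log|\mathcal{K}|\to R$. The non-interactive secret-key capacity is $K_{\mathrm{n.i.}}(\rho)=\sup\{R: R\text{ achievable}\}$. *)

theory Defs
  imports Complex_Main "HOL-Library.FuncSet" "HOL-Library.Extended_Real"
begin

text \<open>An operator on a finite-dimensional system with orthonormal basis indexed by a finite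
set B is a matrix, i.e. a function B x B -> complex (values outside B are irrelevant).
A multipartite system has registers r in a finite set R, register r having dimension d r
with basis labels 0..<d r; the joint basis is the set of functions in PiE R.\<close>

type_synonym 'b op = "'b \<Rightarrow> 'b \<Rightarrow> complex"

definition basis :: "'r set \<Rightarrow> ('r \<Rightarrow> nat) \<Rightarrow> ('r \<Rightarrow> nat) set" where
  "basis R d = PiE R (\<lambda>r. {..<d r})"

definition unit_op :: "'b \<Rightarrow> 'b \<Rightarrow> 'b op" where
  "unit_op a b = (\<lambda>x y. if x = a \<and> y = b then 1 else 0)"

definition op_trace :: "'b set \<Rightarrow> 'b op \<Rightarrow> complex" where
  "op_trace B X = (\<Sum>x\<in>B. X x x)"

definition psd :: "'b set \<Rightarrow> 'b op \<Rightarrow> bool" where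
  "psd B X = (\<forall>v :: 'b \<Rightarrow> complex.
      Im (\<Sum>x\<in>B. \<Sum>y\<in>B. cnj (v x) * X x y * v y) = 0 \<and>
      Re (\<Sum>x\<in>B. \<Sum>y\<in>B. cnj (v x) * X x y * v y) \<ge> 0)"

definition density :: "'b set \<Rightarrow> 'b op \<Rightarrow> bool" where
  "density B X = (finite B \<and> psd B X \<and> op_trace B X = 1)"

definition spectral :: "'b set \<Rightarrow> 'b op \<Rightarrow> ('b \<Rightarrow> real) \<Rightarrow> ('b \<Rightarrow> 'b \<Rightarrow> complex) \<Rightarrow> bool" where
  "spectral B X lam e =
     ((\<forall>i\<in>B. \<forall>j\<in>B. (\<Sum>x\<in>B. cnj (e i x) * e j x) = (if i = j then 1 else 0)) \<and>
      (\<forall>x\<in>B. \<forall>y\<in>B. X x y = (\<Sum>i\<in>B. complex_of_real (lam i) * e i x * cnj (e i y))))"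

definition vn_entropy :: "'b set \<Rightarrow> 'b op \<Rightarrow> real" where
  "vn_entropy B X = (THE s. \<exists>lam e. spectral B X lam e \<and>
      s = - (\<Sum>i\<in>B. if lam i = 0 then 0 else lam i * log 2 (lam i)))"

definition trace_norm_h :: "'b set \<Rightarrow> 'b op \<Rightarrow> real" where
  "trace_norm_h B X = (THE s. \<exists>lam e. spectral B X lam e \<and> s = (\<Sum>i\<in>B. \<bar>lam i\<bar>))"

definition merge :: "'r set \<Rightarrow> ('r \<Rightarrow> nat) \<Rightarrow> ('r \<Rightarrow> nat) \<Rightarrow> ('r \<Rightarrow> nat)" where
  "merge S x z = (\<lambda>r. if r \<in> S then x r else z r)"

definition ptrace :: "'r set \<Rightarrow> ('r \<Rightarrow> nat) \<Rightarrow> 'r set \<Rightarrow> ('r \<Rightarrow> nat) op \<Rightarrow> ('r \<Rightarrow> nat) op" where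
  "ptrace R d S X = (\<lambda>x y. \<Sum>z\<in>basis (R - S) d. X (merge S x z) (merge S y z))"

definition subsys_entropy :: "'r set \<Rightarrow> ('r \<Rightarrow> nat) \<Rightarrow> ('r \<Rightarrow> nat) op \<Rightarrow> 'r set \<Rightarrow> real" where
  "subsys_entropy R d X S = vn_entropy (basis S d) (ptrace R d S X)"

definition cond_entropy :: "'r set \<Rightarrow> ('r \<Rightarrow> nat) \<Rightarrow> ('r \<Rightarrow> nat) op \<Rightarrow> 'r set \<Rightarrow> 'r set \<Rightarrow> real" where
  "cond_entropy R d X A B = subsys_entropy R d X (A \<union> B) - subsys_entropy R d X B"

definition linear_map :: "'a set \<Rightarrow> 'b set \<Rightarrow> ('a op \<Rightarrow> 'b op) \<Rightarrow> bool" where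
  "linear_map B C Phi =
     ((\<forall>X Y c. \<forall>x\<in>C. \<forall>y\<in>C. Phi (\<lambda>a b. c * X a b + Y a b) x y = c * Phi X x y + Phi Y x y) \<and>
      (\<forall>X Y. (\<forall>a\<in>B. \<forall>b\<in>B. X a b = Y a b) \<longrightarrow> (\<forall>x\<in>C. \<forall>y\<in>C. Phi X x y = Phi Y x y)))"

definition ext_anc :: "('a op \<Rightarrow> 'b op) \<Rightarrow> (nat \<times> 'a) op \<Rightarrow> (nat \<times> 'b) op" where
  "ext_anc Phi X = (\<lambda>(i, x) (i', y). Phi (\<lambda>a b. X (i, a) (i', b)) x y)"

definition completely_positive :: "'a set \<Rightarrow> 'b set \<Rightarrow> ('a op \<Rightarrow> 'b op) \<Rightarrow> bool" where
  "completely_positive B C Phi =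
     (linear_map B C Phi \<and>
      (\<forall>k::nat. \<forall>X. psd ({..<k} \<times> B) X \<longrightarrow> psd ({..<k} \<times> C) (ext_anc Phi X)))"

definition trace_preserving :: "'a set \<Rightarrow> 'b set \<Rightarrow> ('a op \<Rightarrow> 'b op) \<Rightarrow> bool" where
  "trace_preserving B C Phi = (\<forall>X. op_trace C (Phi X) = op_trace B X)"

definition instrument :: "'a set \<Rightarrow> 'b set \<Rightarrow> nat set \<Rightarrow> (nat \<Rightarrow> 'a op \<Rightarrow> 'b op) \<Rightarrow> bool" where
  "instrument B C L Phi =
     (finite L \<and> (\<forall>l\<in>L. completely_positive B C (Phi l)) \<and>
      trace_preserving B C (\<lambda>X. \<lambda>x y. \<Sum>l\<in>L. Phi l X x y))"

definition povm :: "'b set \<Rightarrow> nat set \<Rightarrow> (nat \<Rightarrow> 'b op) \<Rightarrow> bool" where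
  "povm C K M = ((\<forall>k\<in>K. psd C (M k)) \<and>
      (\<forall>x\<in>C. \<forall>y\<in>C. (\<Sum>k\<in>K. M k x y) = (if x = y then 1 else 0)))"

text \<open>(bigotimes_{j in J} Phi_j tensor id_E)(X): the players j in J act on their blocks of
registers P j, the registers Eregs are kept; the remaining registers must be covered by the
blocks. Player j's output has basis labels (nat); output basis element (o, e), o j the output
label of player j, e a basis element of the E registers. Defined by linearity via matrix units.\<close>
definition apply_maps ::
  "'r set \<Rightarrow> ('r \<Rightarrow> nat) \<Rightarrow> (nat \<Rightarrow> 'r set) \<Rightarrow> nat set \<Rightarrow> 'r set \<Rightarrow>
   (nat \<Rightarrow> ('r \<Rightarrow> nat) op \<Rightarrow> nat op) \<Rightarrow> ('r \<Rightarrow> nat) op \<Rightarrow>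
   (nat \<Rightarrow> nat) \<Rightarrow> ('r \<Rightarrow> nat) \<Rightarrow> (nat \<Rightarrow> nat) \<Rightarrow> ('r \<Rightarrow> nat) \<Rightarrow> complex" where
  "apply_maps R d P J Eregs Phi X ou e ou' e' =
     (\<Sum>u\<in>basis R d. \<Sum>v\<in>basis R d.
        if restrict u Eregs = e \<and> restrict v Eregs = e'
        then X u v * (\<Prod>j\<in>J. Phi j (unit_op (restrict u (P j)) (restrict v (P j))) (ou j) (ou' j))
        else 0)"

text \<open>Convention: rho lives on registers {0..m} with dimensions dA; register 0 is the
eavesdropper E, register j (1 <= j <= m) is player j's system A_j.\<close>

datatype wreg = RX nat | RA nat | RE

definition w_regs :: "nat \<Rightarrow> wreg set" where
  "w_regs m = RX ` {1..m} \<union> RA ` {1..m} \<union> {RE}"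

definition w_dims :: "(nat \<Rightarrow> nat) \<Rightarrow> (nat \<Rightarrow> nat) \<Rightarrow> (nat \<Rightarrow> nat) \<Rightarrow> wreg \<Rightarrow> nat" where
  "w_dims dA dA' N r = (case r of RX j \<Rightarrow> N j | RA j \<Rightarrow> dA' j | RE \<Rightarrow> dA 0)"

definition omega_cq ::
  "nat \<Rightarrow> (nat \<Rightarrow> nat) \<Rightarrow> (nat \<Rightarrow> nat \<Rightarrow> (nat \<Rightarrow> nat) op \<Rightarrow> nat op) \<Rightarrow> (nat \<Rightarrow> nat) op \<Rightarrow> (wreg \<Rightarrow> nat) op" where
  "omega_cq m dA Phi rho = (\<lambda>g g'.
     if (\<forall>j\<in>{1..m}. g (RX j) = g' (RX j))
     then apply_maps {0..m} dA (\<lambda>j. {j}) {1..m} {0} (\<lambda>j. Phi j (g (RX j))) rho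
            (\<lambda>j. g (RA j)) (restrict (\<lambda>_. g RE) {0}) (\<lambda>j. g' (RA j)) (restrict (\<lambda>_. g' RE) {0})
     else 0)"

definition rate_region_cq :: "nat \<Rightarrow> (wreg \<Rightarrow> nat) \<Rightarrow> (wreg \<Rightarrow> nat) op \<Rightarrow> (nat \<Rightarrow> real) set" where
  "rate_region_cq m dW w = {Rv. (\<forall>j\<in>{1..m}. Rv j \<ge> 0) \<and>
      (\<forall>j\<in>{1..m}. \<forall>J. J \<subseteq> {1..m} - {j} \<longrightarrow>
         (\<Sum>i\<in>J. Rv i) \<ge> cond_entropy (w_regs m) dW w (RX ` J) (RX ` ({1..m} - J) \<union> {RA j}))}"

definition R_CO_cq :: "nat \<Rightarrow> (wreg \<Rightarrow> nat) \<Rightarrow> (wreg \<Rightarrow> nat) op \<Rightarrow> real" where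
  "R_CO_cq m dW w = Inf ((\<lambda>Rv. \<Sum>j\<in>{1..m}. Rv j) ` rate_region_cq m dW w)"

definition tensor_pow :: "nat set \<Rightarrow> nat \<Rightarrow> (nat \<Rightarrow> nat) op \<Rightarrow> (nat \<times> nat \<Rightarrow> nat) op" where
  "tensor_pow R n X = (\<lambda>u v. \<Prod>t<n. X (restrict (\<lambda>j. u (j, t)) R) (restrict (\<lambda>j. v (j, t)) R))"

definition dims_n :: "(nat \<Rightarrow> nat) \<Rightarrow> nat \<times> nat \<Rightarrow> nat" where
  "dims_n dA = (\<lambda>(j, t). dA j)"

definition eve_basis :: "(nat \<Rightarrow> nat) \<Rightarrow> nat \<Rightarrow> (nat \<times> nat \<Rightarrow> nat) set" where
  "eve_basis dA n = basis ({0} \<times> {..<n}) (dims_n dA)"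

definition msg_set :: "nat \<Rightarrow> (nat \<Rightarrow> nat) \<Rightarrow> (nat \<Rightarrow> nat) set" where
  "msg_set m N = PiE {1..m} (\<lambda>j. {..<N j})"

text \<open>Unnormalised eavesdropper operator for message tuple l and key tuple k:
Tr_{A'}[((bigotimes_j Phi_j(l_j)) tensor id)(rho^n) (bigotimes_j D^{(j,l)}_{k_j} tensor 1)].\<close>
definition eve_op ::
  "nat \<Rightarrow> (nat \<Rightarrow> nat) \<Rightarrow> (nat \<Rightarrow> nat) op \<Rightarrow> nat \<Rightarrow> (nat \<Rightarrow> nat) \<Rightarrow>
   (nat \<Rightarrow> nat \<Rightarrow> (nat \<times> nat \<Rightarrow> nat) op \<Rightarrow> nat op) \<Rightarrow> (nat \<Rightarrow> (nat \<Rightarrow> nat) \<Rightarrow> nat \<Rightarrow> nat op) \<Rightarrow>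
   (nat \<Rightarrow> nat) \<Rightarrow> (nat \<Rightarrow> nat) \<Rightarrow> (nat \<times> nat \<Rightarrow> nat) op" where
  "eve_op m dA rho n dout Phi D l k = (\<lambda>e e'.
     \<Sum>ou\<in>PiE {1..m} (\<lambda>j. {..<dout j}). \<Sum>ou'\<in>PiE {1..m} (\<lambda>j. {..<dout j}).
       apply_maps ({0..m} \<times> {..<n}) (dims_n dA) (\<lambda>j. {j} \<times> {..<n}) {1..m} ({0} \<times> {..<n})
         (\<lambda>j. Phi j (l j)) (tensor_pow {0..m} n rho) ou e ou' e'
       * (\<Prod>j\<in>{1..m}. D j l (k j) (ou' j) (ou j)))"

text \<open>A (n, eps)-protocol with key set {..<Kc}, message sets {..<N j} with N j <= 2^(n Rs j),
player instruments Phi j (outputs of dimension dout j), decoding POVMs D j l, and reference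
state tau0 on L_[m] E^n.\<close>
definition ni_protocol_with ::
  "nat \<Rightarrow> (nat \<Rightarrow> nat) \<Rightarrow> (nat \<Rightarrow> nat) op \<Rightarrow> nat \<Rightarrow> (nat \<Rightarrow> real) \<Rightarrow> real \<Rightarrow> nat \<Rightarrow>
   (nat \<Rightarrow> nat) \<Rightarrow> (nat \<Rightarrow> nat) \<Rightarrow> (nat \<Rightarrow> nat \<Rightarrow> (nat \<times> nat \<Rightarrow> nat) op \<Rightarrow> nat op) \<Rightarrow>
   (nat \<Rightarrow> (nat \<Rightarrow> nat) \<Rightarrow> nat \<Rightarrow> nat op) \<Rightarrow> ((nat \<Rightarrow> nat) \<times> (nat \<times> nat \<Rightarrow> nat)) op \<Rightarrow> bool" where
  "ni_protocol_with m dA rho n Rs eps Kc N dout Phi D tau0 =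
     (Kc \<ge> 1 \<and>
      (\<forall>j\<in>{1..m}. real (N j) \<le> 2 powr (real n * Rs j) \<and>
          instrument (basis ({j} \<times> {..<n}) (dims_n dA)) {..<dout j} {..<N j} (Phi j)) \<and>
      (\<forall>j\<in>{1..m}. \<forall>l\<in>msg_set m N. povm {..<dout j} {..<Kc} (D j l)) \<and>
      density (msg_set m N \<times> eve_basis dA n) tau0 \<and>
      Re (\<Sum>l\<in>msg_set m N. \<Sum>\<kappa><Kc.
            op_trace (eve_basis dA n) (eve_op m dA rho n dout Phi D l (\<lambda>_. \<kappa>))) \<ge> 1 - eps \<and>
      trace_norm_h ({..<Kc} \<times> msg_set m N \<times> eve_basis dA n)
        (\<lambda>(k, l, e) (k', l', e').
           (if k = k' \<and> l = l' then
              (\<Sum>kk\<in>{kk \<in> PiE {1..m} (\<lambda>_. {..<Kc}). kk 1 = k}.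
                 eve_op m dA rho n dout Phi D l kk e e')
            else 0)
           - (if k = k' then 1 / of_nat Kc else 0) * tau0 (l, e) (l', e')) / 2 \<le> eps)"

definition ni_protocol ::
  "nat \<Rightarrow> (nat \<Rightarrow> nat) \<Rightarrow> (nat \<Rightarrow> nat) op \<Rightarrow> nat \<Rightarrow> (nat \<Rightarrow> real) \<Rightarrow> real \<Rightarrow> nat \<Rightarrow> bool" where
  "ni_protocol m dA rho n Rs eps Kc = (\<exists>N dout Phi D tau0.
      ni_protocol_with m dA rho n Rs eps Kc N dout Phi D tau0)"

definition achievable :: "nat \<Rightarrow> (nat \<Rightarrow> nat) \<Rightarrow> (nat \<Rightarrow> nat) op \<Rightarrow> real \<Rightarrow> bool" where
  "achievable m dA rho R = (\<exists>(Rs :: nat \<Rightarrow> real) (eps :: nat \<Rightarrow> real) (Kc :: nat \<Rightarrow> nat).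
      eps \<longlonglongrightarrow> 0 \<and> (\<lambda>n. log 2 (real (Kc n)) / real n) \<longlonglongrightarrow> R \<and>
      (\<forall>n. ni_protocol m dA rho n Rs (eps n) (Kc n)))"

definition K_ni :: "nat \<Rightarrow> (nat \<Rightarrow> nat) \<Rightarrow> (nat \<Rightarrow> nat) op \<Rightarrow> ereal" where
  "K_ni m dA rho = Sup (ereal ` {R. achievable m dA rho R})"

end

theory Submission
  imports Defs "HOL-Analysis.L2_Norm" "HOL-Analysis.Topology_Euclidean_Space" "HOL-Analysis.Function_Topology"
begin

text \<open>Every player applies its single-letter instrument to each of the \<open>n\<close> copies, hashes the resulting word
  \<open>x\<^sub>j\<close> into \<open>2\<^sup>n\<^sup>R\<close> bins and broadcasts the bin. From all bins, its own word and its quantum output it decodes the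
  whole tuple of words, and the key is a random function of that tuple. If the rates satisfy the strict versions
  of the constraints of the rate region, decoding succeeds; if in addition the key rate plus the total public rate
  is below \<open>S(X|E)\<close>, the key is almost independent of the messages and the eavesdropper.

  Decoding has to exclude, for every nonempty set \<open>J\<close> of players, all competitors that differ from the true tuple
  exactly on \<open>J\<close>. For each \<open>J\<close> there is a typical projection of the state that ignores \<open>x\<^sub>J\<close>; these do not commute, and
  they are combined into one test in the manner of Sen: the bad subspaces are tilted into distinct
  directions of an ancilla, where being close to each of the good subspaces implies being close to their
  intersection. The tests of the tuples in one bin are applied sequentially. Secrecy follows from a second-moment
  bound on a subspace of the dimension of the typical subspace of \<open>E\<close>. All random choices are
  derandomised by averaging.\<close>

section \<open>Linear algebra over a finite index set\<close>

text \<open>The classical registers make the state block diagonal, so its entropies are Shannon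
  entropies of the pair (block label, eigenvalue index). Every typicality argument is then Chebyshev
  for i.i.d. pairs, and S(X_J | rest, A_j) appears as a dimension 2^(n S(X_M A_j)) multiplied by an
  eigenvalue bound 2^(-n S(X_off J A_j)). The order of choices is forced. A tilt of size d costs a
  term proportional to d that does not shrink with n, while the typicality error is multiplied by a
  factor of order 1/d^2 for small d. Hence d is fixed first and n grows afterwards. The decoding
  error is a square root. What is averaged over the random bins is the quantity G under the root, so
  that the G of all players can be added and one binning serves everybody. The secrecy bound sees
  the binning only through the number of bins, so it holds for every binning: decoding fixes the
  bins, and the key function is chosen afterwards. Entropy and trace norm are given by
  \<open>THE\<close> over spectral decompositions, so existence and uniqueness of the spectrum come
  before any estimate.\<close>

definition ip :: "'b set \<Rightarrow> ('b \<Rightarrow> complex) \<Rightarrow> ('b \<Rightarrow> complex) \<Rightarrow> complex" where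
  "ip B u v = (\<Sum>x\<in>B. cnj (u x) * v x)"

definition nsq :: "'b set \<Rightarrow> ('b \<Rightarrow> complex) \<Rightarrow> real" where
  "nsq B u = (\<Sum>x\<in>B. (cmod (u x))\<^sup>2)"

definition nm :: "'b set \<Rightarrow> ('b \<Rightarrow> complex) \<Rightarrow> real" where
  "nm B u = sqrt (nsq B u)"

definition onf :: "'b set \<Rightarrow> 'k set \<Rightarrow> ('k \<Rightarrow> 'b \<Rightarrow> complex) \<Rightarrow> bool" where
  "onf B K e \<longleftrightarrow> finite K \<and> (\<forall>i\<in>K. \<forall>j\<in>K. ip B (e i) (e j) = (if i = j then 1 else 0))"

definition prj :: "'b set \<Rightarrow> 'k set \<Rightarrow> ('k \<Rightarrow> 'b \<Rightarrow> complex) \<Rightarrow> ('b \<Rightarrow> complex) \<Rightarrow> 'b \<Rightarrow> complex" where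
  "prj B K e v = (\<lambda>x. \<Sum>k\<in>K. ip B (e k) v * e k x)"

definition mv :: "'b set \<Rightarrow> 'b op \<Rightarrow> ('b \<Rightarrow> complex) \<Rightarrow> 'b \<Rightarrow> complex" where
  "mv B X v = (\<lambda>x. \<Sum>y\<in>B. X x y * v y)"

definition herm :: "'b set \<Rightarrow> 'b op \<Rightarrow> bool" where
  "herm B X \<longleftrightarrow> (\<forall>x\<in>B. \<forall>y\<in>B. X y x = cnj (X x y))"

lemma ip_cong: "(\<And>x. x \<in> B \<Longrightarrow> u x = u' x) \<Longrightarrow> (\<And>x. x \<in> B \<Longrightarrow> v x = v' x) \<Longrightarrow> ip B u v = ip B u' v'"
  by (auto simp: ip_def intro!: sum.cong)

lemma nsq_cong: "(\<And>x. x \<in> B \<Longrightarrow> u x = u' x) \<Longrightarrow> nsq B u = nsq B u'"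
  by (auto simp: nsq_def intro!: sum.cong)

lemma nm_cong: "(\<And>x. x \<in> B \<Longrightarrow> u x = u' x) \<Longrightarrow> nm B u = nm B u'"
  unfolding nm_def using nsq_cong[of B u u'] by simp

lemma ip_add_right: "ip B u (\<lambda>x. v x + w x) = ip B u v + ip B u w"
  by (simp add: ip_def algebra_simps sum.distrib)
lemma ip_add_left: "ip B (\<lambda>x. v x + w x) u = ip B v u + ip B w u"
  by (simp add: ip_def algebra_simps sum.distrib)
lemma ip_diff_right: "ip B u (\<lambda>x. v x - w x) = ip B u v - ip B u w"
  by (simp add: ip_def algebra_simps sum_subtractf)
lemma ip_diff_left: "ip B (\<lambda>x. v x - w x) u = ip B v u - ip B w u"
  by (simp add: ip_def algebra_simps sum_subtractf)
lemma ip_scale_right: "ip B u (\<lambda>x. c * v x) = c * ip B u v"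
  by (simp add: ip_def sum_distrib_left algebra_simps)
lemma ip_scale_left: "ip B (\<lambda>x. c * v x) u = cnj c * ip B v u"
  by (simp add: ip_def sum_distrib_left algebra_simps)
lemma ip_sum_right: "ip B u (\<lambda>x. \<Sum>i\<in>I. f i x) = (\<Sum>i\<in>I. ip B u (f i))"
  unfolding ip_def sum_distrib_left by (rule sum.swap)
lemma ip_sum_left: "ip B (\<lambda>x. \<Sum>i\<in>I. f i x) u = (\<Sum>i\<in>I. ip B (f i) u)"
  unfolding ip_def cnj_sum sum_distrib_right by (rule sum.swap)
lemma ip_cnj: "cnj (ip B u v) = ip B v u"
  by (simp add: ip_def mult.commute)
lemma ip_zero_right [simp]: "ip B u (\<lambda>x. 0) = 0" by (simp add: ip_def)

lemma ip_self: "ip B u u = of_real (nsq B u)"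
  unfolding ip_def nsq_def of_real_sum
  by (rule sum.cong) (auto simp: complex_norm_square mult.commute simp del: of_real_power)

lemma nsq_ge0 [simp]: "0 \<le> nsq B u" by (simp add: nsq_def sum_nonneg)
lemma nm_ge0 [simp]: "0 \<le> nm B u" by (simp add: nm_def)
lemma nm_sq: "(nm B u)\<^sup>2 = nsq B u" by (simp add: nm_def)
lemma nsq_0D: "finite B \<Longrightarrow> nsq B u = 0 \<Longrightarrow> x \<in> B \<Longrightarrow> u x = 0"
  by (simp add: nsq_def sum_nonneg_eq_0_iff)
lemma nsq_scale: "nsq B (\<lambda>x. c * u x) = (cmod c)\<^sup>2 * nsq B u"
  by (simp add: nsq_def norm_mult power_mult_distrib sum_distrib_left)
lemma nm_L2: "nm B u = L2_set (\<lambda>x. cmod (u x)) B"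
  by (simp add: nm_def nsq_def L2_set_def)
lemma nm_triangle: "nm B (\<lambda>x. u x + v x) \<le> nm B u + nm B v"
proof -
  have "L2_set (\<lambda>x. cmod (u x + v x)) B \<le> L2_set (\<lambda>x. cmod (u x) + cmod (v x)) B"
    by (rule L2_set_mono) (auto simp: norm_triangle_ineq)
  also have "\<dots> \<le> L2_set (\<lambda>x. cmod (u x)) B + L2_set (\<lambda>x. cmod (v x)) B"
    by (rule L2_set_triangle_ineq)
  finally show ?thesis by (simp add: nm_L2)
qed
lemma nm_minus: "nm B (\<lambda>x. - u x) = nm B u" by (simp add: nm_L2)
lemma nm_triangle_diff: "nm B (\<lambda>x. u x - v x) \<le> nm B u + nm B v"
  using nm_triangle[of B u "\<lambda>x. - v x"] by (simp add: nm_minus)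
lemma nm_sum: "finite I \<Longrightarrow> nm B (\<lambda>x. \<Sum>i\<in>I. f i x) \<le> (\<Sum>i\<in>I. nm B (f i))"
proof (induction I rule: finite_induct)
  case empty then show ?case by (simp add: nm_def nsq_def)
next
  case (insert i I)
  then show ?case using nm_triangle[of B "f i" "\<lambda>x. \<Sum>i\<in>I. f i x"] by simp
qed
lemma cauchy: "cmod (ip B u v) \<le> nm B u * nm B v"
proof -
  have "cmod (ip B u v) \<le> (\<Sum>x\<in>B. \<bar>cmod (u x)\<bar> * \<bar>cmod (v x)\<bar>)"
    unfolding ip_def by (rule order_trans[OF norm_sum]) (simp add: norm_mult)
  also have "\<dots> \<le> nm B u * nm B v" unfolding nm_L2 by (rule L2_set_mult_ineq)
  finally show ?thesis .
qed
lemma nsq_add: "nsq B (\<lambda>x. u x + v x) = nsq B u + nsq B v + 2 * Re (ip B u v)"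
proof -
  have "complex_of_real (nsq B (\<lambda>x. u x + v x)) = of_real (nsq B u) + of_real (nsq B v) + (ip B u v + cnj (ip B u v))"
    unfolding ip_self[symmetric] by (simp add: ip_add_left ip_add_right ip_cnj)
  also have "\<dots> = of_real (nsq B u + nsq B v + 2 * Re (ip B u v))"
    by (simp add: complex_add_cnj)
  finally show ?thesis using of_real_eq_iff by blast
qed

section \<open>Orthonormal families and the projections onto their spans\<close>

lemma onfD: "onf B K e \<Longrightarrow> i \<in> K \<Longrightarrow> j \<in> K \<Longrightarrow> ip B (e i) (e j) = (if i = j then 1 else 0)"
  by (simp add: onf_def)
lemma onf_fin: "onf B K e \<Longrightarrow> finite K" by (simp add: onf_def)
lemma onf_subset: "onf B K e \<Longrightarrow> L \<subseteq> K \<Longrightarrow> onf B L e"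
  unfolding onf_def by (meson finite_subset subsetD)

lemma ip_prj: assumes "onf B K e" "i \<in> K" shows "ip B (e i) (prj B K e v) = ip B (e i) v"
proof -
  have "ip B (e i) (prj B K e v) = (\<Sum>k\<in>K. ip B (e k) v * (if i = k then 1 else 0))"
    unfolding prj_def ip_sum_right ip_scale_right using onfD[OF assms(1,2)] by (auto intro!: sum.cong)
  then show ?thesis using assms by (simp add: onf_fin if_distrib sum.delta' cong: if_cong)
qed

lemma ip_prj_right: "ip B u (prj B K e v) = (\<Sum>k\<in>K. ip B u (e k) * ip B (e k) v)"
  unfolding prj_def ip_sum_right ip_scale_right by (simp add: mult.commute)

lemma ip_prj_left: "ip B (prj B K e v) u = (\<Sum>k\<in>K. ip B v (e k) * ip B (e k) u)"
  unfolding prj_def ip_sum_left ip_scale_left ip_cnj ..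

lemma prj_sa: "ip B (prj B K e u) v = ip B u (prj B K e v)"
  unfolding ip_prj_left ip_prj_right ..

lemma prj_idem: assumes "onf B K e" shows "prj B K e (prj B K e v) = prj B K e v"
  unfolding prj_def[of B K e "prj B K e v"] using ip_prj[OF assms] by (simp add: prj_def)

lemma prj_cong: "(\<And>x. x \<in> B \<Longrightarrow> u x = v x) \<Longrightarrow> prj B K e u = prj B K e v"
  unfolding prj_def by (intro ext sum.cong refl arg_cong2[of _ _ _ _ "(*)"] ip_cong) auto

lemma prj_add: "prj B K e (\<lambda>x. u x + v x) = (\<lambda>x. prj B K e u x + prj B K e v x)"
  by (simp add: prj_def ip_add_right algebra_simps sum.distrib)
lemma prj_diff: "prj B K e (\<lambda>x. u x - v x) = (\<lambda>x. prj B K e u x - prj B K e v x)"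
  by (simp add: prj_def ip_diff_right algebra_simps sum_subtractf)
lemma prj_scale: "prj B K e (\<lambda>x. c * u x) = (\<lambda>x. c * prj B K e u x)"
  by (simp add: prj_def ip_scale_right sum_distrib_left algebra_simps)
lemma prj_sum: "prj B K e (\<lambda>x. \<Sum>i\<in>I. f i x) = (\<lambda>x. \<Sum>i\<in>I. prj B K e (f i) x)"
  unfolding prj_def ip_sum_right sum_distrib_right by (rule ext, rule sum.swap)

lemma nsq_prj: assumes "onf B K e" shows "nsq B (prj B K e v) = (\<Sum>k\<in>K. (cmod (ip B (e k) v))\<^sup>2)"
proof -
  have "complex_of_real (nsq B (prj B K e v)) = ip B v (prj B K e v)"
    unfolding ip_self[symmetric] prj_sa prj_idem[OF assms] ..
  also have "\<dots> = (\<Sum>k\<in>K. cnj (ip B (e k) v) * ip B (e k) v)"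
    unfolding ip_prj_right ip_cnj ..
  also have "\<dots> = of_real (\<Sum>k\<in>K. (cmod (ip B (e k) v))\<^sup>2)"
    unfolding of_real_sum by (rule sum.cong) (auto simp: complex_norm_square mult.commute simp del: of_real_power)
  finally show ?thesis using of_real_eq_iff by blast
qed

lemma ip_prj_diff: assumes "onf B K e" shows "ip B (prj B K e u) (\<lambda>x. v x - prj B K e v x) = 0"
  unfolding ip_diff_right prj_sa prj_idem[OF assms] by simp

lemma ip_diff_prj: assumes "onf B K e"
  shows "ip B u (\<lambda>x. v x - prj B K e v x) = ip B (\<lambda>x. u x - prj B K e u x) (\<lambda>x. v x - prj B K e v x)"
  using ip_prj_diff[OF assms, of u v] by (simp add: ip_diff_left)

lemma pythagoras: assumes "onf B K e"
  shows "nsq B v = nsq B (prj B K e v) + nsq B (\<lambda>x. v x - prj B K e v x)"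
  using nsq_add[of B "prj B K e v" "\<lambda>x. v x - prj B K e v x"] ip_prj_diff[OF assms, of v v] by simp

lemma nsq_prj_le: "onf B K e \<Longrightarrow> nsq B (prj B K e v) \<le> nsq B v"
  using pythagoras[of B K e v] by simp
lemma nm_prj_le: "onf B K e \<Longrightarrow> nm B (prj B K e v) \<le> nm B v"
  by (simp add: nm_def nsq_prj_le)
lemma nm_diff_prj_le: "onf B K e \<Longrightarrow> nm B (\<lambda>x. v x - prj B K e v x) \<le> nm B v"
  using pythagoras[of B K e v] by (simp add: nm_def)
lemma bessel: "onf B K e \<Longrightarrow> (\<Sum>k\<in>K. (cmod (ip B (e k) v))\<^sup>2) \<le> nsq B v"
  using nsq_prj_le[of B K e v] by (simp add: nsq_prj)

text \<open>Labelling the new vectors by a subset of the old labels bounds the dimension. The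
  coefficient clause is the other inclusion of spans: it carries vanishing entries and orthogonality
  over from the \<open>h i\<close> to the basis, which \<open>tilted_test\<close> relies on.\<close>

lemma gram_schmidt:
  assumes "finite I" and fB: "finite B"
  shows "\<exists>K\<subseteq>I. \<exists>e. onf B K e \<and> (\<forall>i\<in>I. \<forall>x\<in>B. prj B K e (h i) x = h i x)
      \<and> (\<forall>k\<in>K. \<exists>c. e k = (\<lambda>x. \<Sum>i\<in>I. c i * h i x))"
  using assms(1)
proof (induction I rule: finite_induct)
  case empty
  show ?case by (rule exI[of _ "{}"]) (simp add: onf_def)
next
  case (insert i I)
  then obtain K e where K: "K \<subseteq> I" "onf B K e" and fx: "\<And>j x. j\<in>I \<Longrightarrow> x\<in>B \<Longrightarrow> prj B K e (h j) x = h j x"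
    and sp: "\<forall>k\<in>K. \<exists>c. e k = (\<lambda>x. \<Sum>i\<in>I. c i * h i x)" by blast
  obtain c where c: "\<And>k. k\<in>K \<Longrightarrow> e k = (\<lambda>x. \<Sum>i\<in>I. c k i * h i x)" using sp by metis
  have sp': "\<exists>d. e k = (\<lambda>x. \<Sum>j\<in>insert i I. d j * h j x)" if "k \<in> K" for k
  proof (rule exI[of _ "(c k)(i:=0)"], rule ext)
    fix x
    have "(\<Sum>j\<in>I. ((c k)(i := 0)) j * h j x) = (\<Sum>j\<in>I. c k j * h j x)" using insert(2) by (intro sum.cong) auto
    then show "e k x = (\<Sum>j\<in>insert i I. ((c k)(i := 0)) j * h j x)" using insert(1,2) fun_cong[OF c[OF that], of x] by simp
  qed
  define q where "q = (\<lambda>x. h i x - prj B K e (h i) x)"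
  show ?case
  proof (cases "\<forall>x\<in>B. q x = 0")
    case True
    then have "\<forall>j\<in>insert i I. \<forall>x\<in>B. prj B K e (h j) x = h j x" using fx by (auto simp: q_def)
    then show ?thesis using K(1,2) sp' by (intro exI[of _ K] conjI exI[of _ e]) auto
  next
    case False

      have q0: "nsq B q \<noteq> 0" using False nsq_0D[OF fB] by blast
      then have qp: "nsq B q > 0" using nsq_ge0[of B q] by linarith
      define g where "g = (\<lambda>x. complex_of_real (1 / sqrt (nsq B q)) * q x)"
      have iK: "i \<notin> K" using K insert by auto
      have gq: "ip B g g = 1" unfolding g_def ip_scale_left ip_scale_right ip_self using qp
        by (simp add: field_simps flip: of_real_mult)
      have kg: "ip B (e k) g = 0" if "k\<in>K" for k
        unfolding g_def ip_scale_right q_def ip_diff_right ip_prj[OF K(2) that] by simp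
      have gk: "ip B g (e k) = 0" if "k\<in>K" for k using kg[OF that] ip_cnj by (metis complex_cnj_zero)
      define e' where "e' = e(i := g)"
      have e'K: "\<And>k. k\<in>K \<Longrightarrow> e' k = e k" and e'i: "e' i = g" using iK by (auto simp: e'_def)
      have on: "onf B (insert i K) e'"
        using K iK onfD[OF K(2)] by (auto simp: onf_def e'K e'i gq kg gk)
      have pr: "prj B (insert i K) e' v = (\<lambda>x. prj B K e v x + ip B g v * g x)" for v
        unfolding prj_def using iK onf_fin[OF K(2)] e'K e'i by (auto simp: algebra_simps intro!: ext sum.cong)
      have gh: "ip B g (h j) = 0" if "j \<in> I" for j
      proof -
        have "ip B g (h j) = ip B g (prj B K e (h j))" using fx[OF that] by (intro ip_cong) auto
        also have "\<dots> = 0" unfolding ip_prj_right using gk by simp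
        finally show ?thesis .
      qed
      have ghi: "ip B g (h i) * g x = q x" for x
      proof -
        have "ip B g (h i) = ip B g q" unfolding q_def ip_diff_right ip_prj_right using gk by simp
        also have "\<dots> = of_real (sqrt (nsq B q))" unfolding g_def ip_scale_left ip_self complex_cnj_complex_of_real of_real_mult[symmetric] using qp
          by (simp add: real_div_sqrt)
        finally show ?thesis using qp by (simp add: g_def)
      qed
      have a: "\<forall>j\<in>insert i I. \<forall>x\<in>B. prj B (insert i K) e' (h j) x = h j x"
        using fx gh ghi by (auto simp: pr q_def)
      have "\<exists>d. g = (\<lambda>x. \<Sum>j\<in>insert i I. d j * h j x)"
      proof -
        let ?s = "complex_of_real (1 / sqrt (nsq B q))"
        have "prj B K e (h i) x = (\<Sum>j\<in>I. (\<Sum>k\<in>K. ip B (e k) (h i) * c k j) * h j x)" for x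
        proof -
          have "prj B K e (h i) x = (\<Sum>k\<in>K. \<Sum>j\<in>I. ip B (e k) (h i) * c k j * h j x)"
            unfolding prj_def
          proof (rule sum.cong[OF refl])
            fix k assume k: "k \<in> K"
            have "e k x = (\<Sum>j\<in>I. c k j * h j x)" using fun_cong[OF c[OF k], of x] .
            then show "ip B (e k) (h i) * e k x = (\<Sum>j\<in>I. ip B (e k) (h i) * c k j * h j x)"
              by (simp add: sum_distrib_left mult.assoc)
          qed
          then show ?thesis by (simp add: sum.swap[of _ K] sum_distrib_right)
        qed
        then have gx: "g x = ?s * (h i x - (\<Sum>j\<in>I. (\<Sum>k\<in>K. ip B (e k) (h i) * c k j) * h j x))" for x
          by (simp add: g_def q_def)
        then have "g = (\<lambda>x. \<Sum>j\<in>insert i I. (if j = i then ?s else - ?s * (\<Sum>k\<in>K. ip B (e k) (h i) * c k j)) * h j x)"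
        proof (intro ext)
          fix x
          have "(\<Sum>j\<in>I. (if j = i then ?s else - ?s * (\<Sum>k\<in>K. ip B (e k) (h i) * c k j)) * h j x)
            = (\<Sum>j\<in>I. - ?s * ((\<Sum>k\<in>K. ip B (e k) (h i) * c k j) * h j x))"
            using insert(2) by (intro sum.cong) auto
          then show "g x = (\<Sum>j\<in>insert i I. (if j = i then ?s else - ?s * (\<Sum>k\<in>K. ip B (e k) (h i) * c k j)) * h j x)"
            using insert(1,2) gx by (simp add: sum_negf sum_distrib_left[symmetric] right_diff_distrib del: of_real_divide)
        qed
        then show ?thesis
          by (rule exI[of _ "\<lambda>j. if j = i then ?s else - ?s * (\<Sum>k\<in>K. ip B (e k) (h i) * c k j)"])
      qed
      then have b: "\<forall>k\<in>insert i K. \<exists>d. e' k = (\<lambda>x. \<Sum>j\<in>insert i I. d j * h j x)"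
        using sp' e'K e'i by auto
      show ?thesis using K(1) on a b by blast
  qed
qed

section \<open>Dimension counting against the standard basis\<close>

definition kd :: "'b \<Rightarrow> 'b \<Rightarrow> complex" where "kd x = (\<lambda>y. if y = x then 1 else 0)"

lemma ip_kd: "finite B \<Longrightarrow> x \<in> B \<Longrightarrow> ip B (kd x) v = v x"
proof -
  assume "finite B" "x \<in> B"
  have "ip B (kd x) v = (\<Sum>y\<in>B. if y = x then v y else 0)" unfolding ip_def kd_def by (rule sum.cong) auto
  then show ?thesis using \<open>finite B\<close> \<open>x\<in>B\<close> by simp
qed
lemma ip_kd_right: "finite B \<Longrightarrow> x \<in> B \<Longrightarrow> ip B v (kd x) = cnj (v x)"
  using ip_kd[of B x v] ip_cnj[of B "kd x" v] by simp
lemma nsq_kd: "finite B \<Longrightarrow> x \<in> B \<Longrightarrow> nsq B (kd x) = 1"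
  using ip_self[of B "kd x"] ip_kd[of B x "kd x"] by (simp add: kd_def)

lemma nsq_onf: "onf B K e \<Longrightarrow> k \<in> K \<Longrightarrow> nsq B (e k) = 1"
  using onfD[of B K e k k] ip_self[of B "e k"] by simp

lemma onf_card_sum: assumes "onf B K e"
  shows "(\<Sum>x\<in>B. \<Sum>k\<in>K. (cmod (e k x))\<^sup>2) = real (card K)"
proof -
  have "(\<Sum>x\<in>B. \<Sum>k\<in>K. (cmod (e k x))\<^sup>2) = (\<Sum>k\<in>K. nsq B (e k))" unfolding nsq_def by (rule sum.swap)
  then show ?thesis using nsq_onf[OF assms] by simp
qed

lemma onf_pt_le: assumes "onf B K e" "finite B" "x\<in>B" shows "(\<Sum>k\<in>K. (cmod (e k x))\<^sup>2) \<le> 1"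
  using bessel[OF assms(1), of "kd x"] by (simp add: ip_kd_right nsq_kd assms)

text \<open>Double counting: the numbers \<open>\<Sum>k\<in>K. (cmod (e k x))\<^sup>2\<close> are at
  most 1 by Bessel and add up to \<open>card K = card B\<close>, so each of them equals 1. Then
  every standard basis vector is fixed by the projection.\<close>

lemma onf_complete:
  assumes on: "onf B K e" and fB: "finite B" and c: "card K = card B" and x: "x \<in> B"
  shows "prj B K e v x = v x"
proof -
  have eq: "(\<Sum>x\<in>B. \<Sum>k\<in>K. (cmod (e k x))\<^sup>2) = (\<Sum>x\<in>B. 1)" using onf_card_sum[OF on] c by simp
  have 1: "(\<Sum>k\<in>K. (cmod (e k x))\<^sup>2) = 1"
    by (rule sum_mono_inv[OF eq]) (use onf_pt_le[OF on fB] fB x in auto)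
  have "nsq B (prj B K e (kd x)) = 1" unfolding nsq_prj[OF on] using 1 by (simp add: ip_kd_right fB x)
  then have z: "nsq B (\<lambda>y. kd x y - prj B K e (kd x) y) = 0"
    using pythagoras[OF on, of "kd x"] nsq_kd[OF fB x] by simp
  have "v x - prj B K e v x = ip B (kd x) (\<lambda>y. v y - prj B K e v y)" by (simp add: ip_kd[OF fB x])
  also have "\<dots> = ip B (\<lambda>y. kd x y - prj B K e (kd x) y) (\<lambda>y. v y - prj B K e v y)" by (rule ip_diff_prj[OF on])
  also have "\<dots> = ip B (\<lambda>y. 0) (\<lambda>y. v y - prj B K e v y)" using nsq_0D[OF fB z] by (intro ip_cong) auto
  finally show ?thesis by (simp add: ip_def)
qed

text \<open>With fewer vectors than \<open>card B\<close> the same count leaves some x below 1, and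
  the residual of \<open>kd x\<close> is the new direction. It is cut to zero off B because
  \<open>eigen_extend\<close> looks for its maximiser among such functions.\<close>

lemma onf_extend:
  assumes on: "onf B K e" and fB: "finite B" and c: "card K < card B"
  shows "\<exists>v. (\<forall>k\<in>K. ip B (e k) v = 0) \<and> nsq B v = 1 \<and> (\<forall>x. x \<notin> B \<longrightarrow> v x = 0)"
proof -
  have "\<exists>x\<in>B. (\<Sum>k\<in>K. (cmod (e k x))\<^sup>2) < 1"
  proof (rule ccontr)
    assume "\<not> ?thesis"
    then have "(\<Sum>x\<in>B. 1) \<le> (\<Sum>x\<in>B. \<Sum>k\<in>K. (cmod (e k x))\<^sup>2)" by (intro sum_mono) force
    then show False using onf_card_sum[OF on] c by simp
  qed
  then obtain x where x: "x\<in>B" "(\<Sum>k\<in>K. (cmod (e k x))\<^sup>2) < 1" by blast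
  define q where "q = (\<lambda>y. kd x y - prj B K e (kd x) y)"
  have qp: "nsq B q > 0" using pythagoras[OF on, of "kd x"] x(2) nsq_prj[OF on, of "kd x"]
    by (simp add: q_def nsq_kd[OF fB x(1)] ip_kd_right[OF fB x(1)])
  define v where "v = (\<lambda>y. if y \<in> B then complex_of_real (1 / sqrt (nsq B q)) * q y else 0)"
  have vc: "nsq B v = nsq B (\<lambda>y. complex_of_real (1 / sqrt (nsq B q)) * q y)" by (rule nsq_cong) (simp add: v_def)
  have "ip B (e k) v = 0" if "k\<in>K" for k
  proof -
    have "ip B (e k) v = ip B (e k) (\<lambda>y. complex_of_real (1 / sqrt (nsq B q)) * q y)"
      by (rule ip_cong) (simp_all add: v_def)
    also have "\<dots> = 0" unfolding ip_scale_right q_def ip_diff_right ip_prj[OF on that] by simp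
    finally show ?thesis .
  qed
  moreover have "nsq B v = 1" unfolding vc nsq_scale using qp by (simp add: norm_divide power_divide)
  ultimately show ?thesis by (intro exI[of _ v]) (simp add: v_def)
qed

section \<open>Spectral theorem for Hermitian matrices\<close>

lemma herm_sa: assumes "herm B X" shows "ip B u (mv B X v) = ip B (mv B X u) v"
proof -
  have "ip B u (mv B X v) = (\<Sum>x\<in>B. \<Sum>y\<in>B. cnj (u x) * X x y * v y)"
    unfolding ip_def mv_def sum_distrib_left by (simp add: mult.assoc)
  also have "\<dots> = (\<Sum>y\<in>B. \<Sum>x\<in>B. cnj (u x) * X x y * v y)" by (rule sum.swap)
  also have "\<dots> = (\<Sum>y\<in>B. cnj (mv B X u y) * v y)"
    unfolding mv_def cnj_sum sum_distrib_right
  proof (intro sum.cong refl)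
    fix x y assume "x \<in> B" "y \<in> B"
    then have "X y x = cnj (X x y)" using assms unfolding herm_def by blast
    then have "cnj (X y x) = X x y" by (metis complex_cnj_cnj)
    then show "cnj (u x) * X x y * v y = cnj (X y x * u x) * v y" by simp
  qed
  finally show ?thesis by (simp add: ip_def)
qed

lemma mv_add: "mv B X (\<lambda>x. u x + v x) = (\<lambda>x. mv B X u x + mv B X v x)"
  by (simp add: mv_def algebra_simps sum.distrib)
lemma mv_scale: "mv B X (\<lambda>x. c * u x) = (\<lambda>x. c * mv B X u x)"
  by (simp add: mv_def algebra_simps sum_distrib_left)
lemma mv_cong: "(\<And>x. x \<in> B \<Longrightarrow> u x = v x) \<Longrightarrow> mv B X u = mv B X v"
  unfolding mv_def by (intro ext sum.cong) auto

text \<open>The quadratic form is maximised over the unit vectors orthogonal to the eigenvectors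
  already found. A maximiser is an eigenvector, since otherwise moving along the residual of the
  eigenvalue equation would increase the form.\<close>

lemma eigen_extend:
  assumes on: "onf B K e" and fB: "finite B" and c: "card K < card B" and he: "herm B X"
    and ev: "\<And>k x. k \<in> K \<Longrightarrow> x \<in> B \<Longrightarrow> mv B X (e k) x = complex_of_real (lam k) * e k x"
  shows "\<exists>v mu. (\<forall>k\<in>K. ip B (e k) v = 0) \<and> nsq B v = 1 \<and> (\<forall>x\<in>B. mv B X v x = complex_of_real mu * v x)"
proof -
  define C where "C = {v. (\<forall>x. x \<notin> B \<longrightarrow> v x = 0) \<and> nsq B v = 1 \<and> (\<forall>k\<in>K. ip B (e k) v = 0)}"
  \<comment> \<open>Functions vanishing off B with entries in the closed unit disc form a product of
    compact sets. Tychonoff thus supplies the compactness of the unit sphere without a normed vector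
    type.\<close>
  define D where "D = PiE UNIV (\<lambda>x. if x \<in> B then cball (0::complex) 1 else {0})"
  have "compactin (product_topology (\<lambda>_. euclidean) UNIV) D"
    unfolding D_def compactin_PiE by (auto simp: compactin_euclidean_iff)
  then have cD: "compact D" by (simp add: euclidean_product_topology compactin_euclidean_iff)
  have CD: "C \<subseteq> D"
  proof
    fix v assume v: "v \<in> C"
    have "cmod (v x) \<le> 1" if "x \<in> B" for x
    proof -
      have "(cmod (v x))\<^sup>2 \<le> nsq B v" unfolding nsq_def using that fB by (intro member_le_sum) auto
      then show ?thesis using v by (simp add: C_def power_le_one_iff)
    qed
    then show "v \<in> D" using v by (auto simp: D_def C_def)
  qed
  have cc: "continuous_on S (\<lambda>v::'a \<Rightarrow> complex. v x)" for S x
    using continuous_on_subset[OF continuous_on_product_coordinates subset_UNIV] .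
  have clC: "closed C"
  proof -
    have "C = (\<Inter>x\<in>-B. {v. v x = 0}) \<inter> {v. nsq B v = 1} \<inter> (\<Inter>k\<in>K. {v. ip B (e k) v = 0})"
      by (auto simp: C_def)
    moreover have "closed {v::'a \<Rightarrow> complex. v x = 0}" for x
      by (rule closed_Collect_eq) (auto intro!: continuous_intros cc)
    moreover have "closed {v. nsq B v = 1}" unfolding nsq_def
      by (rule closed_Collect_eq) (auto intro!: continuous_intros cc)
    moreover have "closed {v. ip B (e k) v = 0}" for k unfolding ip_def
      by (rule closed_Collect_eq) (auto intro!: continuous_intros cc)
    ultimately show ?thesis by (auto intro!: closed_INT closed_Int)
  qed
  have cC: "compact C" using compact_Int_closed[OF cD clC] CD by (simp add: Int_absorb1)
  have neC: "C \<noteq> {}" using onf_extend[OF on fB c] by (auto simp: C_def)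
  have "continuous_on C (\<lambda>v. Re (ip B v (mv B X v)))" unfolding ip_def mv_def
    by (intro continuous_intros cc)
  then obtain v where v: "v \<in> C" and mx: "\<And>w. w \<in> C \<Longrightarrow> Re (ip B w (mv B X w)) \<le> Re (ip B v (mv B X v))"
    using continuous_attains_sup[OF cC neC] by blast
  define mu where "mu = Re (ip B v (mv B X v))"
  have ray: "Re (ip B w (mv B X w)) \<le> mu * nsq B w" if w: "\<forall>k\<in>K. ip B (e k) w = 0" for w
  proof (cases "nsq B w = 0")
    case True
    then have "ip B w (mv B X w) = 0" using nsq_0D[OF fB True] by (simp add: ip_def)
    then show ?thesis using True by simp
  next
    case False
    then have p: "nsq B w > 0" using nsq_ge0[of B w] by linarith
    define s where "s = complex_of_real (1 / sqrt (nsq B w))"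
    define g where "g = (\<lambda>x. if x \<in> B then s * w x else 0)"
    have gs: "\<And>x. x \<in> B \<Longrightarrow> g x = s * w x" by (simp add: g_def)
    have "nsq B g = nsq B (\<lambda>x. s * w x)" by (rule nsq_cong) (rule gs)
    then have n: "nsq B g = 1" unfolding nsq_scale using p by (simp add: s_def norm_divide power_divide)
    have k0: "ip B (e k) g = 0" if "k \<in> K" for k
    proof -
      have "ip B (e k) g = ip B (e k) (\<lambda>x. s * w x)" by (rule ip_cong) (simp_all add: gs)
      then show ?thesis using w that by (simp add: ip_scale_right)
    qed
    have "g \<in> C" using n k0 by (simp add: C_def g_def)
    then have "Re (ip B g (mv B X g)) \<le> mu" using mx by (simp add: mu_def)
    moreover have "ip B g (mv B X g) = ip B (\<lambda>x. s * w x) (mv B X (\<lambda>x. s * w x))"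
    proof -
      have "mv B X g = mv B X (\<lambda>x. s * w x)" by (rule mv_cong) (rule gs)
      then show ?thesis using gs by (intro ip_cong) auto
    qed
    moreover have "\<dots> = of_real (1 / nsq B w) * ip B w (mv B X w)"
    proof -
      have "cnj s * s = of_real (1 / nsq B w)" unfolding s_def complex_cnj_complex_of_real of_real_mult[symmetric]
        using p by (simp add: field_simps)
      then show ?thesis unfolding mv_scale ip_scale_left ip_scale_right by (simp add: mult.assoc[symmetric])
    qed
    ultimately have "(1 / nsq B w) * Re (ip B w (mv B X w)) \<le> mu" by simp
    then show ?thesis using p by (simp add: field_simps)
  qed
  \<comment> \<open>Residual of the eigenvalue equation, which is also the direction of steepest
    change. It stays orthogonal to the \<open>e k\<close> because X is symmetric and they are
    eigenvectors.\<close>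
  define w where "w = (\<lambda>x. of_real mu * v x - mv B X v x)"
  have vk: "\<And>k. k\<in>K \<Longrightarrow> ip B (e k) v = 0" and nv: "nsq B v = 1" using v by (auto simp: C_def)
  have wk: "ip B (e k) w = 0" if "k\<in>K" for k
  proof -
    have "ip B (e k) (mv B X v) = ip B (mv B X (e k)) v" by (rule herm_sa[OF he])
    also have "\<dots> = ip B (\<lambda>x. of_real (lam k) * e k x) v" by (rule ip_cong) (auto simp: ev that)
    also have "\<dots> = 0" by (simp add: ip_scale_left vk that)
    finally show ?thesis by (simp add: w_def ip_diff_right ip_scale_right vk that)
  qed
  define G where "G = mu * nsq B w - Re (ip B w (mv B X w))"
  have G0: "G \<ge> 0" using ray[of w] wk by (simp add: G_def)
  define Nw where "Nw = nsq B w"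
  have key: "0 \<le> 2 * t * Nw + t\<^sup>2 * G" for t :: real
  proof -
    let ?u = "\<lambda>x. v x + of_real t * w x"
    have "\<forall>k\<in>K. ip B (e k) ?u = 0" by (simp add: ip_add_right ip_scale_right vk wk)
    from ray[OF this] have r: "Re (ip B ?u (mv B X ?u)) \<le> mu * nsq B ?u" .
    have n: "nsq B ?u = 1 + t\<^sup>2 * nsq B w + 2 * t * Re (ip B w v)"
      using ip_cnj[of B w v, symmetric] by (simp add: nsq_add nsq_scale nv ip_scale_right)
    have sa: "ip B v (mv B X w) = cnj (ip B w (mv B X v))" unfolding ip_cnj by (rule herm_sa[OF he])
    have m: "Re (ip B ?u (mv B X ?u)) = mu + t\<^sup>2 * Re (ip B w (mv B X w)) + 2 * t * Re (ip B w (mv B X v))"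
      unfolding mv_add mv_scale ip_add_left ip_add_right ip_scale_left ip_scale_right
      by (simp add: mu_def sa power2_eq_square)
    have "of_real Nw = of_real mu * ip B w v - ip B w (mv B X v)"
      unfolding Nw_def ip_self[symmetric] by (subst (2) w_def) (simp add: ip_diff_right ip_scale_right)
    then have "Nw = mu * Re (ip B w v) - Re (ip B w (mv B X v))"
      by (metis Re_complex_of_real minus_complex.sel(1) Re_complex_of_real scaleR_complex.sel(1) scaleR_conv_of_real)
    then have "2 * t * Nw = 2 * t * (mu * Re (ip B w v) - Re (ip B w (mv B X v)))" by simp
    then show ?thesis using r n m by (simp add: G_def algebra_simps)
  qed
  have "Nw = 0"
  proof (rule ccontr)
    assume "Nw \<noteq> 0"
    then have p: "Nw > 0" using nsq_ge0[of B w] by (simp add: Nw_def less_le)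
    \<comment> \<open>At t = -a the right side of \<open>key\<close> becomes -a^2 (G + 2), which is
      negative. The 1 in the denominator covers G = 0.\<close>
    define a where "a = Nw / (G + 1)"
    have a: "Nw = a * (G + 1)" "a > 0" using p G0 by (simp_all add: a_def)
    have "0 \<le> 2 * (- a) * Nw + (- a)\<^sup>2 * G" by (rule key)
    also have "\<dots> = - (a\<^sup>2 * (G + 2))" using a(1) by (simp add: algebra_simps power2_eq_square)
    also have "\<dots> < 0" using a(2) G0 by simp
    finally show False by simp
  qed
  then have "\<forall>x\<in>B. w x = 0" using nsq_0D[OF fB] by (auto simp: Nw_def)
  then have "\<forall>x\<in>B. mv B X v x = complex_of_real mu * v x" by (simp add: w_def)
  then show ?thesis using vk nv by blast
qed

lemma spectral_exists:
  assumes fB: "finite B" and he: "herm B X"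
  shows "\<exists>lam e. spectral B X lam e"
proof -
  have "\<exists>K e lam. K \<subseteq> B \<and> card K = n \<and> onf B K e \<and> (\<forall>k\<in>K. \<forall>x\<in>B. mv B X (e k) x = complex_of_real (lam k) * e k x)"
    if "n \<le> card B" for n
    using that
  proof (induction n)
    case 0
    show ?case by (rule exI[of _ "{}"]) (simp add: onf_def)
  next
    case (Suc n)
    then obtain K e lam where K: "K \<subseteq> B" "card K = n" "onf B K e"
      and ev': "\<forall>k\<in>K. \<forall>x\<in>B. mv B X (e k) x = complex_of_real (lam k) * e k x"
      using Suc_leD[OF Suc.prems] by blast
    have ev: "\<And>k x. k\<in>K \<Longrightarrow> x\<in>B \<Longrightarrow> mv B X (e k) x = complex_of_real (lam k) * e k x" using ev' by blast
    obtain v mu where v: "\<forall>k\<in>K. ip B (e k) v = 0" "nsq B v = 1" "\<forall>x\<in>B. mv B X v x = complex_of_real mu * v x"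
      using eigen_extend[OF K(3) fB _ he ev] K(2) Suc.prems by auto
    have "K \<noteq> B" using K(2) Suc.prems by auto
    then obtain i where i: "i \<in> B" "i \<notin> K" using K(1) by blast
    have v': "\<forall>k\<in>K. ip B v (e k) = 0" using v(1) ip_cnj by (metis complex_cnj_zero)
    define e' where "e' = e(i := v)"
    have e'K: "\<And>k. k\<in>K \<Longrightarrow> e' k = e k" and e'i: "e' i = v" using i by (auto simp: e'_def)
    have "onf B (insert i K) e'" using K(3) onfD[OF K(3)] v v' i
      by (auto simp: onf_def e'K e'i ip_self)
    moreover have "\<forall>k\<in>insert i K. \<forall>x\<in>B. mv B X (e' k) x = complex_of_real ((lam(i:=mu)) k) * e' k x"
      using ev v(3) i by (auto simp: e'K e'i)
    moreover have "card (insert i K) = Suc n" using i K onf_fin[OF K(3)] by simp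
    moreover have "insert i K \<subseteq> B" using i K by simp
    ultimately show ?case by blast
  qed
  from this[of "card B"] obtain K e lam where K: "K \<subseteq> B" "card K = card B" "onf B K e"
      and ev': "\<forall>k\<in>K. \<forall>x\<in>B. mv B X (e k) x = complex_of_real (lam k) * e k x" by blast
  have ev: "\<And>k x. k\<in>K \<Longrightarrow> x\<in>B \<Longrightarrow> mv B X (e k) x = complex_of_real (lam k) * e k x" using ev' by blast
  have KB: "K = B" using K fB by (simp add: card_subset_eq)
  have "X x y = (\<Sum>i\<in>B. complex_of_real (lam i) * e i x * cnj (e i y))" if xy: "x\<in>B" "y\<in>B" for x y
  proof -
    have "X x y = mv B X (kd y) x" unfolding mv_def kd_def using fB xy by (simp add: if_distrib sum.delta cong: if_cong)
    also have "mv B X (kd y) x = mv B X (prj B B e (kd y)) x"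
      using onf_complete[OF K(3) fB K(2)] KB by (subst mv_cong) auto
    also have "\<dots> = (\<Sum>i\<in>B. cnj (e i y) * mv B X (e i) x)"
      unfolding prj_def mv_def sum_distrib_left using xy fB
      by (subst sum.swap) (auto simp: ip_kd_right algebra_simps intro!: sum.cong)
    also have "\<dots> = (\<Sum>i\<in>B. complex_of_real (lam i) * e i x * cnj (e i y))"
      using ev xy KB by (intro sum.cong) (auto simp: algebra_simps)
    finally show ?thesis .
  qed
  then have "spectral B X lam e" using K(3) KB by (simp add: spectral_def onf_def ip_def)
  then show ?thesis by blast
qed

lemma spectral_onf: "finite B \<Longrightarrow> spectral B X lam e \<Longrightarrow> onf B B e"
  by (simp add: spectral_def onf_def ip_def)

lemma spectral_eq: "spectral B X lam e \<Longrightarrow> x\<in>B \<Longrightarrow> y\<in>B \<Longrightarrow> X x y = (\<Sum>i\<in>B. complex_of_real (lam i) * e i x * cnj (e i y))"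
  by (simp add: spectral_def)

lemma spectral_mv: assumes "finite B" "spectral B X lam e" "x \<in> B"
  shows "mv B X v x = (\<Sum>i\<in>B. complex_of_real (lam i) * ip B (e i) v * e i x)"
proof -
  have "mv B X v x = (\<Sum>y\<in>B. \<Sum>i\<in>B. complex_of_real (lam i) * e i x * cnj (e i y) * v y)"
    unfolding mv_def sum_distrib_right[symmetric] using spectral_eq[OF assms(2,3)] by (intro sum.cong) auto
  also have "\<dots> = (\<Sum>i\<in>B. \<Sum>y\<in>B. complex_of_real (lam i) * e i x * cnj (e i y) * v y)" by (rule sum.swap)
  finally show ?thesis unfolding ip_def by (simp add: sum_distrib_left sum_distrib_right algebra_simps)
qed

lemma spectral_eigen: assumes "finite B" "spectral B X lam e" "x \<in> B" "j \<in> B"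
  shows "mv B X (e j) x = complex_of_real (lam j) * e j x"
proof -
  have "mv B X (e j) x = (\<Sum>i\<in>B. if i = j then complex_of_real (lam j) * e j x else 0)"
    unfolding spectral_mv[OF assms(1-3)] using onfD[OF spectral_onf[OF assms(1,2)]] assms(4)
    by (intro sum.cong) auto
  then show ?thesis using assms by simp
qed

lemma spectral_herm: assumes "spectral B X lam e" shows "herm B X"
  unfolding herm_def using spectral_eq[OF assms] by (auto simp: algebra_simps intro!: sum.cong)

lemma spectral_qf: assumes "finite B" "spectral B X lam e"
  shows "ip B u (mv B X v) = (\<Sum>i\<in>B. complex_of_real (lam i) * ip B u (e i) * ip B (e i) v)"
proof -
  have "ip B u (mv B X v) = ip B u (\<lambda>x. \<Sum>i\<in>B. complex_of_real (lam i) * ip B (e i) v * e i x)"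
    using spectral_mv[OF assms] by (intro ip_cong) auto
  then show ?thesis unfolding ip_sum_right ip_scale_right by (simp add: algebra_simps)
qed

text \<open>The squared overlaps of two eigenbases form a doubly stochastic matrix whose entry (i,
  j) vanishes unless \<open>lam i = mu j\<close>. Summing it against f by rows and by columns gives
  both sides. This is what makes the \<open>THE\<close> in entropy and trace norm
  meaningful.\<close>

lemma spectral_fun_unique:
  fixes f :: "real \<Rightarrow> real"
  assumes fB: "finite B" and s1: "spectral B X lam e" and s2: "spectral B X mu g"
  shows "(\<Sum>i\<in>B. f (lam i)) = (\<Sum>i\<in>B. f (mu i))"
proof -
  have one: "(\<Sum>j\<in>B. (cmod (ip B (g' j) (e' i)))\<^sup>2) = 1" if "onf B B g'" "onf B B e'" "i\<in>B" for i g' e'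
  proof -
    have "(\<Sum>j\<in>B. (cmod (ip B (g' j) (e' i)))\<^sup>2) = nsq B (prj B B g' (e' i))" by (rule nsq_prj[OF that(1), symmetric])
    also have "\<dots> = nsq B (e' i)" using onf_complete[OF that(1) fB refl] by (intro nsq_cong) auto
    finally show ?thesis using nsq_onf[OF that(2,3)] by simp
  qed
  have o: "onf B B e" "onf B B g" using spectral_onf fB s1 s2 by auto
  have ov: "f (lam i) * (cmod (ip B (g j) (e i)))\<^sup>2 = f (mu j) * (cmod (ip B (g j) (e i)))\<^sup>2" if "i\<in>B" "j\<in>B" for i j
  proof -
    have "ip B (g j) (mv B X (e i)) = of_real (lam i) * ip B (g j) (e i)"
      unfolding ip_scale_right[symmetric] by (rule ip_cong) (simp_all add: spectral_eigen[OF fB s1 _ that(1)])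
    moreover have "ip B (mv B X (g j)) (e i) = of_real (mu j) * ip B (g j) (e i)"
    proof -
      have "ip B (mv B X (g j)) (e i) = ip B (\<lambda>x. of_real (mu j) * g j x) (e i)"
        by (rule ip_cong) (simp_all add: spectral_eigen[OF fB s2 _ that(2)])
      then show ?thesis by (simp add: ip_scale_left)
    qed
    ultimately have "of_real (lam i) * ip B (g j) (e i) = of_real (mu j) * ip B (g j) (e i)"
      using herm_sa[OF spectral_herm[OF s1], of "g j" "e i"] by metis
    then have "ip B (g j) (e i) = 0 \<or> lam i = mu j" by (metis mult_right_cancel of_real_eq_iff)
    then show ?thesis by auto
  qed
  have "(\<Sum>i\<in>B. f (lam i)) = (\<Sum>i\<in>B. \<Sum>j\<in>B. f (lam i) * (cmod (ip B (g j) (e i)))\<^sup>2)"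
    unfolding sum_distrib_left[symmetric] using one[OF o(2,1)] by simp
  also have "\<dots> = (\<Sum>i\<in>B. \<Sum>j\<in>B. f (mu j) * (cmod (ip B (g j) (e i)))\<^sup>2)" using ov by (intro sum.cong refl) auto
  also have "\<dots> = (\<Sum>j\<in>B. \<Sum>i\<in>B. f (mu j) * (cmod (ip B (g j) (e i)))\<^sup>2)" by (rule sum.swap)
  also have "\<dots> = (\<Sum>j\<in>B. \<Sum>i\<in>B. f (mu j) * (cmod (ip B (e i) (g j)))\<^sup>2)"
  proof -
    have "cmod (ip B (g j) (e i)) = cmod (ip B (e i) (g j))" for i j using ip_cnj complex_mod_cnj by metis
    then show ?thesis by simp
  qed
  also have "\<dots> = (\<Sum>j\<in>B. f (mu j))"
    unfolding sum_distrib_left[symmetric] using one[OF o] by simp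
  finally show ?thesis .
qed

section \<open>Entropy and trace norm read off any spectral decomposition\<close>

lemma vn_entropy_eq:
  assumes "finite B" "spectral B X lam e"
  shows "vn_entropy B X = - (\<Sum>i\<in>B. if lam i = 0 then 0 else lam i * log 2 (lam i))"
  unfolding vn_entropy_def
proof (rule the_equality)
  fix s assume "\<exists>lam e. spectral B X lam e \<and> s = - (\<Sum>i\<in>B. if lam i = 0 then 0 else lam i * log 2 (lam i))"
  then obtain mu g where "spectral B X mu g" "s = - (\<Sum>i\<in>B. if mu i = 0 then 0 else mu i * log 2 (mu i))" by blast
  then show "s = - (\<Sum>i\<in>B. if lam i = 0 then 0 else lam i * log 2 (lam i))"
    using spectral_fun_unique[OF assms, of mu g "\<lambda>t. if t = 0 then 0 else t * log 2 t"] by simp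
qed (use assms(2) in blast)

lemma trace_norm_eq:
  assumes "finite B" "spectral B X lam e"
  shows "trace_norm_h B X = (\<Sum>i\<in>B. \<bar>lam i\<bar>)"
  unfolding trace_norm_h_def
proof (rule the_equality)
  fix s assume "\<exists>lam e. spectral B X lam e \<and> s = (\<Sum>i\<in>B. \<bar>lam i\<bar>)"
  then obtain mu g where "spectral B X mu g" "s = (\<Sum>i\<in>B. \<bar>mu i\<bar>)" by blast
  then show "s = (\<Sum>i\<in>B. \<bar>lam i\<bar>)"
    using spectral_fun_unique[OF assms, of mu g abs] by simp
qed (use assms(2) in blast)

section \<open>Positive semidefinite matrices as Gram matrices\<close>

lemma qf_eq: "(\<Sum>x\<in>B. \<Sum>y\<in>B. cnj (v x) * X x y * v y) = ip B v (mv B X v)"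
  unfolding ip_def mv_def sum_distrib_left by (simp add: mult.assoc)

lemma psd_alt: "psd B X \<longleftrightarrow> (\<forall>v. Im (ip B v (mv B X v)) = 0 \<and> Re (ip B v (mv B X v)) \<ge> 0)"
  by (simp add: psd_def qf_eq)

lemma mv_kd: assumes "finite B" "y \<in> B" shows "mv B X (kd y) = (\<lambda>x. X x y)"
  unfolding mv_def kd_def using assms by (simp add: if_distrib sum.delta cong: if_cong)

lemma psd_herm: assumes fB: "finite B" and p: "psd B X" shows "herm B X"
proof -
  have im: "Im (ip B v (mv B X v)) = 0" for v using p by (simp add: psd_alt)
  { fix x y assume xy: "x\<in>B" "y\<in>B"
    have a: "Im (X x x) = 0" if "x\<in>B" for x using im[of "kd x"] by (simp add: mv_kd ip_kd fB that)
    \<comment> \<open>Polarisation: the form is real at \<open>kd x + c * kd y\<close>. The choice c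
      = 1 compares the imaginary parts of the two off-diagonal entries, c = \<i> their real
      parts.\<close>
    have "Im (ip B (\<lambda>z. kd x z + c * kd y z) (mv B X (\<lambda>z. kd x z + c * kd y z))) = 0" for c by (rule im)
    then have "Im (X x x + c * X x y + (cnj c * X y x + cnj c * c * X y y)) = 0" for c
      by (simp add: mv_add mv_scale ip_add_left ip_add_right ip_scale_left ip_scale_right mv_kd ip_kd fB xy mult.assoc algebra_simps)
    from this[of 1] this[of \<i>] have "X y x = cnj (X x y)" using a[OF xy(1)] a[OF xy(2)]
      by (simp add: complex_eq_iff)
  }
  then show ?thesis unfolding herm_def by blast
qed

lemma psd_spectral_nonneg: assumes "finite B" "psd B X" "spectral B X lam e" "i \<in> B" shows "lam i \<ge> 0"
proof -
  have "ip B (e i) (mv B X (e i)) = ip B (e i) (\<lambda>x. of_real (lam i) * e i x)"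
    using spectral_eigen[OF assms(1,3) _ assms(4)] by (intro ip_cong) auto
  also have "\<dots> = of_real (lam i)" using onfD[OF spectral_onf[OF assms(1,3)]] assms(4) by (simp add: ip_scale_right)
  finally show ?thesis using assms(2) unfolding psd_alt by (metis Re_complex_of_real)
qed

lemma psd_spectral: assumes "finite B" "psd B X"
  obtains lam e where "spectral B X lam e" "\<And>i. i\<in>B \<Longrightarrow> lam i \<ge> 0"
  using spectral_exists[OF assms(1) psd_herm[OF assms]] psd_spectral_nonneg[OF assms] by blast

text \<open>Eigenvectors scaled by the roots of their eigenvalues. This factorisation stands in for
  operator square roots and for Kraus operators: positivity of products, compositions and marginals
  is proved by multiplying Gram vectors.\<close>

lemma psd_gramE: assumes fB: "finite B" and p: "psd B X"
  obtains g :: "'b \<Rightarrow> 'b \<Rightarrow> complex" where "\<And>x y. x\<in>B \<Longrightarrow> y\<in>B \<Longrightarrow> X x y = (\<Sum>i\<in>B. g i x * cnj (g i y))"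
proof -
  obtain lam e where s: "spectral B X lam e" "\<And>i. i\<in>B \<Longrightarrow> lam i \<ge> 0" using psd_spectral[OF assms] by blast
  define g where "g = (\<lambda>i x. complex_of_real (sqrt (lam i)) * e i x)"
  have "X x y = (\<Sum>i\<in>B. g i x * cnj (g i y))" if "x\<in>B" "y\<in>B" for x y
    unfolding spectral_eq[OF s(1) that]
  proof (rule sum.cong[OF refl])
    fix i assume "i\<in>B"
    then have "complex_of_real (lam i) = of_real (sqrt (lam i)) * of_real (sqrt (lam i))"
      using s(2) by (simp flip: of_real_mult)
    then show "of_real (lam i) * e i x * cnj (e i y) = g i x * cnj (g i y)" by (simp add: g_def algebra_simps)
  qed
  then show ?thesis by (rule that)
qed

lemma gram_qf:
  assumes "\<And>x y. x\<in>B \<Longrightarrow> y\<in>B \<Longrightarrow> X x y = (\<Sum>i\<in>I. g i x * cnj (g i y))"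
  shows "ip B v (mv B X v) = of_real (\<Sum>i\<in>I. (cmod (ip B (g i) v))\<^sup>2)"
proof -
  have "ip B v (mv B X v) = (\<Sum>x\<in>B. \<Sum>y\<in>B. \<Sum>i\<in>I. (cnj (v x) * g i x) * (cnj (g i y) * v y))"
    unfolding qf_eq[symmetric] using assms
    by (intro sum.cong refl) (simp add: sum_distrib_left sum_distrib_right mult.assoc)
  also have "\<dots> = (\<Sum>i\<in>I. \<Sum>x\<in>B. \<Sum>y\<in>B. (cnj (v x) * g i x) * (cnj (g i y) * v y))"
    by (simp add: sum.swap[of _ I])
  also have "\<dots> = (\<Sum>i\<in>I. ip B v (g i) * ip B (g i) v)" by (simp add: ip_def sum_product)
  also have "\<dots> = (\<Sum>i\<in>I. of_real ((cmod (ip B (g i) v))\<^sup>2))"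
    by (intro sum.cong refl) (metis complex_norm_square ip_cnj mult.commute)
  finally show ?thesis by simp
qed

lemma gram_psd:
  assumes "\<And>x y. x\<in>B \<Longrightarrow> y\<in>B \<Longrightarrow> X x y = (\<Sum>i\<in>I. g i x * cnj (g i y))"
  shows "psd B X"
proof -
  have "ip B v (mv B X v) = of_real (\<Sum>i\<in>I. (cmod (ip B (g i) v))\<^sup>2)" for v by (rule gram_qf) (rule assms)
  then show ?thesis unfolding psd_alt by (simp add: sum_nonneg)
qed

section \<open>Positive operators and trace-norm certificates\<close>

lemma psd_cong: assumes "\<And>x y. x\<in>B \<Longrightarrow> y\<in>B \<Longrightarrow> X x y = Y x y" shows "psd B X \<longleftrightarrow> psd B Y"
proof -
  have "(\<Sum>x\<in>B. \<Sum>y\<in>B. cnj (v x) * X x y * v y) = (\<Sum>x\<in>B. \<Sum>y\<in>B. cnj (v x) * Y x y * v y)" for v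
    using assms by (intro sum.cong refl) auto
  then show ?thesis by (simp add: psd_def)
qed

lemma psd_add: assumes "psd B X" "psd B Y" shows "psd B (\<lambda>x y. X x y + Y x y)"
  using assms unfolding psd_def by (auto simp: algebra_simps sum.distrib)

lemma psd_scale: assumes "psd B X" "c \<ge> 0" shows "psd B (\<lambda>x y. complex_of_real c * X x y)"
proof -
  have "(\<Sum>x\<in>B. \<Sum>y\<in>B. cnj (v x) * (of_real c * X x y) * v y) = of_real c * (\<Sum>x\<in>B. \<Sum>y\<in>B. cnj (v x) * X x y * v y)" for v
    unfolding sum_distrib_left by (intro sum.cong refl) (simp add: algebra_simps)
  then show ?thesis using assms unfolding psd_def by auto
qed

lemma psd_zero: "psd B (\<lambda>x y. 0)" by (simp add: psd_def)

lemma psd_sum: "finite I \<Longrightarrow> (\<And>i. i \<in> I \<Longrightarrow> psd B (X i)) \<Longrightarrow> psd B (\<lambda>x y. \<Sum>i\<in>I. X i x y)"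
proof (induction I rule: finite_induct)
  case empty then show ?case by (simp add: psd_zero)
next
  case (insert i I) then show ?case using psd_add[of B "X i" "\<lambda>x y. \<Sum>i\<in>I. X i x y"] by simp
qed

lemma psd_rank1: "psd B (\<lambda>x y. u x * cnj (u y))"
  by (rule gram_psd[where I="{()}" and g="\<lambda>_. u"]) simp

lemma op_trace_cong: "(\<And>x. x\<in>B \<Longrightarrow> X x x = Y x x) \<Longrightarrow> op_trace B X = op_trace B Y"
  by (simp add: op_trace_def)
lemma op_trace_add: "op_trace B (\<lambda>x y. X x y + Y x y) = op_trace B X + op_trace B Y"
  by (simp add: op_trace_def sum.distrib)
lemma op_trace_sum: "op_trace B (\<lambda>x y. \<Sum>i\<in>I. X i x y) = (\<Sum>i\<in>I. op_trace B (X i))"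
  unfolding op_trace_def by (rule sum.swap)
lemma op_trace_scale: "op_trace B (\<lambda>x y. c * X x y) = c * op_trace B X"
  by (simp add: op_trace_def sum_distrib_left)
lemma op_trace_rank1: "op_trace B (\<lambda>x y. u x * cnj (u y)) = of_real (nsq B u)"
  unfolding ip_self[symmetric] by (simp add: op_trace_def ip_def mult.commute)

lemma psd_diag: assumes "finite B" "psd B X" "x \<in> B" shows "Im (X x x) = 0" "Re (X x x) \<ge> 0"
  using assms(2) mv_kd[OF assms(1,3), of X] ip_kd[OF assms(1,3), of "mv B X (kd x)"]
  unfolding psd_alt by (metis)+

lemma psd_trace: assumes "finite B" "psd B X" shows "Re (op_trace B X) \<ge> 0" "Im (op_trace B X) = 0"
  unfolding op_trace_def Re_sum Im_sum using psd_diag[OF assms] by (auto intro: sum_nonneg)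

text \<open>A certificate for \<open>\<Sum>\<^sub>i \<parallel>Y\<^sub>i\<parallel>\<^sub>1 \<le> c\<close>; unlike the trace norm of the definitions, which is read off a spectral
  decomposition, it is visibly subadditive.\<close>

definition tn_bound :: "'i set \<Rightarrow> 'b set \<Rightarrow> ('i \<Rightarrow> 'b op) \<Rightarrow> real \<Rightarrow> bool" where
  "tn_bound I B Y c \<longleftrightarrow> (\<exists>P N. (\<forall>i\<in>I. psd B (P i) \<and> psd B (N i) \<and> (\<forall>x\<in>B. \<forall>y\<in>B. Y i x y = P i x y - N i x y))
     \<and> (\<Sum>i\<in>I. Re (op_trace B (P i)) + Re (op_trace B (N i))) \<le> c)"

lemma tn_boundI: assumes "\<And>i. i\<in>I \<Longrightarrow> psd B (P i)" "\<And>i. i\<in>I \<Longrightarrow> psd B (N i)"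
  "\<And>i x y. i\<in>I \<Longrightarrow> x\<in>B \<Longrightarrow> y\<in>B \<Longrightarrow> Y i x y = P i x y - N i x y"
  "(\<Sum>i\<in>I. Re (op_trace B (P i)) + Re (op_trace B (N i))) \<le> c"
  shows "tn_bound I B Y c"
  unfolding tn_bound_def by (rule exI[of _ P], rule exI[of _ N], intro conjI ballI) (simp_all add: assms)

lemma tn_boundE:
  assumes "tn_bound I B Y c"
  obtains P N where "\<And>i. i\<in>I \<Longrightarrow> psd B (P i)" "\<And>i. i\<in>I \<Longrightarrow> psd B (N i)"
    "\<And>i x y. i\<in>I \<Longrightarrow> x\<in>B \<Longrightarrow> y\<in>B \<Longrightarrow> Y i x y = P i x y - N i x y"
    "(\<Sum>i\<in>I. Re (op_trace B (P i)) + Re (op_trace B (N i))) \<le> c"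
proof -
  obtain P N where "\<forall>i\<in>I. psd B (P i) \<and> psd B (N i) \<and> (\<forall>x\<in>B. \<forall>y\<in>B. Y i x y = P i x y - N i x y)"
    "(\<Sum>i\<in>I. Re (op_trace B (P i)) + Re (op_trace B (N i))) \<le> c"
    using assms unfolding tn_bound_def by blast
  then show thesis by (intro that[of P N]) simp_all
qed

lemma tn_bound_mono: "tn_bound I B Y c \<Longrightarrow> c \<le> c' \<Longrightarrow> tn_bound I B Y c'"
  unfolding tn_bound_def by (meson order_trans)

lemma tn_bound_cong: assumes "tn_bound I B Y c" "\<And>i x y. i\<in>I \<Longrightarrow> x\<in>B \<Longrightarrow> y\<in>B \<Longrightarrow> Y i x y = Z i x y" shows "tn_bound I B Z c"
proof -
  obtain P N where h: "\<And>i. i\<in>I \<Longrightarrow> psd B (P i)" "\<And>i. i\<in>I \<Longrightarrow> psd B (N i)"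
    "\<And>i x y. i\<in>I \<Longrightarrow> x\<in>B \<Longrightarrow> y\<in>B \<Longrightarrow> Y i x y = P i x y - N i x y"
    "(\<Sum>i\<in>I. Re (op_trace B (P i)) + Re (op_trace B (N i))) \<le> c"
    using tn_boundE[OF assms(1)] by blast
  show ?thesis by (rule tn_boundI[of I B P N, OF h(1,2) _ h(4)]) (use h(3) assms(2) in auto)
qed

lemma tn_bound_add: assumes "tn_bound I B Y c" "tn_bound I B Z d" shows "tn_bound I B (\<lambda>i x y. Y i x y + Z i x y) (c + d)"
proof -
  obtain P N where h: "\<And>i. i\<in>I \<Longrightarrow> psd B (P i)" "\<And>i. i\<in>I \<Longrightarrow> psd B (N i)"
    "\<And>i x y. i\<in>I \<Longrightarrow> x\<in>B \<Longrightarrow> y\<in>B \<Longrightarrow> Y i x y = P i x y - N i x y"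
    "(\<Sum>i\<in>I. Re (op_trace B (P i)) + Re (op_trace B (N i))) \<le> c"
    using tn_boundE[OF assms(1)] by blast
  obtain Q M where g: "\<And>i. i\<in>I \<Longrightarrow> psd B (Q i)" "\<And>i. i\<in>I \<Longrightarrow> psd B (M i)"
    "\<And>i x y. i\<in>I \<Longrightarrow> x\<in>B \<Longrightarrow> y\<in>B \<Longrightarrow> Z i x y = Q i x y - M i x y"
    "(\<Sum>i\<in>I. Re (op_trace B (Q i)) + Re (op_trace B (M i))) \<le> d"
    using tn_boundE[OF assms(2)] by blast
  show ?thesis
  proof (rule tn_boundI[of I B "\<lambda>i x y. P i x y + Q i x y" "\<lambda>i x y. N i x y + M i x y"])
    show "(\<Sum>i\<in>I. Re (op_trace B (\<lambda>x y. P i x y + Q i x y)) + Re (op_trace B (\<lambda>x y. N i x y + M i x y))) \<le> c + d"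
      using h(4) g(4) by (simp add: op_trace_add sum.distrib)
  qed (use h g in \<open>auto intro: psd_add\<close>)
qed

lemma psd_block:
  assumes fI: "finite I" and fB: "finite B" and P: "\<And>i. i \<in> I \<Longrightarrow> psd B (P i)"
  shows "psd (I \<times> B) (\<lambda>p q. if fst p = fst q then P (fst p) (snd p) (snd q) else 0)"
proof -
  have "(\<Sum>x\<in>I \<times> B. \<Sum>y\<in>I \<times> B. cnj (v x) * (if fst x = fst y then P (fst x) (snd x) (snd y) else 0) * v y)
    = (\<Sum>i\<in>I. \<Sum>x\<in>B. \<Sum>y\<in>B. cnj (v (i,x)) * P i x y * v (i,y))" for v :: "'a \<times> 'b \<Rightarrow> complex"
    unfolding sum.cartesian_product' fst_conv snd_conv
  proof (intro sum.cong refl)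
    fix i x assume i: "i \<in> I"
    have "(\<Sum>j\<in>I. \<Sum>y\<in>B. cnj (v (i,x)) * (if i = j then P i x y else 0) * v (j,y)) = (\<Sum>j\<in>I. if j = i then \<Sum>y\<in>B. cnj (v (i,x)) * P i x y * v (i,y) else 0)"
      by (intro sum.cong refl) auto
    then show "(\<Sum>j\<in>I. \<Sum>y\<in>B. cnj (v (i,x)) * (if i = j then P i x y else 0) * v (j,y)) = (\<Sum>y\<in>B. cnj (v (i,x)) * P i x y * v (i,y))"
      using fI i by simp
  qed
  then show ?thesis using P unfolding psd_def by (simp add: sum_nonneg)
qed

text \<open>In an eigenbasis of X = P - N each eigenvalue is <e_k, P e_k> - <e_k, N e_k>, so its
  modulus is at most the sum of the two nonnegative terms. Summed over the basis these are the
  traces of P and N.\<close>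

lemma tn_bound_trace_norm:
  assumes fI: "finite I" and fB: "finite B" and t: "tn_bound I B Y c"
    and X: "\<And>i j x y. i\<in>I \<Longrightarrow> j\<in>I \<Longrightarrow> x\<in>B \<Longrightarrow> y\<in>B \<Longrightarrow> X (i,x) (j,y) = (if i = j then Y i x y else 0)"
  shows "trace_norm_h (I \<times> B) X \<le> c"
proof -
  obtain P N where h: "\<And>i. i\<in>I \<Longrightarrow> psd B (P i)" "\<And>i. i\<in>I \<Longrightarrow> psd B (N i)"
    "\<And>i x y. i\<in>I \<Longrightarrow> x\<in>B \<Longrightarrow> y\<in>B \<Longrightarrow> Y i x y = P i x y - N i x y"
    "(\<Sum>i\<in>I. Re (op_trace B (P i)) + Re (op_trace B (N i))) \<le> c"
    using tn_boundE[OF t] by blast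
  let ?B = "I \<times> B"
  have fIB: "finite ?B" using fI fB by simp
  define bd :: "('a \<Rightarrow> 'b op) \<Rightarrow> ('a \<times> 'b) op" where "bd = (\<lambda>P p q. if fst p = fst q then P (fst p) (snd p) (snd q) else 0)"
  have psdbd: "psd ?B (bd Q)" if "\<And>i. i\<in>I \<Longrightarrow> psd B (Q i)" for Q
    unfolding bd_def by (rule psd_block[OF fI fB that])
  have XX: "X p q = bd P p q - bd N p q" if "p \<in> ?B" "q \<in> ?B" for p q
    using that X h(3) by (auto simp: bd_def)
  have "herm ?B X" unfolding herm_def
  proof (intro ballI)
    fix x y assume xy: "x \<in> ?B" "y\<in> ?B"
    have "bd Q y x = cnj (bd Q x y)" if "\<And>i. i\<in>I \<Longrightarrow> psd B (Q i)" for Q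
      using psd_herm[OF fIB psdbd[of Q, OF that]] xy unfolding herm_def by blast
    then show "X y x = cnj (X x y)" using XX xy h(1,2) by simp
  qed
  then obtain lam e where s: "spectral ?B X lam e" using spectral_exists[OF fIB] by blast
  have on: "onf ?B ?B e" by (rule spectral_onf[OF fIB s])
  \<comment> \<open>The trace may be computed in the basis e, by expanding each standard basis
    vector in it.\<close>
  have tr: "(\<Sum>k\<in>?B. ip ?B (e k) (mv ?B M (e k))) = op_trace ?B M" for M
  proof -
    have "(\<Sum>k\<in>?B. ip ?B (e k) (mv ?B M (e k))) = (\<Sum>k\<in>?B. \<Sum>x\<in>?B. \<Sum>y\<in>?B. M x y * (ip ?B (e k) (kd x) * e k y))"
      unfolding qf_eq[symmetric] by (intro sum.cong refl) (simp add: ip_kd_right fIB)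
    also have "\<dots> = (\<Sum>x\<in>?B. \<Sum>y\<in>?B. M x y * prj ?B ?B e (kd x) y)"
      unfolding prj_def sum_distrib_left by (rule trans[OF sum.swap], rule sum.cong[OF refl], rule sum.swap)
    also have "\<dots> = (\<Sum>x\<in>?B. \<Sum>y\<in>?B. M x y * kd x y)" using onf_complete[OF on fIB refl] by (intro sum.cong refl) auto
    also have "\<dots> = op_trace ?B M" unfolding op_trace_def kd_def using fIB by (simp add: if_distrib sum.delta cong: if_cong)
    finally show ?thesis .
  qed
  have trbd: "op_trace ?B (bd Q) = (\<Sum>i\<in>I. op_trace B (Q i))" for Q
    unfolding op_trace_def sum.cartesian_product' by (simp add: bd_def)
  have mvd: "mv ?B X v p = mv ?B (bd P) v p - mv ?B (bd N) v p" if "p \<in> ?B" for v p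
    unfolding mv_def sum_subtractf[symmetric] by (intro sum.cong refl) (simp only: XX[OF that] left_diff_distrib)
  have lamk: "\<bar>lam k\<bar> \<le> Re (ip ?B (e k) (mv ?B (bd P) (e k))) + Re (ip ?B (e k) (mv ?B (bd N) (e k)))" if k: "k \<in> ?B" for k
  proof -
    have "ip ?B (e k) (mv ?B X (e k)) = ip ?B (e k) (\<lambda>x. of_real (lam k) * e k x)"
      using spectral_eigen[OF fIB s _ k] by (intro ip_cong) auto
    then have "of_real (lam k) = ip ?B (e k) (mv ?B X (e k))" using onfD[OF on k k] by (simp add: ip_scale_right)
    also have "\<dots> = ip ?B (e k) (\<lambda>p. mv ?B (bd P) (e k) p - mv ?B (bd N) (e k) p)"
      using mvd by (intro ip_cong) auto
    finally have "lam k = Re (ip ?B (e k) (mv ?B (bd P) (e k))) - Re (ip ?B (e k) (mv ?B (bd N) (e k)))"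
      unfolding ip_diff_right by (metis Re_complex_of_real minus_complex.sel(1))
    moreover have "Re (ip ?B (e k) (mv ?B (bd P) (e k))) \<ge> 0" "Re (ip ?B (e k) (mv ?B (bd N) (e k))) \<ge> 0"
      using psdbd[OF h(1)] psdbd[OF h(2)] unfolding psd_alt by auto
    ultimately show ?thesis by linarith
  qed
  have "trace_norm_h ?B X = (\<Sum>k\<in>?B. \<bar>lam k\<bar>)" by (rule trace_norm_eq[OF fIB s])
  also have "\<dots> \<le> (\<Sum>k\<in>?B. Re (ip ?B (e k) (mv ?B (bd P) (e k))) + Re (ip ?B (e k) (mv ?B (bd N) (e k))))"
    by (rule sum_mono) (rule lamk)
  also have "\<dots> = Re (op_trace ?B (bd P)) + Re (op_trace ?B (bd N))"
    unfolding tr[symmetric] Re_sum sum.distrib ..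
  also have "\<dots> \<le> c" using h(4) unfolding trbd Re_sum sum.distrib .
  finally show ?thesis .
qed

text \<open>The squared Hilbert-Schmidt norm; without the root it is additive over blocks and over
  the average taken in \<open>hash_exists\<close>.\<close>

definition frob :: "'b set \<Rightarrow> 'b op \<Rightarrow> real" where
  "frob B Y = (\<Sum>x\<in>B. \<Sum>y\<in>B. (cmod (Y x y))\<^sup>2)"

lemma frob_spectral: assumes fB: "finite B" and s: "spectral B X lam e" shows "frob B X = (\<Sum>i\<in>B. (lam i)\<^sup>2)"
proof -
  have on: "onf B B e" by (rule spectral_onf[OF fB s])
  have "frob B X = (\<Sum>y\<in>B. nsq B (mv B X (kd y)))" unfolding frob_def nsq_def using fB by (subst sum.swap) (simp add: mv_kd)
  also have "\<dots> = (\<Sum>y\<in>B. \<Sum>i\<in>B. (lam i)\<^sup>2 * (cmod (e i y))\<^sup>2)"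
  proof (rule sum.cong[OF refl])
    fix y assume y: "y \<in> B"
    have "nsq B (mv B X (kd y)) = nsq B (prj B B e (mv B X (kd y)))"
      using onf_complete[OF on fB refl] by (intro nsq_cong) auto
    also have "\<dots> = (\<Sum>i\<in>B. (cmod (ip B (e i) (mv B X (kd y))))\<^sup>2)" by (rule nsq_prj[OF on])
    also have "\<dots> = (\<Sum>i\<in>B. (lam i)\<^sup>2 * (cmod (e i y))\<^sup>2)"
    proof (rule sum.cong[OF refl])
      fix i assume i: "i \<in> B"
      have "ip B (e i) (mv B X (kd y)) = ip B (mv B X (e i)) (kd y)" by (rule herm_sa[OF spectral_herm[OF s]])
      also have "\<dots> = cnj (of_real (lam i) * e i y)" unfolding ip_kd_right[OF fB y] spectral_eigen[OF fB s y i] ..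
      finally show "(cmod (ip B (e i) (mv B X (kd y))))\<^sup>2 = (lam i)\<^sup>2 * (cmod (e i y))\<^sup>2"
        by (simp add: norm_mult power_mult_distrib)
    qed
    finally show "nsq B (mv B X (kd y)) = (\<Sum>i\<in>B. (lam i)\<^sup>2 * (cmod (e i y))\<^sup>2)" .
  qed
  also have "\<dots> = (\<Sum>i\<in>B. (lam i)\<^sup>2 * nsq B (e i))" unfolding nsq_def sum_distrib_left by (rule sum.swap)
  also have "\<dots> = (\<Sum>i\<in>B. (lam i)\<^sup>2)" using nsq_onf[OF on] by simp
  finally show ?thesis .
qed

text \<open>Cauchy--Schwarz: on a subspace of dimension \<open>card K\<close> the trace norm is at most
  \<open>sqrt (card K)\<close> times the Hilbert--Schmidt norm.\<close>

lemma tn_bound_proj: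
  assumes fI: "finite I" and fB: "finite B" and he: "\<And>i. i\<in>I \<Longrightarrow> herm B (Y i)"
    and on: "onf B K g" and su: "\<And>i v x. i \<in> I \<Longrightarrow> x\<in>B \<Longrightarrow> prj B K g (mv B (Y i) v) x = mv B (Y i) v x"
  shows "tn_bound I B Y (sqrt (card I * card K * (\<Sum>i\<in>I. frob B (Y i))))"
proof -
  have "\<exists>lam e. spectral B (Y i) lam e" if "i\<in>I" for i by (rule spectral_exists[OF fB he[OF that]])
  then obtain lam e where s: "\<And>i. i \<in> I \<Longrightarrow> spectral B (Y i) (lam i) (e i)" by metis
  define P where "P = (\<lambda>i x y. \<Sum>k\<in>B. complex_of_real (max (lam i k) 0) * (e i k x * cnj (e i k y)))"
  define N where "N = (\<lambda>i x y. \<Sum>k\<in>B. complex_of_real (max (- lam i k) 0) * (e i k x * cnj (e i k y)))"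
  have ab: "(\<Sum>k\<in>B. \<bar>lam i k\<bar>) \<le> sqrt (card K) * sqrt (frob B (Y i))" if i: "i\<in>I" for i
  proof -
    have oe: "onf B B (e i)" by (rule spectral_onf[OF fB s[OF i]])
    have pe: "lam i k = 0 \<or> nsq B (prj B K g (e i k)) = 1" if k: "k\<in>B" for k
    proof (cases "lam i k = 0")
      case False
      have "prj B K g (e i k) x = e i k x" if x: "x\<in>B" for x
      proof -
        have ek: "\<And>y. y\<in>B \<Longrightarrow> e i k y = of_real (1 / lam i k) * mv B (Y i) (e i k) y"
          using spectral_eigen[OF fB s[OF i] _ k] False by simp
        have "prj B K g (e i k) x = prj B K g (\<lambda>y. of_real (1 / lam i k) * mv B (Y i) (e i k) y) x"
          using fun_cong[OF prj_cong[OF ek]] .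
        also have "\<dots> = of_real (1 / lam i k) * mv B (Y i) (e i k) x" unfolding prj_scale su[OF i x] ..
        finally show ?thesis using ek[OF x] by simp
      qed
      then show ?thesis using nsq_cong[of B "prj B K g (e i k)" "e i k"] nsq_onf[OF oe k] by simp
    qed simp
    \<comment> \<open>The weight of eigenvector k inside the subspace: it is 1 whenever the
      eigenvalue is nonzero, never exceeds 1, and the weights sum to at most \<open>card K\<close>.
      Inserting it before Cauchy-Schwarz produces \<open>sqrt (card K)\<close> instead of the root
      of the full dimension.\<close>
    let ?p = "\<lambda>k. nsq B (prj B K g (e i k))"
    have p1: "?p k \<le> 1" if "k\<in>B" for k using nsq_prj_le[OF on, of "e i k"] nsq_onf[OF oe that] by simp
    have "(\<Sum>k\<in>B. ?p k) = (\<Sum>j\<in>K. \<Sum>k\<in>B. (cmod (ip B (g j) (e i k)))\<^sup>2)"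
      unfolding nsq_prj[OF on] by (rule sum.swap)
    also have "\<dots> \<le> (\<Sum>j\<in>K. 1)"
    proof (rule sum_mono)
      fix j assume j: "j\<in>K"
      have "(\<Sum>k\<in>B. (cmod (ip B (e i k) (g j)))\<^sup>2) \<le> nsq B (g j)" by (rule bessel[OF oe])
      then show "(\<Sum>k\<in>B. (cmod (ip B (g j) (e i k)))\<^sup>2) \<le> 1"
        using nsq_onf[OF on j] by (metis (no_types, lifting) complex_mod_cnj ip_cnj sum.cong)
    qed
    finally have pK: "(\<Sum>k\<in>B. ?p k) \<le> card K" by simp
    have "(\<Sum>k\<in>B. \<bar>lam i k\<bar>) = (\<Sum>k\<in>B. \<bar>?p k\<bar> * \<bar>lam i k\<bar>)" using pe by (intro sum.cong refl) auto
    also have "\<dots> \<le> L2_set ?p B * L2_set (lam i) B" by (rule L2_set_mult_ineq)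
    also have "\<dots> \<le> sqrt (card K) * L2_set (lam i) B"
    proof (rule mult_right_mono)
      have "(\<Sum>k\<in>B. (?p k)\<^sup>2) \<le> (\<Sum>k\<in>B. ?p k)" using p1 by (intro sum_mono) (simp add: power2_eq_square mult_left_le)
      then show "L2_set ?p B \<le> sqrt (card K)" unfolding L2_set_def using pK by simp
    qed simp
    finally show ?thesis by (simp add: L2_set_def frob_spectral[OF fB s[OF i]])
  qed
  show ?thesis
  proof (rule tn_boundI[of I B P N])
    fix i assume i: "i\<in>I"
    show "psd B (P i)" "psd B (N i)" unfolding P_def N_def
      by (intro psd_sum fB psd_scale psd_rank1; simp)+
    fix x y assume xy: "x\<in>B" "y\<in>B"
    have L: "complex_of_real (lam i k) = of_real (max (lam i k) 0) - of_real (max (- lam i k) 0)" for k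
      unfolding of_real_diff[symmetric] by (simp add: max_def)
    show "Y i x y = P i x y - N i x y" unfolding spectral_eq[OF s[OF i] xy] P_def N_def sum_subtractf[symmetric]
      by (intro sum.cong refl) (simp only: L left_diff_distrib mult.assoc)
  next
    have "Re (op_trace B (P i)) + Re (op_trace B (N i)) = (\<Sum>k\<in>B. \<bar>lam i k\<bar>)" if i: "i\<in>I" for i
    proof -
      have "max (lam i k) 0 + max (- lam i k) 0 = \<bar>lam i k\<bar>" for k by simp
      then show ?thesis unfolding P_def N_def op_trace_sum op_trace_scale op_trace_rank1 Re_sum sum.distrib[symmetric]
        using nsq_onf[OF spectral_onf[OF fB s[OF i]]] by (intro sum.cong refl) simp
    qed
    then have "(\<Sum>i\<in>I. Re (op_trace B (P i)) + Re (op_trace B (N i))) \<le> (\<Sum>i\<in>I. sqrt (card K) * sqrt (frob B (Y i)))"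
      using ab by (intro sum_mono) simp
    also have "\<dots> = sqrt (card K) * (\<Sum>i\<in>I. \<bar>1\<bar> * \<bar>sqrt (frob B (Y i))\<bar>)"
      by (simp add: sum_distrib_left frob_def sum_nonneg)
    also have "\<dots> \<le> sqrt (card K) * (L2_set (\<lambda>_. 1) I * L2_set (\<lambda>i. sqrt (frob B (Y i))) I)"
      by (intro mult_left_mono L2_set_mult_ineq) simp
    also have "\<dots> = sqrt (card I * card K * (\<Sum>i\<in>I. frob B (Y i)))"
      by (simp add: L2_set_def frob_def sum_nonneg real_sqrt_mult)
    finally show "(\<Sum>i\<in>I. Re (op_trace B (P i)) + Re (op_trace B (N i))) \<le> sqrt (card I * card K * (\<Sum>i\<in>I. frob B (Y i)))" .
  qed
qed

section \<open>Uniform random functions and product distributions\<close>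

lemma sum_PiE_insert:
  assumes "t \<notin> T" shows "(\<Sum>g\<in>PiE (insert t T) B. h g) = (\<Sum>y\<in>B t. \<Sum>g\<in>PiE T B. h (g(t := y)))"
proof -
  have i: "inj_on (\<lambda>(y, g). g(t := y)) (B t \<times> PiE T B)"
  proof (rule inj_onI, clarsimp)
    fix y g y' g' assume a: "g \<in> PiE T B" "g' \<in> PiE T B" and e: "g(t := y) = g'(t := y')"
    have "y = y'" using fun_cong[OF e, of t] by simp
    moreover have "g s = g' s" for s
    proof (cases "s = t")
      case True then show ?thesis using PiE_arb[OF a(1) assms] PiE_arb[OF a(2) assms] by simp
    next
      case False then show ?thesis using fun_cong[OF e, of s] by simp
    qed
    ultimately show "y = y' \<and> g = g'" by auto
  qed
  show ?thesis unfolding PiE_insert_eq sum.reindex[OF i] sum.cartesian_product by (simp add: case_prod_unfold comp_def)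
qed

lemma sum_PiE_prod:
  fixes f :: "'a \<Rightarrow> 'b \<Rightarrow> 'c::comm_semiring_1"
  assumes "finite A" "\<And>x. x \<in> A \<Longrightarrow> finite (B x)"
  shows "(\<Sum>g\<in>PiE A B. \<Prod>x\<in>A. f x (g x)) = (\<Prod>x\<in>A. \<Sum>y\<in>B x. f x y)"
  by (rule prod_sum_PiE[OF assms, symmetric])

text \<open>Pairwise independence of a uniformly random function: its values at two distinct points
  are independent and uniform. The normalisation is multiplied out, so no division occurs.\<close>

lemma sum_PiE_pair:
  fixes g h :: "'b \<Rightarrow> real"
  assumes fX: "finite Xs" and fC: "finite C" and x: "x\<in>Xs" "x'\<in>Xs" "x \<noteq> x'"
  shows "(\<Sum>F\<in>PiE Xs (\<lambda>_. C). g (F x) * h (F x')) * real (card C)^2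
    = sum g C * sum h C * real (card (PiE Xs (\<lambda>_. C)))"
proof -
  define k where "k = (\<lambda>y. if y = x then g else if y = x' then h else (\<lambda>_. 1))"
  have sp: "(\<Prod>y\<in>Xs. q y) = q x * q x' * (\<Prod>y\<in>Xs - {x} - {x'}. q y)" for q :: "'a \<Rightarrow> real"
    using prod.remove[OF fX x(1), of q] prod.remove[of "Xs - {x}" x' q] x fX by (simp add: mult.assoc)
  have k1: "(\<Prod>y\<in>Xs - {x} - {x'}. k y (F y)) = 1" for F by (rule prod.neutral) (auto simp: k_def)
  have "(\<Sum>F\<in>PiE Xs (\<lambda>_. C). g (F x) * h (F x')) = (\<Sum>F\<in>PiE Xs (\<lambda>_. C). \<Prod>y\<in>Xs. k y (F y))"
    unfolding sp[of "\<lambda>y. k y (_ y)"] k1 using x(3) by (simp add: k_def)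
  also have "\<dots> = (\<Prod>y\<in>Xs. \<Sum>a\<in>C. k y a)" by (rule sum_PiE_prod) (use fX fC in auto)
  also have "\<dots> = sum g C * sum h C * (\<Prod>y\<in>Xs - {x} - {x'}. \<Sum>a\<in>C. k y a)"
    unfolding sp[of "\<lambda>y. \<Sum>a\<in>C. k y a"] using x(3) by (simp add: k_def)
  also have "(\<Prod>y\<in>Xs - {x} - {x'}. \<Sum>a\<in>C. k y a) = (\<Prod>y\<in>Xs - {x} - {x'}. real (card C))"
    by (rule prod.cong) (auto simp: k_def)
  finally have 1: "(\<Sum>F\<in>PiE Xs (\<lambda>_. C). g (F x) * h (F x')) = sum g C * sum h C * (\<Prod>y\<in>Xs - {x} - {x'}. real (card C))" .
  have "real (card (PiE Xs (\<lambda>_. C))) = real (card C) * real (card C) * (\<Prod>y\<in>Xs - {x} - {x'}. real (card C))"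
    unfolding card_PiE[OF fX] of_nat_prod by (rule sp)
  then show ?thesis unfolding 1 by (simp add: power2_eq_square)
qed

lemma exists_le_average:
  fixes f :: "'a \<Rightarrow> real" and c :: real
  assumes "finite A" "A \<noteq> {}" "sum f A \<le> c * card A" shows "\<exists>a\<in>A. f a \<le> c"
proof (rule ccontr)
  assume "\<not> ?thesis"
  then have "(\<Sum>a\<in>A. c) < sum f A" using assms by (intro sum_strict_mono) auto
  then show False using assms(3) by (simp add: mult.commute)
qed

lemma sum_shift_moments:
  fixes Q F :: "'g \<Rightarrow> real"
  shows "(\<Sum>g\<in>A. c * Q g * (b + F g)) = c * b * (\<Sum>g\<in>A. Q g) + c * (\<Sum>g\<in>A. Q g * F g)"
    and "(\<Sum>g\<in>A. c * Q g * (b + F g)\<^sup>2) = c * b\<^sup>2 * (\<Sum>g\<in>A. Q g) + 2 * (c * b) * (\<Sum>g\<in>A. Q g * F g) + c * (\<Sum>g\<in>A. Q g * (F g)\<^sup>2)"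
  unfolding sum_distrib_left sum.distrib[symmetric] by (intro sum.cong refl; simp add: algebra_simps power2_eq_square)+

text \<open>Mass, mean and variance of a sum of centred i.i.d. variables. They are proved together
  because adding one factor to the second moment calls on the other two.\<close>

lemma iid_moments:
  fixes p ph :: "'w \<Rightarrow> real"
  assumes fT: "finite T" and fO: "finite Om" and p1: "sum p Om = 1" and c: "(\<Sum>a\<in>Om. p a * ph a) = 0"
  shows "(\<Sum>w\<in>PiE T (\<lambda>_. Om). \<Prod>t\<in>T. p (w t)) = 1"
    "(\<Sum>w\<in>PiE T (\<lambda>_. Om). (\<Prod>t\<in>T. p (w t)) * (\<Sum>t\<in>T. ph (w t))) = 0"
    "(\<Sum>w\<in>PiE T (\<lambda>_. Om). (\<Prod>t\<in>T. p (w t)) * (\<Sum>t\<in>T. ph (w t))\<^sup>2) = card T * (\<Sum>a\<in>Om. p a * (ph a)\<^sup>2)"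
  using fT
proof (induction T rule: finite_induct)
  case empty
  { case 1 show ?case by simp }
  { case 2 show ?case by simp }
  { case 3 show ?case by simp }
next
  case (insert t T)
  have P: "(\<Prod>s\<in>insert t T. p ((w(t:=y)) s)) = p y * (\<Prod>s\<in>T. p (w s))" for w y
  proof -
    have "(\<Prod>s\<in>T. p ((w(t:=y)) s)) = (\<Prod>s\<in>T. p (w s))" using insert(2) by (intro prod.cong) auto
    then show ?thesis using insert(1,2) by simp
  qed
  have S: "(\<Sum>s\<in>insert t T. ph ((w(t:=y)) s)) = ph y + (\<Sum>s\<in>T. ph (w s))" for w y
  proof -
    have "(\<Sum>s\<in>T. ph ((w(t:=y)) s)) = (\<Sum>s\<in>T. ph (w s))" using insert(2) by (intro sum.cong) auto
    then show ?thesis using insert(1,2) by simp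
  qed
  let ?A = "PiE T (\<lambda>_. Om)" and ?Q = "\<lambda>w. \<Prod>s\<in>T. p (w s)" and ?F = "\<lambda>w. \<Sum>s\<in>T. ph (w s)"
  { case 1 show ?case unfolding sum_PiE_insert[OF insert(2)] P sum_distrib_left[symmetric] insert(3) using p1 by simp }
  { case 2
    show ?case unfolding sum_PiE_insert[OF insert(2)] P S sum_shift_moments(1) insert(3) insert(4) using c by simp }
  { case 3
    have "(\<Sum>y\<in>Om. \<Sum>g\<in>?A. p y * ?Q g * (ph y + ?F g)\<^sup>2)
      = (\<Sum>y\<in>Om. p y * (ph y)\<^sup>2 * (\<Sum>g\<in>?A. ?Q g) + 2 * (p y * ph y) * (\<Sum>g\<in>?A. ?Q g * ?F g) + p y * (\<Sum>g\<in>?A. ?Q g * (?F g)\<^sup>2))"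
      unfolding sum_shift_moments(2) ..
    also have "\<dots> = (\<Sum>y\<in>Om. p y * (ph y)\<^sup>2) + (\<Sum>y\<in>Om. p y * (card T * (\<Sum>a\<in>Om. p a * (ph a)\<^sup>2)))"
      unfolding insert(3) insert(4) insert(5) by (simp add: sum.distrib)
    also have "\<dots> = card (insert t T) * (\<Sum>a\<in>Om. p a * (ph a)\<^sup>2)"
      unfolding sum_distrib_right[symmetric] p1 using insert(1,2) by (simp add: algebra_simps)
    finally show ?case unfolding sum_PiE_insert[OF insert(2)] P S .
  }
qed

section \<open>Weak typicality\<close>

definition shannon :: "'w set \<Rightarrow> ('w \<Rightarrow> real) \<Rightarrow> real" where
  "shannon Om p = - (\<Sum>a\<in>Om. if p a = 0 then 0 else p a * log 2 (p a))"

text \<open>The positions form an arbitrary set T, since players' systems are indexed by times and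
  the copies of E by pairs (0, t).\<close>

definition typseq :: "'t set \<Rightarrow> 'w set \<Rightarrow> ('w \<Rightarrow> real) \<Rightarrow> real \<Rightarrow> ('t \<Rightarrow> 'w) set" where
  "typseq T Om p d = {w \<in> PiE T (\<lambda>_. Om).
     2 powr (- (card T * (shannon Om p + d))) \<le> (\<Prod>t\<in>T. p (w t)) \<and>
     (\<Prod>t\<in>T. p (w t)) \<le> 2 powr (- (card T * (shannon Om p - d)))}"

text \<open>The variance of the self-information -log p, the constant of Chebyshev's inequality
  below. Letters of probability zero contribute nothing, being weighted by p.\<close>

definition info_var :: "'w set \<Rightarrow> ('w \<Rightarrow> real) \<Rightarrow> real" where
  "info_var Om p = (\<Sum>a\<in>Om. p a * (- log 2 (p a) - shannon Om p)\<^sup>2)"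

text \<open>Chebyshev for the sum of the centred self-informations of the letters.\<close>

lemma typ_prob:
  fixes p :: "'w \<Rightarrow> real" and d :: real
  assumes fT: "finite T" "T \<noteq> {}" and fO: "finite Om" and p1: "sum p Om = 1" and p0: "\<And>a. a\<in>Om \<Longrightarrow> p a \<ge> 0" and d: "d > 0"
  shows "(\<Sum>w\<in>PiE T (\<lambda>_. Om) - typseq T Om p d. \<Prod>t\<in>T. p (w t)) \<le> info_var Om p / (card T * d\<^sup>2)"
proof -
  let ?S = "shannon Om p"
  define ph where "ph = (\<lambda>a. - log 2 (p a) - ?S)"
  let ?A = "PiE T (\<lambda>_. Om)" and ?Q = "\<lambda>w. \<Prod>t\<in>T. p (w t)" and ?F = "\<lambda>w. \<Sum>t\<in>T. ph (w t)"
  have n0: "card T > 0" using fT by (simp add: card_gt_0_iff)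
  have "(\<Sum>a\<in>Om. p a * ph a) = - (\<Sum>a\<in>Om. if p a = 0 then 0 else p a * log 2 (p a)) - (\<Sum>a\<in>Om. p a) * ?S"
    unfolding sum_negf[symmetric] sum_distrib_right sum_subtractf[symmetric] ph_def by (intro sum.cong refl) (auto simp: algebra_simps)
  then have c: "(\<Sum>a\<in>Om. p a * ph a) = 0" unfolding p1 by (simp add: shannon_def)
  have fA: "finite ?A" using fT fO by (intro finite_PiE) auto
  have Q0: "?Q w \<ge> 0" if "w \<in> ?A" for w using that p0 by (intro prod_nonneg) auto
  \<comment> \<open>Words of probability zero are not covered by the logarithm, but they carry no
    mass; every other atypical word has a sum deviating by at least
    \<open>card T * d\<close>.\<close>
  have far: "?Q w = 0 \<or> (?F w)\<^sup>2 \<ge> (card T * d)\<^sup>2" if w: "w \<in> ?A - typseq T Om p d" for w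
  proof (cases "?Q w = 0")
    case False
    have pos: "p (w t) > 0" if "t\<in>T" for t
    proof -
      have "p (w t) \<ge> 0" using w that p0 by auto
      moreover have "p (w t) \<noteq> 0" using False fT that by auto
      ultimately show ?thesis by simp
    qed
    then have Qp: "?Q w > 0" by (intro prod_pos) auto
    have "log 2 (?Q w) = (\<Sum>t\<in>T. log 2 (p (w t)))"
      using pos fT(1)
    proof (induction T rule: infinite_finite_induct)
      case (insert t T)
      have "(\<Prod>t\<in>T. p (w t)) > 0" using insert.prems by (intro prod_pos) auto
      moreover have "p (w t) > 0" using insert.prems by simp
      ultimately have "log 2 (p (w t) * (\<Prod>t\<in>T. p (w t))) = log 2 (p (w t)) + log 2 (\<Prod>t\<in>T. p (w t))"
        by (intro log_mult_pos)
      then show ?case using insert by simp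
    qed auto
    then have l: "- log 2 (?Q w) = card T * ?S + ?F w" by (simp add: ph_def sum_subtractf sum_negf)
    have "\<not> (2 powr (- (card T * (?S + d))) \<le> ?Q w \<and> ?Q w \<le> 2 powr (- (card T * (?S - d))))"
      using w by (simp add: typseq_def)
    then have "\<not> (- (card T * (?S + d)) \<le> log 2 (?Q w) \<and> log 2 (?Q w) \<le> - (card T * (?S - d)))"
      using Qp by (simp add: le_log_iff log_le_iff)
    then have "\<bar>?F w\<bar> \<ge> card T * d" using l by (auto simp: algebra_simps)
    then have "(card T * d)\<^sup>2 \<le> \<bar>?F w\<bar>\<^sup>2" by (rule power_mono) (use d in simp)
    then show ?thesis by simp
  qed simp
  have "(\<Sum>w\<in>?A - typseq T Om p d. ?Q w) * (card T * d)\<^sup>2 \<le> (\<Sum>w\<in>?A - typseq T Om p d. ?Q w * (?F w)\<^sup>2)"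
    unfolding sum_distrib_right
  proof (rule sum_mono)
    fix w assume w: "w \<in> ?A - typseq T Om p d"
    show "?Q w * (card T * d)\<^sup>2 \<le> ?Q w * (?F w)\<^sup>2"
      using far[OF w] Q0[of w] w by (elim disjE) (simp, intro mult_left_mono, auto)
  qed
  also have "\<dots> \<le> (\<Sum>w\<in>?A. ?Q w * (?F w)\<^sup>2)" using Q0 fA by (intro sum_mono2) auto
  also have "\<dots> = card T * info_var Om p" unfolding iid_moments(3)[OF fT(1) fO p1 c] by (simp add: info_var_def ph_def)
  finally have "(\<Sum>w\<in>?A - typseq T Om p d. ?Q w) * (card T * d\<^sup>2) * card T \<le> info_var Om p * card T"
    by (simp add: power2_eq_square algebra_simps)
  then show ?thesis using n0 d by (simp add: pos_le_divide_eq mult.commute)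
qed

lemma typ_card:
  fixes p :: "'w \<Rightarrow> real" and d :: real
  assumes fT: "finite T" and fO: "finite Om" and p1: "sum p Om = 1" and p0: "\<And>a. a\<in>Om \<Longrightarrow> p a \<ge> 0"
  shows "card (typseq T Om p d) \<le> 2 powr (card T * (shannon Om p + d))"
proof -
  let ?A = "PiE T (\<lambda>_. Om)" and ?Q = "\<lambda>w. \<Prod>t\<in>T. p (w t)"
  have fA: "finite ?A" using fT fO by (intro finite_PiE) auto
  have "(\<Sum>w\<in>typseq T Om p d. 2 powr (- (card T * (shannon Om p + d)))) \<le> (\<Sum>w\<in>typseq T Om p d. ?Q w)"
    by (rule sum_mono) (simp add: typseq_def)
  also have "\<dots> \<le> (\<Sum>w\<in>?A. ?Q w)" using fA p0 by (intro sum_mono2) (auto simp: typseq_def intro!: prod_nonneg)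
  also have "\<dots> = (\<Prod>t\<in>T. sum p Om)" using fT fO by (intro sum_PiE_prod) auto
  finally have "card (typseq T Om p d) * 2 powr (- (card T * (shannon Om p + d))) \<le> 1" using p1 by simp
  then show ?thesis unfolding powr_minus by (simp add: field_simps)
qed

section \<open>Sequential measurements\<close>

text \<open>\<open>hit P xs x v\<close> is the unnormalised branch of \<open>v\<close> in which \<open>x\<close> is the first test of the list to accept;
  \<open>res P xs v\<close> is the branch in which none accepts.\<close>

fun hit :: "('x \<Rightarrow> ('b \<Rightarrow> complex) \<Rightarrow> 'b \<Rightarrow> complex) \<Rightarrow> 'x list \<Rightarrow> 'x \<Rightarrow> ('b \<Rightarrow> complex) \<Rightarrow> 'b \<Rightarrow> complex" where
  "hit P [] x v = (\<lambda>_. 0)"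
| "hit P (y # ys) x v = (if y = x then P y v else hit P ys x (\<lambda>b. v b - P y v b))"

fun res :: "('x \<Rightarrow> ('b \<Rightarrow> complex) \<Rightarrow> 'b \<Rightarrow> complex) \<Rightarrow> 'x list \<Rightarrow> ('b \<Rightarrow> complex) \<Rightarrow> 'b \<Rightarrow> complex" where
  "res P [] v = v"
| "res P (y # ys) v = res P ys (\<lambda>b. v b - P y v b)"

context
  fixes B :: "'b set" and K :: "'x \<Rightarrow> 'k set" and e :: "'x \<Rightarrow> 'k \<Rightarrow> 'b \<Rightarrow> complex"
    and P :: "'x \<Rightarrow> ('b \<Rightarrow> complex) \<Rightarrow> 'b \<Rightarrow> complex"
  defines "P \<equiv> \<lambda>x. prj B (K x) (e x)"
begin

lemma hit_lin: "hit P xs x (\<lambda>b. u b + v b) = (\<lambda>b. hit P xs x u b + hit P xs x v b)"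
  "hit P xs x (\<lambda>b. c * v b) = (\<lambda>b. c * hit P xs x v b)"
proof (induction xs arbitrary: u v)
  case (Cons y ys)
  have L1: "(\<lambda>b. u b + v b - P y (\<lambda>b. u b + v b) b) = (\<lambda>b. (u b - P y u b) + (v b - P y v b))" for u v
    unfolding P_def prj_add by (simp add: algebra_simps)
  have L2: "(\<lambda>b. c * v b - P y (\<lambda>b. c * v b) b) = (\<lambda>b. c * (v b - P y v b))" for v
    unfolding P_def prj_scale by (simp add: algebra_simps)
  { case 1
    show ?case
    proof (cases "y = x")
      case True then show ?thesis by (simp add: P_def prj_add)
    next
      case False
      have "hit P ys x (\<lambda>b. (\<lambda>b. u b + v b) b - P y (\<lambda>b. u b + v b) b) = hit P ys x (\<lambda>b. (u b - P y u b) + (v b - P y v b))" by (rule arg_cong[of _ _ "hit P ys x", OF L1[of u v]])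
      then show ?thesis using False unfolding Cons.IH(1) by simp
    qed }
  { case 2
    show ?case
    proof (cases "y = x")
      case True then show ?thesis by (simp add: P_def prj_scale)
    next
      case False
      have "hit P ys x (\<lambda>b. (\<lambda>b. c * u b) b - P y (\<lambda>b. c * u b) b) = hit P ys x (\<lambda>b. c * (u b - P y u b))" by (rule arg_cong[of _ _ "hit P ys x", OF L2[of u]])
      then show ?thesis using False unfolding Cons.IH(2) by simp
    qed }
qed simp_all

lemma hit_sum: "finite I \<Longrightarrow> hit P xs x (\<lambda>b. \<Sum>i\<in>I. c i * f i b) = (\<lambda>b. \<Sum>i\<in>I. c i * hit P xs x (f i) b)"
proof (induction I rule: finite_induct)
  case empty
  show ?case using hit_lin(2)[of xs x 0 "\<lambda>_. 0"] by simp
qed (simp add: hit_lin)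

lemma hit_cong: assumes "\<And>b. b \<in> B \<Longrightarrow> u b = v b" shows "hit P xs x u = hit P xs x v"
  using assms
proof (induction xs arbitrary: u v)
  case (Cons y ys)
  have eq: "P y u = P y v" unfolding P_def by (rule prj_cong) (rule Cons.prems)
  have "hit P ys x (\<lambda>b. u b - P y u b) = hit P ys x (\<lambda>b. v b - P y v b)"
    by (rule Cons.IH) (simp add: Cons.prems eq)
  then show ?case using eq by (simp only: hit.simps)
qed simp

text \<open>Each test splits a vector into two orthogonal branches, so the family of all final
  branches depends isometrically on the input. This becomes the completeness relation of the
  decoder.\<close>

lemma hit_isometry:
  assumes "distinct xs" "\<And>x. x \<in> set xs \<Longrightarrow> onf B (K x) (e x)"
  shows "ip B u v = (\<Sum>x\<in>set xs. ip B (hit P xs x u) (hit P xs x v)) + ip B (res P xs u) (res P xs v)"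
  using assms
proof (induction xs arbitrary: u v)
  case (Cons y ys)
  let ?u = "\<lambda>b. u b - P y u b" and ?v = "\<lambda>b. v b - P y v b"
  have on: "onf B (K y) (e y)" using Cons.prems by simp
  have "ip B u v = ip B (P y u) (P y v) + ip B ?u ?v"
    unfolding P_def ip_diff_left ip_diff_right prj_sa prj_idem[OF on] by simp
  also have "ip B ?u ?v = (\<Sum>x\<in>set ys. ip B (hit P ys x ?u) (hit P ys x ?v)) + ip B (res P ys ?u) (res P ys ?v)"
    by (rule Cons.IH) (use Cons.prems in auto)
  also have "(\<Sum>x\<in>set ys. ip B (hit P ys x ?u) (hit P ys x ?v)) = (\<Sum>x\<in>set ys. ip B (hit P (y#ys) x u) (hit P (y#ys) x v))"
    using Cons.prems by (intro sum.cong) auto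
  finally show ?case using Cons.prems by simp
qed simp

text \<open>A quantum union bound. A piece of z lost at test y lies in the range of
  \<open>P y\<close>, so its overlap with v is an overlap with \<open>P y v\<close>; at x itself the
  lost piece meets \<open>v - P x v\<close>. Cauchy-Schwarz over all steps bounds the change of
  overlap by the root of the total test error times the root of the norm lost. Keeping z apart from
  v lets the induction pass to the shrunken vector.\<close>

lemma hit_chain:
  assumes "distinct xs" "x \<in> set xs" "\<And>x. x \<in> set xs \<Longrightarrow> onf B (K x) (e x)"
  shows "nsq B (hit P xs x z) \<le> nsq B z \<and> cmod (ip B v z - ip B v (hit P xs x z))
    \<le> sqrt ((\<Sum>y\<in>set xs - {x}. nsq B (P y v)) + nsq B (\<lambda>b. v b - P x v b)) * sqrt (nsq B z - nsq B (hit P xs x z))"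
  using assms
proof (induction xs arbitrary: z)
  case (Cons y ys)
  have on: "onf B (K y) (e y)" using Cons.prems by simp
  let ?z = "\<lambda>b. z b - P y z b"
  let ?R = "nsq B (\<lambda>b. v b - P x v b)"
  have py: "nsq B z = nsq B (P y z) + nsq B ?z" unfolding P_def by (rule pythagoras[OF on])
  show ?case
  proof (cases "y = x")
    case True
    have "ip B v z - ip B v (P y z) = ip B v ?z" by (rule ip_diff_right[symmetric])
    also have "\<dots> = ip B (\<lambda>b. v b - P y v b) ?z" unfolding P_def by (rule ip_diff_prj[OF on])
    finally have "cmod (ip B v z - ip B v (P y z)) = cmod (ip B (\<lambda>b. v b - P y v b) ?z)" by simp
    also have "\<dots> \<le> nm B (\<lambda>b. v b - P y v b) * nm B ?z" by (rule cauchy)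
    also have "\<dots> = sqrt ?R * sqrt (nsq B z - nsq B (P y z))" using py True by (simp add: nm_def)
    also have "\<dots> \<le> sqrt ((\<Sum>y\<in>set (y#ys) - {x}. nsq B (P y v)) + ?R) * sqrt (nsq B z - nsq B (P y z))"
      using py by (intro mult_right_mono real_sqrt_le_mono) (simp_all add: sum_nonneg)
    finally show ?thesis using True py by simp
  next
    case False
    let ?h = "hit P ys x ?z"
    let ?E = "(\<Sum>y\<in>set ys - {x}. nsq B (P y v)) + ?R"
    have IH: "nsq B ?h \<le> nsq B ?z" "cmod (ip B v ?z - ip B v ?h) \<le> sqrt ?E * sqrt (nsq B ?z - nsq B ?h)"
      using Cons.IH[of ?z] Cons.prems False by auto
    have E0: "?E \<ge> 0" by (simp add: sum_nonneg)
    have "set (y # ys) - {x} = insert y (set ys - {x})" "y \<notin> set ys - {x}" using False Cons.prems(1) by auto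
    then have Es: "(\<Sum>y\<in>set (y#ys) - {x}. nsq B (P y v)) + ?R = nsq B (P y v) + ?E" by simp
    have "ip B v z - ip B v ?h = ip B v (P y z) + (ip B v ?z - ip B v ?h)" by (simp add: ip_diff_right)
    also have "ip B v (P y z) = ip B (P y v) (P y z)" unfolding P_def prj_sa prj_idem[OF on] ..
    finally have "cmod (ip B v z - ip B v ?h) \<le> cmod (ip B (P y v) (P y z)) + cmod (ip B v ?z - ip B v ?h)"
      using norm_triangle_ineq by metis
    also have "\<dots> \<le> nm B (P y v) * nm B (P y z) + sqrt ?E * sqrt (nsq B ?z - nsq B ?h)"
      using cauchy IH(2) by (rule add_mono)
    also have "\<dots> \<le> sqrt ((nm B (P y v))\<^sup>2 + (sqrt ?E)\<^sup>2) * sqrt ((nm B (P y z))\<^sup>2 + (sqrt (nsq B ?z - nsq B ?h))\<^sup>2)"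
    proof -
      \<comment> \<open>Cauchy-Schwarz in the plane merges the loss at the first test with the
        losses of the remaining tests.\<close>
      have "a * b + c * d \<le> sqrt (a\<^sup>2 + c\<^sup>2) * sqrt (b\<^sup>2 + d\<^sup>2)" for a b c d :: real
      proof -
        have "(a * b + c * d)\<^sup>2 \<le> (a\<^sup>2 + c\<^sup>2) * (b\<^sup>2 + d\<^sup>2)"
          using zero_le_power2[of "a * d - b * c"] by (simp add: power2_eq_square algebra_simps)
        then show ?thesis unfolding real_sqrt_mult[symmetric] by (rule real_le_rsqrt)
      qed
      then show ?thesis .
    qed
    also have "\<dots> = sqrt (nsq B (P y v) + ?E) * sqrt (nsq B z - nsq B ?h)"
      using E0 IH(1) py by (simp add: nm_sq)
    finally have f: "cmod (ip B v z - ip B v ?h) \<le> sqrt (nsq B (P y v) + ?E) * sqrt (nsq B z - nsq B ?h)" .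
    have "nsq B ?h \<le> nsq B z" using IH(1) py nsq_ge0[of B "P y z"] by linarith
    with f show ?thesis unfolding Es using False by simp
  qed
qed simp

text \<open>\<open>hit_chain\<close> with z = v, where the overlap of v with itself is its squared
  norm; one factor \<open>nm B v\<close> is then cancelled.\<close>

lemma hit_lower:
  assumes "distinct xs" "x \<in> set xs" "\<And>x. x \<in> set xs \<Longrightarrow> onf B (K x) (e x)"
  shows "nm B (hit P xs x v) \<ge> nm B v - sqrt ((\<Sum>y\<in>set xs - {x}. nsq B (P y v)) + nsq B (\<lambda>b. v b - P x v b))"
proof (cases "nm B v = 0")
  case True
  have "sqrt ((\<Sum>y\<in>set xs - {x}. nsq B (P y v)) + nsq B (\<lambda>b. v b - P x v b)) \<ge> 0" by (simp add: sum_nonneg)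
  then show ?thesis using True nm_ge0[of B "hit P xs x v"] by linarith
next
  case False
  let ?E = "sqrt ((\<Sum>y\<in>set xs - {x}. nsq B (P y v)) + nsq B (\<lambda>b. v b - P x v b))"
  let ?h = "hit P xs x v"
  have E0: "?E \<ge> 0" by (simp add: sum_nonneg)
  have c: "cmod (ip B v v - ip B v ?h) \<le> ?E * sqrt (nsq B v - nsq B ?h)" using hit_chain[OF assms] by blast
  also have "\<dots> \<le> ?E * nm B v" unfolding nm_def by (intro mult_left_mono E0 real_sqrt_le_mono) simp
  finally have "cmod (ip B v v) - cmod (ip B v ?h) \<le> ?E * nm B v" using norm_triangle_ineq2[of "ip B v v" "ip B v ?h"] by linarith
  moreover have "cmod (ip B v v) = nm B v * nm B v" unfolding ip_self using nm_sq[of B v] by (simp add: power2_eq_square)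
  moreover have "cmod (ip B v ?h) \<le> nm B v * nm B ?h" by (rule cauchy)
  ultimately have "nm B v * nm B v \<le> nm B v * (nm B ?h + ?E)" by (simp add: algebra_simps)
  then have "nm B v \<le> nm B ?h + ?E" using False nm_ge0[of B v] by (simp add: mult_le_cancel_left)
  then show ?thesis by simp
qed

end

section \<open>Simultaneous tests\<close>

definition tens :: "('b \<Rightarrow> complex) \<Rightarrow> ('a \<Rightarrow> complex) \<Rightarrow> 'b \<times> 'a \<Rightarrow> complex" where
  "tens u a = (\<lambda>p. u (fst p) * a (snd p))"

lemma ip_tens: "ip (B \<times> A) (tens u a) (tens v c) = ip B u v * ip A a c"
  unfolding ip_def tens_def sum_product sum.cartesian_product by (intro sum.cong refl) auto
lemma nsq_tens: "nsq (B \<times> A) (tens u a) = nsq B u * nsq A a"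
  unfolding nsq_def tens_def sum_product sum.cartesian_product by (intro sum.cong refl) (auto simp: norm_mult power_mult_distrib)
lemma nm_tens: "nm (B \<times> A) (tens u a) = nm B u * nm A a"
  by (simp add: nm_def nsq_tens real_sqrt_mult)
lemma tens_add: "tens (\<lambda>b. u b + v b) a = (\<lambda>p. tens u a p + tens v a p)"
  by (auto simp: tens_def algebra_simps)
lemma tens_scale: "tens (\<lambda>b. c * v b) a = (\<lambda>p. c * tens v a p)"
  by (auto simp: tens_def algebra_simps)
lemma tens_sum: "tens (\<lambda>b. \<Sum>i\<in>I. f i b) a = (\<lambda>p. \<Sum>i\<in>I. tens (f i) a p)"
  by (auto simp: tens_def sum_distrib_right)

text \<open>Left unnormalised on purpose: tilts along different label sets then agree entry by entry
  wherever their labels agree, which is how \<open>simultaneous_tests\<close> replaces the tilt of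
  one tuple by that of another.\<close>

definition tilt :: "real \<Rightarrow> 'a \<Rightarrow> 'a set \<Rightarrow> 'a \<Rightarrow> complex" where
  "tilt d z L = (\<lambda>\<alpha>. if \<alpha> = z then 1 else if \<alpha> \<in> L then complex_of_real d else 0)"

lemma nsq_tilt: assumes "finite A" "z \<in> A" "L \<subseteq> A" "z \<notin> L" shows "nsq A (tilt d z L) = 1 + d\<^sup>2 * card L"
proof -
  have "nsq A (tilt d z L) = (\<Sum>\<alpha>\<in>insert z L. (cmod (tilt d z L \<alpha>))\<^sup>2)"
    unfolding nsq_def using assms by (intro sum.mono_neutral_right) (auto simp: tilt_def)
  also have "\<dots> = (cmod (tilt d z L z))\<^sup>2 + (\<Sum>\<alpha>\<in>L. (cmod (tilt d z L \<alpha>))\<^sup>2)"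
    using assms finite_subset[OF assms(3,1)] by simp
  also have "(\<Sum>\<alpha>\<in>L. (cmod (tilt d z L \<alpha>))\<^sup>2) = (\<Sum>\<alpha>\<in>L. d\<^sup>2)"
    using assms by (intro sum.cong refl) (auto simp: tilt_def)
  also have "(cmod (tilt d z L z))\<^sup>2 = 1" by (simp add: tilt_def)
  finally show ?thesis by simp
qed

text \<open>Projections onto the "bad" subspaces are tilted into different ancilla directions, so that a
  vector almost orthogonal to each of them is almost orthogonal to their span.\<close>

lemma tilted_test:
  fixes e :: "'k \<Rightarrow> 'b \<Rightarrow> complex" and eJ :: "'i set \<Rightarrow> 'l \<Rightarrow> 'b \<Rightarrow> complex" and lb :: "'i set \<Rightarrow> 'a"
  assumes fB: "finite B" and fA: "finite A" and zA: "z \<in> A" and fJ: "finite Js"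
    and lbA: "lb ` Js \<subseteq> A" and inj: "inj_on lb Js" and zl: "z \<notin> lb ` Js"
    and Jf: "\<And>J. J \<in> Js \<Longrightarrow> finite J \<and> card J \<le> Mx"
    and onJ: "\<And>J. J \<in> Js \<Longrightarrow> onf B (KJ J) (eJ J)" and on: "onf B K e" and d: "d > 0"
  defines "a \<equiv> tilt d z (lb ` Js)" and "aJ \<equiv> \<lambda>J. tilt d z (lb ` {J'\<in>Js. J \<subseteq> J'})"
  shows "\<exists>KT\<subseteq>K. \<exists>eT. onf (B \<times> A) KT eT \<and> (\<forall>k\<in>KT. \<forall>b \<alpha>. \<alpha> \<notin> insert z (lb ` Js) \<longrightarrow> eT k (b, \<alpha>) = 0)
    \<and> (\<forall>J\<in>Js. \<forall>h. (\<forall>b\<in>B. prj B (KJ J) (eJ J) h b = 0) \<longrightarrow> (\<forall>k\<in>KT. ip (B \<times> A) (eT k) (tens h (aJ J)) = 0))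
    \<and> (\<forall>u. nm (B \<times> A) (\<lambda>p. tens u a p - prj (B \<times> A) KT eT (tens u a) p)
        \<le> 2 * nm A a * nm B (\<lambda>b. u b - prj B K e u b)
          + ((1 + d\<^sup>2 * real (card Js)) * (1 + real (card Js)) ^ Mx / d) * (\<Sum>J\<in>Js. nm B (\<lambda>b. u b - prj B (KJ J) (eJ J) u b)))"
proof -
  let ?BA = "B \<times> A"
  let ?N = "1 + d\<^sup>2 * card Js"
  have fBA: "finite ?BA" using fB fA by simp
  \<comment> \<open>The vectors \<open>hh J b\<close> span the complement of the good subspace of J.
    Each is tilted along the labels of all supersets of J, because a competitor differing from the
    tested tuple exactly on J shares with it the labels of precisely those sets.\<close>
  define hh where "hh = (\<lambda>J b x. kd b x - prj B (KJ J) (eJ J) (kd b) x)"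
  define fam where "fam = (\<lambda>q. tens (hh (fst q) (snd q)) (aJ (fst q)))"
  obtain KW :: "('i set \<times> 'b) set" and eW where W: "onf ?BA KW eW" and Wf: "\<forall>i\<in>Js \<times> B. \<forall>p\<in>?BA. prj ?BA KW eW (fam i) p = fam i p"
    and Wc: "\<forall>k\<in>KW. \<exists>c. eW k = (\<lambda>p. \<Sum>q\<in>Js \<times> B. c q * fam q p)"
    using gram_schmidt[OF finite_cartesian_product[OF fJ fB] fBA, of fam] by blast
  obtain cW where cW: "\<And>k. k\<in>KW \<Longrightarrow> eW k = (\<lambda>p. \<Sum>q\<in>Js \<times> B. cW k q * fam q p)" using Wc by metis
  let ?PW = "prj ?BA KW eW"
  \<comment> \<open>The test projects onto the span of the vectors e_k (x) a after their components
    in the span W of all tilted bad vectors have been removed.\<close>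
  define tt where "tt = (\<lambda>k p. tens (e k) a p - ?PW (tens (e k) a) p)"
  obtain KT eT where KT: "KT \<subseteq> K" and T: "onf ?BA KT eT" and Tf: "\<forall>k\<in>K. \<forall>p\<in>?BA. prj ?BA KT eT (tt k) p = tt k p"
    and Tc: "\<forall>k\<in>KT. \<exists>c. eT k = (\<lambda>p. \<Sum>i\<in>K. c i * tt i p)"
    using gram_schmidt[OF onf_fin[OF on] fBA, of tt] by blast
  let ?PT = "prj ?BA KT eT"
  have hh0: "prj B (KJ J) (eJ J) (hh J b) = (\<lambda>_. 0)" if "J\<in>Js" for J b
    unfolding hh_def prj_diff prj_idem[OF onJ[OF that]] by simp
  have sup: "eT k (b, \<alpha>) = 0" if k: "k\<in>KT" and al: "\<alpha> \<notin> insert z (lb ` Js)" for k b \<alpha>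
  proof -
    have "fam q (b,\<alpha>) = 0" for q using al by (auto simp: fam_def tens_def aJ_def tilt_def)
    then have "\<And>k. k\<in>KW \<Longrightarrow> eW k (b,\<alpha>) = 0" using cW by simp
    then have "tt i (b,\<alpha>) = 0" for i using al by (simp add: tt_def prj_def tens_def a_def tilt_def)
    moreover obtain c where "eT k = (\<lambda>p. \<Sum>i\<in>K. c i * tt i p)" using Tc k by blast
    ultimately show ?thesis by simp
  qed
  have Worth: "ip ?BA (eT k) w = 0" if k: "k\<in>KT" and w: "\<And>p. p\<in>?BA \<Longrightarrow> ?PW w p = w p" for k w
  proof -
    have "ip ?BA (tt i) w = 0" for i
    proof -
      have "ip ?BA (tt i) w = ip ?BA (tens (e i) a) w - ip ?BA (tens (e i) a) (?PW w)"
        unfolding tt_def ip_diff_left prj_sa ..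
      also have "ip ?BA (tens (e i) a) (?PW w) = ip ?BA (tens (e i) a) w" using w by (intro ip_cong) auto
      finally show ?thesis by simp
    qed
    moreover obtain c where "eT k = (\<lambda>p. \<Sum>i\<in>K. c i * tt i p)" using Tc k by blast
    ultimately show ?thesis by (simp add: ip_sum_left ip_scale_left)
  qed
  \<comment> \<open>A vector annihilated by the projection for J is a combination of the
    \<open>hh J b\<close>, so tensored with \<open>aJ J\<close> it lies in W, to which the test is
    orthogonal.\<close>
  have kill: "ip ?BA (eT k) (tens h (aJ J)) = 0"
    if J: "J\<in>Js" and h: "\<forall>b\<in>B. prj B (KJ J) (eJ J) h b = 0" and k: "k\<in>KT" for J h k
  proof -
    define s where "s = (\<lambda>p. \<Sum>b\<in>B. h b * fam (J,b) p)"
    have hs: "tens h (aJ J) p = s p" if p: "p\<in>?BA" for p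
    proof -
      have kdx: "(\<Sum>b\<in>B. h b * kd b x) = h x" if "x\<in>B" for x
        using ip_kd_right[of B _ h] fB that by (simp add: kd_def if_distrib cong: if_cong)
      have "prj B (KJ J) (eJ J) h (fst p) = prj B (KJ J) (eJ J) (\<lambda>x. \<Sum>b\<in>B. h b * kd b x) (fst p)"
        by (rule fun_cong[OF prj_cong]) (simp add: kdx)
      then have "(\<Sum>b\<in>B. h b * prj B (KJ J) (eJ J) (kd b) (fst p)) = 0"
        unfolding prj_sum prj_scale using h p by auto
      then have "(\<Sum>b\<in>B. h b * hh J b (fst p)) = h (fst p)"
        using kdx p by (auto simp: hh_def right_diff_distrib sum_subtractf)
      then show ?thesis by (simp add: s_def fam_def tens_def mult.assoc[symmetric] sum_distrib_right[symmetric])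
    qed
    have "?PW s p = s p" if p: "p\<in>?BA" for p
      unfolding s_def prj_sum prj_scale using Wf J p by (intro sum.cong refl) auto
    then have "ip ?BA (eT k) s = 0" by (rule Worth[OF k])
    moreover have "ip ?BA (eT k) (tens h (aJ J)) = ip ?BA (eT k) s" using hs by (intro ip_cong) auto
    ultimately show ?thesis by simp
  qed
  have cL: "card (lb ` L) = card L" if "L \<subseteq> Js" for L using inj that by (intro card_image) (rule inj_on_subset)
  have aJ2: "nsq A (aJ J) \<le> ?N" for J
  proof -
    have "nsq A (aJ J) = 1 + d\<^sup>2 * card {J'\<in>Js. J \<subseteq> J'}"
      unfolding aJ_def using lbA zl by (subst nsq_tilt[OF fA zA]) (auto simp: cL)
    also have "\<dots> \<le> ?N" using fJ by (intro add_left_mono mult_left_mono) (auto intro: card_mono)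
    finally show ?thesis .
  qed
  \<comment> \<open>On the support of \<open>aJ J\<close> the vectors a and \<open>aJ J\<close>
    coincide, so their inner product is a squared norm.\<close>
  have aaJ: "cmod (ip A a (aJ J)) \<le> ?N" for J
  proof -
    have "ip A a (aJ J) = ip A (aJ J) (aJ J)" unfolding ip_def by (intro sum.cong refl) (auto simp: a_def aJ_def tilt_def)
    then show ?thesis using aJ2[of J] by (simp add: ip_self)
  qed
  let ?C = "1 + real (card Js)"
  \<comment> \<open>The component w of u (x) a in W is a sum of h_J (x) aJ J with every h_J bad for
    J. Bounding each h_J by |w| and using |w|^2 = <u (x) a, w>, a factor |w| cancels and only the
    distances of u from the good subspaces remain.\<close>
  have Wbound: "nm ?BA (?PW (tens u a)) \<le> (?N * ?C ^ Mx / d) * (\<Sum>J\<in>Js. nm B (\<lambda>b. u b - prj B (KJ J) (eJ J) u b))" for u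
  proof -
    define w where "w = ?PW (tens u a)"
    define hJ where "hJ = (\<lambda>J x. \<Sum>b\<in>B. (\<Sum>k\<in>KW. ip ?BA (eW k) (tens u a) * cW k (J,b)) * hh J b x)"
    have hJ0: "prj B (KJ J) (eJ J) (hJ J) = (\<lambda>_. 0)" if "J\<in>Js" for J
      unfolding hJ_def prj_sum prj_scale hh0[OF that] by simp
    have w: "w p = (\<Sum>J\<in>Js. tens (hJ J) (aJ J) p)" for p
    proof -
      have "w p = (\<Sum>k\<in>KW. ip ?BA (eW k) (tens u a) * (\<Sum>q\<in>Js \<times> B. cW k q * fam q p))"
        unfolding w_def prj_def using cW by (intro sum.cong refl) auto
      also have "\<dots> = (\<Sum>q\<in>Js \<times> B. (\<Sum>k\<in>KW. ip ?BA (eW k) (tens u a) * cW k q) * fam q p)"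
        unfolding sum_distrib_left sum_distrib_right by (subst sum.swap) (simp add: mult.assoc)
      also have "\<dots> = (\<Sum>J\<in>Js. \<Sum>b\<in>B. (\<Sum>k\<in>KW. ip ?BA (eW k) (tens u a) * cW k (J,b)) * fam (J,b) p)"
        by (rule sum.cartesian_product')
      also have "\<dots> = (\<Sum>J\<in>Js. tens (hJ J) (aJ J) p)"
        by (simp add: hJ_def tens_def fam_def sum_distrib_right mult.assoc)
      finally show ?thesis .
    qed
    define G where "G = nm ?BA w / d"
    \<comment> \<open>Reading w at the ancilla label of J' isolates d times the sum of the h_J over
      all J contained in J'. This is the origin of the factor 1/d.\<close>
    have gb: "nm B (\<lambda>b. \<Sum>J\<in>{J\<in>Js. J \<subseteq> J'}. hJ J b) \<le> G" if J': "J'\<in>Js" for J'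
    proof -
      have wl: "w (b, lb J') = of_real d * (\<Sum>J\<in>{J\<in>Js. J \<subseteq> J'}. hJ J b)" for b
      proof -
        have "aJ J (lb J') = (if J \<subseteq> J' then of_real d else 0)" for J
          using J' zl inj unfolding aJ_def tilt_def by (auto dest: inj_onD)
        then have "w (b, lb J') = (\<Sum>J\<in>Js. if J \<subseteq> J' then of_real d * hJ J b else 0)"
          unfolding w tens_def by (intro sum.cong refl) auto
        also have "\<dots> = (\<Sum>J\<in>{J\<in>Js. J \<subseteq> J'}. of_real d * hJ J b)" using fJ by (simp add: sum.inter_filter)
        finally show ?thesis by (simp add: sum_distrib_left)
      qed
      have "d\<^sup>2 * nsq B (\<lambda>b. \<Sum>J\<in>{J\<in>Js. J \<subseteq> J'}. hJ J b) = (\<Sum>b\<in>B. (cmod (w (b, lb J')))\<^sup>2)"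
        unfolding wl nsq_def norm_mult power_mult_distrib by (simp add: sum_distrib_left)
      also have "\<dots> \<le> (\<Sum>b\<in>B. \<Sum>\<alpha>\<in>A. (cmod (w (b, \<alpha>)))\<^sup>2)"
        using lbA J' fA by (intro sum_mono member_le_sum) auto
      also have "\<dots> = nsq ?BA w" unfolding nsq_def sum.cartesian_product' ..
      finally have "sqrt (d\<^sup>2 * nsq B (\<lambda>b. \<Sum>J\<in>{J\<in>Js. J \<subseteq> J'}. hJ J b)) \<le> nm ?BA w" unfolding nm_def by simp
      then have "d * nm B (\<lambda>b. \<Sum>J\<in>{J\<in>Js. J \<subseteq> J'}. hJ J b) \<le> nm ?BA w" using d by (simp add: nm_def real_sqrt_mult)
      then show ?thesis using d by (simp add: G_def pos_le_divide_eq mult.commute)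
    qed
    have G0: "G \<ge> 0" using d by (simp add: G_def)
    \<comment> \<open>Inversion over the inclusion order: h_J is the sum over subsets of J minus the
      h of proper subsets, and each level costs at most a factor C.\<close>
    have hb: "nm B (hJ J) \<le> ?C ^ card J * G" if "J\<in>Js" for J
      using that
    proof (induction "card J" arbitrary: J rule: less_induct)
      case less
      let ?S = "{J'\<in>Js. J' \<subset> J}"
      have fS: "finite ?S" using fJ by simp
      have "{J'\<in>Js. J' \<subseteq> J} = insert J ?S" using less.prems by auto
      then have "hJ J b = (\<Sum>J'\<in>{J'\<in>Js. J' \<subseteq> J}. hJ J' b) - (\<Sum>J'\<in>?S. hJ J' b)" for b using fS by simp
      then have eq: "hJ J = (\<lambda>b. (\<Sum>J'\<in>{J'\<in>Js. J' \<subseteq> J}. hJ J' b) - (\<Sum>J'\<in>?S. hJ J' b))" by (rule ext)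
      have "nm B (hJ J) \<le> G + nm B (\<lambda>b. \<Sum>J'\<in>?S. hJ J' b)"
        by (subst eq) (rule order_trans[OF nm_triangle_diff], use gb[OF less.prems] in simp)
      also have "nm B (\<lambda>b. \<Sum>J'\<in>?S. hJ J' b) \<le> (\<Sum>J'\<in>?S. nm B (hJ J'))" by (rule nm_sum[OF fS])
      also have "\<dots> \<le> (\<Sum>J'\<in>?S. ?C ^ (card J - 1) * G)"
      proof (rule sum_mono)
        fix J' assume J': "J'\<in>?S"
        then have lt: "card J' < card J" using Jf[OF less.prems] by (auto intro: psubset_card_mono)
        have "nm B (hJ J') \<le> ?C ^ card J' * G" using less.hyps[OF lt] J' by simp
        also have "\<dots> \<le> ?C ^ (card J - 1) * G" using lt G0 by (intro mult_right_mono power_increasing) auto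
        finally show "nm B (hJ J') \<le> ?C ^ (card J - 1) * G" .
      qed
      also have "\<dots> = card ?S * (?C ^ (card J - 1) * G)" by simp
      finally have b1: "nm B (hJ J) \<le> G + card ?S * (?C ^ (card J - 1) * G)" by simp
      show ?case
      proof (cases "?S = {}")
        case True
        have "1 \<le> ?C ^ card J" by (rule one_le_power) simp
        then have "G \<le> ?C ^ card J * G" using G0 mult_right_mono[of 1 "?C ^ card J" G] by simp
        then show ?thesis using b1 True by simp
      next
        case False
        then obtain J' where "J'\<in>?S" by blast
        then have "card J > 0" using psubset_card_mono[of J J'] Jf[OF less.prems] by auto
        then have Cs: "?C ^ card J = ?C * ?C ^ (card J - 1)" by (simp add: power_eq_if)
        have o: "1 \<le> ?C ^ (card J - 1)" by (rule one_le_power) simp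
        have "card ?S \<le> card Js" using fJ by (intro card_mono) auto
        then have "card ?S * (?C ^ (card J - 1) * G) \<le> card Js * (?C ^ (card J - 1) * G)"
          using o G0 by (intro mult_right_mono) auto
        moreover have "G \<le> ?C ^ (card J - 1) * G" using o G0 mult_right_mono[OF o G0] by simp
        ultimately show ?thesis using b1 unfolding Cs by (simp add: algebra_simps)
      qed
    qed
    have C1: "?C ^ card J \<le> ?C ^ Mx" if "J\<in>Js" for J using Jf[OF that] by (intro power_increasing) auto
    have hb': "nm B (hJ J) \<le> ?C ^ Mx * G" if "J\<in>Js" for J
      using hb[OF that] mult_right_mono[OF C1[OF that] G0] by linarith
    \<comment> \<open>Since h_J is bad for J, its overlap with u is an overlap with the part of u
      outside the good subspace of J.\<close>
    have "complex_of_real (nsq ?BA w) = ip ?BA (tens u a) w"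
      unfolding ip_self[symmetric] w_def prj_sa prj_idem[OF W] ..
    also have "\<dots> = ip ?BA (tens u a) (\<lambda>p. \<Sum>J\<in>Js. tens (hJ J) (aJ J) p)" using w by (intro ip_cong) auto
    also have "\<dots> = (\<Sum>J\<in>Js. ip B u (hJ J) * ip A a (aJ J))" unfolding ip_sum_right ip_tens ..
    finally have "nsq ?BA w = cmod (\<Sum>J\<in>Js. ip B u (hJ J) * ip A a (aJ J))" by (metis nsq_ge0 norm_of_real abs_of_nonneg)
    also have "\<dots> \<le> (\<Sum>J\<in>Js. (nm B (\<lambda>b. u b - prj B (KJ J) (eJ J) u b) * (?C ^ Mx * G)) * ?N)"
    proof (rule order_trans[OF norm_sum], rule sum_mono)
      fix J assume J: "J\<in>Js"
      have "ip B u (hJ J) = ip B (\<lambda>b. u b - prj B (KJ J) (eJ J) u b) (hJ J)"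
        unfolding ip_diff_left prj_sa hJ0[OF J] by simp
      then have "cmod (ip B u (hJ J)) \<le> nm B (\<lambda>b. u b - prj B (KJ J) (eJ J) u b) * nm B (hJ J)" using cauchy by metis
      also have "\<dots> \<le> nm B (\<lambda>b. u b - prj B (KJ J) (eJ J) u b) * (?C ^ Mx * G)" using hb'[OF J] by (intro mult_left_mono) auto
      finally show "cmod (ip B u (hJ J) * ip A a (aJ J)) \<le> (nm B (\<lambda>b. u b - prj B (KJ J) (eJ J) u b) * (?C ^ Mx * G)) * ?N"
        unfolding norm_mult using aaJ[of J] G0 by (intro mult_mono) auto
    qed
    also have "\<dots> = (?N * ?C ^ Mx / d) * (\<Sum>J\<in>Js. nm B (\<lambda>b. u b - prj B (KJ J) (eJ J) u b)) * nm ?BA w"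
      by (simp add: G_def sum_distrib_left sum_distrib_right mult_ac sum_divide_distrib)
    finally have "nm ?BA w * nm ?BA w \<le> (?N * ?C ^ Mx / d) * (\<Sum>J\<in>Js. nm B (\<lambda>b. u b - prj B (KJ J) (eJ J) u b)) * nm ?BA w"
      using nm_sq[of ?BA w] by (simp add: power2_eq_square)
    then have "nm ?BA w = 0 \<or> nm ?BA w \<le> (?N * ?C ^ Mx / d) * (\<Sum>J\<in>Js. nm B (\<lambda>b. u b - prj B (KJ J) (eJ J) u b))"
      using nm_ge0[of ?BA w] by (simp only: mult_le_cancel_right) linarith
    moreover have "0 \<le> (?N * ?C ^ Mx / d) * (\<Sum>J\<in>Js. nm B (\<lambda>b. u b - prj B (KJ J) (eJ J) u b))"
      using d by (intro mult_nonneg_nonneg divide_nonneg_pos sum_nonneg) auto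
    ultimately show ?thesis unfolding w_def[symmetric] by linarith
  qed
  have bound: "nm ?BA (\<lambda>p. tens u a p - ?PT (tens u a) p)
        \<le> 2 * nm A a * nm B (\<lambda>b. u b - prj B K e u b)
          + (?N * ?C ^ Mx / d) * (\<Sum>J\<in>Js. nm B (\<lambda>b. u b - prj B (KJ J) (eJ J) u b))" for u
  proof -
    define pu where "pu = prj B K e u"
    define q where "q = (\<lambda>b. u b - pu b)"
    define s where "s = (\<lambda>p. tens pu a p - ?PW (tens pu a) p)"
    have tpu: "tens pu a = (\<lambda>p. \<Sum>k\<in>K. ip B (e k) u * tens (e k) a p)"
      unfolding pu_def prj_def tens_sum tens_scale ..
    have ss: "s = (\<lambda>p. \<Sum>k\<in>K. ip B (e k) u * tt k p)"
      unfolding s_def tpu prj_sum prj_scale tt_def by (simp add: sum_subtractf[symmetric] right_diff_distrib)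
    have Ts: "?PT s p = s p" if "p\<in>?BA" for p
      unfolding ss prj_sum prj_scale using Tf that by (intro sum.cong refl) auto
    let ?D = "\<lambda>v p. v p - ?PT v p"
    have u: "u = (\<lambda>b. pu b + q b)" by (simp add: q_def)
    \<comment> \<open>The part s is accepted without loss. The bad component of pu (x) a differs
      from that of u (x) a by at most |q (x) a|, and q (x) a occurs once more as the remainder;
      hence the factor 2.\<close>
    have tu: "tens u a = (\<lambda>p. s p + (?PW (tens pu a) p + tens q a p))"
      by (subst u) (simp add: tens_add s_def)
    have "nm ?BA (?D (tens u a)) = nm ?BA (\<lambda>p. ?D (?PW (tens pu a)) p + ?D (tens q a) p)"
      unfolding tu prj_add using Ts by (intro nm_cong) simp
    also have "\<dots> \<le> nm ?BA (?D (?PW (tens pu a))) + nm ?BA (?D (tens q a))" by (rule nm_triangle)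
    also have "\<dots> \<le> nm ?BA (?PW (tens pu a)) + nm ?BA (tens q a)" by (intro add_mono nm_diff_prj_le T)
    also have "?PW (tens pu a) = (\<lambda>p. ?PW (tens u a) p - ?PW (tens q a) p)"
    proof -
      have "tens u a = (\<lambda>p. tens pu a p + tens q a p)" by (subst u) (rule tens_add)
      then show ?thesis by (simp add: prj_add)
    qed
    also have "nm ?BA (\<lambda>p. ?PW (tens u a) p - ?PW (tens q a) p) \<le> nm ?BA (?PW (tens u a)) + nm ?BA (?PW (tens q a))"
      by (rule nm_triangle_diff)
    also have "nm ?BA (?PW (tens q a)) \<le> nm ?BA (tens q a)" by (rule nm_prj_le[OF W])
    finally show ?thesis using Wbound[of u] by (simp add: nm_tens q_def pu_def algebra_simps)
  qed
  show ?thesis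
    by (rule exI[of _ KT], rule conjI[OF KT], rule exI[of _ eT], intro conjI T)
      (use sup kill bound in auto)
qed

section \<open>One tilted test per tuple\<close>

definition off :: "nat set \<Rightarrow> (nat \<Rightarrow> 'x) \<Rightarrow> nat \<Rightarrow> 'x" where
  "off J x = (\<lambda>i. if i \<in> J then undefined else x i)"

definition diffset :: "(nat \<Rightarrow> 'x) \<Rightarrow> (nat \<Rightarrow> 'x) \<Rightarrow> nat set" where
  "diffset x y = {i. x i \<noteq> y i}"

text \<open>Ancilla directions: \<open>None\<close> is the unperturbed one, \<open>Some (J, y)\<close> belongs to the test for \<open>J\<close> and the letters
  \<open>y\<close> off \<open>J\<close>, so tuples that agree off \<open>J\<close> share it.\<close>

definition anc :: "nat set set \<Rightarrow> (nat \<Rightarrow> 'x) set \<Rightarrow> (nat set \<times> (nat \<Rightarrow> 'x)) option set" where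
  "anc Js Xs = insert None (Some ` (Js \<times> (\<Union>J\<in>Js. off J ` Xs)))"

definition lab :: "(nat \<Rightarrow> 'x) \<Rightarrow> nat set \<Rightarrow> (nat set \<times> (nat \<Rightarrow> 'x)) option" where
  "lab x J = Some (J, off J x)"

lemma off_eq_iff: "off J x = off J y \<longleftrightarrow> diffset x y \<subseteq> J"
  unfolding off_def diffset_def fun_eq_iff by auto

lemma nm_sum_square: fixes f :: "'a \<Rightarrow> real" shows "(\<Sum>i\<in>I. f i)\<^sup>2 \<le> card I * (\<Sum>i\<in>I. (f i)\<^sup>2)"
proof -
  have "\<bar>\<Sum>i\<in>I. f i\<bar> \<le> (\<Sum>i\<in>I. \<bar>1\<bar> * \<bar>f i\<bar>)" by (rule order_trans[OF sum_abs]) simp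
  also have "\<dots> \<le> L2_set (\<lambda>_. 1) I * L2_set f I" by (rule L2_set_mult_ineq)
  finally have "\<bar>\<Sum>i\<in>I. f i\<bar>\<^sup>2 \<le> (L2_set (\<lambda>_. 1) I * L2_set f I)\<^sup>2" by (intro power_mono) auto
  then show ?thesis by (simp add: L2_set_def power_mult_distrib sum_nonneg)
qed

text \<open>Acceptance of the right tuple is \<open>tilted_test\<close>. For a competitor x that
  differs from x' exactly on J, the test of x' sees the tilt of x as \<open>aJ x' J\<close> and is
  blind to the part of \<open>u x i\<close> that is bad for J, so only the projection for J remains;
  \<open>mu\<close> bounds its total contribution. The factor \<open>card (K x')\<close> counts the
  basis vectors of the test, which survive the tilting as a subset of the original labels.\<close>

lemma simultaneous_tests:
  fixes Xs :: "(nat \<Rightarrow> 'x) set" and u :: "(nat \<Rightarrow> 'x) \<Rightarrow> 'i \<Rightarrow> 'b \<Rightarrow> complex" and K :: "(nat \<Rightarrow> 'x) \<Rightarrow> 'k set" and c d \<epsilon> :: real and \<mu> :: "nat set \<Rightarrow> real"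
  assumes fX: "finite Xs" and fB: "finite B" and fI: "finite I" and fJ: "finite Js"
    and Jf: "\<And>J. J \<in> Js \<Longrightarrow> finite J \<and> card J \<le> Mx"
    and on: "\<And>x. x \<in> Xs \<Longrightarrow> onf B (K x) (e x)"
    and onJ: "\<And>J x. J \<in> Js \<Longrightarrow> x \<in> Xs \<Longrightarrow> onf B (KJ J x) (eJ J x)"
    and dep: "\<And>J x x'. J \<in> Js \<Longrightarrow> x \<in> Xs \<Longrightarrow> x' \<in> Xs \<Longrightarrow> diffset x x' \<subseteq> J \<Longrightarrow> KJ J x = KJ J x' \<and> eJ J x = eJ J x'"
    and err0: "(\<Sum>x\<in>Xs. \<Sum>i\<in>I. nsq B (\<lambda>b. u x i b - prj B (K x) (e x) (u x i) b)) \<le> \<epsilon>"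
    and errJ: "\<And>J. J \<in> Js \<Longrightarrow> (\<Sum>x\<in>Xs. \<Sum>i\<in>I. nsq B (\<lambda>b. u x i b - prj B (KJ J x) (eJ J x) (u x i) b)) \<le> \<epsilon>"
    and mu: "\<And>J x' h. J \<in> Js \<Longrightarrow> x' \<in> Xs \<Longrightarrow>
       (\<Sum>x\<in>{x\<in>Xs. diffset x x' = J}. \<Sum>i\<in>I. (cmod (ip B h (prj B (KJ J x) (eJ J x) (u x i))))\<^sup>2) \<le> \<mu> J * nsq B h"
    and mu0: "\<And>J. J \<in> Js \<Longrightarrow> \<mu> J \<ge> 0" and d: "d > 0"
  defines "c \<equiv> real (card Js)" and "A \<equiv> anc Js Xs" and "ax \<equiv> \<lambda>x. tilt d None (lab x ` Js)"
  shows "\<exists>KT eT. (\<forall>x\<in>Xs. onf (B \<times> A) (KT x) (eT x))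
    \<and> (\<Sum>x\<in>Xs. \<Sum>i\<in>I. nsq (B \<times> A) (\<lambda>p. tens (u x i) (ax x) p - prj (B \<times> A) (KT x :: 'k set) (eT x) (tens (u x i) (ax x)) p))
        \<le> (8 * (1 + d\<^sup>2 * c) + 2 * ((1 + d\<^sup>2 * c) * (1 + c) ^ Mx / d)\<^sup>2 * c\<^sup>2) * \<epsilon>
    \<and> (\<forall>x'\<in>Xs. \<forall>J\<in>Js. (\<Sum>x\<in>{x\<in>Xs. diffset x x' = J}. \<Sum>i\<in>I. nsq (B \<times> A) (prj (B \<times> A) (KT x') (eT x') (tens (u x i) (ax x))))
        \<le> card (K x') * \<mu> J * (1 + d\<^sup>2 * c))"
proof -
  let ?N = "1 + d\<^sup>2 * c"
  let ?q = "?N * (1 + c) ^ Mx / d"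
  let ?BA = "B \<times> A"
  have fA: "finite A" using fJ fX by (simp add: A_def anc_def)
  have zA: "None \<in> A" by (simp add: A_def anc_def)
  have lA: "lab x ` Js \<subseteq> A" if "x \<in> Xs" for x using that by (auto simp: A_def anc_def lab_def)
  have li: "inj_on (lab x) Js" for x by (auto simp: inj_on_def lab_def)
  have lz: "None \<notin> lab x ` Js" for x by (auto simp: lab_def)
  define aJ where "aJ = (\<lambda>(x :: nat \<Rightarrow> 'x) J. tilt d None (lab x ` {J'\<in>Js. J \<subseteq> J'}))"
  define Q where "Q = (\<lambda>x KT eT. KT \<subseteq> K x \<and> onf ?BA KT eT
    \<and> (\<forall>k\<in>KT. \<forall>b \<alpha>. \<alpha> \<notin> insert None (lab x ` Js) \<longrightarrow> eT k (b, \<alpha>) = 0)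
    \<and> (\<forall>J\<in>Js. \<forall>h. (\<forall>b\<in>B. prj B (KJ J x) (eJ J x) h b = 0) \<longrightarrow> (\<forall>k\<in>KT. ip ?BA (eT k) (tens h (aJ x J)) = 0))
    \<and> (\<forall>u. nm ?BA (\<lambda>p. tens u (ax x) p - prj ?BA KT eT (tens u (ax x)) p)
        \<le> 2 * nm A (ax x) * nm B (\<lambda>b. u b - prj B (K x) (e x) u b)
          + ?q * (\<Sum>J\<in>Js. nm B (\<lambda>b. u b - prj B (KJ J x) (eJ J x) u b))))"
  have "\<exists>KT eT. Q x KT eT" if x: "x \<in> Xs" for x
  proof -
    have "\<exists>KT\<subseteq>K x. \<exists>eT. onf ?BA KT eT
    \<and> (\<forall>k\<in>KT. \<forall>b \<alpha>. \<alpha> \<notin> insert None (lab x ` Js) \<longrightarrow> eT k (b, \<alpha>) = 0)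
    \<and> (\<forall>J\<in>Js. \<forall>h. (\<forall>b\<in>B. prj B (KJ J x) (eJ J x) h b = 0) \<longrightarrow> (\<forall>k\<in>KT. ip ?BA (eT k) (tens h (aJ x J)) = 0))
    \<and> (\<forall>u. nm ?BA (\<lambda>p. tens u (ax x) p - prj ?BA KT eT (tens u (ax x)) p)
        \<le> 2 * nm A (ax x) * nm B (\<lambda>b. u b - prj B (K x) (e x) u b)
          + ?q * (\<Sum>J\<in>Js. nm B (\<lambda>b. u b - prj B (KJ J x) (eJ J x) u b)))"
      unfolding ax_def aJ_def c_def by (rule tilted_test[OF fB fA zA fJ lA[OF x] li lz Jf onJ[OF _ x] on[OF x] d])
    then show ?thesis unfolding Q_def by (elim exE conjE) (intro exI conjI)
  qed
  then obtain KT eT where Q: "\<And>x. x\<in>Xs \<Longrightarrow> Q x (KT x) (eT x)" by metis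
  have KT: "\<And>x. x\<in>Xs \<Longrightarrow> KT x \<subseteq> K x" and T: "\<And>x. x\<in>Xs \<Longrightarrow> onf ?BA (KT x) (eT x)"
    and sup: "\<And>x k b \<alpha>. x\<in>Xs \<Longrightarrow> k\<in>KT x \<Longrightarrow> \<alpha> \<notin> insert None (lab x ` Js) \<Longrightarrow> eT x k (b, \<alpha>) = 0"
    and kill: "\<And>x J h k. x\<in>Xs \<Longrightarrow> J\<in>Js \<Longrightarrow> \<forall>b\<in>B. prj B (KJ J x) (eJ J x) h b = 0 \<Longrightarrow> k\<in>KT x \<Longrightarrow> ip ?BA (eT x k) (tens h (aJ x J)) = 0"
    and bd: "\<And>x u. x\<in>Xs \<Longrightarrow> nm ?BA (\<lambda>p. tens u (ax x) p - prj ?BA (KT x) (eT x) (tens u (ax x)) p)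
        \<le> 2 * nm A (ax x) * nm B (\<lambda>b. u b - prj B (K x) (e x) u b)
          + ?q * (\<Sum>J\<in>Js. nm B (\<lambda>b. u b - prj B (KJ J x) (eJ J x) u b))"
    using Q unfolding Q_def by blast+
  have cL: "card (lab x ` L) = card L" for x and L :: "nat set set" by (intro card_image) (auto simp: inj_on_def lab_def)
  have a2: "nsq A (ax x) = ?N" if "x\<in>Xs" for x
    unfolding ax_def using nsq_tilt[OF fA zA lA[OF that] lz] by (simp add: c_def cL)
  have aJ2: "nsq A (aJ x J) \<le> ?N" if "x\<in>Xs" for x J
  proof -
    have "nsq A (aJ x J) = 1 + d\<^sup>2 * card {J'\<in>Js. J \<subseteq> J'}"
      unfolding aJ_def using lA[OF that] lz by (subst nsq_tilt[OF fA zA]) (auto simp: cL)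
    also have "\<dots> \<le> ?N" unfolding c_def using fJ by (intro add_left_mono mult_left_mono) (auto intro: card_mono)
    finally show ?thesis .
  qed
  have N0: "?N \<ge> 0" by (simp add: c_def)
  have one: "nsq ?BA (\<lambda>p. tens u (ax x) p - prj ?BA (KT x) (eT x) (tens u (ax x)) p)
     \<le> 8 * ?N * nsq B (\<lambda>b. u b - prj B (K x) (e x) u b) + 2 * ?q\<^sup>2 * c * (\<Sum>J\<in>Js. nsq B (\<lambda>b. u b - prj B (KJ J x) (eJ J x) u b))"
    (is "?l \<le> 8 * ?N * ?p + 2 * ?q\<^sup>2 * c * ?r") if x: "x\<in>Xs" for x u
  proof -
    let ?s = "\<Sum>J\<in>Js. nm B (\<lambda>b. u b - prj B (KJ J x) (eJ J x) u b)"
    let ?t = "2 * nm A (ax x) * nm B (\<lambda>b. u b - prj B (K x) (e x) u b)"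
    have "?l = (nm ?BA (\<lambda>p. tens u (ax x) p - prj ?BA (KT x) (eT x) (tens u (ax x)) p))\<^sup>2" by (simp add: nm_sq)
    also have "\<dots> \<le> (?t + ?q * ?s)\<^sup>2" by (intro power_mono bd x) simp
    \<comment> \<open>Squaring a two-term sum costs a factor 2, and the 2 already in
      \<open>?t\<close> becomes 4: together the 8 of the statement.\<close>
    also have "\<dots> \<le> 2 * ?t\<^sup>2 + 2 * (?q * ?s)\<^sup>2"
    proof -
      have "(a + b)\<^sup>2 \<le> 2 * a\<^sup>2 + 2 * b\<^sup>2" for a b :: real
        using zero_le_power2[of "a - b"] by (simp add: power2_eq_square algebra_simps)
      then show ?thesis .
    qed
    also have "?t\<^sup>2 = 4 * ?N * ?p" by (simp add: power_mult_distrib nm_sq a2[OF x])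
    also have "(?q * ?s)\<^sup>2 \<le> ?q\<^sup>2 * (c * ?r)"
    proof -
      have "?s\<^sup>2 \<le> c * ?r"
        using nm_sum_square[of "\<lambda>J. nm B (\<lambda>b. u b - prj B (KJ J x) (eJ J x) u b)" Js] by (simp add: nm_sq c_def)
      then have "?q\<^sup>2 * ?s\<^sup>2 \<le> ?q\<^sup>2 * (c * ?r)" by (rule mult_left_mono) simp
      then show ?thesis by (simp only: power_mult_distrib)
    qed
    finally show ?thesis by (simp add: distrib_right distrib_left mult.assoc)
  qed
  have 2: "(\<Sum>x\<in>Xs. \<Sum>i\<in>I. nsq ?BA (\<lambda>p. tens (u x i) (ax x) p - prj ?BA (KT x) (eT x) (tens (u x i) (ax x)) p))
        \<le> (8 * ?N + 2 * ?q\<^sup>2 * c\<^sup>2) * \<epsilon>"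
  proof -
    have "(\<Sum>x\<in>Xs. \<Sum>i\<in>I. nsq ?BA (\<lambda>p. tens (u x i) (ax x) p - prj ?BA (KT x) (eT x) (tens (u x i) (ax x)) p))
      \<le> (\<Sum>x\<in>Xs. \<Sum>i\<in>I. 8 * ?N * nsq B (\<lambda>b. u x i b - prj B (K x) (e x) (u x i) b)
          + 2 * ?q\<^sup>2 * c * (\<Sum>J\<in>Js. nsq B (\<lambda>b. u x i b - prj B (KJ J x) (eJ J x) (u x i) b)))"
      by (intro sum_mono one)
    also have "\<dots> = 8 * ?N * (\<Sum>x\<in>Xs. \<Sum>i\<in>I. nsq B (\<lambda>b. u x i b - prj B (K x) (e x) (u x i) b))
       + 2 * ?q\<^sup>2 * c * (\<Sum>J\<in>Js. \<Sum>x\<in>Xs. \<Sum>i\<in>I. nsq B (\<lambda>b. u x i b - prj B (KJ J x) (eJ J x) (u x i) b))"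
      unfolding sum.distrib sum_distrib_left[symmetric] by (simp add: sum.swap[of _ _ Js])
    also have "\<dots> \<le> 8 * ?N * \<epsilon> + 2 * ?q\<^sup>2 * c * (\<Sum>J\<in>Js. \<epsilon>)"
      using N0 by (intro add_mono mult_left_mono err0 sum_mono errJ) (auto simp: c_def)
    also have "\<dots> = (8 * ?N + 2 * ?q\<^sup>2 * c\<^sup>2) * \<epsilon>" by (simp add: c_def power2_eq_square algebra_simps)
    finally show ?thesis .
  qed
  have 3: "(\<Sum>x\<in>{x\<in>Xs. diffset x x' = J}. \<Sum>i\<in>I. nsq ?BA (prj ?BA (KT x') (eT x') (tens (u x i) (ax x))))
        \<le> card (K x') * \<mu> J * ?N" if x': "x'\<in>Xs" and J: "J\<in>Js" for x' J
  proof -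
    \<comment> \<open>The test vector with its ancilla contracted against \<open>aJ x' J\<close>.
      Its squared norm is at most that of the tilt, which is where the last factor of the claim
      comes from.\<close>
    define g where "g = (\<lambda>k b. \<Sum>\<alpha>\<in>A. cnj (aJ x' J \<alpha>) * eT x' k (b, \<alpha>))"
    have ipg: "ip ?BA (eT x' k) (tens v (aJ x' J)) = ip B (g k) v" for k v
      unfolding ip_def tens_def g_def sum.cartesian_product' by (simp add: cnj_sum sum_distrib_right sum_distrib_left mult_ac)
    have gn: "nsq B (g k) \<le> ?N" if k: "k\<in>KT x'" for k
    proof -
      have "(cmod (g k b))\<^sup>2 \<le> nsq A (aJ x' J) * (\<Sum>\<alpha>\<in>A. (cmod (eT x' k (b,\<alpha>)))\<^sup>2)" for b
      proof -
        have "cmod (g k b) = cmod (ip A (aJ x' J) (\<lambda>\<alpha>. eT x' k (b,\<alpha>)))" by (simp add: g_def ip_def)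
        also have "\<dots> \<le> nm A (aJ x' J) * nm A (\<lambda>\<alpha>. eT x' k (b,\<alpha>))" by (rule cauchy)
        finally have "(cmod (g k b))\<^sup>2 \<le> (nm A (aJ x' J) * nm A (\<lambda>\<alpha>. eT x' k (b,\<alpha>)))\<^sup>2" by (intro power_mono) auto
        then show ?thesis by (simp add: power_mult_distrib nm_sq nsq_def)
      qed
      then have "nsq B (g k) \<le> nsq A (aJ x' J) * (\<Sum>b\<in>B. \<Sum>\<alpha>\<in>A. (cmod (eT x' k (b,\<alpha>)))\<^sup>2)"
        unfolding nsq_def[of B] sum_distrib_left[of "nsq A (aJ x' J)"] by (intro sum_mono) simp
      also have "(\<Sum>b\<in>B. \<Sum>\<alpha>\<in>A. (cmod (eT x' k (b,\<alpha>)))\<^sup>2) = nsq ?BA (eT x' k)" unfolding nsq_def sum.cartesian_product' ..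
      also have "\<dots> = 1" by (rule nsq_onf[OF T[OF x'] k])
      finally show ?thesis using aJ2[OF x', of J] by simp
    qed
    have red: "ip ?BA (eT x' k) (tens (u x i) (ax x)) = ip B (g k) (prj B (KJ J x) (eJ J x) (u x i))"
      if x: "x\<in>Xs" "diffset x x' = J" and k: "k\<in>KT x'" for x i k
    proof -
      have D: "KJ J x = KJ J x'" "eJ J x = eJ J x'" using dep[OF J x(1) x'] x(2) by auto
      have "ip ?BA (eT x' k) (tens (u x i) (ax x)) = ip ?BA (eT x' k) (tens (u x i) (aJ x' J))"
        unfolding ip_def
      proof (rule sum.cong[OF refl])
        fix p assume "p \<in> ?BA"
        obtain b \<alpha> where p: "p = (b,\<alpha>)" by (cases p)
        show "cnj (eT x' k p) * tens (u x i) (ax x) p = cnj (eT x' k p) * tens (u x i) (aJ x' J) p"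
        proof (cases "\<alpha> \<in> insert None (lab x' ` Js)")
          case False
          then have "eT x' k p = 0" unfolding p by (rule sup[OF x' k])
          then show ?thesis by simp
        next
          case True
          \<comment> \<open>Labels record the letters off J', so x and x' share the label of J'
            exactly when their difference set J lies inside J'.\<close>
          have "lab x J'' = lab x' J' \<longleftrightarrow> J'' = J' \<and> J \<subseteq> J'" for J' J''
            unfolding lab_def using off_eq_iff[of J' x x'] x(2) by auto
          then have "ax x \<alpha> = aJ x' J \<alpha>" using True unfolding ax_def aJ_def tilt_def
            by (auto simp: image_iff) (metis option.discI lab_def)+
          then show ?thesis unfolding p tens_def by simp
        qed
      qed
      also have "\<dots> = ip ?BA (eT x' k) (\<lambda>p. tens (prj B (KJ J x) (eJ J x) (u x i)) (aJ x' J) p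
          + tens (\<lambda>b. u x i b - prj B (KJ J x) (eJ J x) (u x i) b) (aJ x' J) p)"
        by (simp add: tens_def algebra_simps)
      also have "\<dots> = ip B (g k) (prj B (KJ J x) (eJ J x) (u x i)) + 0"
      proof -
        have "prj B (KJ J x') (eJ J x') (\<lambda>b. u x i b - prj B (KJ J x) (eJ J x) (u x i) b) = (\<lambda>_. 0)"
          unfolding D prj_diff prj_idem[OF onJ[OF J x']] by simp
        then show ?thesis unfolding ip_add_right ipg[symmetric] using kill[OF x' J _ k] by simp
      qed
      finally show ?thesis by simp
    qed
    have "(\<Sum>x\<in>{x\<in>Xs. diffset x x' = J}. \<Sum>i\<in>I. nsq ?BA (prj ?BA (KT x') (eT x') (tens (u x i) (ax x))))
      = (\<Sum>x\<in>{x\<in>Xs. diffset x x' = J}. \<Sum>i\<in>I. \<Sum>k\<in>KT x'. (cmod (ip B (g k) (prj B (KJ J x) (eJ J x) (u x i))))\<^sup>2)"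
      unfolding nsq_prj[OF T[OF x']] using red by (intro sum.cong refl) auto
    also have "\<dots> = (\<Sum>k\<in>KT x'. \<Sum>x\<in>{x\<in>Xs. diffset x x' = J}. \<Sum>i\<in>I. (cmod (ip B (g k) (prj B (KJ J x) (eJ J x) (u x i))))\<^sup>2)"
      by (simp add: sum.swap[of _ "KT x'"])
    also have "\<dots> \<le> (\<Sum>k\<in>KT x'. \<mu> J * nsq B (g k))" by (intro sum_mono mu J x')
    also have "\<dots> \<le> (\<Sum>k\<in>KT x'. \<mu> J * ?N)"
      using gn mu0[OF J] by (intro sum_mono mult_left_mono) auto
    also have "\<dots> \<le> (\<Sum>k\<in>K x'. \<mu> J * ?N)"
      using KT[OF x'] onf_fin[OF on[OF x']] N0 mu0[OF J] by (intro sum_mono2) auto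
    finally show ?thesis by simp
  qed
  show ?thesis by (intro exI[of _ KT] exI[of _ eT] conjI ballI T 2 3)
qed

text \<open>The tests are run with the ancilla in the untilted state z, at distance at most D from
  the tilt for which they are designed. As Gram matrices of branches the outcomes are positive, and
  \<open>hit_isometry\<close> makes them complete. The average of the root errors is moved under one
  root by Cauchy-Schwarz.\<close>

lemma decoder_exists:
  fixes Xs :: "'x set" and u :: "'x \<Rightarrow> 'i \<Rightarrow> 'b \<Rightarrow> complex" and KT :: "'x \<Rightarrow> 'k set" and cls :: "'x \<Rightarrow> 'c"
  assumes fX: "finite Xs" and fB: "finite B" and fA: "finite A" and zA: "z \<in> A" and fI: "finite I"
    and T: "\<And>x. x \<in> Xs \<Longrightarrow> onf (B \<times> A) (KT x) (eT x)"
    and ax1: "\<And>x. x \<in> Xs \<Longrightarrow> nm A (ax x) \<ge> 1" and ax2: "\<And>x. x \<in> Xs \<Longrightarrow> nm A (\<lambda>\<alpha>. ax x \<alpha> - kd z \<alpha>) \<le> D"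
    and tot: "(\<Sum>x\<in>Xs. \<Sum>i\<in>I. nsq B (u x i)) = 1"
  shows "\<exists>Lam Rm. (\<forall>c. \<forall>x. psd B (Lam c x)) \<and> (\<forall>c. psd B (Rm c))
    \<and> (\<forall>c. \<forall>b\<in>B. \<forall>b'\<in>B. (\<Sum>x\<in>{x\<in>Xs. cls x = c}. Lam c x b b') + Rm c b b' = (if b = b' then 1 else 0))
    \<and> (\<Sum>x\<in>Xs. \<Sum>i\<in>I. nsq B (u x i) - Re (ip B (u x i) (mv B (Lam (cls x) x) (u x i))))
      \<le> 2 * sqrt (\<Sum>x\<in>Xs. \<Sum>i\<in>I. nsq (B \<times> A) (\<lambda>p. tens (u x i) (ax x) p - prj (B \<times> A) (KT x) (eT x) (tens (u x i) (ax x)) p)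
          + (\<Sum>y\<in>{y\<in>Xs. cls y = cls x} - {x}. nsq (B \<times> A) (prj (B \<times> A) (KT y) (eT y) (tens (u x i) (ax x))))) + 2 * D"
proof -
  let ?BA = "B \<times> A"
  let ?P = "\<lambda>x. prj ?BA (KT x) (eT x)"
  have "\<exists>xs. set xs = {x\<in>Xs. cls x = c} \<and> distinct xs" for c using finite_distinct_list[of "{x\<in>Xs. cls x = c}"] fX by simp
  then obtain xs where xs: "\<And>c. set (xs c) = {x\<in>Xs. cls x = c}" "\<And>c. distinct (xs c)" by metis
  have Tc: "\<And>x c. x \<in> set (xs c) \<Longrightarrow> onf ?BA (KT x) (eT x)" using T xs(1) by auto
  \<comment> \<open>Branches of the basis vectors of B, with the ancilla prepared in z; their inner
    products are the matrix entries of the POVM after tracing out the ancilla.\<close>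
  define H where "H = (\<lambda>c x b. hit ?P (xs c) x (tens (kd b) (kd z)))"
  define R where "R = (\<lambda>c b. res ?P (xs c) (tens (kd b) (kd z)))"
  define Lam where "Lam = (\<lambda>c x b b'. ip ?BA (H c x b) (H c x b'))"
  define Rm where "Rm = (\<lambda>c b b'. ip ?BA (R c b) (R c b'))"
  have psdip: "psd B (\<lambda>b b'. ip ?BA (h b) (h b'))" for h :: "'b \<Rightarrow> _"
    by (rule gram_psd[where I="?BA" and g="\<lambda>p b. cnj (h b p)"]) (simp add: ip_def)
  have id: "(\<Sum>x\<in>{x\<in>Xs. cls x = c}. Lam c x b b') + Rm c b b' = (if b = b' then 1 else 0)" if b: "b\<in>B" "b'\<in>B" for c b b'
  proof -
    have "(\<Sum>x\<in>{x\<in>Xs. cls x = c}. Lam c x b b') + Rm c b b' = ip ?BA (tens (kd b) (kd z)) (tens (kd b') (kd z))"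
      unfolding Lam_def Rm_def H_def R_def xs(1)[symmetric] by (rule hit_isometry[OF xs(2) Tc, symmetric])
    also have "\<dots> = (if b = b' then 1 else 0)" unfolding ip_tens ip_kd[OF fB b(1)] ip_kd[OF fA zA] by (simp add: kd_def)
    finally show ?thesis .
  qed
  have qf: "ip B v (mv B (Lam c x) v) = of_real (nsq ?BA (hit ?P (xs c) x (tens v (kd z))))" for v c x
  proof -
    have kdx: "(\<Sum>b\<in>B. v b * kd b y) = v y" if "y\<in>B" for y
      using fB that by (simp add: kd_def if_distrib cong: if_cong)
    have "hit ?P (xs c) x (tens v (kd z)) = hit ?P (xs c) x (\<lambda>p. \<Sum>b\<in>B. v b * tens (kd b) (kd z) p)"
      by (rule hit_cong) (auto simp: tens_def mult.assoc[symmetric] sum_distrib_right[symmetric] kdx)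
    also have "\<dots> = (\<lambda>p. \<Sum>b\<in>B. v b * H c x b p)" unfolding H_def by (rule hit_sum[OF fB])
    finally have h: "hit ?P (xs c) x (tens v (kd z)) = (\<lambda>p. \<Sum>b\<in>B. v b * H c x b p)" .
    have "ip B v (mv B (Lam c x) v) = of_real (\<Sum>p\<in>?BA. (cmod (ip B (\<lambda>b. cnj (H c x b p)) v))\<^sup>2)"
      by (rule gram_qf) (simp add: Lam_def ip_def)
    also have "(\<Sum>p\<in>?BA. (cmod (ip B (\<lambda>b. cnj (H c x b p)) v))\<^sup>2) = nsq ?BA (hit ?P (xs c) x (tens v (kd z)))"
      unfolding nsq_def h by (simp add: ip_def mult.commute)
    finally show ?thesis .
  qed
  define E where "E = (\<lambda>x i. nsq ?BA (\<lambda>p. tens (u x i) (ax x) p - ?P x (tens (u x i) (ax x)) p)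
          + (\<Sum>y\<in>{y\<in>Xs. cls y = cls x} - {x}. nsq ?BA (?P y (tens (u x i) (ax x)))))"
  have E0: "E x i \<ge> 0" for x i by (simp add: E_def sum_nonneg)
  have one: "nsq B (u x i) - Re (ip B (u x i) (mv B (Lam (cls x) x) (u x i))) \<le> 2 * (nm B (u x i) * sqrt (E x i)) + 2 * D * nsq B (u x i)"
    if x: "x\<in>Xs" for x i
  proof -
    let ?xs = "xs (cls x)" and ?u = "u x i"
    have xm: "x \<in> set ?xs" using x xs(1) by simp
    let ?h = "hit ?P ?xs x"
    let ?v = "tens ?u (kd z)" and ?w = "tens ?u (ax x)" and ?r = "tens ?u (\<lambda>\<alpha>. ax x \<alpha> - kd z \<alpha>)"
    have le: "nm ?BA (?h y) \<le> nm ?BA y" for y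
      using hit_chain[OF xs(2) xm Tc, where z=y] by (simp add: nm_def)
    have "nm ?BA ?w - sqrt (E x i) \<le> nm ?BA (?h ?w)"
      using hit_lower[OF xs(2) xm Tc, where v="?w"] by (simp add: E_def xs(1) add.commute)
    moreover have "?h ?w = (\<lambda>p. ?h ?v p + ?h ?r p)"
    proof -
      have "?w = (\<lambda>p. ?v p + ?r p)" by (auto simp: tens_def algebra_simps)
      then show ?thesis using hit_lin(1)[of ?BA KT eT ?xs x ?v ?r] by simp
    qed
    moreover have "nm ?BA (\<lambda>p. ?h ?v p + ?h ?r p) \<le> nm ?BA (?h ?v) + nm ?BA (?h ?r)" by (rule nm_triangle)
    moreover have "nm ?BA (?h ?r) \<le> nm B ?u * D"
      by (rule order_trans[OF le]) (simp add: nm_tens ax2[OF x] mult_left_mono)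
    moreover have "nm ?BA ?w \<ge> nm B ?u" using mult_left_mono[OF ax1[OF x] nm_ge0[of B ?u]] by (simp add: nm_tens)
    ultimately have lo: "nm B ?u - nm ?BA (?h ?v) \<le> sqrt (E x i) + nm B ?u * D" by simp
    have z1: "nm A (kd z) = 1" by (simp add: nm_def nsq_kd[OF fA zA])
    have up: "nm ?BA (?h ?v) \<le> nm B ?u" using le[of ?v] by (simp add: nm_tens z1)
    \<comment> \<open>Difference of squares: the bound on norms from \<open>hit_lower\<close>
      becomes one on probabilities at the price of a factor 2 times the norm of u.\<close>
    have "nsq B ?u - nsq ?BA (?h ?v) = (nm B ?u + nm ?BA (?h ?v)) * (nm B ?u - nm ?BA (?h ?v))"
      unfolding nm_sq[symmetric] by (simp add: power2_eq_square algebra_simps)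
    also have "\<dots> \<le> (2 * nm B ?u) * (nm B ?u - nm ?BA (?h ?v))" using up by (intro mult_right_mono) auto
    also have "\<dots> \<le> (2 * nm B ?u) * (sqrt (E x i) + nm B ?u * D)" using lo by (intro mult_left_mono) auto
    finally show ?thesis unfolding qf using nm_sq[of B ?u] by (simp add: power2_eq_square algebra_simps)
  qed
  have "(\<Sum>x\<in>Xs. \<Sum>i\<in>I. nsq B (u x i) - Re (ip B (u x i) (mv B (Lam (cls x) x) (u x i))))
    \<le> (\<Sum>x\<in>Xs. \<Sum>i\<in>I. 2 * (nm B (u x i) * sqrt (E x i)) + 2 * D * nsq B (u x i))" by (intro sum_mono one)
  also have "\<dots> = 2 * (\<Sum>p\<in>Xs\<times>I. \<bar>nm B (u (fst p) (snd p))\<bar> * \<bar>sqrt (E (fst p) (snd p))\<bar>) + 2 * D"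
    unfolding sum.distrib sum_distrib_left[symmetric] tot sum.cartesian_product' using E0 by simp
  also have "\<dots> \<le> 2 * (L2_set (\<lambda>p. nm B (u (fst p) (snd p))) (Xs\<times>I) * L2_set (\<lambda>p. sqrt (E (fst p) (snd p))) (Xs\<times>I)) + 2 * D"
    by (intro add_right_mono mult_left_mono L2_set_mult_ineq) simp
  also have "L2_set (\<lambda>p. nm B (u (fst p) (snd p))) (Xs\<times>I) = 1"
    unfolding L2_set_def nm_sq sum.cartesian_product' by (simp add: tot)
  also have "L2_set (\<lambda>p. sqrt (E (fst p) (snd p))) (Xs\<times>I) = sqrt (\<Sum>x\<in>Xs. \<Sum>i\<in>I. E x i)"
    unfolding L2_set_def sum.cartesian_product' using E0 by simp
  finally have fin: "(\<Sum>x\<in>Xs. \<Sum>i\<in>I. nsq B (u x i) - Re (ip B (u x i) (mv B (Lam (cls x) x) (u x i)))) \<le> 2 * sqrt (\<Sum>x\<in>Xs. \<Sum>i\<in>I. E x i) + 2 * D" by simp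
  show ?thesis
    apply (rule exI[of _ Lam], rule exI[of _ Rm], intro conjI allI ballI)
    subgoal unfolding Lam_def by (rule psdip)
    subgoal unfolding Rm_def by (rule psdip)
    subgoal by (rule id)
    subgoal using fin unfolding E_def .
    done
qed

text \<open>Players hash independently. Where x and y agree a collision is certain; where they
  differ it has probability \<open>1 / Mb i\<close>. Only the coordinates of
  \<open>diffset x y\<close> therefore contribute.\<close>

lemma collision_count:
  fixes X :: "nat \<Rightarrow> 'x set"
  assumes fM: "finite M" and fX: "\<And>i. i\<in>M \<Longrightarrow> finite (X i)" and Mb: "\<And>i. i\<in>M \<Longrightarrow> Mb i \<ge> (1::nat)"
    and x: "x \<in> PiE M X" "y \<in> PiE M X"
  shows "(\<Sum>f\<in>PiE M (\<lambda>i. PiE (X i) (\<lambda>_. {..<Mb i})). if \<forall>i\<in>M. f i (x i) = f i (y i) then 1 else 0)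
     * (\<Prod>i\<in>diffset x y. real (Mb i)) = real (card (PiE M (\<lambda>i. PiE (X i) (\<lambda>_. {..<Mb i}))))"
proof -
  have dM: "diffset x y \<subseteq> M" unfolding diffset_def using PiE_arb[OF x(1)] PiE_arb[OF x(2)] by force
  let ?F = "\<lambda>i. PiE (X i) (\<lambda>_. {..<Mb i})"
  have fF: "finite (?F i)" if "i\<in>M" for i using fX[OF that] by (intro finite_PiE) auto
  have p: "(if \<forall>i\<in>M. f i (x i) = f i (y i) then 1 else 0) = (\<Prod>i\<in>M. if f i (x i) = f i (y i) then 1 else 0 :: real)" for f
    using fM by (induction M rule: finite_induct) auto
  have one: "(\<Sum>g\<in>?F i. if g (x i) = g (y i) then 1 else 0) * (if i \<in> diffset x y then real (Mb i) else 1) = real (card (?F i))" if i: "i\<in>M" for i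
  proof (cases "i \<in> diffset x y")
    case False then show ?thesis by (simp add: diffset_def)
  next
    case True
    then have ne: "x i \<noteq> y i" by (simp add: diffset_def)
    have xi: "x i \<in> X i" "y i \<in> X i" using x i by auto
    let ?I = "\<lambda>c a. if a = c then 1 else 0 :: real"
    \<comment> \<open>Splitting a collision by the common bin c turns it into a product of functions
      of the two values, as \<open>sum_PiE_pair\<close> expects.\<close>
    have "(\<Sum>g\<in>?F i. if g (x i) = g (y i) then 1 else 0 :: real) = (\<Sum>g\<in>?F i. \<Sum>c<Mb i. ?I c (g (x i)) * ?I c (g (y i)))"
    proof (rule sum.cong[OF refl])
      fix g assume "g \<in> ?F i"
      then have "g (x i) \<in> {..<Mb i}" using xi by auto
      moreover have "(\<Sum>c<Mb i. ?I c (g (x i)) * ?I c (g (y i))) = (\<Sum>c<Mb i. if c = g (x i) then (if g (x i) = g (y i) then 1 else 0) else 0)"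
        by (intro sum.cong refl) auto
      ultimately show "(if g (x i) = g (y i) then 1 else 0) = (\<Sum>c<Mb i. ?I c (g (x i)) * ?I c (g (y i)))" by simp
    qed
    also have "\<dots> = (\<Sum>c<Mb i. \<Sum>g\<in>?F i. ?I c (g (x i)) * ?I c (g (y i)))" by (rule sum.swap)
    finally have "(\<Sum>g\<in>?F i. if g (x i) = g (y i) then 1 else 0 :: real) * (real (Mb i))^2
       = (\<Sum>c<Mb i. (\<Sum>g\<in>?F i. ?I c (g (x i)) * ?I c (g (y i))) * (real (card {..<Mb i}))^2)"
      by (simp add: sum_distrib_right)
    also have "\<dots> = (\<Sum>c<Mb i. sum (?I c) {..<Mb i} * sum (?I c) {..<Mb i} * real (card (?F i)))"
      by (intro sum.cong refl sum_PiE_pair fX i xi ne) auto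
    also have "\<dots> = real (Mb i) * real (card (?F i))" by simp
    finally show ?thesis using True Mb[OF i] by (simp add: power2_eq_square)
  qed
  have "(\<Prod>i\<in>diffset x y. real (Mb i)) = (\<Prod>i\<in>M. if i \<in> diffset x y then real (Mb i) else 1)"
    using dM fM by (simp add: prod.inter_restrict[symmetric] Int_absorb1)
  then have "(\<Sum>f\<in>PiE M ?F. if \<forall>i\<in>M. f i (x i) = f i (y i) then 1 else 0) * (\<Prod>i\<in>diffset x y. real (Mb i))
    = (\<Prod>i\<in>M. \<Sum>g\<in>?F i. if g (x i) = g (y i) then 1 else 0) * (\<Prod>i\<in>M. if i \<in> diffset x y then real (Mb i) else 1)"
    unfolding p by (subst sum_PiE_prod[OF fM fF]) simp_all
  also have "\<dots> = (\<Prod>i\<in>M. real (card (?F i)))" unfolding prod.distrib[symmetric] using one by (intro prod.cong) auto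
  finally show ?thesis unfolding card_PiE[OF fM] by simp
qed

section \<open>Privacy amplification\<close>

lemma sum_swap2: "(\<Sum>a\<in>A. \<Sum>x\<in>D. \<Sum>y\<in>D'. g a x y) = (\<Sum>x\<in>D. \<Sum>y\<in>D'. \<Sum>a\<in>A. g a x y)"
  by (rule trans[OF sum.swap], rule sum.cong[OF refl], rule sum.swap)

lemma frob_gram:
  assumes "\<And>b b'. b\<in>B \<Longrightarrow> b'\<in>B \<Longrightarrow> X b b' = (\<Sum>i\<in>I. p i b * cnj (p i b'))"
  shows "frob B X = (\<Sum>i\<in>I. \<Sum>i'\<in>I. (cmod (ip B (p i') (p i)))\<^sup>2)"
proof -
  have "complex_of_real (frob B X) = (\<Sum>b\<in>B. \<Sum>b'\<in>B. X b b' * cnj (X b b'))"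
    unfolding frob_def of_real_sum by (simp add: complex_norm_square del: of_real_power)
  also have "\<dots> = (\<Sum>b\<in>B. \<Sum>b'\<in>B. \<Sum>i\<in>I. \<Sum>i'\<in>I. (cnj (p i' b) * p i b) * (cnj (p i b') * p i' b'))"
    using assms by (intro sum.cong refl) (simp add: cnj_sum sum_product mult_ac)
  also have "\<dots> = (\<Sum>i\<in>I. \<Sum>i'\<in>I. \<Sum>b\<in>B. \<Sum>b'\<in>B. (cnj (p i' b) * p i b) * (cnj (p i b') * p i' b'))"
    unfolding sum_swap2[where A=B and D=I and D'=I] ..
  also have "\<dots> = (\<Sum>i\<in>I. \<Sum>i'\<in>I. ip B (p i') (p i) * ip B (p i) (p i'))"
    unfolding ip_def sum_product ..
  also have "\<dots> = (\<Sum>i\<in>I. \<Sum>i'\<in>I. complex_of_real ((cmod (ip B (p i') (p i)))\<^sup>2))"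
    by (intro sum.cong refl) (metis complex_norm_square ip_cnj)
  finally have "complex_of_real (frob B X) = complex_of_real (\<Sum>i\<in>I. \<Sum>i'\<in>I. (cmod (ip B (p i') (p i)))\<^sup>2)" by simp
  then show ?thesis using of_real_eq_iff by blast
qed

lemma cmod_real_comb_sq:
  fixes c :: "'x \<Rightarrow> real" and z :: "'x \<Rightarrow> complex"
  shows "(cmod (\<Sum>x\<in>D. of_real (c x) * z x))\<^sup>2 = (\<Sum>x\<in>D. \<Sum>x'\<in>D. c x * c x' * Re (z x * cnj (z x')))"
proof -
  have "complex_of_real ((cmod (\<Sum>x\<in>D. of_real (c x) * z x))\<^sup>2) = (\<Sum>x\<in>D. \<Sum>x'\<in>D. of_real (c x * c x') * (z x * cnj (z x')))"
    unfolding complex_norm_square cnj_sum sum_product by (intro sum.cong refl) simp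
  then have "Re (complex_of_real ((cmod (\<Sum>x\<in>D. of_real (c x) * z x))\<^sup>2)) = (\<Sum>x\<in>D. \<Sum>x'\<in>D. Re (of_real (c x * c x') * (z x * cnj (z x'))))"
    by simp
  then show ?thesis by simp
qed

text \<open>The deviation of the indicator of key k from a uniform key; weighting states by it gives
  real minus ideal.\<close>

definition hcoef :: "nat \<Rightarrow> ('x \<Rightarrow> nat) \<Rightarrow> 'x \<Rightarrow> nat \<Rightarrow> real" where
  "hcoef Kc F x k = (if F x = k then 1 else 0) - 1 / Kc"

lemma hcoef_sum: assumes "Kc \<ge> 1" "a < Kc"
  shows "(\<Sum>k<Kc. (if a = k then 1 else 0) - 1 / real Kc) = 0" "(\<Sum>k<Kc. (if k = a then 1 else 0) - 1 / real Kc) = 0"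
  using assms by (simp_all add: sum_subtractf)

text \<open>The centred coefficients at two different points are independent with mean zero, so
  cross terms vanish. On the diagonal the squares over k sum to \<open>1 - 1 / Kc\<close>.\<close>

lemma hash_second_moment:
  fixes z :: "'x \<Rightarrow> complex"
  assumes fX: "finite Xs" and K: "Kc \<ge> 1" and D: "D \<subseteq> Xs"
  shows "(\<Sum>F\<in>PiE Xs (\<lambda>_. {..<Kc}). \<Sum>k<Kc. (cmod (\<Sum>x\<in>D. of_real (hcoef Kc F x k) * z x))\<^sup>2)
    \<le> real (card (PiE Xs (\<lambda>_. {..<Kc}))) * (\<Sum>x\<in>D. (cmod (z x))\<^sup>2)"
proof -
  let ?Fs = "PiE Xs (\<lambda>_. {..<Kc})"
  have cross: "(\<Sum>F\<in>?Fs. \<Sum>k<Kc. hcoef Kc F x k * hcoef Kc F x' k) \<le> (if x = x' then real (card ?Fs) else 0)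
      \<and> (x \<noteq> x' \<longrightarrow> (\<Sum>F\<in>?Fs. \<Sum>k<Kc. hcoef Kc F x k * hcoef Kc F x' k) = 0)"
    if x: "x\<in>Xs" "x'\<in>Xs" for x x'
  proof (cases "x = x'")
    case True
    have "(\<Sum>k<Kc. hcoef Kc F x k * hcoef Kc F x k) \<le> 1" if F: "F \<in> ?Fs" for F
    proof -
      have a: "F x < Kc" using F x by auto
      have "(\<Sum>k<Kc. hcoef Kc F x k * hcoef Kc F x k) = (\<Sum>k<Kc. (if F x = k then 1 - 2 / Kc else 0) + 1 / Kc * (1 / Kc))"
        by (intro sum.cong refl) (auto simp: hcoef_def algebra_simps)
      also have "\<dots> = 1 - 1 / Kc" using a K by (simp add: sum.distrib)
      finally show ?thesis by simp
    qed
    then have "(\<Sum>F\<in>?Fs. \<Sum>k<Kc. hcoef Kc F x k * hcoef Kc F x k) \<le> (\<Sum>F\<in>?Fs. 1)" by (rule sum_mono)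
    then show ?thesis using True by simp
  next
    case False
    have h0: "(\<Sum>F\<in>?Fs. hcoef Kc F x k * hcoef Kc F x' k) = 0" if k: "k < Kc" for k
    proof -
      let ?g = "\<lambda>a. (if a = k then 1 else 0) - 1 / real Kc"
      have "(\<Sum>F\<in>?Fs. ?g (F x) * ?g (F x')) * real (card {..<Kc})^2 = sum ?g {..<Kc} * sum ?g {..<Kc} * real (card ?Fs)"
        by (rule sum_PiE_pair[OF fX _ x False]) simp
      then show ?thesis using K hcoef_sum(2)[OF K k] by (simp add: hcoef_def)
    qed
    have "(\<Sum>F\<in>?Fs. \<Sum>k<Kc. hcoef Kc F x k * hcoef Kc F x' k) = 0"
      by (subst sum.swap, rule sum.neutral) (simp add: h0)
    then show ?thesis using False by simp
  qed
  have DX: "x\<in>Xs" if "x\<in>D" for x using D that by auto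
  have fD: "finite D" using D fX by (rule finite_subset)
  have "(\<Sum>F\<in>?Fs. \<Sum>k<Kc. (cmod (\<Sum>x\<in>D. of_real (hcoef Kc F x k) * z x))\<^sup>2)
    = (\<Sum>x\<in>D. \<Sum>x'\<in>D. (\<Sum>F\<in>?Fs. \<Sum>k<Kc. hcoef Kc F x k * hcoef Kc F x' k) * Re (z x * cnj (z x')))"
    unfolding cmod_real_comb_sq sum_distrib_right sum_swap2[where D=D and D'=D] ..
  also have "\<dots> = (\<Sum>x\<in>D. \<Sum>x'\<in>D. if x' = x then (\<Sum>F\<in>?Fs. \<Sum>k<Kc. hcoef Kc F x k * hcoef Kc F x k) * Re (z x * cnj (z x)) else 0)"
    using cross DX by (intro sum.cong refl) auto
  also have "\<dots> = (\<Sum>x\<in>D. (\<Sum>F\<in>?Fs. \<Sum>k<Kc. hcoef Kc F x k * hcoef Kc F x k) * (cmod (z x))\<^sup>2)"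
    using fD by (simp add: complex_norm_square[symmetric] del: of_real_power)
  also have "\<dots> \<le> (\<Sum>x\<in>D. real (card ?Fs) * (cmod (z x))\<^sup>2)"
  proof (intro sum_mono mult_right_mono)
    fix x assume "x \<in> D"
    then show "(\<Sum>F\<in>?Fs. \<Sum>k<Kc. hcoef Kc F x k * hcoef Kc F x k) \<le> real (card ?Fs)" using cross[OF DX DX, of x x] by simp
  qed simp
  finally show ?thesis by (simp add: sum_distrib_left)
qed

text \<open>Gentle measurement without operator square roots: the difference of \<open>|p + q><p + q|\<close> and \<open>|p><p|\<close> is split so that
  each part has trace of the order of \<open>t \<parallel>p\<parallel>\<^sup>2 + \<parallel>q\<parallel>\<^sup>2 / t\<close>.\<close>

lemma gentle_decomposition:
  fixes p q :: "'b \<Rightarrow> complex"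
  assumes t: "t > 0"
  defines "a \<equiv> \<lambda>b. of_real (sqrt t) * p b + of_real (1 / sqrt t) * q b"
    and "c \<equiv> \<lambda>b. of_real (sqrt t) * p b - of_real (1 / sqrt t) * q b"
  shows "(p b + q b) * cnj (p b' + q b') - p b * cnj (p b')
      = (of_real (1/2) * (a b * cnj (a b')) + q b * cnj (q b')) - of_real (1/2) * (c b * cnj (c b'))"
    "1/2 * nsq B a + 1/2 * nsq B c = t * nsq B p + nsq B q / t"
proof -
  have s: "complex_of_real (sqrt t) * of_real (1 / sqrt t) = 1" using t by (simp flip: of_real_mult)
  have x: "a b * cnj (a b') - c b * cnj (c b') = 2 * (complex_of_real (sqrt t) * of_real (1 / sqrt t)) * (p b * cnj (q b') + q b * cnj (p b'))"
  proof -
    have "(r * x + s * y) * (r * x' + s * y') - (r * x - s * y) * (r * x' - s * y') = 2 * (r * s) * (x * y' + y * x')" for r s x y x' y' :: complex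
      by (simp add: algebra_simps)
    then show ?thesis unfolding a_def c_def by (simp only: complex_cnj_add complex_cnj_diff complex_cnj_mult complex_cnj_complex_of_real)
  qed
  have "of_real (1/2) * (a b * cnj (a b')) - of_real (1/2) * (c b * cnj (c b')) = p b * cnj (q b') + q b * cnj (p b')"
    unfolding right_diff_distrib[symmetric] x s by simp
  then show "(p b + q b) * cnj (p b' + q b') - p b * cnj (p b')
      = (of_real (1/2) * (a b * cnj (a b')) + q b * cnj (q b')) - of_real (1/2) * (c b * cnj (c b'))"
    by (simp add: algebra_simps)
  have n: "nsq B (\<lambda>b. of_real (sqrt t) * p b) = t * nsq B p" "nsq B (\<lambda>b. of_real (1 / sqrt t) * q b) = nsq B q / t"
    unfolding nsq_scale using t by (simp_all add: norm_divide power_divide)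
  have "nsq B a = t * nsq B p + nsq B q / t + 2 * Re (ip B (\<lambda>b. of_real (sqrt t) * p b) (\<lambda>b. of_real (1 / sqrt t) * q b))"
    unfolding a_def nsq_add n ..
  moreover have "nsq B c = t * nsq B p + nsq B q / t - 2 * Re (ip B (\<lambda>b. of_real (sqrt t) * p b) (\<lambda>b. of_real (1 / sqrt t) * q b))"
  proof -
    have "c = (\<lambda>b. of_real (sqrt t) * p b + (- 1) * (of_real (1 / sqrt t) * q b))" by (simp add: c_def)
    then have "nsq B c = nsq B (\<lambda>b. of_real (sqrt t) * p b) + nsq B (\<lambda>b. (- 1) * (of_real (1 / sqrt t) * q b))
      + 2 * Re (ip B (\<lambda>b. of_real (sqrt t) * p b) (\<lambda>b. (- 1) * (of_real (1 / sqrt t) * q b)))" by (simp only: nsq_add)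
    then show ?thesis unfolding ip_scale_right[of B _ "-1"] nsq_scale[of B "-1"] n by simp
  qed
  ultimately show "1/2 * nsq B a + 1/2 * nsq B c = t * nsq B p + nsq B q / t" by (simp only:) (simp add: field_simps)
qed

text \<open>Each state of E is replaced by \<open>wt x\<close>, its projection to \<open>KE\<close>
  restricted to the eigenvectors in \<open>G x\<close>. For these the second moment of the hash is
  at most \<nu>, and Cauchy-Schwarz over \<open>Kc * card L\<close> blocks of dimension
  \<open>card KE\<close> gives the root. The replacement is paid for by the gentle decomposition
  with parameter t. The binning f enters only through the number of its values.\<close>

lemma hash_exists:
  fixes Xs :: "'x set" and lam :: "'x \<Rightarrow> 'i \<Rightarrow> real" and e :: "'x \<Rightarrow> 'i \<Rightarrow> 'b \<Rightarrow> complex" and f :: "'x \<Rightarrow> 'l"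
  assumes fX: "finite Xs" and fB: "finite B" and fL: "finite L" and fl: "f ` Xs \<subseteq> L"
    and on: "\<And>x. x\<in>Xs \<Longrightarrow> onf B I (e x)" and lam0: "\<And>x i. x\<in>Xs \<Longrightarrow> i\<in>I \<Longrightarrow> lam x i \<ge> 0" and fI: "finite I"
    and G: "\<And>x. x\<in>Xs \<Longrightarrow> G x \<subseteq> I" and nu: "\<And>x i. x\<in>Xs \<Longrightarrow> i\<in>G x \<Longrightarrow> lam x i \<le> \<nu>" and nu0: "\<nu> \<ge> 0"
    and tot: "(\<Sum>x\<in>Xs. \<Sum>i\<in>I. lam x i) = 1"
    and cut: "(\<Sum>x\<in>Xs. \<Sum>i\<in>I - G x. lam x i) \<le> \<epsilon>"
    and onE: "onf B KE eE"
  defines "u \<equiv> \<lambda>x i b. of_real (sqrt (lam x i)) * e x i b"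
  assumes prE: "(\<Sum>x\<in>Xs. \<Sum>i\<in>I. nsq B (\<lambda>b. u x i b - prj B KE eE (u x i) b)) \<le> \<epsilon>"
    and K: "Kc \<ge> 1" and t: "t > 0"
  shows "\<exists>F\<in>PiE Xs (\<lambda>_. {..<Kc}). tn_bound ({..<Kc} \<times> L) B
     (\<lambda>kl b b'. \<Sum>x\<in>{x\<in>Xs. f x = snd kl}. of_real (hcoef Kc F x (fst kl)) * (\<Sum>i\<in>I. u x i b * cnj (u x i b')))
     (sqrt (real Kc * card L * card KE * \<nu>) + 2 * (t + \<epsilon> / t + 2 * \<epsilon>))"
proof -
  define p where "p = (\<lambda>x i. prj B KE eE (u x i))"
  define q where "q = (\<lambda>x i b. u x i b - p x i b)"
  define wt where "wt = (\<lambda>x b b'. \<Sum>i\<in>G x. p x i b * cnj (p x i b'))"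
  have fG: "finite (G x)" if "x\<in>Xs" for x using G[OF that] fI by (rule finite_subset)
  have nu': "nsq B (u x i) = lam x i" if "x\<in>Xs" "i\<in>I" for x i
    using lam0[OF that] nsq_onf[OF on[OF that(1)] that(2)] by (simp add: u_def nsq_scale)
  have np: "nsq B (p x i) \<le> lam x i" if "x\<in>Xs" "i\<in>I" for x i
    unfolding p_def nu'[OF that, symmetric] by (rule nsq_prj_le[OF onE])
  have frw: "frob B (wt x) \<le> \<nu> * (\<Sum>i\<in>I. lam x i)" if x: "x\<in>Xs" for x
  proof -
    have "frob B (wt x) = (\<Sum>i\<in>G x. \<Sum>i'\<in>G x. (cmod (ip B (p x i') (p x i)))\<^sup>2)"
      by (rule frob_gram) (simp add: wt_def)
    also have "\<dots> \<le> (\<Sum>i\<in>G x. \<nu> * lam x i)"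
    proof (rule sum_mono)
      fix i assume i: "i \<in> G x"
      have iI: "i\<in>I" using G[OF x] i by auto
      have "(\<Sum>i'\<in>G x. (cmod (ip B (p x i') (p x i)))\<^sup>2) \<le> (\<Sum>i'\<in>G x. \<nu> * (cmod (ip B (e x i') (p x i)))\<^sup>2)"
      proof (rule sum_mono)
        fix i' assume i': "i' \<in> G x"
        \<comment> \<open>Only one of the two projections is needed in the inner product, which
          exposes a factor \<open>sqrt (lam x i')\<close>. Bounding it by \<nu> leaves a Bessel sum
          over an orthonormal family.\<close>
        have "ip B (p x i') (p x i) = ip B (u x i') (p x i)"
          unfolding p_def prj_sa prj_idem[OF onE] ..
        also have "\<dots> = of_real (sqrt (lam x i')) * ip B (e x i') (p x i)" by (simp add: u_def ip_scale_left)
        finally have "(cmod (ip B (p x i') (p x i)))\<^sup>2 = lam x i' * (cmod (ip B (e x i') (p x i)))\<^sup>2"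
          using lam0[OF x, of i'] G[OF x] i' by (auto simp: norm_mult power_mult_distrib)
        then show "(cmod (ip B (p x i') (p x i)))\<^sup>2 \<le> \<nu> * (cmod (ip B (e x i') (p x i)))\<^sup>2"
          using nu[OF x i'] by (simp add: mult_right_mono)
      qed
      also have "\<dots> \<le> \<nu> * nsq B (p x i)"
        unfolding sum_distrib_left[symmetric] by (intro mult_left_mono bessel nu0 onf_subset[OF on[OF x] G[OF x]])
      also have "\<dots> \<le> \<nu> * lam x i" using np[OF x iI] nu0 by (intro mult_left_mono)
      finally show "(\<Sum>i'\<in>G x. (cmod (ip B (p x i') (p x i)))\<^sup>2) \<le> \<nu> * lam x i" .
    qed
    also have "\<dots> \<le> (\<Sum>i\<in>I. \<nu> * lam x i)" using G[OF x] fI lam0[OF x] nu0 by (intro sum_mono2) auto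
    finally show ?thesis by (simp add: sum_distrib_left)
  qed
  define ap where "ap = (\<lambda>x i b. of_real (sqrt t) * p x i b + of_real (1 / sqrt t) * q x i b)"
  define cp where "cp = (\<lambda>x i b. of_real (sqrt t) * p x i b - of_real (1 / sqrt t) * q x i b)"
  define Px where "Px = (\<lambda>x b b'. (\<Sum>i\<in>G x. of_real (1/2) * (ap x i b * cnj (ap x i b')) + q x i b * cnj (q x i b'))
     + (\<Sum>i\<in>I - G x. u x i b * cnj (u x i b')))"
  define Nx where "Nx = (\<lambda>x b b'. \<Sum>i\<in>G x. of_real (1/2) * (cp x i b * cnj (cp x i b')))"
  have half: "psd B (\<lambda>b b'. of_real (1/2) * (v b * cnj (v b')))" for v :: "'b \<Rightarrow> complex" by (intro psd_scale psd_rank1) simp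
  have psdPN: "psd B (Px x)" "psd B (Nx x)" if x: "x\<in>Xs" for x
    unfolding Px_def Nx_def by (intro psd_add psd_sum fG[OF x] half psd_rank1 finite_Diff fI)+
  have wPN: "(\<Sum>i\<in>I. u x i b * cnj (u x i b')) - wt x b b' = Px x b b' - Nx x b b'" if x: "x\<in>Xs" for x b b'
  proof -
    have "(\<Sum>i\<in>I. u x i b * cnj (u x i b')) = (\<Sum>i\<in>I - G x. u x i b * cnj (u x i b')) + (\<Sum>i\<in>G x. u x i b * cnj (u x i b'))"
      using fI G[OF x] by (simp add: sum.subset_diff)
    moreover have "(\<Sum>i\<in>G x. u x i b * cnj (u x i b')) - wt x b b'
       = (\<Sum>i\<in>G x. of_real (1/2) * (ap x i b * cnj (ap x i b')) + q x i b * cnj (q x i b')) - Nx x b b'"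
      unfolding wt_def Nx_def sum_subtractf[symmetric]
    proof (rule sum.cong[OF refl])
      fix i
      show "u x i b * cnj (u x i b') - p x i b * cnj (p x i b') = of_real (1/2) * (ap x i b * cnj (ap x i b')) + q x i b * cnj (q x i b')
         - of_real (1/2) * (cp x i b * cnj (cp x i b'))"
        using gentle_decomposition(1)[OF t, of "p x i" b "q x i" b'] unfolding ap_def cp_def by (simp add: q_def)
    qed
    ultimately show ?thesis by (simp add: Px_def)
  qed
  \<comment> \<open>The trace-norm cost of replacing the state of x by \<open>wt x\<close>.\<close>
  define \<theta> where "\<theta> = (\<lambda>x. Re (op_trace B (Px x)) + Re (op_trace B (Nx x)))"
  have th0: "\<theta> x \<ge> 0" if "x\<in>Xs" for x unfolding \<theta>_def using psd_trace(1)[OF fB psdPN(1)[OF that]] psd_trace(1)[OF fB psdPN(2)[OF that]] by simp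
  have thx: "\<theta> x \<le> t * (\<Sum>i\<in>I. lam x i) + (1/t + 1) * (\<Sum>i\<in>I. nsq B (q x i)) + (\<Sum>i\<in>I - G x. lam x i)" if x: "x\<in>Xs" for x
  proof -
    have "\<theta> x = (\<Sum>i\<in>G x. 1/2 * nsq B (ap x i) + nsq B (q x i)) + (\<Sum>i\<in>I - G x. nsq B (u x i)) + (\<Sum>i\<in>G x. 1/2 * nsq B (cp x i))"
      unfolding \<theta>_def Px_def Nx_def op_trace_add op_trace_sum op_trace_scale op_trace_rank1 by simp
    also have "\<dots> = (\<Sum>i\<in>G x. t * nsq B (p x i) + (1/t + 1) * nsq B (q x i)) + (\<Sum>i\<in>I - G x. nsq B (u x i))"
    proof -
      have g: "1/2 * nsq B (ap x i) + 1/2 * nsq B (cp x i) = t * nsq B (p x i) + nsq B (q x i) / t" for i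
        unfolding ap_def cp_def by (rule gentle_decomposition(2)[OF t])
      have "(\<Sum>i\<in>G x. 1/2 * nsq B (ap x i) + nsq B (q x i)) + (\<Sum>i\<in>G x. 1/2 * nsq B (cp x i)) = (\<Sum>i\<in>G x. t * nsq B (p x i) + (1/t + 1) * nsq B (q x i))"
        unfolding sum.distrib[symmetric]
      proof (rule sum.cong[OF refl])
        fix i show "1 / 2 * nsq B (ap x i) + nsq B (q x i) + 1 / 2 * nsq B (cp x i) = t * nsq B (p x i) + (1 / t + 1) * nsq B (q x i)"
          using g[of i] by (simp add: algebra_simps)
      qed
      then show ?thesis by simp
    qed
    also have "(\<Sum>i\<in>G x. t * nsq B (p x i) + (1/t + 1) * nsq B (q x i)) \<le> (\<Sum>i\<in>I. t * lam x i + (1/t + 1) * nsq B (q x i))"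
    proof -
      have "(\<Sum>i\<in>G x. t * nsq B (p x i) + (1/t + 1) * nsq B (q x i)) \<le> (\<Sum>i\<in>G x. t * lam x i + (1/t + 1) * nsq B (q x i))"
        using np[OF x] G[OF x] t by (intro sum_mono add_right_mono mult_left_mono) auto
      also have "\<dots> \<le> (\<Sum>i\<in>I. t * lam x i + (1/t + 1) * nsq B (q x i))"
        using fI G[OF x] lam0[OF x] t by (intro sum_mono2 add_nonneg_nonneg mult_nonneg_nonneg) auto
      finally show ?thesis .
    qed
    also have "(\<Sum>i\<in>I - G x. nsq B (u x i)) = (\<Sum>i\<in>I - G x. lam x i)" using nu'[OF x] by (intro sum.cong) auto
    finally show ?thesis by (simp add: sum.distrib sum_distrib_left)
  qed
  have thtot: "(\<Sum>x\<in>Xs. \<theta> x) \<le> t + \<epsilon> / t + 2 * \<epsilon>"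
  proof -
    have "(\<Sum>x\<in>Xs. \<theta> x) \<le> (\<Sum>x\<in>Xs. t * (\<Sum>i\<in>I. lam x i) + (1/t + 1) * (\<Sum>i\<in>I. nsq B (q x i)) + (\<Sum>i\<in>I - G x. lam x i))"
      by (intro sum_mono thx)
    also have "\<dots> = t * 1 + (1/t + 1) * (\<Sum>x\<in>Xs. \<Sum>i\<in>I. nsq B (q x i)) + (\<Sum>x\<in>Xs. \<Sum>i\<in>I - G x. lam x i)"
      unfolding sum.distrib sum_distrib_left[symmetric] tot ..
    also have "\<dots> \<le> t * 1 + (1/t + 1) * \<epsilon> + \<epsilon>"
      using prE cut t by (intro add_mono mult_left_mono) (auto simp: q_def p_def)
    finally show ?thesis by (simp add: algebra_simps)
  qed
  let ?Fs = "PiE Xs (\<lambda>_. {..<Kc})"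
  define Y where "Y = (\<lambda>F kl b b'. \<Sum>x\<in>{x\<in>Xs. f x = snd kl}. of_real (hcoef Kc F x (fst kl)) * wt x b b')"
  have fFs: "finite ?Fs" using fX by (intro finite_PiE) auto
  have neFs: "?Fs \<noteq> {}" using K by (auto simp: PiE_eq_empty_iff lessThan_empty_iff)
  have "(\<Sum>F\<in>?Fs. \<Sum>kl\<in>{..<Kc}\<times>L. frob B (Y F kl)) \<le> \<nu> * card ?Fs"
  proof -
    have "(\<Sum>F\<in>?Fs. \<Sum>kl\<in>{..<Kc}\<times>L. frob B (Y F kl)) = (\<Sum>F\<in>?Fs. \<Sum>k<Kc. \<Sum>l\<in>L. \<Sum>b\<in>B. \<Sum>b'\<in>B. (cmod (Y F (k,l) b b'))\<^sup>2)"
      unfolding frob_def sum.cartesian_product' ..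
    also have "\<dots> = (\<Sum>l\<in>L. \<Sum>b\<in>B. \<Sum>b'\<in>B. \<Sum>F\<in>?Fs. \<Sum>k<Kc. (cmod (Y F (k,l) b b'))\<^sup>2)"
      unfolding sum.swap[of _ L] sum_swap2[where D=B and D'=B and A="{..<Kc}"] sum_swap2[where D=B and D'=B and A="?Fs"] ..
    \<comment> \<open>The scalar second moment is applied to every matrix entry separately, with the
      words of one bin as its index set.\<close>
    also have "\<dots> \<le> (\<Sum>l\<in>L. \<Sum>b\<in>B. \<Sum>b'\<in>B. real (card ?Fs) * (\<Sum>x\<in>{x\<in>Xs. f x = l}. (cmod (wt x b b'))\<^sup>2))"
      unfolding Y_def fst_conv snd_conv by (intro sum_mono hash_second_moment[OF fX K]) auto
    also have "\<dots> = real (card ?Fs) * (\<Sum>l\<in>L. \<Sum>x\<in>{x\<in>Xs. f x = l}. frob B (wt x))"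
      unfolding sum_distrib_left[symmetric] frob_def sum_swap2[where D=B and D'=B and A="{x \<in> Xs. f x = _}"] ..
    also have "(\<Sum>l\<in>L. \<Sum>x\<in>{x\<in>Xs. f x = l}. frob B (wt x)) = (\<Sum>x\<in>Xs. frob B (wt x))"
      by (rule sum.group[OF fX fL fl])
    also have "real (card ?Fs) * (\<Sum>x\<in>Xs. frob B (wt x)) \<le> real (card ?Fs) * (\<Sum>x\<in>Xs. \<nu> * (\<Sum>i\<in>I. lam x i))"
      by (intro mult_left_mono sum_mono frw) auto
    also have "\<dots> = \<nu> * card ?Fs" unfolding sum_distrib_left[symmetric] tot by simp
    finally show ?thesis .
  qed
  then obtain F where F: "F\<in>?Fs" and fr: "(\<Sum>kl\<in>{..<Kc}\<times>L. frob B (Y F kl)) \<le> \<nu>"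
    using exists_le_average[OF fFs neFs] by blast
  have t1: "tn_bound ({..<Kc}\<times>L) B (Y F) (sqrt (real Kc * card L * card KE * \<nu>))"
  proof -
    have "tn_bound ({..<Kc}\<times>L) B (Y F) (sqrt (card ({..<Kc}\<times>L) * card KE * (\<Sum>kl\<in>{..<Kc}\<times>L. frob B (Y F kl))))"
    proof (rule tn_bound_proj[OF _ fB _ onE])
      show "finite ({..<Kc} \<times> L)" using fL by simp
      fix kl assume "kl \<in> {..<Kc} \<times> L"
      show "herm B (Y F kl)" unfolding herm_def
      proof (intro ballI)
        fix b b' assume "b\<in>B" "b'\<in>B"
        have "wt x b' b = cnj (wt x b b')" for x by (simp add: wt_def mult.commute)
        then show "Y F kl b' b = cnj (Y F kl b b')" unfolding Y_def by simp
      qed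
      fix v b assume b: "b\<in>B"
      have wm: "mv B (wt x) v b = (\<Sum>i\<in>G x. ip B (p x i) v * p x i b)" for x b
        unfolding mv_def wt_def ip_def sum_distrib_right by (subst sum.swap) (simp add: mult_ac)
      have Ym: "mv B (Y F kl) v = (\<lambda>b. \<Sum>x\<in>{x\<in>Xs. f x = snd kl}. of_real (hcoef Kc F x (fst kl)) * (\<Sum>i\<in>G x. ip B (p x i) v * p x i b))"
        unfolding wm[symmetric] by (rule ext) (simp add: mv_def Y_def sum_distrib_right sum_distrib_left sum.swap[of _ B] mult.assoc)
      show "prj B KE eE (mv B (Y F kl) v) b = mv B (Y F kl) v b"
        unfolding Ym prj_sum prj_scale by (simp add: p_def prj_idem[OF onE])
    qed
    then show ?thesis
    proof (rule tn_bound_mono)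
      show "sqrt (card ({..<Kc}\<times>L) * card KE * (\<Sum>kl\<in>{..<Kc}\<times>L. frob B (Y F kl))) \<le> sqrt (real Kc * card L * card KE * \<nu>)"
        using fr by (intro real_sqrt_le_mono) (auto simp: card_cartesian_product intro!: mult_left_mono)
    qed
  qed
  let ?C = "\<lambda>x k. hcoef Kc F x k"
  have t2: "tn_bound ({..<Kc}\<times>L) B (\<lambda>kl b b'. \<Sum>x\<in>{x\<in>Xs. f x = snd kl}. of_real (?C x (fst kl)) * (Px x b b' - Nx x b b')) (2 * (t + \<epsilon> / t + 2 * \<epsilon>))"
  proof (rule tn_boundI[where P="\<lambda>kl b b'. \<Sum>x\<in>{x\<in>Xs. f x = snd kl}. of_real (max (?C x (fst kl)) 0) * Px x b b' + of_real (max (- ?C x (fst kl)) 0) * Nx x b b'"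
      and N="\<lambda>kl b b'. \<Sum>x\<in>{x\<in>Xs. f x = snd kl}. of_real (max (?C x (fst kl)) 0) * Nx x b b' + of_real (max (- ?C x (fst kl)) 0) * Px x b b'"])
    fix kl assume "kl \<in> {..<Kc}\<times>L"
    show "psd B (\<lambda>b b'. \<Sum>x\<in>{x\<in>Xs. f x = snd kl}. of_real (max (?C x (fst kl)) 0) * Px x b b' + of_real (max (- ?C x (fst kl)) 0) * Nx x b b')"
      by (intro psd_sum psd_add psd_scale) (use fX psdPN in auto)
    show "psd B (\<lambda>b b'. \<Sum>x\<in>{x\<in>Xs. f x = snd kl}. of_real (max (?C x (fst kl)) 0) * Nx x b b' + of_real (max (- ?C x (fst kl)) 0) * Px x b b')"
      by (intro psd_sum psd_add psd_scale) (use fX psdPN in auto)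
    fix b b'
    have L: "complex_of_real (?C x k) = of_real (max (?C x k) 0) - of_real (max (- ?C x k) 0)" for x k
      unfolding of_real_diff[symmetric] by (simp add: max_def)
    show "(\<Sum>x\<in>{x\<in>Xs. f x = snd kl}. of_real (?C x (fst kl)) * (Px x b b' - Nx x b b'))
      = (\<Sum>x\<in>{x\<in>Xs. f x = snd kl}. of_real (max (?C x (fst kl)) 0) * Px x b b' + of_real (max (- ?C x (fst kl)) 0) * Nx x b b')
       - (\<Sum>x\<in>{x\<in>Xs. f x = snd kl}. of_real (max (?C x (fst kl)) 0) * Nx x b b' + of_real (max (- ?C x (fst kl)) 0) * Px x b b')"
      unfolding sum_subtractf[symmetric] by (intro sum.cong refl) (simp only: L, simp only: algebra_simps)
  next
    have ab: "max a 0 + max (- a) 0 = \<bar>a\<bar>" for a :: real by simp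
    have "(\<Sum>kl\<in>{..<Kc}\<times>L. Re (op_trace B (\<lambda>b b'. \<Sum>x\<in>{x\<in>Xs. f x = snd kl}. of_real (max (?C x (fst kl)) 0) * Px x b b' + of_real (max (- ?C x (fst kl)) 0) * Nx x b b'))
      + Re (op_trace B (\<lambda>b b'. \<Sum>x\<in>{x\<in>Xs. f x = snd kl}. of_real (max (?C x (fst kl)) 0) * Nx x b b' + of_real (max (- ?C x (fst kl)) 0) * Px x b b')))
     = (\<Sum>kl\<in>{..<Kc}\<times>L. \<Sum>x\<in>{x\<in>Xs. f x = snd kl}. \<bar>?C x (fst kl)\<bar> * \<theta> x)"
    proof (rule sum.cong[OF refl])
      fix kl :: "nat \<times> 'l"
      let ?S = "{x\<in>Xs. f x = snd kl}"
      show "Re (op_trace B (\<lambda>b b'. \<Sum>x\<in>?S. of_real (max (?C x (fst kl)) 0) * Px x b b' + of_real (max (- ?C x (fst kl)) 0) * Nx x b b'))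
      + Re (op_trace B (\<lambda>b b'. \<Sum>x\<in>?S. of_real (max (?C x (fst kl)) 0) * Nx x b b' + of_real (max (- ?C x (fst kl)) 0) * Px x b b'))
      = (\<Sum>x\<in>?S. \<bar>?C x (fst kl)\<bar> * \<theta> x)"
        unfolding op_trace_sum op_trace_add op_trace_scale Re_sum sum.distrib[symmetric] ab[symmetric] \<theta>_def
        by (intro sum.cong refl) (simp add: algebra_simps)
    qed
    also have "\<dots> = (\<Sum>k<Kc. \<Sum>l\<in>L. \<Sum>x\<in>{x\<in>Xs. f x = l}. \<bar>?C x k\<bar> * \<theta> x)" unfolding sum.cartesian_product' by simp
    also have "\<dots> = (\<Sum>k<Kc. \<Sum>x\<in>Xs. \<bar>?C x k\<bar> * \<theta> x)" by (intro sum.cong refl sum.group fX fL fl)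
    also have "\<dots> = (\<Sum>x\<in>Xs. (\<Sum>k<Kc. \<bar>?C x k\<bar>) * \<theta> x)" unfolding sum_distrib_right by (rule sum.swap)
    \<comment> \<open>For fixed x the coefficients have total modulus at most 2: one for the real
      key and one for the uniform key.\<close>
    also have "\<dots> \<le> (\<Sum>x\<in>Xs. 2 * \<theta> x)"
    proof (rule sum_mono)
      fix x assume x: "x\<in>Xs"
      have "F x < Kc" using F x by auto
      have "(\<Sum>k<Kc. \<bar>?C x k\<bar>) \<le> (\<Sum>k<Kc. (if F x = k then 1 else 0) + 1 / real Kc)"
        by (intro sum_mono) (auto simp: hcoef_def)
      also have "\<dots> = 2" using \<open>F x < Kc\<close> K by (simp add: sum.distrib)
      finally show "(\<Sum>k<Kc. \<bar>?C x k\<bar>) * \<theta> x \<le> 2 * \<theta> x" using th0[OF x] by (rule mult_right_mono)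
    qed
    also have "\<dots> \<le> 2 * (t + \<epsilon> / t + 2 * \<epsilon>)" using thtot by (simp add: sum_distrib_left[symmetric])
    finally show "(\<Sum>kl\<in>{..<Kc}\<times>L. Re (op_trace B (\<lambda>b b'. \<Sum>x\<in>{x\<in>Xs. f x = snd kl}. of_real (max (?C x (fst kl)) 0) * Px x b b' + of_real (max (- ?C x (fst kl)) 0) * Nx x b b'))
      + Re (op_trace B (\<lambda>b b'. \<Sum>x\<in>{x\<in>Xs. f x = snd kl}. of_real (max (?C x (fst kl)) 0) * Nx x b b' + of_real (max (- ?C x (fst kl)) 0) * Px x b b'))) \<le> 2 * (t + \<epsilon> / t + 2 * \<epsilon>)" .
  qed
  have "tn_bound ({..<Kc} \<times> L) B
     (\<lambda>kl b b'. \<Sum>x\<in>{x\<in>Xs. f x = snd kl}. of_real (?C x (fst kl)) * (\<Sum>i\<in>I. u x i b * cnj (u x i b')))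
     (sqrt (real Kc * card L * card KE * \<nu>) + 2 * (t + \<epsilon> / t + 2 * \<epsilon>))"
  proof (rule tn_bound_cong[OF tn_bound_add[OF t1 t2]])
    fix kl b b' assume "b\<in>B" "b'\<in>B"
    show "Y F kl b b' + (\<Sum>x\<in>{x\<in>Xs. f x = snd kl}. of_real (?C x (fst kl)) * (Px x b b' - Nx x b b'))
       = (\<Sum>x\<in>{x\<in>Xs. f x = snd kl}. of_real (?C x (fst kl)) * (\<Sum>i\<in>I. u x i b * cnj (u x i b')))"
      unfolding Y_def sum.distrib[symmetric]
    proof (rule sum.cong[OF refl])
      fix x assume "x \<in> {x\<in>Xs. f x = snd kl}"
      then have "(\<Sum>i\<in>I. u x i b * cnj (u x i b')) = wt x b b' + (Px x b b' - Nx x b b')" using wPN[of x b b'] by (simp add: algebra_simps)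
      then show "of_real (?C x (fst kl)) * wt x b b' + of_real (?C x (fst kl)) * (Px x b b' - Nx x b b') = of_real (?C x (fst kl)) * (\<Sum>i\<in>I. u x i b * cnj (u x i b'))"
        by (simp add: distrib_left)
    qed
  qed
  then show ?thesis using F by blast
qed

section \<open>Product ensembles\<close>

definition tE :: "'t set \<Rightarrow> ('y \<Rightarrow> 'c \<Rightarrow> 'c \<Rightarrow> complex) \<Rightarrow> ('t \<Rightarrow> 'y) \<Rightarrow> ('t \<Rightarrow> 'c) \<Rightarrow> ('t \<Rightarrow> 'c) \<Rightarrow> complex" where
  "tE T e x k b = (\<Prod>t\<in>T. e (x t) (k t) (b t))"

definition tL :: "'t set \<Rightarrow> ('y \<Rightarrow> 'c \<Rightarrow> real) \<Rightarrow> ('t \<Rightarrow> 'y) \<Rightarrow> ('t \<Rightarrow> 'c) \<Rightarrow> real" where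
  "tL T lam x k = (\<Prod>t\<in>T. lam (x t) (k t))"

text \<open>Typicality is asked of the word and the eigenvalue index jointly. One classical typical
  set of pairs thus defines a subspace for every word, and its error and dimension are controlled
  after summing over the words.\<close>

definition tK :: "'t set \<Rightarrow> 'y set \<Rightarrow> 'c set \<Rightarrow> ('y \<Rightarrow> 'c \<Rightarrow> real) \<Rightarrow> real \<Rightarrow> ('t \<Rightarrow> 'y) \<Rightarrow> ('t \<Rightarrow> 'c) set" where
  "tK T Y B lam d x = {k \<in> PiE T (\<lambda>_. B). (\<lambda>t\<in>T. (x t, k t)) \<in> typseq T (Y \<times> B) (case_prod lam) d}"

lemma sum_PiE_Times:
  "(\<Sum>s\<in>PiE T (\<lambda>_. Y \<times> B). g s) = (\<Sum>x\<in>PiE T (\<lambda>_. Y). \<Sum>k\<in>PiE T (\<lambda>_. B). g (\<lambda>t\<in>T. (x t, k t)))"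
proof -
  let ?i = "\<lambda>p. \<lambda>t\<in>T. (fst p t, snd p t)" and ?j = "\<lambda>s. (\<lambda>t\<in>T. fst (s t), \<lambda>t\<in>T. snd (s t))"
  have "(\<Sum>s\<in>PiE T (\<lambda>_. Y \<times> B). g s) = (\<Sum>p\<in>PiE T (\<lambda>_. Y) \<times> PiE T (\<lambda>_. B). g (?i p))"
  proof (rule sum.reindex_bij_witness[where i="?i" and j="?j"])
    fix s assume s: "s \<in> PiE T (\<lambda>_. Y \<times> B)"
    show ij: "?i (?j s) = s" using s by (auto simp: fun_eq_iff restrict_def PiE_def extensional_def)
    show "?j s \<in> PiE T (\<lambda>_. Y) \<times> PiE T (\<lambda>_. B)" using s by (auto simp: PiE_iff mem_Times_iff)
    show "g (?i (?j s)) = g s" unfolding ij ..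
  next
    fix p assume p: "p \<in> PiE T (\<lambda>_. Y) \<times> PiE T (\<lambda>_. B)"
    show "?j (?i p) = p" using p by (cases p) (auto simp: fun_eq_iff restrict_def PiE_def extensional_def)
    show "?i p \<in> PiE T (\<lambda>_. Y \<times> B)" using p by (auto simp: PiE_iff)
  qed
  then show ?thesis by (simp add: sum.cartesian_product')
qed

lemma tE_onf:
  assumes fT: "finite T" and fB: "finite B" and on: "\<And>t. t \<in> T \<Longrightarrow> onf B B (e (x t))"
  shows "onf (PiE T (\<lambda>_. B)) (PiE T (\<lambda>_. B)) (tE T e x)"
  unfolding onf_def
proof (intro conjI ballI)
  show "finite (PiE T (\<lambda>_. B))" using fT fB by (intro finite_PiE) auto
  fix k k' assume k: "k \<in> PiE T (\<lambda>_. B)" "k' \<in> PiE T (\<lambda>_. B)"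
  have "ip (PiE T (\<lambda>_. B)) (tE T e x k) (tE T e x k') = (\<Sum>b\<in>PiE T (\<lambda>_. B). \<Prod>t\<in>T. cnj (e (x t) (k t) (b t)) * e (x t) (k' t) (b t))"
    unfolding ip_def tE_def cnj_prod prod.distrib ..
  also have "\<dots> = (\<Prod>t\<in>T. ip B (e (x t) (k t)) (e (x t) (k' t)))"
    unfolding ip_def by (rule sum_PiE_prod[OF fT]) (use fB in auto)
  also have "\<dots> = (\<Prod>t\<in>T. if k t = k' t then 1 else 0)"
  proof (rule prod.cong[OF refl])
    fix t assume t: "t\<in>T"
    show "ip B (e (x t) (k t)) (e (x t) (k' t)) = (if k t = k' t then 1 else 0)"
      by (rule onfD[OF on[OF t]]) (use k t in auto)
  qed
  also have "\<dots> = (if k = k' then 1 else 0)"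
  proof (cases "k = k'")
    case False
    then obtain t where "t\<in>T" "k t \<noteq> k' t" using PiE_ext[OF k] by blast
    then show ?thesis using fT False by (auto intro!: prod_zero)
  qed simp
  finally show "ip (PiE T (\<lambda>_. B)) (tE T e x k) (tE T e x k') = (if k = k' then 1 else 0)" .
qed

lemma tE_spectral:
  assumes fT: "finite T" and fB: "finite B" and b: "b \<in> PiE T (\<lambda>_. B)" "b' \<in> PiE T (\<lambda>_. B)"
    and w: "\<And>t b b'. t \<in> T \<Longrightarrow> b\<in>B \<Longrightarrow> b'\<in>B \<Longrightarrow> w (x t) b b' = (\<Sum>k\<in>B. complex_of_real (lam (x t) k) * e (x t) k b * cnj (e (x t) k b'))"
  shows "(\<Prod>t\<in>T. w (x t) (b t) (b' t)) = (\<Sum>k\<in>PiE T (\<lambda>_. B). complex_of_real (tL T lam x k) * tE T e x k b * cnj (tE T e x k b'))"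
proof -
  have "(\<Prod>t\<in>T. w (x t) (b t) (b' t)) = (\<Prod>t\<in>T. \<Sum>k\<in>B. complex_of_real (lam (x t) k) * e (x t) k (b t) * cnj (e (x t) k (b' t)))"
    by (rule prod.cong[OF refl], rule w) (use b in auto)
  also have "\<dots> = (\<Sum>k\<in>PiE T (\<lambda>_. B). \<Prod>t\<in>T. complex_of_real (lam (x t) (k t)) * e (x t) (k t) (b t) * cnj (e (x t) (k t) (b' t)))"
    by (rule sum_PiE_prod[OF fT, symmetric]) (use fB in auto)
  finally show ?thesis unfolding tL_def tE_def cnj_prod of_real_prod prod.distrib .
qed

lemma tL_nonneg: "(\<And>t. t\<in>T \<Longrightarrow> lam (x t) (k t) \<ge> 0) \<Longrightarrow> tL T lam x k \<ge> 0"
  unfolding tL_def by (rule prod_nonneg) auto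

context
  fixes T :: "'t set" and Y :: "'y set" and B :: "'c set" and lam :: "'y \<Rightarrow> 'c \<Rightarrow> real" and d :: real
  assumes fT: "finite T" and fY: "finite Y" and fB: "finite B"
    and lam0: "\<And>y k. y\<in>Y \<Longrightarrow> k\<in>B \<Longrightarrow> lam y k \<ge> 0" and lam1: "(\<Sum>y\<in>Y. \<Sum>k\<in>B. lam y k) = 1"
begin

lemma lam_sum: "sum (case_prod lam) (Y \<times> B) = 1"
  using lam1 by (simp add: sum.cartesian_product)

lemma tL_restrict: "(\<Prod>t\<in>T. case_prod lam ((\<lambda>t\<in>T. (x t, k t)) t)) = tL T lam x k"
  unfolding tL_def by (rule prod.cong) auto

lemma tL_total: "(\<Sum>x\<in>PiE T (\<lambda>_. Y). \<Sum>k\<in>PiE T (\<lambda>_. B). tL T lam x k) = 1"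
proof -
  have "(\<Sum>s\<in>PiE T (\<lambda>_. Y \<times> B). \<Prod>t\<in>T. case_prod lam (s t)) = (\<Prod>t\<in>T. sum (case_prod lam) (Y \<times> B))"
    by (rule sum_PiE_prod[OF fT]) (use fY fB in auto)
  then show ?thesis unfolding sum_PiE_Times tL_restrict lam_sum by simp
qed

lemma tK_error:
  assumes "T \<noteq> {}" "d > 0"
  shows "(\<Sum>x\<in>PiE T (\<lambda>_. Y). \<Sum>k\<in>PiE T (\<lambda>_. B) - tK T Y B lam d x. tL T lam x k) \<le> info_var (Y \<times> B) (case_prod lam) / (card T * d\<^sup>2)"
proof -
  let ?TS = "typseq T (Y \<times> B) (case_prod lam) d"
  let ?Bn = "PiE T (\<lambda>_. B)" and ?Yn = "PiE T (\<lambda>_. Y)"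
  have fBn: "finite ?Bn" using fT fB by (intro finite_PiE) auto
  have fYB: "finite (PiE T (\<lambda>_. Y \<times> B))" using fT fB fY by (intro finite_PiE) auto
  have "(\<Sum>s\<in>PiE T (\<lambda>_. Y \<times> B) - ?TS. \<Prod>t\<in>T. case_prod lam (s t)) = (\<Sum>s\<in>PiE T (\<lambda>_. Y \<times> B). if s \<in> ?TS then 0 else \<Prod>t\<in>T. case_prod lam (s t))"
    by (rule sum.mono_neutral_cong_left) (use fYB in auto)
  also have "\<dots> = (\<Sum>x\<in>?Yn. \<Sum>k\<in>?Bn. if (\<lambda>t\<in>T. (x t, k t)) \<in> ?TS then 0 else tL T lam x k)"
    unfolding sum_PiE_Times tL_restrict ..
  also have "\<dots> = (\<Sum>x\<in>?Yn. \<Sum>k\<in>?Bn - tK T Y B lam d x. tL T lam x k)"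
    by (intro sum.cong refl sum.mono_neutral_cong_right) (use fBn in \<open>auto simp: tK_def\<close>)
  finally show ?thesis
    using typ_prob[OF fT assms(1) finite_cartesian_product[OF fY fB] lam_sum _ assms(2)] lam0 by fastforce
qed

text \<open>Pairs of a word and an index in its typical set are exactly the typical pair sequences,
  so the dimensions summed over the words are the size of that set.\<close>

lemma tK_card: "(\<Sum>x\<in>PiE T (\<lambda>_. Y). real (card (tK T Y B lam d x))) \<le> 2 powr (card T * (shannon (Y \<times> B) (case_prod lam) + d))"
proof -
  let ?TS = "typseq T (Y \<times> B) (case_prod lam) d"
  let ?Bn = "PiE T (\<lambda>_. B)" and ?Yn = "PiE T (\<lambda>_. Y)"
  have fBn: "finite ?Bn" using fT fB by (intro finite_PiE) auto
  have fYB: "finite (PiE T (\<lambda>_. Y \<times> B))" using fT fB fY by (intro finite_PiE) auto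
  have "real (card ?TS) = (\<Sum>s\<in>PiE T (\<lambda>_. Y \<times> B). if s \<in> ?TS then 1 else 0)"
    using fYB by (simp add: sum.If_cases Int_absorb1 typseq_def Collect_conj_eq Int_commute)
  also have "\<dots> = (\<Sum>x\<in>?Yn. \<Sum>k\<in>?Bn. if (\<lambda>t\<in>T. (x t, k t)) \<in> ?TS then 1 else 0)" by (rule sum_PiE_Times)
  also have "\<dots> = (\<Sum>x\<in>?Yn. real (card (tK T Y B lam d x)))"
    using fBn by (intro sum.cong refl) (simp add: tK_def sum.If_cases Collect_conj_eq)
  finally show ?thesis
    using typ_card[OF fT finite_cartesian_product[OF fY fB] lam_sum, of d] lam0 by fastforce
qed

lemma tK_le: assumes "k \<in> tK T Y B lam d x"
  shows "tL T lam x k \<le> 2 powr (- (card T * (shannon (Y \<times> B) (case_prod lam) - d)))"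
  using assms unfolding tK_def typseq_def tL_restrict[symmetric] by blast

end

lemma nsq_diff_prj_complete:
  assumes "onf B B e" "finite B" "K \<subseteq> B"
  shows "nsq B (\<lambda>b. v b - prj B K e v b) = (\<Sum>k\<in>B - K. (cmod (ip B (e k) v))\<^sup>2)"
proof -
  have onK: "onf B K e" "onf B (B - K) e" using onf_subset[OF assms(1)] assms(3) by auto
  have "v b - prj B K e v b = prj B (B - K) e v b" if "b\<in>B" for b
  proof -
    have "v b = prj B B e v b" using onf_complete[OF assms(1,2) refl that] by simp
    also have "\<dots> = prj B (B - K) e v b + prj B K e v b" unfolding prj_def using assms by (simp add: sum.subset_diff)
    finally show ?thesis by simp
  qed
  then have "nsq B (\<lambda>b. v b - prj B K e v b) = nsq B (prj B (B - K) e v)" by (rule nsq_cong)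
  then show ?thesis using nsq_prj[OF onK(2)] by simp
qed

section \<open>Decoding with random binning\<close>

text \<open>Transposition: a tuple of words is indexed by player and then time, while product states
  need the letters of all players at one time.\<close>

definition colm :: "nat \<Rightarrow> nat set \<Rightarrow> (nat \<Rightarrow> nat \<Rightarrow> nat) \<Rightarrow> nat \<Rightarrow> nat \<Rightarrow> nat" where
  "colm n M x = (\<lambda>t\<in>{..<n}. \<lambda>i\<in>M. x i t)"

definition srcs :: "nat set \<Rightarrow> (nat \<Rightarrow> nat) \<Rightarrow> nat \<Rightarrow> (nat \<Rightarrow> nat \<Rightarrow> nat) set" where
  "srcs M N n = PiE M (\<lambda>i. PiE {..<n} (\<lambda>_. {..<N i}))"

definition tups :: "nat set \<Rightarrow> (nat \<Rightarrow> nat) \<Rightarrow> (nat \<Rightarrow> nat) set" where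
  "tups M N = PiE M (\<lambda>i. {..<N i})"

lemma sum_colm: "(\<Sum>s\<in>PiE {..<n} (\<lambda>_. tups M N). g s) = (\<Sum>x\<in>srcs M N n. g (colm n M x))"
proof (rule sum.reindex_bij_witness[where i="colm n M" and j="\<lambda>s. \<lambda>i\<in>M. \<lambda>t\<in>{..<n}. s t i"])
  fix s assume s: "s \<in> PiE {..<n} (\<lambda>_. tups M N)"
  let ?j = "\<lambda>i\<in>M. \<lambda>t\<in>{..<n}. s t i"
  show ij: "colm n M ?j = s"
  proof (rule ext)
    fix t show "colm n M ?j t = s t"
    proof (cases "t < n")
      case True
      then have "s t \<in> tups M N" using s by auto
      then have "restrict (s t) M = s t" by (simp add: tups_def PiE_restrict)
      moreover have "colm n M ?j t = restrict (s t) M" using True by (auto simp: colm_def restrict_def)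
      ultimately show ?thesis by simp
    next
      case False then show ?thesis using PiE_arb[OF s, of t] by (simp add: colm_def)
    qed
  qed
  show "?j \<in> srcs M N n" using s by (auto simp: srcs_def tups_def PiE_iff)
  show "g (colm n M ?j) = g s" unfolding ij ..
next
  fix x assume x: "x \<in> srcs M N n"
  show "(\<lambda>i\<in>M. \<lambda>t\<in>{..<n}. colm n M x t i) = x"
  proof (intro ext)
    fix i t
    have xi: "x i \<in> PiE {..<n} (\<lambda>_. {..<N i})" if "i \<in> M" using x that by (auto simp: srcs_def)
    show "(\<lambda>i\<in>M. \<lambda>t\<in>{..<n}. colm n M x t i) i t = x i t"
      using PiE_arb[OF x[unfolded srcs_def], of i] PiE_arb[OF xi, of t] by (cases "i \<in> M"; cases "t < n") (auto simp: colm_def)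
  qed
  show "colm n M x \<in> PiE {..<n} (\<lambda>_. tups M N)" using x by (auto simp: srcs_def colm_def tups_def PiE_iff)
qed

lemma colm_mem: "x \<in> srcs M N n \<Longrightarrow> L \<subseteq> M \<Longrightarrow> colm n L x \<in> PiE {..<n} (\<lambda>_. tups L N)"
  unfolding srcs_def tups_def colm_def by (auto simp: restrict_def PiE_def Pi_def extensional_def subset_iff)

lemma colm_apply: "t < n \<Longrightarrow> colm n M x t = (\<lambda>i\<in>M. x i t)" by (simp add: colm_def)

lemma finite_srcs: "finite M \<Longrightarrow> finite (srcs M N n)"
  unfolding srcs_def by (intro finite_PiE) auto

definition binset :: "nat set \<Rightarrow> (nat \<Rightarrow> nat) \<Rightarrow> nat \<Rightarrow> (nat \<Rightarrow> nat) \<Rightarrow> (nat \<Rightarrow> (nat \<Rightarrow> nat) \<Rightarrow> nat) set" where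
  "binset M N n Mb = PiE M (\<lambda>i. PiE (PiE {..<n} (\<lambda>_. {..<N i})) (\<lambda>_. {..<Mb i}))"

definition bins :: "nat set \<Rightarrow> (nat \<Rightarrow> (nat \<Rightarrow> nat) \<Rightarrow> nat) \<Rightarrow> (nat \<Rightarrow> nat \<Rightarrow> nat) \<Rightarrow> nat \<Rightarrow> nat" where
  "bins M f x = (\<lambda>i\<in>M. f i (x i))"

definition prod_op :: "nat \<Rightarrow> ((nat \<Rightarrow> nat) \<Rightarrow> 'c op) \<Rightarrow> (nat \<Rightarrow> nat \<Rightarrow> nat) \<Rightarrow> nat set \<Rightarrow> (nat \<Rightarrow> 'c) op" where
  "prod_op n w x M = (\<lambda>b b'. \<Prod>t<n. w (\<lambda>i\<in>M. x i t) (b t) (b' t))"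

text \<open>The trace of \<open>w y\<close> carries the probability of y, so this is the
  unnormalised state given the letters on L after forgetting the others.\<close>

definition marg_op :: "(nat \<Rightarrow> nat) set \<Rightarrow> nat set \<Rightarrow> ((nat \<Rightarrow> nat) \<Rightarrow> 'c op) \<Rightarrow> (nat \<Rightarrow> nat) \<Rightarrow> 'c op" where
  "marg_op Y L w y' = (\<lambda>b b'. \<Sum>y\<in>{y\<in>Y. restrict y L = y'}. w y b b')"

text \<open>The decoder of player \<open>j\<close> on seeing \<open>cl\<close>, its own word and all bins: outcome \<open>x\<close> is the guessed tuple, \<open>Rm\<close> the
  failure outcome.\<close>

definition bin_decoder where
  "bin_decoder M N n j B w f err Lam Rm \<longleftrightarrow>
     (\<forall>cl x. psd (PiE {..<n} (\<lambda>_. B)) (Lam cl x)) \<and> (\<forall>cl. psd (PiE {..<n} (\<lambda>_. B)) (Rm cl))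
     \<and> (\<forall>cl. \<forall>b\<in>PiE {..<n} (\<lambda>_. B). \<forall>b'\<in>PiE {..<n} (\<lambda>_. B).
          (\<Sum>x\<in>{x\<in>srcs M N n. (x j, bins M f x) = cl}. Lam cl x b b') + Rm cl b b' = (if b = b' then 1 else 0))
     \<and> 1 - (\<Sum>x\<in>srcs M N n. Re (\<Sum>b\<in>PiE {..<n} (\<lambda>_. B). \<Sum>b'\<in>PiE {..<n} (\<lambda>_. B).
            prod_op n w x M b' b * Lam (x j, bins M f x) x b b')) \<le> err"

lemma bin_decoder_mono: "bin_decoder M N n j B w f err Lam Rm \<Longrightarrow> err \<le> err' \<Longrightarrow> bin_decoder M N n j B w f err' Lam Rm"
  unfolding bin_decoder_def by (elim conjE, intro conjI) (assumption | linarith)+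

text \<open>\<open>lam J\<close> is the spectrum after the letters of J are forgotten, so
  \<open>S {} - S J\<close> is the entropy of X_J given the rest and the output of j. Averaged over
  bins, G has two parts: the Chebyshev errors of all J, and the number of typical test dimensions
  times the largest typical eigenvalue for J times the collision probability. The bound concerns G,
  not its root, so that different players can be combined later.\<close>

lemma decoder_block:
  fixes w :: "(nat \<Rightarrow> nat) \<Rightarrow> 'c op" and lam :: "nat set \<Rightarrow> (nat \<Rightarrow> nat) \<Rightarrow> 'c \<Rightarrow> real" and n :: nat and d dt :: real
  assumes fM: "finite M" and jM: "j \<in> M" and fB: "finite B" and n: "n \<ge> 1" and dt: "dt > 0" and d: "d > 0"
    and Mb: "\<And>i. i\<in>M \<Longrightarrow> Mb i \<ge> (1::nat)"
    and sp: "\<And>J y. J \<subseteq> M - {j} \<Longrightarrow> y \<in> tups (M - J) N \<Longrightarrow> spectral B (marg_op (tups M N) (M - J) w y) (lam J y) (e J y)"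
    and l0: "\<And>J y k. J \<subseteq> M - {j} \<Longrightarrow> y \<in> tups (M - J) N \<Longrightarrow> k\<in>B \<Longrightarrow> lam J y k \<ge> 0"
    and l1: "\<And>J. J \<subseteq> M - {j} \<Longrightarrow> (\<Sum>y\<in>tups (M - J) N. \<Sum>k\<in>B. lam J y k) = 1"
  defines "S \<equiv> \<lambda>J. shannon (tups (M - J) N \<times> B) (case_prod (lam J))"
    and "V \<equiv> \<lambda>J. info_var (tups (M - J) N \<times> B) (case_prod (lam J))"
    and "Js \<equiv> {J. J \<subseteq> M - {j} \<and> J \<noteq> {}}" and "c \<equiv> real (card {J. J \<subseteq> M - {j} \<and> J \<noteq> {}})"
  shows "\<exists>G. (\<forall>f. G f \<ge> (0::real)) \<and> (\<Sum>f\<in>binset M N n Mb. G f) \<le> real (card (binset M N n Mb)) *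
       ((8 * (1 + d\<^sup>2 * c) + 2 * ((1 + d\<^sup>2 * c) * (1 + c) ^ card M / d)\<^sup>2 * c\<^sup>2) * ((\<Sum>J\<in>insert {} Js. V J) / (n * dt\<^sup>2))
        + (1 + d\<^sup>2 * c) * (\<Sum>J\<in>Js. 2 powr (- (n * (S J - dt))) * 2 powr (n * (S {} + dt)) / (\<Prod>i\<in>J. real (Mb i))))
    \<and> (\<forall>f. \<exists>Lam Rm. bin_decoder M N n j B w f (2 * sqrt (G f) + 2 * (d * sqrt c)) Lam Rm)"
proof -
  let ?T = "{..<n}" and ?Bn = "PiE {..<n} (\<lambda>_. B)" and ?Xs = "srcs M N n"
  let ?Fs = "binset M N n Mb"
  have fT: "finite ?T" by simp
  have Tne: "?T \<noteq> {}" using n by (auto simp: lessThan_empty_iff)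
  have fBn: "finite ?Bn" using fB by (intro finite_PiE) auto
  have fX: "finite ?Xs" by (rule finite_srcs[OF fM])
  have fY: "finite (tups (M - J) N)" for J unfolding tups_def using fM by (intro finite_PiE) auto
  have fJs: "finite Js" unfolding Js_def using fM by simp
  have JsD: "J \<subseteq> M - {j}" if "J \<in> Js" for J using that by (simp add: Js_def)
  have E0: "{} \<subseteq> M - {j}" by simp
  have on1: "onf B B (e J y)" if "J \<subseteq> M - {j}" "y \<in> tups (M - J) N" for J y by (rule spectral_onf[OF fB sp[OF that]])
  define q where "q = (\<lambda>J x. colm n (M - J) x)"
  have qm: "q J x \<in> PiE ?T (\<lambda>_. tups (M - J) N)" if "x \<in> ?Xs" for J x
    unfolding q_def by (rule colm_mem[OF that]) auto
  have qmt: "q J x t \<in> tups (M - J) N" if "x \<in> ?Xs" "t \<in> ?T" for J x t using qm[OF that(1), of J] that(2) by auto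
  have onn: "onf ?Bn ?Bn (tE ?T (e J) s)" if J: "J \<subseteq> M - {j}" and s: "s \<in> PiE ?T (\<lambda>_. tups (M - J) N)" for J s
    by (rule tE_onf[OF fT fB], rule on1[OF J]) (use s in auto)
  define KK where "KK = (\<lambda>J x. tK ?T (tups (M - J) N) B (lam J) dt (q J x))"
  define EE where "EE = (\<lambda>J x. tE ?T (e J) (q J x))"
  have KB: "KK J x \<subseteq> ?Bn" for J x by (auto simp: KK_def tK_def)
  have onEE: "onf ?Bn ?Bn (EE J x)" if "J \<subseteq> M - {j}" "x \<in> ?Xs" for J x
    unfolding EE_def by (rule onn[OF that(1) qm[OF that(2)]])
  have onKK: "onf ?Bn (KK J x) (EE J x)" if "J \<subseteq> M - {j}" "x \<in> ?Xs" for J x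
    by (rule onf_subset[OF onEE[OF that] KB])
  define LL where "LL = (\<lambda>x k. tL ?T (lam {}) (q {} x) k)"
  have LL0: "LL x k \<ge> 0" if "x\<in>?Xs" "k\<in>?Bn" for x k
    unfolding LL_def using that qmt[OF that(1), of _ "{}"] by (intro tL_nonneg l0[OF E0]) auto
  define u where "u = (\<lambda>x k b. complex_of_real (sqrt (LL x k)) * EE {} x k b)"
  have restr: "restrict y M = y" if "y \<in> tups M N" for y using that by (simp add: tups_def PiE_restrict)
  have ucl0: "marg_op (tups M N) M w y = w y" if "y \<in> tups M N" for y
  proof -
    have "{y' \<in> tups M N. restrict y' M = y} = {y}" using restr that by auto
    then show ?thesis by (simp add: marg_op_def)
  qed
  have gram: "prod_op n w x M b b' = (\<Sum>k\<in>?Bn. u x k b * cnj (u x k b'))" if x: "x\<in>?Xs" and b: "b\<in>?Bn" "b'\<in>?Bn" for x b b'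
  proof -
    have "prod_op n w x M b b' = (\<Prod>t\<in>?T. marg_op (tups M N) M w (q {} x t) (b t) (b' t))"
      unfolding prod_op_def
    proof (rule prod.cong[OF refl])
      fix t assume t: "t\<in>?T"
      have "q {} x t = (\<lambda>i\<in>M. x i t)" using t by (simp add: q_def colm_apply)
      moreover have "q {} x t \<in> tups M N" using qmt[OF x t, of "{}"] by simp
      ultimately show "w (\<lambda>i\<in>M. x i t) (b t) (b' t) = marg_op (tups M N) M w (q {} x t) (b t) (b' t)" using ucl0 by simp
    qed
    also have "\<dots> = (\<Sum>k\<in>?Bn. complex_of_real (tL ?T (lam {}) (q {} x) k) * tE ?T (e {}) (q {} x) k b * cnj (tE ?T (e {}) (q {} x) k b'))"
      by (rule tE_spectral[OF fT fB b]) (use spectral_eq[OF sp[OF E0]] qmt[OF x, of _ "{}"] in auto)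
    also have "\<dots> = (\<Sum>k\<in>?Bn. u x k b * cnj (u x k b'))"
    proof (rule sum.cong[OF refl])
      fix k assume k: "k\<in>?Bn"
      have sq: "of_real (sqrt (LL x k)) * complex_of_real (sqrt (LL x k)) = complex_of_real (LL x k)" using LL0[OF x k] by (simp flip: of_real_mult)
      have "u x k b * cnj (u x k b') = (of_real (sqrt (LL x k)) * complex_of_real (sqrt (LL x k))) * EE {} x k b * cnj (EE {} x k b')"
        by (simp add: u_def mult_ac)
      then show "complex_of_real (tL ?T (lam {}) (q {} x) k) * tE ?T (e {}) (q {} x) k b * cnj (tE ?T (e {}) (q {} x) k b') = u x k b * cnj (u x k b')"
        unfolding sq by (simp add: LL_def EE_def)
    qed
    finally show ?thesis .
  qed
  \<comment> \<open>Summing over all tuples with the same letters off J factorises over time into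
    marginal states, which are diagonal in the product eigenbasis of s. All estimates for J follow
    from this identity by choosing h.\<close>
  have KI: "(\<Sum>x\<in>{x\<in>?Xs. q J x = s}. \<Sum>k\<in>?Bn. (cmod (ip ?Bn h (u x k)))\<^sup>2)
     = (\<Sum>k\<in>?Bn. tL ?T (lam J) s k * (cmod (ip ?Bn (tE ?T (e J) s k) h))\<^sup>2)"
    if J: "J \<subseteq> M - {j}" and s: "s \<in> PiE ?T (\<lambda>_. tups (M - J) N)" for J s h
  proof -
    let ?W = "\<lambda>b b'. \<Sum>x\<in>{x\<in>?Xs. q J x = s}. prod_op n w x M b b'"
    have W: "?W b b' = (\<Sum>k\<in>?Bn. complex_of_real (tL ?T (lam J) s k) * tE ?T (e J) s k b * cnj (tE ?T (e J) s k b'))"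
      if b: "b\<in>?Bn" "b'\<in>?Bn" for b b'
    proof -
      have "?W b b' = (\<Sum>x\<in>?Xs. if (\<forall>t\<in>?T. restrict (colm n M x t) (M - J) = s t) then \<Prod>t<n. w (colm n M x t) (b t) (b' t) else 0)"
      proof (rule sum.mono_neutral_cong_left[OF fX])
        show "\<forall>x\<in>?Xs - {x\<in>?Xs. q J x = s}. (if (\<forall>t\<in>?T. restrict (colm n M x t) (M - J) = s t) then \<Prod>t<n. w (colm n M x t) (b t) (b' t) else 0) = 0"
        proof
          fix x assume x: "x \<in> ?Xs - {x\<in>?Xs. q J x = s}"
          have "\<not> (\<forall>t\<in>?T. restrict (colm n M x t) (M - J) = s t)"
          proof
            assume a: "\<forall>t\<in>?T. restrict (colm n M x t) (M - J) = s t"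
            have "q J x = s"
            proof (rule PiE_ext[OF qm s])
              show "x \<in> ?Xs" using x by simp
              fix t assume "t\<in>?T"
              then show "q J x t = s t" using bspec[OF a, of t] by (simp add: q_def colm_apply restrict_restrict) (metis Diff_subset inf.absorb_iff2)
            qed
            then show False using x by simp
          qed
          then show "(if (\<forall>t\<in>?T. restrict (colm n M x t) (M - J) = s t) then \<Prod>t<n. w (colm n M x t) (b t) (b' t) else 0) = 0" by (simp only: if_False)
        qed
        fix x assume x: "x \<in> {x\<in>?Xs. q J x = s}"
        have "restrict (colm n M x t) (M - J) = s t" if "t\<in>?T" for t
          using x that by (auto simp: q_def colm_def restrict_def)
        then show "prod_op n w x M b b' = (if (\<forall>t\<in>?T. restrict (colm n M x t) (M - J) = s t) then \<Prod>t<n. w (colm n M x t) (b t) (b' t) else 0)"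
          by (simp add: prod_op_def colm_apply)
      qed auto
      also have "\<dots> = (\<Sum>r\<in>PiE ?T (\<lambda>_. tups M N). if (\<forall>t\<in>?T. restrict (r t) (M - J) = s t) then \<Prod>t<n. w (r t) (b t) (b' t) else 0)"
        by (rule sum_colm[symmetric])
      also have "\<dots> = (\<Sum>r\<in>PiE ?T (\<lambda>t. {y\<in>tups M N. restrict y (M - J) = s t}). \<Prod>t<n. w (r t) (b t) (b' t))"
      proof (rule sum.mono_neutral_cong_right)
        show "finite (PiE ?T (\<lambda>_. tups M N))" using fY[of "{}"] by (intro finite_PiE) auto
        show "PiE ?T (\<lambda>t. {y\<in>tups M N. restrict y (M - J) = s t}) \<subseteq> PiE ?T (\<lambda>_. tups M N)" by (rule PiE_mono) auto
        show "\<forall>r\<in>PiE ?T (\<lambda>_. tups M N) - PiE ?T (\<lambda>t. {y\<in>tups M N. restrict y (M - J) = s t}).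
          (if (\<forall>t\<in>?T. restrict (r t) (M - J) = s t) then \<Prod>t<n. w (r t) (b t) (b' t) else 0) = 0"
          by (auto simp: PiE_iff)
      qed (auto simp: PiE_iff)
      also have "\<dots> = (\<Prod>t<n. marg_op (tups M N) (M - J) w (s t) (b t) (b' t))"
        unfolding marg_op_def by (rule sum_PiE_prod[OF fT]) (use fY[of "{}"] in auto)
      also have "\<dots> = (\<Sum>k\<in>?Bn. complex_of_real (tL ?T (lam J) s k) * tE ?T (e J) s k b * cnj (tE ?T (e J) s k b'))"
      proof (rule tE_spectral[OF fT fB b])
        fix t b b' assume "t\<in>?T" "b\<in>B" "b'\<in>B"
        then show "marg_op (tups M N) (M - J) w (s t) b b' = (\<Sum>k\<in>B. complex_of_real (lam J (s t) k) * e J (s t) k b * cnj (e J (s t) k b'))"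
          using s by (intro spectral_eq[OF sp[OF J]]) auto
      qed
      finally show ?thesis .
    qed
    have "complex_of_real (\<Sum>x\<in>{x\<in>?Xs. q J x = s}. \<Sum>k\<in>?Bn. (cmod (ip ?Bn h (u x k)))\<^sup>2) = ip ?Bn h (mv ?Bn ?W h)"
    proof -
      have "ip ?Bn h (mv ?Bn ?W h) = of_real (\<Sum>p\<in>{x\<in>?Xs. q J x = s} \<times> ?Bn. (cmod (ip ?Bn (u (fst p) (snd p)) h))\<^sup>2)"
        by (rule gram_qf) (use gram in \<open>simp add: sum.cartesian_product'\<close>)
      moreover have "cmod (ip ?Bn (u x k) h) = cmod (ip ?Bn h (u x k))" for x k using ip_cnj complex_mod_cnj by metis
      ultimately show ?thesis by (simp add: sum.cartesian_product')
    qed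
    also have "\<dots> = (\<Sum>k\<in>?Bn. complex_of_real (tL ?T (lam J) s k) * ip ?Bn h (tE ?T (e J) s k) * ip ?Bn (tE ?T (e J) s k) h)"
      by (rule spectral_qf[OF fBn]) (use onn[OF J s] W in \<open>simp add: spectral_def onf_def ip_def\<close>)
    also have "\<dots> = complex_of_real (\<Sum>k\<in>?Bn. tL ?T (lam J) s k * (cmod (ip ?Bn (tE ?T (e J) s k) h))\<^sup>2)"
      unfolding of_real_sum
    proof (rule sum.cong[OF refl])
      fix k
      have "ip ?Bn h (tE ?T (e J) s k) * ip ?Bn (tE ?T (e J) s k) h = of_real ((cmod (ip ?Bn (tE ?T (e J) s k) h))\<^sup>2)"
        unfolding complex_norm_square ip_cnj by simp
      then show "complex_of_real (tL ?T (lam J) s k) * ip ?Bn h (tE ?T (e J) s k) * ip ?Bn (tE ?T (e J) s k) h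
        = complex_of_real (tL ?T (lam J) s k * (cmod (ip ?Bn (tE ?T (e J) s k) h))\<^sup>2)" by (simp add: mult.assoc)
    qed
    finally show ?thesis using of_real_eq_iff by blast
  qed
  define \<epsilon> where "\<epsilon> = (\<Sum>J\<in>insert {} Js. V J) / (n * dt\<^sup>2)"
  have V0: "V J \<ge> 0" if "J \<subseteq> M - {j}" for J unfolding V_def info_var_def using l0[OF that] by (auto intro!: sum_nonneg)
  have err: "(\<Sum>s\<in>PiE ?T (\<lambda>_. tups (M - J) N). \<Sum>k\<in>?Bn - tK ?T (tups (M - J) N) B (lam J) dt s. tL ?T (lam J) s k) \<le> \<epsilon>" if J: "J \<in> insert {} Js" for J
  proof -
    have J': "J \<subseteq> M - {j}" using J JsD by auto
    have "(\<Sum>s\<in>PiE ?T (\<lambda>_. tups (M - J) N). \<Sum>k\<in>?Bn - tK ?T (tups (M - J) N) B (lam J) dt s. tL ?T (lam J) s k)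
       \<le> V J / (card ?T * dt\<^sup>2)"
      unfolding V_def by (rule tK_error[OF fT fY fB l0[OF J'] l1[OF J'] Tne dt])
    also have "\<dots> \<le> \<epsilon>" unfolding \<epsilon>_def card_lessThan
    proof (rule divide_right_mono)
      show "V J \<le> (\<Sum>J\<in>insert {} Js. V J)" using J V0 JsD fJs by (intro member_le_sum) auto
    qed simp
    finally show ?thesis .
  qed
  \<comment> \<open>With h an atypical eigenvector, \<open>KI\<close> turns the rejected weight into
    the total atypical eigenvalue mass.\<close>
  have errJ: "(\<Sum>x\<in>?Xs. \<Sum>i\<in>?Bn. nsq ?Bn (\<lambda>b. u x i b - prj ?Bn (KK J x) (EE J x) (u x i) b)) \<le> \<epsilon>" if J: "J \<in> insert {} Js" for J
  proof -
    have J': "J \<subseteq> M - {j}" using J JsD by auto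
    let ?Yn = "PiE ?T (\<lambda>_. tups (M - J) N)"
    have "(\<Sum>x\<in>?Xs. \<Sum>i\<in>?Bn. nsq ?Bn (\<lambda>b. u x i b - prj ?Bn (KK J x) (EE J x) (u x i) b))
      = (\<Sum>x\<in>?Xs. \<Sum>i\<in>?Bn. \<Sum>k\<in>?Bn - KK J x. (cmod (ip ?Bn (EE J x k) (u x i)))\<^sup>2)"
      using nsq_diff_prj_complete[OF onEE[OF J'] fBn KB] by (intro sum.cong refl) auto
    also have "\<dots> = (\<Sum>s\<in>?Yn. \<Sum>x\<in>{x\<in>?Xs. q J x = s}. \<Sum>i\<in>?Bn. \<Sum>k\<in>?Bn - KK J x. (cmod (ip ?Bn (EE J x k) (u x i)))\<^sup>2)"
      by (rule sum.group[OF fX _ image_subsetI[OF qm], symmetric]) (use fY in \<open>auto intro!: finite_PiE\<close>)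
    also have "\<dots> = (\<Sum>s\<in>?Yn. \<Sum>k\<in>?Bn - tK ?T (tups (M - J) N) B (lam J) dt s. tL ?T (lam J) s k)"
    proof (rule sum.cong[OF refl])
      fix s assume s: "s \<in> ?Yn"
      let ?K = "?Bn - tK ?T (tups (M - J) N) B (lam J) dt s"
      have "(\<Sum>x\<in>{x\<in>?Xs. q J x = s}. \<Sum>i\<in>?Bn. \<Sum>k\<in>?Bn - KK J x. (cmod (ip ?Bn (EE J x k) (u x i)))\<^sup>2)
        = (\<Sum>x\<in>{x\<in>?Xs. q J x = s}. \<Sum>i\<in>?Bn. \<Sum>k\<in>?K. (cmod (ip ?Bn (tE ?T (e J) s k) (u x i)))\<^sup>2)"
        by (intro sum.cong refl) (auto simp: KK_def EE_def)
      also have "\<dots> = (\<Sum>k\<in>?K. \<Sum>x\<in>{x\<in>?Xs. q J x = s}. \<Sum>i\<in>?Bn. (cmod (ip ?Bn (tE ?T (e J) s k) (u x i)))\<^sup>2)"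
        by (simp add: sum.swap[of _ ?K])
      also have "\<dots> = (\<Sum>k\<in>?K. tL ?T (lam J) s k)"
      proof (rule sum.cong[OF refl])
        fix k assume k: "k\<in>?K"
        have "(\<Sum>x\<in>{x\<in>?Xs. q J x = s}. \<Sum>i\<in>?Bn. (cmod (ip ?Bn (tE ?T (e J) s k) (u x i)))\<^sup>2)
          = (\<Sum>k'\<in>?Bn. tL ?T (lam J) s k' * (cmod (ip ?Bn (tE ?T (e J) s k') (tE ?T (e J) s k)))\<^sup>2)" by (rule KI[OF J' s])
        also have "\<dots> = (\<Sum>k'\<in>?Bn. if k' = k then tL ?T (lam J) s k else 0)"
          using onfD[OF onn[OF J' s]] k by (intro sum.cong refl) auto
        also have "\<dots> = tL ?T (lam J) s k" using k fBn by simp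
        finally show "(\<Sum>x\<in>{x\<in>?Xs. q J x = s}. \<Sum>i\<in>?Bn. (cmod (ip ?Bn (tE ?T (e J) s k) (u x i)))\<^sup>2) = tL ?T (lam J) s k" .
      qed
      finally show "(\<Sum>x\<in>{x\<in>?Xs. q J x = s}. \<Sum>i\<in>?Bn. \<Sum>k\<in>?Bn - KK J x. (cmod (ip ?Bn (EE J x k) (u x i)))\<^sup>2) = (\<Sum>k\<in>?K. tL ?T (lam J) s k)" .
    qed
    also have "\<dots> \<le> \<epsilon>" by (rule err[OF J])
    finally show ?thesis .
  qed
  define \<mu> where "\<mu> = (\<lambda>J. 2 powr (- (n * (S J - dt))))"
  have mu: "(\<Sum>x\<in>{x\<in>?Xs. diffset x x' = J}. \<Sum>i\<in>?Bn. (cmod (ip ?Bn h (prj ?Bn (KK J x) (EE J x) (u x i))))\<^sup>2) \<le> \<mu> J * nsq ?Bn h"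
    if J: "J\<in>Js" and x': "x'\<in>?Xs" for J x' h
  proof -
    \<comment> \<open>All competitors share the projection for J, so it can be moved onto h.
      Enlarging the sum to every tuple with the same letters off J makes \<open>KI\<close>
      applicable.\<close>
    let ?s = "q J x'" and ?h = "prj ?Bn (KK J x') (EE J x') h"
    have qx: "q J x = ?s" if "diffset x x' = J" for x
      using that unfolding q_def colm_def diffset_def by (auto simp: restrict_def fun_eq_iff)
    have "(\<Sum>x\<in>{x\<in>?Xs. diffset x x' = J}. \<Sum>i\<in>?Bn. (cmod (ip ?Bn h (prj ?Bn (KK J x) (EE J x) (u x i))))\<^sup>2)
      = (\<Sum>x\<in>{x\<in>?Xs. diffset x x' = J}. \<Sum>i\<in>?Bn. (cmod (ip ?Bn ?h (u x i)))\<^sup>2)"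
      by (intro sum.cong refl) (auto simp: KK_def EE_def qx prj_sa)
    also have "\<dots> \<le> (\<Sum>x\<in>{x\<in>?Xs. q J x = ?s}. \<Sum>i\<in>?Bn. (cmod (ip ?Bn ?h (u x i)))\<^sup>2)"
      using fX qx by (intro sum_mono2) (auto intro: sum_nonneg)
    also have "\<dots> = (\<Sum>k\<in>?Bn. tL ?T (lam J) ?s k * (cmod (ip ?Bn (tE ?T (e J) ?s k) ?h))\<^sup>2)" by (rule KI[OF JsD[OF J] qm[OF x']])
    also have "\<dots> = (\<Sum>k\<in>KK J x'. tL ?T (lam J) ?s k * (cmod (ip ?Bn (EE J x' k) h))\<^sup>2)"
    proof (rule sum.mono_neutral_cong_right[OF fBn KB])
      show "\<forall>k\<in>?Bn - KK J x'. tL ?T (lam J) ?s k * (cmod (ip ?Bn (tE ?T (e J) ?s k) ?h))\<^sup>2 = 0"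
      proof
        fix k assume k: "k \<in> ?Bn - KK J x'"
        have "ip ?Bn (EE J x' k) ?h = (\<Sum>k'\<in>KK J x'. ip ?Bn (EE J x' k) (EE J x' k') * ip ?Bn (EE J x' k') h)" by (rule ip_prj_right)
        also have "\<dots> = 0" using onfD[OF onEE[OF JsD[OF J] x']] k KB by (intro sum.neutral) (auto simp: subset_iff)
        finally show "tL ?T (lam J) ?s k * (cmod (ip ?Bn (tE ?T (e J) ?s k) ?h))\<^sup>2 = 0" by (simp add: EE_def)
      qed
      fix k assume k: "k \<in> KK J x'"
      show "tL ?T (lam J) ?s k * (cmod (ip ?Bn (tE ?T (e J) ?s k) ?h))\<^sup>2 = tL ?T (lam J) ?s k * (cmod (ip ?Bn (EE J x' k) h))\<^sup>2"
        using ip_prj[OF onKK[OF JsD[OF J] x'] k] by (simp add: EE_def)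
    qed
    also have "\<dots> \<le> (\<Sum>k\<in>KK J x'. \<mu> J * (cmod (ip ?Bn (EE J x' k) h))\<^sup>2)"
    proof (intro sum_mono mult_right_mono)
      fix k assume "k \<in> KK J x'"
      then show "tL ?T (lam J) ?s k \<le> \<mu> J" unfolding \<mu>_def S_def KK_def
        using tK_le[OF fT fY fB l0[OF JsD[OF J]] l1[OF JsD[OF J]]] by fastforce
    qed simp
    also have "\<dots> \<le> \<mu> J * nsq ?Bn h" unfolding sum_distrib_left[symmetric]
      by (intro mult_left_mono bessel onKK[OF JsD[OF J] x']) (simp add: \<mu>_def)
    finally show ?thesis .
  qed
  have dep: "KK J x = KK J x' \<and> EE J x = EE J x'" if "diffset x x' \<subseteq> J" for J x x'
  proof -
    have "q J x = q J x'" using that unfolding q_def colm_def diffset_def by (auto simp: restrict_def fun_eq_iff)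
    then show ?thesis by (simp add: KK_def EE_def)
  qed
  have Jf: "finite J \<and> card J \<le> card M" if "J\<in>Js" for J
    using JsD[OF that] fM by (meson Diff_subset card_mono finite_subset subset_trans)
  let ?A = "anc Js ?Xs"
  define ax :: "(nat \<Rightarrow> nat \<Rightarrow> nat) \<Rightarrow> (nat set \<times> (nat \<Rightarrow> nat \<Rightarrow> nat)) option \<Rightarrow> complex" where "ax = (\<lambda>x. tilt d None (lab x ` Js))"
  let ?N = "1 + d\<^sup>2 * c"
  let ?c1 = "8 * ?N + 2 * (?N * (1 + c) ^ card M / d)\<^sup>2 * c\<^sup>2"
  let ?BA = "?Bn \<times> ?A"
  have cJ: "c = real (card Js)" by (simp add: c_def Js_def)
  have mu0: "\<mu> J \<ge> 0" for J by (simp add: \<mu>_def)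
  have "\<exists>KT eT. (\<forall>x\<in>?Xs. onf ?BA (KT x) (eT x))
    \<and> (\<Sum>x\<in>?Xs. \<Sum>i\<in>?Bn. nsq ?BA (\<lambda>p. tens (u x i) (ax x) p - prj ?BA (KT x :: (nat \<Rightarrow> 'c) set) (eT x) (tens (u x i) (ax x)) p)) \<le> ?c1 * \<epsilon>
    \<and> (\<forall>x'\<in>?Xs. \<forall>J\<in>Js. (\<Sum>x\<in>{x\<in>?Xs. diffset x x' = J}. \<Sum>i\<in>?Bn. nsq ?BA (prj ?BA (KT x') (eT x') (tens (u x i) (ax x)))) \<le> card (KK {} x') * \<mu> J * ?N)"
    unfolding ax_def cJ
  proof (rule simultaneous_tests[OF fX fBn fBn fJs _ _ _ _ _ _ mu _ d])
    fix J assume "J\<in>Js" then show "finite J \<and> card J \<le> card M" by (rule Jf)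
  next
    fix x assume "x\<in>?Xs" then show "onf ?Bn (KK {} x) (EE {} x)" by (rule onKK[OF E0])
  next
    fix J x assume "J\<in>Js" "x\<in>?Xs" then show "onf ?Bn (KK J x) (EE J x)" using onKK[OF JsD] by blast
  next
    fix J x x' assume "x \<in> ?Xs" "x' \<in> ?Xs" "diffset x x' \<subseteq> J" then show "KK J x = KK J x' \<and> EE J x = EE J x'" by (intro dep)
  next
    show "(\<Sum>x\<in>?Xs. \<Sum>i\<in>?Bn. nsq ?Bn (\<lambda>b. u x i b - prj ?Bn (KK {} x) (EE {} x) (u x i) b)) \<le> \<epsilon>" by (rule errJ) simp
  next
    fix J assume "J\<in>Js"
    then show "(\<Sum>x\<in>?Xs. \<Sum>i\<in>?Bn. nsq ?Bn (\<lambda>b. u x i b - prj ?Bn (KK J x) (EE J x) (u x i) b)) \<le> \<epsilon>" by (intro errJ) simp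
  qed (simp_all add: mu0)
  then obtain KT :: "(nat \<Rightarrow> nat \<Rightarrow> nat) \<Rightarrow> (nat \<Rightarrow> 'c) set" and eT where TT: "\<forall>x\<in>?Xs. onf ?BA (KT x) (eT x)"
    and T2: "(\<Sum>x\<in>?Xs. \<Sum>i\<in>?Bn. nsq ?BA (\<lambda>p. tens (u x i) (ax x) p - prj ?BA (KT x) (eT x) (tens (u x i) (ax x)) p)) \<le> ?c1 * \<epsilon>"
    and T3: "\<forall>x'\<in>?Xs. \<forall>J\<in>Js. (\<Sum>x\<in>{x\<in>?Xs. diffset x x' = J}. \<Sum>i\<in>?Bn. nsq ?BA (prj ?BA (KT x') (eT x') (tens (u x i) (ax x)))) \<le> card (KK {} x') * \<mu> J * ?N"
    by (elim exE conjE) (rule that)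
  have tot: "(\<Sum>x\<in>?Xs. \<Sum>i\<in>?Bn. nsq ?Bn (u x i)) = 1"
  proof -
    have "(\<Sum>x\<in>?Xs. \<Sum>i\<in>?Bn. nsq ?Bn (u x i)) = (\<Sum>x\<in>?Xs. \<Sum>i\<in>?Bn. tL ?T (lam {}) (colm n M x) i)"
      using LL0 nsq_onf[OF onEE[OF E0]] by (intro sum.cong refl) (simp add: u_def nsq_scale LL_def q_def)
    also have "\<dots> = (\<Sum>s\<in>PiE ?T (\<lambda>_. tups M N). \<Sum>i\<in>?Bn. tL ?T (lam {}) s i)" by (rule sum_colm[symmetric])
    also have "\<dots> = 1" using tL_total[OF fT fY[of "{}"] fB l0[OF E0] l1[OF E0]] by simp
    finally show ?thesis .
  qed
  define G where "G = (\<lambda>f. \<Sum>x\<in>?Xs. \<Sum>i\<in>?Bn. nsq ?BA (\<lambda>p. tens (u x i) (ax x) p - prj ?BA (KT x) (eT x) (tens (u x i) (ax x)) p)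
          + (\<Sum>y\<in>{y\<in>?Xs. (y j, bins M f y) = (x j, bins M f x)} - {x}. nsq ?BA (prj ?BA (KT y) (eT y) (tens (u x i) (ax x)))))"
  define Q where "Q = (\<lambda>y x. \<Sum>i\<in>?Bn. nsq ?BA (prj ?BA (KT y) (eT y) (tens (u x i) (ax x))))"
  have G0: "G f \<ge> 0" for f by (simp add: G_def sum_nonneg)
  \<comment> \<open>Competitors in the class of x have the same word for j and differ from x, so
    their difference set is a nonempty subset of M - {j}, and they collide with x in every
    bin.\<close>
  have GQ: "G f = (\<Sum>x\<in>?Xs. \<Sum>i\<in>?Bn. nsq ?BA (\<lambda>p. tens (u x i) (ax x) p - prj ?BA (KT x) (eT x) (tens (u x i) (ax x)) p))
     + (\<Sum>y\<in>?Xs. \<Sum>x\<in>?Xs. if diffset x y \<in> Js then (if \<forall>i\<in>M. f i (x i) = f i (y i) then Q y x else 0) else 0)" for f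
  proof -
    have "(\<Sum>x\<in>?Xs. \<Sum>i\<in>?Bn. \<Sum>y\<in>{y\<in>?Xs. (y j, bins M f y) = (x j, bins M f x)} - {x}. nsq ?BA (prj ?BA (KT y) (eT y) (tens (u x i) (ax x))))
      = (\<Sum>x\<in>?Xs. \<Sum>y\<in>{y\<in>?Xs. (y j, bins M f y) = (x j, bins M f x)} - {x}. Q y x)"
      unfolding Q_def by (intro sum.cong refl sum.swap)
    also have "\<dots> = (\<Sum>x\<in>?Xs. \<Sum>y\<in>?Xs. if diffset x y \<in> Js then (if \<forall>i\<in>M. f i (x i) = f i (y i) then Q y x else 0) else 0)"
    proof (rule sum.cong[OF refl])
      fix x assume x: "x\<in>?Xs"
      have eq: "y \<in> {y\<in>?Xs. (y j, bins M f y) = (x j, bins M f x)} - {x} \<longleftrightarrow> diffset x y \<in> Js \<and> (\<forall>i\<in>M. f i (x i) = f i (y i))" if y: "y\<in>?Xs" for y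
      proof -
        have sub: "diffset x y \<subseteq> M" using x y PiE_arb[of x M] PiE_arb[of y M] unfolding srcs_def diffset_def by force
        have "bins M f y = bins M f x \<longleftrightarrow> (\<forall>i\<in>M. f i (x i) = f i (y i))" by (auto simp: bins_def fun_eq_iff restrict_def)
        moreover have "y = x \<longleftrightarrow> diffset x y = {}" by (auto simp: diffset_def fun_eq_iff)
        moreover have "y j = x j \<longleftrightarrow> j \<notin> diffset x y" by (auto simp: diffset_def)
        ultimately show ?thesis using sub y by (auto simp: Js_def)
      qed
      show "(\<Sum>y\<in>{y\<in>?Xs. (y j, bins M f y) = (x j, bins M f x)} - {x}. Q y x) = (\<Sum>y\<in>?Xs. if diffset x y \<in> Js then (if \<forall>i\<in>M. f i (x i) = f i (y i) then Q y x else 0) else 0)"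
        using eq fX by (intro sum.mono_neutral_cong_left) auto
    qed
    also have "\<dots> = (\<Sum>y\<in>?Xs. \<Sum>x\<in>?Xs. if diffset x y \<in> Js then (if \<forall>i\<in>M. f i (x i) = f i (y i) then Q y x else 0) else 0)" by (rule sum.swap)
    finally show ?thesis by (simp add: G_def sum.distrib)
  qed
  have avg: "(\<Sum>f\<in>?Fs. G f) \<le> real (card ?Fs) * (?c1 * \<epsilon> + ?N * (\<Sum>J\<in>Js. \<mu> J * 2 powr (n * (S {} + dt)) / (\<Prod>i\<in>J. real (Mb i))))"
  proof -
    have Mbp: "(\<Prod>i\<in>J. real (Mb i)) > 0" if "J \<in> Js" for J using JsD[OF that] Mb by (intro prod_pos) fastforce
    have col: "(\<Sum>f\<in>?Fs. if \<forall>i\<in>M. f i (x i) = f i (y i) then Q y x else 0) = real (card ?Fs) * (Q y x / (\<Prod>i\<in>diffset x y. real (Mb i)))"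
      if x: "x\<in>?Xs" "y\<in>?Xs" "diffset x y \<in> Js" for x y
    proof -
      have "(\<Sum>f\<in>?Fs. if \<forall>i\<in>M. f i (x i) = f i (y i) then Q y x else 0) = (\<Sum>f\<in>?Fs. if \<forall>i\<in>M. f i (x i) = f i (y i) then 1 else 0) * Q y x"
        unfolding sum_distrib_right by (intro sum.cong refl) auto
      moreover have "(\<Sum>f\<in>?Fs. if \<forall>i\<in>M. f i (x i) = f i (y i) then 1 else 0) * (\<Prod>i\<in>diffset x y. real (Mb i)) = real (card ?Fs)"
        unfolding binset_def by (rule collision_count[OF fM _ Mb]) (use x in \<open>auto simp: srcs_def intro!: finite_PiE\<close>)
      ultimately show ?thesis using Mbp[OF x(3)] by (simp add: field_simps)
    qed
    have "(\<Sum>f\<in>?Fs. \<Sum>y\<in>?Xs. \<Sum>x\<in>?Xs. if diffset x y \<in> Js then (if \<forall>i\<in>M. f i (x i) = f i (y i) then Q y x else 0) else 0)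
       = (\<Sum>y\<in>?Xs. \<Sum>x\<in>?Xs. \<Sum>f\<in>?Fs. if diffset x y \<in> Js then (if \<forall>i\<in>M. f i (x i) = f i (y i) then Q y x else 0) else 0)"
      by (rule sum_swap2)
    also have "\<dots> = (\<Sum>y\<in>?Xs. \<Sum>x\<in>?Xs. if diffset x y \<in> Js then real (card ?Fs) * (Q y x / (\<Prod>i\<in>diffset x y. real (Mb i))) else 0)"
      using col by (intro sum.cong refl) auto
    also have "\<dots> = (\<Sum>y\<in>?Xs. \<Sum>x\<in>{x\<in>?Xs. diffset x y \<in> Js}. real (card ?Fs) * (Q y x / (\<Prod>i\<in>diffset x y. real (Mb i))))"
      by (rule sum.cong[OF refl], rule sum.inter_filter[OF fX, symmetric])
    also have "\<dots> = (\<Sum>y\<in>?Xs. \<Sum>J\<in>Js. \<Sum>x\<in>{x\<in>{x\<in>?Xs. diffset x y \<in> Js}. diffset x y = J}. real (card ?Fs) * (Q y x / (\<Prod>i\<in>diffset x y. real (Mb i))))"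
      by (intro sum.cong refl sum.group[symmetric]) (use fX fJs in auto)
    also have "\<dots> = (\<Sum>y\<in>?Xs. \<Sum>J\<in>Js. real (card ?Fs) / (\<Prod>i\<in>J. real (Mb i)) * (\<Sum>x\<in>{x\<in>?Xs. diffset x y = J}. Q y x))"
      unfolding sum_distrib_left by (intro sum.cong refl) auto
    also have "\<dots> \<le> (\<Sum>y\<in>?Xs. \<Sum>J\<in>Js. real (card ?Fs) / (\<Prod>i\<in>J. real (Mb i)) * (card (KK {} y) * \<mu> J * ?N))"
      using T3 Mbp unfolding Q_def by (intro sum_mono mult_left_mono) (auto intro!: divide_nonneg_pos)
    also have "\<dots> = (\<Sum>J\<in>Js. (\<Sum>y\<in>?Xs. real (card (KK {} y))) * (real (card ?Fs) / (\<Prod>i\<in>J. real (Mb i)) * (\<mu> J * ?N)))"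
      unfolding sum_distrib_right by (subst sum.swap) (intro sum.cong refl, simp add: mult_ac)
    also have "\<dots> \<le> (\<Sum>J\<in>Js. 2 powr (n * (S {} + dt)) * (real (card ?Fs) / (\<Prod>i\<in>J. real (Mb i)) * (\<mu> J * ?N)))"
    proof (intro sum_mono mult_right_mono)
      \<comment> \<open>Summed over the tested tuples, the test dimensions count typical pairs,
        which gives the exponent S {}.\<close>
      have "(\<Sum>y\<in>?Xs. real (card (KK {} y))) = (\<Sum>s\<in>PiE ?T (\<lambda>_. tups M N). real (card (tK ?T (tups M N) B (lam {}) dt s)))"
        unfolding sum_colm by (simp add: KK_def q_def)
      also have "\<dots> \<le> 2 powr (n * (S {} + dt))"
        using tK_card[OF fT fY[of "{}"] fB l0[OF E0] l1[OF E0], of dt] by (simp add: S_def)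
      finally show "(\<Sum>y\<in>?Xs. real (card (KK {} y))) \<le> 2 powr (n * (S {} + dt))" .
    next
      fix J assume "J\<in>Js"
      then show "0 \<le> real (card ?Fs) / (\<Prod>i\<in>J. real (Mb i)) * (\<mu> J * ?N)"
        using Mbp[of J] by (intro mult_nonneg_nonneg divide_nonneg_pos) (auto simp: \<mu>_def cJ)
    qed
    also have "\<dots> = real (card ?Fs) * (?N * (\<Sum>J\<in>Js. \<mu> J * 2 powr (n * (S {} + dt)) / (\<Prod>i\<in>J. real (Mb i))))"
      unfolding sum_distrib_left by (intro sum.cong refl) (simp add: mult_ac)
    finally have b2: "(\<Sum>f\<in>?Fs. \<Sum>y\<in>?Xs. \<Sum>x\<in>?Xs. if diffset x y \<in> Js then (if \<forall>i\<in>M. f i (x i) = f i (y i) then Q y x else 0) else 0)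
       \<le> real (card ?Fs) * (?N * (\<Sum>J\<in>Js. \<mu> J * 2 powr (n * (S {} + dt)) / (\<Prod>i\<in>J. real (Mb i))))" .
    have "(\<Sum>f\<in>?Fs. (\<Sum>x\<in>?Xs. \<Sum>i\<in>?Bn. nsq ?BA (\<lambda>p. tens (u x i) (ax x) p - prj ?BA (KT x) (eT x) (tens (u x i) (ax x)) p))) \<le> real (card ?Fs) * (?c1 * \<epsilon>)"
      using T2 by (simp add: mult_left_mono)
    then show ?thesis using b2 unfolding GQ sum.distrib distrib_left by linarith
  qed
  have ax1: "nm ?A (ax x) \<ge> 1" and ax2: "nm ?A (\<lambda>\<alpha>. ax x \<alpha> - kd None \<alpha>) \<le> d * sqrt c" if x: "x\<in>?Xs" for x
  proof -
    have fA: "finite ?A" using fJs fX by (simp add: anc_def)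
    have lA: "lab x ` Js \<subseteq> ?A" using x by (auto simp: anc_def lab_def)
    have lz: "None \<notin> lab x ` Js" by (auto simp: lab_def)
    have cL: "card (lab x ` Js) = card Js" by (intro card_image) (auto simp: inj_on_def lab_def)
    have n1: "nsq ?A (ax x) = 1 + d\<^sup>2 * c" unfolding ax_def using nsq_tilt[OF fA _ lA lz] by (simp add: cL cJ anc_def)
    then show "nm ?A (ax x) \<ge> 1" by (simp add: nm_def cJ)
    have "nsq ?A (\<lambda>\<alpha>. ax x \<alpha> - kd None \<alpha>) = (\<Sum>\<alpha>\<in>lab x ` Js. (cmod (ax x \<alpha> - kd None \<alpha>))\<^sup>2)"
      unfolding nsq_def using fA lA by (intro sum.mono_neutral_right) (auto simp: ax_def tilt_def kd_def)
    also have "\<dots> = (\<Sum>\<alpha>\<in>lab x ` Js. d\<^sup>2)" using lz by (intro sum.cong refl) (auto simp: lab_def ax_def tilt_def kd_def)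
    also have "\<dots> = c * d\<^sup>2" by (simp add: cL cJ)
    finally show "nm ?A (\<lambda>\<alpha>. ax x \<alpha> - kd None \<alpha>) \<le> d * sqrt c" using d by (simp add: nm_def real_sqrt_mult mult.commute)
  qed
  have fA: "finite ?A" "None \<in> ?A" using fJs fX by (auto simp: anc_def)
  have dec: "\<exists>Lam Rm. bin_decoder M N n j B w f (2 * sqrt (G f) + 2 * (d * sqrt c)) Lam Rm" for f
  proof -
    have "\<exists>Lam Rm. (\<forall>cl x. psd ?Bn (Lam cl x)) \<and> (\<forall>cl. psd ?Bn (Rm cl)) \<and>
      (\<forall>cl. \<forall>b\<in>?Bn. \<forall>b'\<in>?Bn. (\<Sum>x\<in>{x\<in>?Xs. (x j, bins M f x) = cl}. Lam cl x b b') + Rm cl b b' = (if b = b' then 1 else 0))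
      \<and> (\<Sum>x\<in>?Xs. \<Sum>i\<in>?Bn. nsq ?Bn (u x i) - Re (ip ?Bn (u x i) (mv ?Bn (Lam (x j, bins M f x) x) (u x i)))) \<le> 2 * sqrt (G f) + 2 * (d * sqrt c)"
      unfolding G_def
      by (rule decoder_exists[where KT=KT and eT=eT and ax=ax, OF fX fBn fA fBn _ ax1 ax2 tot]) (use TT in auto)
    then obtain Lam Rm where L: "\<forall>cl x. psd ?Bn (Lam cl x)" "\<forall>cl. psd ?Bn (Rm cl)"
      "\<forall>cl. \<forall>b\<in>?Bn. \<forall>b'\<in>?Bn. (\<Sum>x\<in>{x\<in>?Xs. (x j, bins M f x) = cl}. Lam cl x b b') + Rm cl b b' = (if b = b' then 1 else 0)"
      and Le: "(\<Sum>x\<in>?Xs. \<Sum>i\<in>?Bn. nsq ?Bn (u x i) - Re (ip ?Bn (u x i) (mv ?Bn (Lam (x j, bins M f x) x) (u x i)))) \<le> 2 * sqrt (G f) + 2 * (d * sqrt c)"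
      by (elim exE conjE) (rule that)
    have tr: "(\<Sum>i\<in>?Bn. ip ?Bn (u x i) (mv ?Bn X (u x i))) = (\<Sum>b\<in>?Bn. \<Sum>b'\<in>?Bn. prod_op n w x M b' b * X b b')" if x: "x\<in>?Xs" for x X
    proof -
      have "(\<Sum>i\<in>?Bn. ip ?Bn (u x i) (mv ?Bn X (u x i))) = (\<Sum>i\<in>?Bn. \<Sum>b\<in>?Bn. \<Sum>b'\<in>?Bn. u x i b' * cnj (u x i b) * X b b')"
        unfolding qf_eq[symmetric] by (intro sum.cong refl) (simp add: mult_ac)
      also have "\<dots> = (\<Sum>b\<in>?Bn. \<Sum>b'\<in>?Bn. \<Sum>i\<in>?Bn. u x i b' * cnj (u x i b) * X b b')" by (rule sum_swap2)
      also have "\<dots> = (\<Sum>b\<in>?Bn. \<Sum>b'\<in>?Bn. prod_op n w x M b' b * X b b')"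
        unfolding sum_distrib_right[symmetric] using gram[OF x] by (intro sum.cong refl) auto
      finally show ?thesis .
    qed
    have "1 - (\<Sum>x\<in>?Xs. Re (\<Sum>b\<in>?Bn. \<Sum>b'\<in>?Bn. prod_op n w x M b' b * Lam (x j, bins M f x) x b b'))
      = (\<Sum>x\<in>?Xs. \<Sum>i\<in>?Bn. nsq ?Bn (u x i) - Re (ip ?Bn (u x i) (mv ?Bn (Lam (x j, bins M f x) x) (u x i))))"
      unfolding sum_subtractf tot Re_sum[symmetric] using tr by simp
    then show ?thesis unfolding bin_decoder_def using L Le by (intro exI[of _ Lam] exI[of _ Rm]) simp
  qed
  show ?thesis
    by (rule exI[of _ G]) (use G0 avg dec in \<open>simp add: \<epsilon>_def \<mu>_def\<close>)
qed

lemma spectral_onfI: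
  assumes "onf B B e" "\<And>x y. x\<in>B \<Longrightarrow> y\<in>B \<Longrightarrow> X x y = (\<Sum>i\<in>B. complex_of_real (lam i) * e i x * cnj (e i y))"
  shows "spectral B X lam e"
  using assms by (simp add: spectral_def onf_def ip_def)

section \<open>Asymptotics of decoding and hashing\<close>

definition floor_pow :: "real \<Rightarrow> nat" where "floor_pow y = nat \<lfloor>2 powr y\<rfloor>"

lemma floor_pow_le: "real (floor_pow y) \<le> 2 powr y"
  unfolding floor_pow_def by (simp add: of_nat_nat)

lemma floor_pow_ge: assumes "y \<ge> 0" shows "floor_pow y \<ge> 1" "real (floor_pow y) \<ge> 2 powr y / 2"
proof -
  have p: "(2::real) powr y \<ge> 1" using assms by (simp add: ge_one_powr_ge_zero)
  then have "\<lfloor>2 powr y\<rfloor> \<ge> 1" by simp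
  then show 1: "floor_pow y \<ge> 1" unfolding floor_pow_def by linarith
  have "real (floor_pow y) > 2 powr y - 1" unfolding floor_pow_def using p by (simp add: of_nat_nat)
  moreover have "real (floor_pow y) \<ge> 1" using 1 by simp
  ultimately show "real (floor_pow y) \<ge> 2 powr y / 2" by linarith
qed

lemma powr_decay: assumes "g > 0" shows "(\<lambda>n. 2 powr (- (real n * g))) \<longlonglongrightarrow> 0"
proof -
  have "(\<lambda>n. (2 powr (- g)) ^ n) \<longlonglongrightarrow> 0" using assms by (intro LIMSEQ_realpow_zero) (auto simp: powr_less_one)
  moreover have "(2 powr (- g)) ^ n = 2 powr (- (real n * g))" for n
    by (simp add: powr_realpow[symmetric] powr_powr mult.commute)
  ultimately show ?thesis by simp
qed

lemma over_n_tendsto: "(\<lambda>n. c / real n) \<longlonglongrightarrow> 0" for c :: real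
  using tendsto_mult_right_zero[OF lim_inverse_n, of c] by (simp add: divide_inverse)

lemma finite_gap: fixes g :: "'a \<Rightarrow> real"
  assumes "finite A" "\<And>a. a \<in> A \<Longrightarrow> g a > 0" shows "\<exists>\<delta>>0. \<forall>a\<in>A. \<delta> < g a"
proof (cases "A = {}")
  case False
  have "Min (g ` A) > 0" using assms False by simp
  then obtain \<delta> where "0 < \<delta>" "\<delta> < Min (g ` A)" using dense by blast
  then show ?thesis using assms False by auto
qed (auto intro: exI[of _ 1])

text \<open>The slack dt lies below half of every gap of a rate constraint, the tilt d is small
  enough for \<eta>, and then n grows: the constants depending on d multiply terms that
  vanish.\<close>

lemma decoder_asymp:
  fixes w :: "(nat \<Rightarrow> nat) \<Rightarrow> 'c op" and lam :: "nat set \<Rightarrow> (nat \<Rightarrow> nat) \<Rightarrow> 'c \<Rightarrow> real" and R :: "nat \<Rightarrow> real" and \<eta> :: real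
  assumes fM: "finite M" and jM: "j \<in> M" and fB: "finite B"
    and sp: "\<And>J y. J \<subseteq> M - {j} \<Longrightarrow> y \<in> tups (M - J) N \<Longrightarrow> spectral B (marg_op (tups M N) (M - J) w y) (lam J y) (e J y)"
    and l0: "\<And>J y k. J \<subseteq> M - {j} \<Longrightarrow> y \<in> tups (M - J) N \<Longrightarrow> k\<in>B \<Longrightarrow> lam J y k \<ge> 0"
    and l1: "\<And>J. J \<subseteq> M - {j} \<Longrightarrow> (\<Sum>y\<in>tups (M - J) N. \<Sum>k\<in>B. lam J y k) = 1"
    and R0: "\<And>i. i\<in>M \<Longrightarrow> R i \<ge> 0"
    and R: "\<And>J. J \<subseteq> M - {j} \<Longrightarrow> J \<noteq> {} \<Longrightarrow>
       (\<Sum>i\<in>J. R i) > shannon (tups (M - {}) N \<times> B) (case_prod (lam {})) - shannon (tups (M - J) N \<times> B) (case_prod (lam J))"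
    and eta: "\<eta> > 0"
  shows "\<forall>\<^sub>F n in sequentially. \<exists>G. (\<forall>f. G f \<ge> (0::real))
    \<and> (\<Sum>f\<in>binset M N n (\<lambda>i. floor_pow (n * R i)). G f) \<le> real (card (binset M N n (\<lambda>i. floor_pow (n * R i)))) * \<eta>
    \<and> (\<forall>f. \<exists>Lam Rm. bin_decoder M N n j B w f (2 * sqrt (G f) + \<eta>) Lam Rm)"
proof -
  let ?Js = "{J. J \<subseteq> M - {j} \<and> J \<noteq> {}}"
  let ?S = "\<lambda>J. shannon (tups (M - J) N \<times> B) (case_prod (lam J))"
  let ?V = "\<lambda>J. info_var (tups (M - J) N \<times> B) (case_prod (lam J))"
  define c where "c = real (card ?Js)"
  have fJs: "finite ?Js" using fM by simp
  define gap where "gap = (\<lambda>J. (\<Sum>i\<in>J. R i) - (?S {} - ?S J))"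
  have "\<exists>\<delta>>0. \<forall>J\<in>?Js. \<delta> < gap J / 2"
  proof (rule finite_gap[OF fJs])
    fix J assume "J \<in> ?Js"
    then have "?S {} - ?S J < (\<Sum>i\<in>J. R i)" by (intro R) auto
    then show "0 < gap J / 2" by (simp add: gap_def)
  qed
  then obtain dt where dt: "dt > 0" and dtg': "\<forall>J\<in>?Js. dt < gap J / 2" by blast
  have dtg: "2 * dt < gap J" if "J\<in>?Js" for J using bspec[OF dtg' that] by simp
  \<comment> \<open>Chosen so that \<open>2 * d * sqrt c + d = \<eta>\<close>. The summand 1 keeps
    the denominator positive when there is no other player and c = 0.\<close>
  define d where "d = \<eta> / (2 * sqrt c + 1)"
  have sc: "sqrt c \<ge> 0" by (simp add: c_def)
  have d: "d > 0" unfolding d_def by (rule divide_pos_pos[OF eta]) (use sc in linarith)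
  have dc: "2 * (d * sqrt c) \<le> \<eta>"
  proof -
    have "2 * sqrt c + 1 \<noteq> 0" using sc by linarith
    then have "d * (2 * sqrt c + 1) = \<eta>" by (simp add: d_def)
    then have "2 * (d * sqrt c) + d = \<eta>" by (simp add: algebra_simps)
    then show ?thesis using d by linarith
  qed
  let ?c1 = "8 * (1 + d\<^sup>2 * c) + 2 * ((1 + d\<^sup>2 * c) * (1 + c) ^ card M / d)\<^sup>2 * c\<^sup>2"
  let ?N = "1 + d\<^sup>2 * c"
  let ?v = "\<Sum>J\<in>insert {} ?Js. ?V J"
  \<comment> \<open>The factor 2 ^ card J undoes the rounding of the bin numbers, and 2 dt is the
    typicality slack of dimension and eigenvalue together.\<close>
  define bd where "bd = (\<lambda>n::nat. ?c1 * (?v / dt\<^sup>2 / n) + ?N * (\<Sum>J\<in>?Js. 2 ^ card J * 2 powr (- (n * (gap J - 2 * dt)))))"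
  have "bd \<longlonglongrightarrow> ?c1 * 0 + ?N * (\<Sum>J\<in>?Js. 2 ^ card J * 0)"
    unfolding bd_def using dtg by (intro tendsto_intros over_n_tendsto powr_decay) auto
  then have "bd \<longlonglongrightarrow> 0" by simp
  then have "\<forall>\<^sub>F n in sequentially. bd n < \<eta>" using eta by (rule order_tendstoD(2))
  then have "\<forall>\<^sub>F n in sequentially. bd n < \<eta> \<and> n \<ge> 1" using eventually_ge_at_top[of 1] by (rule eventually_conj)
  then show ?thesis
  proof (rule eventually_mono)
    fix n :: nat assume n: "bd n < \<eta> \<and> n \<ge> 1"
    let ?Mb = "\<lambda>i. floor_pow (n * R i)"
    have Mb: "?Mb i \<ge> 1" if "i\<in>M" for i using R0[OF that] by (intro floor_pow_ge) simp
    have "\<exists>G. (\<forall>f. G f \<ge> (0::real))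
      \<and> (\<Sum>f\<in>binset M N n ?Mb. G f) \<le> real (card (binset M N n ?Mb)) *
       (?c1 * (?v / (n * dt\<^sup>2)) + ?N * (\<Sum>J\<in>?Js. 2 powr (- (n * (?S J - dt))) * 2 powr (n * (?S {} + dt)) / (\<Prod>i\<in>J. real (?Mb i))))
      \<and> (\<forall>f. \<exists>Lam Rm. bin_decoder M N n j B w f (2 * sqrt (G f) + 2 * (d * sqrt c)) Lam Rm)"
      unfolding c_def by (rule decoder_block[OF fM jM fB _ dt d Mb sp l0 l1]) (use n in simp)
    then obtain G where G: "\<forall>f. G f \<ge> (0::real)" and Gs: "(\<Sum>f\<in>binset M N n ?Mb. G f) \<le> real (card (binset M N n ?Mb)) *
       (?c1 * (?v / (n * dt\<^sup>2)) + ?N * (\<Sum>J\<in>?Js. 2 powr (- (n * (?S J - dt))) * 2 powr (n * (?S {} + dt)) / (\<Prod>i\<in>J. real (?Mb i))))"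
      and Gd: "\<forall>f. \<exists>Lam Rm. bin_decoder M N n j B w f (2 * sqrt (G f) + 2 * (d * sqrt c)) Lam Rm"
      by (elim exE conjE) (rule that)
    have le: "?c1 * (?v / (n * dt\<^sup>2)) + ?N * (\<Sum>J\<in>?Js. 2 powr (- (n * (?S J - dt))) * 2 powr (n * (?S {} + dt)) / (\<Prod>i\<in>J. real (?Mb i))) \<le> bd n"
      unfolding bd_def
    proof (intro add_mono mult_left_mono sum_mono)
      show "?v / (n * dt\<^sup>2) \<le> ?v / dt\<^sup>2 / n" by (simp add: mult.commute)
      fix J assume J: "J \<in> ?Js"
      have fJ: "finite J" by (rule finite_subset[of J "M - {j}"]) (use J fM in auto)
      have "2 powr (n * (\<Sum>i\<in>J. R i)) / 2 ^ card J = (\<Prod>i\<in>J. 2 powr (n * R i) / 2)"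
        using fJ by (simp add: prod_dividef powr_sum sum_distrib_left)
      also have "\<dots> \<le> (\<Prod>i\<in>J. real (?Mb i))"
      proof (intro prod_mono conjI)
        fix i assume "i \<in> J"
        then have "R i \<ge> 0" using J R0 by auto
        then show "2 powr (n * R i) / 2 \<le> real (?Mb i)" by (intro floor_pow_ge) simp
      qed simp
      finally have low: "2 powr (n * (\<Sum>i\<in>J. R i)) / 2 ^ card J \<le> (\<Prod>i\<in>J. real (?Mb i))" .
      have "2 powr (- (n * (?S J - dt))) * 2 powr (n * (?S {} + dt)) / (\<Prod>i\<in>J. real (?Mb i))
         \<le> 2 powr (- (n * (?S J - dt))) * 2 powr (n * (?S {} + dt)) / (2 powr (n * (\<Sum>i\<in>J. R i)) / 2 ^ card J)"
      proof (rule divide_left_mono[OF low])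
        have p0: "0 < 2 powr (n * (\<Sum>i\<in>J. R i)) / 2 ^ card J" by simp
        show "0 < (\<Prod>i\<in>J. real (?Mb i)) * (2 powr (n * (\<Sum>i\<in>J. R i)) / 2 ^ card J)"
          by (rule mult_pos_pos[OF less_le_trans[OF p0 low] p0])
      qed simp
      also have "\<dots> = 2 ^ card J * (2 powr (- (n * (?S J - dt))) * 2 powr (n * (?S {} + dt)) / 2 powr (n * (\<Sum>i\<in>J. R i)))" by simp
      also have "2 powr (- (n * (?S J - dt))) * 2 powr (n * (?S {} + dt)) / 2 powr (n * (\<Sum>i\<in>J. R i)) = 2 powr (- (n * (gap J - 2 * dt)))"
        unfolding powr_add[symmetric] powr_diff[symmetric] by (rule arg_cong[of _ _ "\<lambda>z. 2 powr z"]) (simp add: gap_def algebra_simps)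
      finally show "2 powr (- (n * (?S J - dt))) * 2 powr (n * (?S {} + dt)) / (\<Prod>i\<in>J. real (?Mb i)) \<le> 2 ^ card J * 2 powr (- (n * (gap J - 2 * dt)))" .
    qed (auto simp: c_def)
    have Gs': "(\<Sum>f\<in>binset M N n ?Mb. G f) \<le> real (card (binset M N n ?Mb)) * \<eta>"
      by (rule order_trans[OF Gs], rule mult_left_mono) (use le n in auto)
    show "\<exists>G. (\<forall>f. G f \<ge> (0::real)) \<and> (\<Sum>f\<in>binset M N n ?Mb. G f) \<le> real (card (binset M N n ?Mb)) * \<eta>
    \<and> (\<forall>f. \<exists>Lam Rm. bin_decoder M N n j B w f (2 * sqrt (G f) + \<eta>) Lam Rm)"
    proof (rule exI[of _ G], intro conjI allI G[rule_format] Gs')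
      fix f
      obtain Lam Rm where "bin_decoder M N n j B w f (2 * sqrt (G f) + 2 * (d * sqrt c)) Lam Rm" using spec[OF Gd, of f] by (elim exE) (rule that)
      then have "bin_decoder M N n j B w f (2 * sqrt (G f) + \<eta>) Lam Rm" by (rule bin_decoder_mono) (use dc in linarith)
      then show "\<exists>Lam Rm. bin_decoder M N n j B w f (2 * sqrt (G f) + \<eta>) Lam Rm" by (intro exI)
    qed
  qed
qed

text \<open>The copies of E are registers (0, t) in the protocol, so the columns are indexed by such
  pairs here.\<close>

definition tsx :: "nat \<Rightarrow> nat set \<Rightarrow> (nat \<Rightarrow> nat \<Rightarrow> nat) \<Rightarrow> nat \<times> nat \<Rightarrow> nat \<Rightarrow> nat" where
  "tsx n M x = (\<lambda>p\<in>{0} \<times> {..<n}. colm n M x (snd p))"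

lemma sum_tsx: "(\<Sum>s\<in>PiE ({0} \<times> {..<n}) (\<lambda>_. tups M N). g s) = (\<Sum>x\<in>srcs M N n. g (tsx n M x))"
proof -
  let ?T = "{0::nat} \<times> {..<n}"
  let ?i = "\<lambda>s. \<lambda>p\<in>?T. s (snd p)" and ?j = "\<lambda>s. \<lambda>t\<in>{..<n}. s (0::nat, t)"
  have "(\<Sum>s\<in>PiE ?T (\<lambda>_. tups M N). g s) = (\<Sum>s\<in>PiE {..<n} (\<lambda>_. tups M N). g (?i s))"
  proof (rule sum.reindex_bij_witness[where i="?i" and j="?j"])
    fix s assume s: "s \<in> PiE ?T (\<lambda>_. tups M N)"
    show ij: "?i (?j s) = s"
    proof (rule ext)
      fix p show "?i (?j s) p = s p" using PiE_arb[OF s, of p] by (cases p; cases "p \<in> ?T") auto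
    qed
    show "?j s \<in> PiE {..<n} (\<lambda>_. tups M N)" using s by (auto simp: PiE_iff)
    show "g (?i (?j s)) = g s" unfolding ij ..
  next
    fix s assume s: "s \<in> PiE {..<n} (\<lambda>_. tups M N)"
    show "?j (?i s) = s"
    proof (rule ext)
      fix t show "?j (?i s) t = s t" using PiE_arb[OF s, of t] by (cases "t < n") auto
    qed
    show "?i s \<in> PiE ?T (\<lambda>_. tups M N)" using s by (auto simp: PiE_iff)
  qed
  also have "\<dots> = (\<Sum>x\<in>srcs M N n. g (?i (colm n M x)))" by (rule sum_colm)
  finally show ?thesis unfolding tsx_def .
qed

definition prod_opE :: "nat \<Rightarrow> ((nat \<Rightarrow> nat) \<Rightarrow> 'c op) \<Rightarrow> (nat \<Rightarrow> nat \<Rightarrow> nat) \<Rightarrow> nat set \<Rightarrow> (nat \<times> nat \<Rightarrow> 'c) op" where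
  "prod_opE n w x M = (\<lambda>b b'. \<Prod>p\<in>{0} \<times> {..<n}. w (\<lambda>i\<in>M. x i (snd p)) (b p) (b' p))"

text \<open>The subspace is the typical subspace of the marginal on E, of dimension at most 2^(n (SE
  + dt)), and the eigenvalues kept are at most 2^(-n (SX - dt)). Their exponents differ by the
  entropy of X given E, up to the slack.\<close>

lemma hash_block:
  fixes w :: "(nat \<Rightarrow> nat) \<Rightarrow> 'c op" and lam :: "(nat \<Rightarrow> nat) \<Rightarrow> 'c \<Rightarrow> real" and lamE :: "'c \<Rightarrow> real" and n :: nat and dt t :: real
    and f :: "(nat \<Rightarrow> nat \<Rightarrow> nat) \<Rightarrow> 'l"
  assumes fM: "finite M" and fB: "finite B" and n: "n \<ge> 1" and dt: "dt > 0" and t: "t > 0" and K: "Kc \<ge> 1"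
    and sp: "\<And>y. y \<in> tups M N \<Longrightarrow> spectral B (w y) (lam y) (e y)"
    and l0: "\<And>y k. y \<in> tups M N \<Longrightarrow> k\<in>B \<Longrightarrow> lam y k \<ge> 0" and l1: "(\<Sum>y\<in>tups M N. \<Sum>k\<in>B. lam y k) = 1"
    and spE: "spectral B (\<lambda>b b'. \<Sum>y\<in>tups M N. w y b b') lamE eE"
    and lE0: "\<And>k. k\<in>B \<Longrightarrow> lamE k \<ge> 0" and lE1: "(\<Sum>k\<in>B. lamE k) = 1"
    and fL: "finite L" and fl: "f ` srcs M N n \<subseteq> L"
  defines "SX \<equiv> shannon (tups M N \<times> B) (case_prod lam)" and "VX \<equiv> info_var (tups M N \<times> B) (case_prod lam)"
    and "SE \<equiv> shannon ({()} \<times> B) (\<lambda>(y,k). lamE k)" and "VE \<equiv> info_var ({()} \<times> B) (\<lambda>(y,k). lamE k)"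
  shows "\<exists>F\<in>PiE (srcs M N n) (\<lambda>_. {..<Kc}). tn_bound ({..<Kc} \<times> L) (PiE ({0} \<times> {..<n}) (\<lambda>_. B))
     (\<lambda>kl b b'. \<Sum>x\<in>{x\<in>srcs M N n. f x = snd kl}. of_real (hcoef Kc F x (fst kl)) * prod_opE n w x M b b')
     (sqrt (real Kc * card L * 2 powr (n * (SE + dt)) * 2 powr (- (n * (SX - dt))))
       + 2 * (t + ((VX + VE) / (n * dt\<^sup>2)) / t + 2 * ((VX + VE) / (n * dt\<^sup>2))))"
proof -
  let ?T = "{0::nat} \<times> {..<n}"
  let ?Bn = "PiE ?T (\<lambda>_. B)" and ?Xs = "srcs M N n"
  have fT: "finite ?T" by simp
  have Tne: "?T \<noteq> {}" using n by (auto simp: lessThan_empty_iff)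
  have cT: "card ?T = n" by (simp add: card_cartesian_product)
  have fBn: "finite ?Bn" using fB by (intro finite_PiE) auto
  have fX: "finite ?Xs" by (rule finite_srcs[OF fM])
  have fY: "finite (tups M N)" unfolding tups_def using fM by (intro finite_PiE) auto
  have V0: "VX \<ge> 0" "VE \<ge> 0" unfolding VX_def VE_def info_var_def using l0 lE0 by (auto intro!: sum_nonneg)
  define \<epsilon> where "\<epsilon> = (VX + VE) / (n * dt\<^sup>2)"
  define q where "q = tsx n M"
  have qm: "q x \<in> PiE ?T (\<lambda>_. tups M N)" if "x\<in>?Xs" for x
    using colm_mem[OF that subset_refl] unfolding q_def tsx_def by (auto simp: PiE_iff)
  have qt: "q x p = (\<lambda>i\<in>M. x i (snd p))" if "p \<in> ?T" for x p using that by (auto simp: q_def tsx_def colm_def)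
  have qmt: "q x p \<in> tups M N" if "x\<in>?Xs" "p\<in>?T" for x p by (rule PiE_mem[OF qm[OF that(1)] that(2)])
  define EE where "EE = (\<lambda>x. tE ?T e (q x))"
  define LL where "LL = (\<lambda>x. tL ?T lam (q x))"
  define Gs where "Gs = (\<lambda>x. tK ?T (tups M N) B lam dt (q x))"
  have onEE: "onf ?Bn ?Bn (EE x)" if x: "x\<in>?Xs" for x
    unfolding EE_def by (rule tE_onf[OF fT fB]) (rule spectral_onf[OF fB sp[OF qmt[OF x]]])
  have LL0: "LL x k \<ge> 0" if x: "x\<in>?Xs" and k: "k\<in>?Bn" for x k
    unfolding LL_def
  proof (rule tL_nonneg)
    fix p assume p: "p \<in> ?T"
    show "lam (q x p) (k p) \<ge> 0" by (rule l0[OF qmt[OF x p] PiE_mem[OF k p]])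
  qed
  define u where "u = (\<lambda>x k b. complex_of_real (sqrt (LL x k)) * EE x k b)"
  have gram: "prod_opE n w x M b b' = (\<Sum>k\<in>?Bn. u x k b * cnj (u x k b'))" if x: "x\<in>?Xs" and b: "b\<in>?Bn" "b'\<in>?Bn" for x b b'
  proof -
    have "prod_opE n w x M b b' = (\<Prod>p\<in>?T. w (q x p) (b p) (b' p))"
      unfolding prod_opE_def using qt by (intro prod.cong refl) simp
    also have "\<dots> = (\<Sum>k\<in>?Bn. complex_of_real (LL x k) * EE x k b * cnj (EE x k b'))"
      unfolding LL_def EE_def by (rule tE_spectral[OF fT fB b]) (use spectral_eq[OF sp] qmt[OF x] in auto)
    also have "\<dots> = (\<Sum>k\<in>?Bn. u x k b * cnj (u x k b'))"
    proof (rule sum.cong[OF refl])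
      fix k assume k: "k\<in>?Bn"
      have sq: "of_real (sqrt (LL x k)) * complex_of_real (sqrt (LL x k)) = complex_of_real (LL x k)" using LL0[OF x k] by (simp flip: of_real_mult)
      have "u x k b * cnj (u x k b') = (of_real (sqrt (LL x k)) * complex_of_real (sqrt (LL x k))) * EE x k b * cnj (EE x k b')"
        by (simp add: u_def mult_ac)
      then show "complex_of_real (LL x k) * EE x k b * cnj (EE x k b') = u x k b * cnj (u x k b')" unfolding sq by simp
    qed
    finally show ?thesis .
  qed
  \<comment> \<open>A one-letter alphabet lets the results on product ensembles apply to the single
    marginal operator on E.\<close>
  let ?eE = "tE ?T (\<lambda>_. eE) (\<lambda>_\<in>?T. ())" and ?lE = "tL ?T (\<lambda>_. lamE) (\<lambda>_\<in>?T. ())"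
  define KE where "KE = tK ?T {()} B (\<lambda>_. lamE) dt (\<lambda>_\<in>?T. ())"
  have onE: "onf ?Bn ?Bn ?eE" by (rule tE_onf[OF fT fB]) (rule spectral_onf[OF fB spE])
  have KEB: "KE \<subseteq> ?Bn" by (auto simp: KE_def tK_def)
  have KI: "(\<Sum>x\<in>?Xs. \<Sum>k\<in>?Bn. (cmod (ip ?Bn h (u x k)))\<^sup>2) = (\<Sum>k\<in>?Bn. ?lE k * (cmod (ip ?Bn (?eE k) h))\<^sup>2)" for h
  proof -
    let ?W = "\<lambda>b b'. \<Sum>x\<in>?Xs. prod_opE n w x M b b'"
    have W: "?W b b' = (\<Sum>k\<in>?Bn. complex_of_real (?lE k) * ?eE k b * cnj (?eE k b'))" if b: "b\<in>?Bn" "b'\<in>?Bn" for b b'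
    proof -
      have "?W b b' = (\<Sum>x\<in>?Xs. \<Prod>p\<in>?T. w (q x p) (b p) (b' p))"
        unfolding prod_opE_def using qt by (intro sum.cong prod.cong refl) simp
      also have "\<dots> = (\<Sum>s\<in>PiE ?T (\<lambda>_. tups M N). \<Prod>p\<in>?T. w (s p) (b p) (b' p))" unfolding q_def by (rule sum_tsx[symmetric])
      also have "\<dots> = (\<Prod>p\<in>?T. \<Sum>y\<in>tups M N. w y (b p) (b' p))" by (rule sum_PiE_prod[OF fT fY])
      also have "\<dots> = (\<Sum>k\<in>?Bn. complex_of_real (?lE k) * ?eE k b * cnj (?eE k b'))"
        by (rule tE_spectral[OF fT fB b, where w="\<lambda>_ b b'. \<Sum>y\<in>tups M N. w y b b'"]) (use spectral_eq[OF spE] in auto)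
      finally show ?thesis .
    qed
    have "complex_of_real (\<Sum>x\<in>?Xs. \<Sum>k\<in>?Bn. (cmod (ip ?Bn h (u x k)))\<^sup>2) = ip ?Bn h (mv ?Bn ?W h)"
    proof -
      have "ip ?Bn h (mv ?Bn ?W h) = of_real (\<Sum>p\<in>?Xs \<times> ?Bn. (cmod (ip ?Bn (u (fst p) (snd p)) h))\<^sup>2)"
        by (rule gram_qf) (use gram in \<open>simp add: sum.cartesian_product'\<close>)
      moreover have "cmod (ip ?Bn (u x k) h) = cmod (ip ?Bn h (u x k))" for x k using ip_cnj complex_mod_cnj by metis
      ultimately show ?thesis by (simp add: sum.cartesian_product')
    qed
    also have "\<dots> = (\<Sum>k\<in>?Bn. complex_of_real (?lE k) * ip ?Bn h (?eE k) * ip ?Bn (?eE k) h)"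
      by (rule spectral_qf[OF fBn spectral_onfI[OF onE W]])
    also have "\<dots> = complex_of_real (\<Sum>k\<in>?Bn. ?lE k * (cmod (ip ?Bn (?eE k) h))\<^sup>2)"
      unfolding of_real_sum
    proof (rule sum.cong[OF refl])
      fix k
      have "ip ?Bn h (?eE k) * ip ?Bn (?eE k) h = of_real ((cmod (ip ?Bn (?eE k) h))\<^sup>2)"
        unfolding complex_norm_square ip_cnj by simp
      then show "complex_of_real (?lE k) * ip ?Bn h (?eE k) * ip ?Bn (?eE k) h
        = complex_of_real (?lE k * (cmod (ip ?Bn (?eE k) h))\<^sup>2)" by (simp add: mult.assoc)
    qed
    finally show ?thesis using of_real_eq_iff by blast
  qed
  have unit1: "PiE ?T (\<lambda>_. {()}) = {\<lambda>_\<in>?T. ()}" by auto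
  have l1E: "(\<Sum>y\<in>{()}. \<Sum>k\<in>B. lamE k) = 1" using lE1 by simp
  have tot: "(\<Sum>x\<in>?Xs. \<Sum>k\<in>?Bn. LL x k) = 1"
    using tL_total[OF fT fY fB l0 l1] unfolding sum_tsx LL_def q_def by simp
  have div: "V / (card ?T * dt\<^sup>2) \<le> \<epsilon>" if "V \<le> VX + VE" for V
    unfolding cT \<epsilon>_def using that by (intro divide_right_mono) auto
  have cut: "(\<Sum>x\<in>?Xs. \<Sum>k\<in>?Bn - Gs x. LL x k) \<le> \<epsilon>"
    using tK_error[OF fT fY fB l0 l1 Tne dt] div[of VX] V0 unfolding sum_tsx LL_def Gs_def q_def VX_def by linarith
  have errE: "(\<Sum>k\<in>?Bn - KE. ?lE k) \<le> \<epsilon>"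
    using tK_error[OF fT _ fB _ l1E Tne dt] lE0 div[of VE] V0 unfolding unit1 KE_def VE_def case_prod_unfold by (fastforce simp: case_prod_unfold)
  have prE: "(\<Sum>x\<in>?Xs. \<Sum>k\<in>?Bn. nsq ?Bn (\<lambda>b. u x k b - prj ?Bn KE ?eE (u x k) b)) \<le> \<epsilon>"
  proof -
    have "(\<Sum>x\<in>?Xs. \<Sum>k\<in>?Bn. nsq ?Bn (\<lambda>b. u x k b - prj ?Bn KE ?eE (u x k) b))
      = (\<Sum>x\<in>?Xs. \<Sum>k\<in>?Bn. \<Sum>k'\<in>?Bn - KE. (cmod (ip ?Bn (?eE k') (u x k)))\<^sup>2)"
      unfolding nsq_diff_prj_complete[OF onE fBn KEB] ..
    also have "\<dots> = (\<Sum>k'\<in>?Bn - KE. \<Sum>x\<in>?Xs. \<Sum>k\<in>?Bn. (cmod (ip ?Bn (?eE k') (u x k)))\<^sup>2)"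
      by (simp add: sum.swap[of _ "?Bn - KE"])
    also have "\<dots> = (\<Sum>k'\<in>?Bn - KE. ?lE k')"
    proof (rule sum.cong[OF refl])
      fix k' assume k': "k' \<in> ?Bn - KE"
      have "(\<Sum>x\<in>?Xs. \<Sum>k\<in>?Bn. (cmod (ip ?Bn (?eE k') (u x k)))\<^sup>2) = (\<Sum>k\<in>?Bn. ?lE k * (cmod (ip ?Bn (?eE k) (?eE k')))\<^sup>2)" by (rule KI)
      also have "\<dots> = (\<Sum>k\<in>?Bn. if k = k' then ?lE k' else 0)" using onfD[OF onE] k' by (intro sum.cong refl) auto
      also have "\<dots> = ?lE k'" using k' fBn by simp
      finally show "(\<Sum>x\<in>?Xs. \<Sum>k\<in>?Bn. (cmod (ip ?Bn (?eE k') (u x k)))\<^sup>2) = ?lE k'" .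
    qed
    finally show ?thesis using errE by simp
  qed
  define \<nu> where "\<nu> = 2 powr (- (n * (SX - dt)))"
  have nu: "LL x k \<le> \<nu>" if "k \<in> Gs x" for x k
    using tK_le[OF fT fY fB l0 l1, of k dt "q x"] that unfolding Gs_def LL_def \<nu>_def SX_def cT by simp
  have cKE: "real (card KE) \<le> 2 powr (n * (SE + dt))"
    using tK_card[OF fT _ fB _ l1E, of dt] lE0 unfolding unit1 KE_def SE_def cT by (simp add: case_prod_unfold)
  have "\<exists>F\<in>PiE ?Xs (\<lambda>_. {..<Kc}). tn_bound ({..<Kc} \<times> L) ?Bn
     (\<lambda>kl b b'. \<Sum>x\<in>{x\<in>?Xs. f x = snd kl}. of_real (hcoef Kc F x (fst kl)) * (\<Sum>k\<in>?Bn. u x k b * cnj (u x k b')))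
     (sqrt (real Kc * card L * card KE * \<nu>) + 2 * (t + \<epsilon> / t + 2 * \<epsilon>))"
    unfolding u_def
  proof (rule hash_exists[where G=Gs and \<nu>=\<nu> and \<epsilon>=\<epsilon> and lam=LL and e=EE and eE="?eE", OF fX fBn fL fl onEE LL0 fBn _ nu _ tot cut _ _ K t])
    show "Gs x \<subseteq> ?Bn" for x by (auto simp: Gs_def tK_def)
    show "0 \<le> \<nu>" by (simp add: \<nu>_def)
    show "onf ?Bn KE ?eE" by (rule onf_subset[OF onE KEB])
    show "(\<Sum>x\<in>?Xs. \<Sum>i\<in>?Bn. nsq ?Bn (\<lambda>b. complex_of_real (sqrt (LL x i)) * EE x i b
       - prj ?Bn KE ?eE (\<lambda>b. complex_of_real (sqrt (LL x i)) * EE x i b) b)) \<le> \<epsilon>" using prE unfolding u_def .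
  qed
  then obtain F where F: "F\<in>PiE ?Xs (\<lambda>_. {..<Kc})" and tn: "tn_bound ({..<Kc} \<times> L) ?Bn
     (\<lambda>kl b b'. \<Sum>x\<in>{x\<in>?Xs. f x = snd kl}. of_real (hcoef Kc F x (fst kl)) * (\<Sum>k\<in>?Bn. u x k b * cnj (u x k b')))
     (sqrt (real Kc * card L * card KE * \<nu>) + 2 * (t + \<epsilon> / t + 2 * \<epsilon>))" by blast
  have "tn_bound ({..<Kc} \<times> L) ?Bn
     (\<lambda>kl b b'. \<Sum>x\<in>{x\<in>?Xs. f x = snd kl}. of_real (hcoef Kc F x (fst kl)) * prod_opE n w x M b b')
     (sqrt (real Kc * card L * card KE * \<nu>) + 2 * (t + \<epsilon> / t + 2 * \<epsilon>))"
    by (rule tn_bound_cong[OF tn]) (use gram in \<open>auto intro!: sum.cong\<close>)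
  then have "tn_bound ({..<Kc} \<times> L) ?Bn
     (\<lambda>kl b b'. \<Sum>x\<in>{x\<in>?Xs. f x = snd kl}. of_real (hcoef Kc F x (fst kl)) * prod_opE n w x M b b')
     (sqrt (real Kc * card L * 2 powr (n * (SE + dt)) * \<nu>) + 2 * (t + \<epsilon> / t + 2 * \<epsilon>))"
    by (rule tn_bound_mono) (use cKE in \<open>auto intro!: mult_right_mono mult_left_mono simp: \<nu>_def\<close>)
  then show ?thesis using F unfolding \<epsilon>_def \<nu>_def by blast
qed

text \<open>The binning is universally quantified: only the number of bin tuples, at most 2^(n sum
  R), is used. A binning found for decoding can thus be inserted afterwards.\<close>

lemma hash_asymp:
  fixes w :: "(nat \<Rightarrow> nat) \<Rightarrow> 'c op" and lam :: "(nat \<Rightarrow> nat) \<Rightarrow> 'c \<Rightarrow> real" and lamE :: "'c \<Rightarrow> real" and R :: "nat \<Rightarrow> real" and r \<eta> :: real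
  assumes fM: "finite M" and fB: "finite B"
    and sp: "\<And>y. y \<in> tups M N \<Longrightarrow> spectral B (w y) (lam y) (e y)"
    and l0: "\<And>y k. y \<in> tups M N \<Longrightarrow> k\<in>B \<Longrightarrow> lam y k \<ge> 0" and l1: "(\<Sum>y\<in>tups M N. \<Sum>k\<in>B. lam y k) = 1"
    and spE: "spectral B (\<lambda>b b'. \<Sum>y\<in>tups M N. w y b b') lamE eE"
    and lE0: "\<And>k. k\<in>B \<Longrightarrow> lamE k \<ge> 0" and lE1: "(\<Sum>k\<in>B. lamE k) = 1"
    and r: "r \<ge> 0"
    and gap: "r + (\<Sum>i\<in>M. R i) < shannon (tups M N \<times> B) (case_prod lam) - shannon ({()} \<times> B) (\<lambda>(y,k). lamE k)"
    and eta: "\<eta> > 0"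
  shows "\<forall>\<^sub>F n in sequentially. \<forall>f\<in>binset M N n (\<lambda>i. floor_pow (n * R i)). \<exists>F\<in>PiE (srcs M N n) (\<lambda>_. {..<floor_pow (n * r)}).
     tn_bound ({..<floor_pow (n * r)} \<times> PiE M (\<lambda>i. {..<floor_pow (n * R i)})) (PiE ({0} \<times> {..<n}) (\<lambda>_. B))
     (\<lambda>kl b b'. \<Sum>x\<in>{x\<in>srcs M N n. bins M f x = snd kl}. of_real (hcoef (floor_pow (n * r)) F x (fst kl)) * prod_opE n w x M b b') \<eta>"
proof -
  let ?SX = "shannon (tups M N \<times> B) (case_prod lam)" and ?SE = "shannon ({()} \<times> B) (\<lambda>(y,k). lamE k)"
  let ?V = "info_var (tups M N \<times> B) (case_prod lam) + info_var ({()} \<times> B) (\<lambda>(y,k). lamE k)"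
  define g where "g = ?SX - ?SE - r - (\<Sum>i\<in>M. R i)"
  have g: "g > 0" using gap by (simp add: g_def)
  \<comment> \<open>The slack occurs twice in the exponent and uses up g/2, leaving decay at rate
    g/2.\<close>
  define dt where "dt = g / 4"
  have dt: "dt > 0" using g by (simp add: dt_def)
  \<comment> \<open>The only term that does not vanish with n is 2 t, here \<eta>/2.\<close>
  define t where "t = \<eta> / 4"
  have t: "t > 0" using eta by (simp add: t_def)
  define bd where "bd = (\<lambda>n::nat. sqrt (2 powr (- (n * (g / 2)))) + 2 * (t + (?V / dt\<^sup>2 / n) / t + 2 * (?V / dt\<^sup>2 / n)))"
  have "bd \<longlonglongrightarrow> sqrt 0 + 2 * (t + 0 / t + 2 * 0)"
    unfolding bd_def using g t by (intro tendsto_intros over_n_tendsto powr_decay) auto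
  then have "bd \<longlonglongrightarrow> \<eta> / 2" by (simp add: t_def)
  from order_tendstoD(2)[OF this, of \<eta>] have "\<forall>\<^sub>F n in sequentially. bd n < \<eta>" using eta by simp
  then have "\<forall>\<^sub>F n in sequentially. bd n < \<eta> \<and> n \<ge> 1" using eventually_ge_at_top[of 1] by (rule eventually_conj)
  then show ?thesis
  proof (rule eventually_mono, intro ballI)
    fix n :: nat and f
    assume n: "bd n < \<eta> \<and> n \<ge> 1" and f: "f \<in> binset M N n (\<lambda>i. floor_pow (n * R i))"
    let ?Kc = "floor_pow (n * r)" and ?L = "PiE M (\<lambda>i. {..<floor_pow (n * R i)})"
    have K1: "?Kc \<ge> 1" using r by (intro floor_pow_ge) simp
    have fL: "finite ?L" using fM by (intro finite_PiE) auto
    have fl: "bins M f ` srcs M N n \<subseteq> ?L"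
    proof
      fix l assume "l \<in> bins M f ` srcs M N n"
      then obtain x where x: "x \<in> srcs M N n" "l = bins M f x" by blast
      have "f i (x i) < floor_pow (n * R i)" if "i\<in>M" for i
        using f x that unfolding binset_def srcs_def by (auto simp: PiE_iff)
      then show "l \<in> ?L" unfolding x(2) bins_def by auto
    qed
    have cLr: "real (card ?L) \<le> 2 powr (n * (\<Sum>i\<in>M. R i))"
    proof -
      have "real (card ?L) = (\<Prod>i\<in>M. real (floor_pow (n * R i)))" using fM by (simp add: card_PiE)
      also have "\<dots> \<le> (\<Prod>i\<in>M. 2 powr (n * R i))" by (intro prod_mono) (simp add: floor_pow_le)
      also have "\<dots> = 2 powr (n * (\<Sum>i\<in>M. R i))" using fM by (simp add: powr_sum sum_distrib_left)
      finally show ?thesis .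
    qed
    have le: "sqrt (real ?Kc * card ?L * 2 powr (n * (?SE + dt)) * 2 powr (- (n * (?SX - dt))))
       + 2 * (t + (?V / (n * dt\<^sup>2)) / t + 2 * (?V / (n * dt\<^sup>2))) \<le> bd n"
    proof -
      have "real ?Kc * card ?L * 2 powr (n * (?SE + dt)) * 2 powr (- (n * (?SX - dt)))
         \<le> 2 powr (n * r) * 2 powr (n * (\<Sum>i\<in>M. R i)) * 2 powr (n * (?SE + dt)) * 2 powr (- (n * (?SX - dt)))"
        by (intro mult_right_mono mult_mono floor_pow_le cLr) auto
      also have "\<dots> = 2 powr (- (n * (g / 2)))"
        unfolding powr_add[symmetric] by (rule arg_cong[of _ _ "\<lambda>z. 2 powr z"]) (simp add: g_def dt_def field_simps)
      finally show ?thesis unfolding bd_def by (intro add_mono real_sqrt_le_mono) (simp_all add: mult.commute)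
    qed
    obtain F where F: "F\<in>PiE (srcs M N n) (\<lambda>_. {..<?Kc})" and tn: "tn_bound ({..<?Kc} \<times> ?L) (PiE ({0} \<times> {..<n}) (\<lambda>_. B))
     (\<lambda>kl b b'. \<Sum>x\<in>{x\<in>srcs M N n. bins M f x = snd kl}. of_real (hcoef ?Kc F x (fst kl)) * prod_opE n w x M b b')
     (sqrt (real ?Kc * card ?L * 2 powr (n * (?SE + dt)) * 2 powr (- (n * (?SX - dt))))
       + 2 * (t + (?V / (n * dt\<^sup>2)) / t + 2 * (?V / (n * dt\<^sup>2))))"
      using hash_block[OF fM fB _ dt t K1 sp l0 l1 spE lE0 lE1 fL fl] n by blast
    show "\<exists>F\<in>PiE (srcs M N n) (\<lambda>_. {..<?Kc}). tn_bound ({..<?Kc} \<times> ?L) (PiE ({0} \<times> {..<n}) (\<lambda>_. B))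
     (\<lambda>kl b b'. \<Sum>x\<in>{x\<in>srcs M N n. bins M f x = snd kl}. of_real (hcoef ?Kc F x (fst kl)) * prod_opE n w x M b b') \<eta>"
    proof (rule bexI[OF _ F], rule tn_bound_mono[OF tn])
      show "sqrt (real ?Kc * card ?L * 2 powr (n * (?SE + dt)) * 2 powr (- (n * (?SX - dt))))
       + 2 * (t + (?V / (n * dt\<^sup>2)) / t + 2 * (?V / (n * dt\<^sup>2))) \<le> \<eta>" using le n by linarith
    qed
  qed
qed

section \<open>Kraus representations and the single-letter ensemble\<close>

text \<open>Choi's argument: complete positivity is applied to the unnormalised maximally entangled
  vector, and a Gram factorisation of the resulting matrix is a Kraus representation.\<close>

lemma cp_kraus:
  fixes Phi :: "'b op \<Rightarrow> 'c op"
  assumes fB: "finite B" and fC: "finite C" and cp: "completely_positive B C Phi"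
  shows "\<exists>g :: (nat \<times> 'c) \<Rightarrow> 'b \<Rightarrow> 'c \<Rightarrow> complex. \<forall>a\<in>B. \<forall>a'\<in>B. \<forall>x\<in>C. \<forall>x'\<in>C.
     Phi (unit_op a a') x x' = (\<Sum>i\<in>{..<card B} \<times> C. g i a x * cnj (g i a' x'))"
proof -
  obtain h where h: "bij_betw h {..<card B} B" using ex_bij_betw_nat_finite[OF fB] by (auto simp: atLeast0LessThan)
  \<comment> \<open>The maximally entangled vector. The ancilla in the definition of complete
    positivity is labelled by naturals, hence the enumeration h of B.\<close>
  define v where "v = (\<lambda>p :: nat \<times> 'b. if snd p = h (fst p) then 1 else 0 :: complex)"
  define X where "X = (\<lambda>p p'. v p * cnj (v p'))"
  have "psd ({..<card B} \<times> B) X" unfolding X_def by (rule psd_rank1)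
  then have ps: "psd ({..<card B} \<times> C) (ext_anc Phi X)" using cp unfolding completely_positive_def by blast
  have "finite ({..<card B} \<times> C)" using fC by simp
  then obtain g where g: "\<And>p p'. p \<in> {..<card B} \<times> C \<Longrightarrow> p' \<in> {..<card B} \<times> C \<Longrightarrow>
      ext_anc Phi X p p' = (\<Sum>i\<in>{..<card B} \<times> C. g i p * cnj (g i p'))" using psd_gramE[OF _ ps] by blast
  have u: "(\<lambda>a b. X (i, a) (i', b)) = unit_op (h i) (h i')" for i i' by (auto simp: X_def v_def unit_op_def fun_eq_iff)
  define k where "k = inv_into {..<card B} h"
  have k: "k a \<in> {..<card B}" "h (k a) = a" if "a \<in> B" for a
    using bij_betw_apply[OF bij_betw_inv_into[OF h] that] bij_betw_inv_into_right[OF h that] by (simp_all add: k_def)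
  show ?thesis
  proof (rule exI[of _ "\<lambda>i a x. g i (k a, x)"], intro ballI)
    fix a a' x x' assume a: "a\<in>B" "a'\<in>B" and x: "x\<in>C" "x'\<in>C"
    have "ext_anc Phi X (k a, x) (k a', x') = (\<Sum>i\<in>{..<card B} \<times> C. g i (k a, x) * cnj (g i (k a', x')))"
      by (rule g) (use a x k in auto)
    then show "Phi (unit_op a a') x x' = (\<Sum>i\<in>{..<card B} \<times> C. g i (k a, x) * cnj (g i (k a', x')))"
      by (simp add: ext_anc_def u k a)
  qed
qed

lemma instrument_trace:
  assumes ins: "instrument B C L Phi" and fB: "finite B" and b: "b \<in> B"
  shows "(\<Sum>l\<in>L. \<Sum>x\<in>C. Phi l (unit_op b b') x x) = (if b = b' then 1 else 0)"
proof -
  have "op_trace C (\<lambda>x y. \<Sum>l\<in>L. Phi l (unit_op b b') x y) = op_trace B (unit_op b b')"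
    using ins unfolding instrument_def trace_preserving_def by blast
  moreover have "op_trace B (unit_op b b') = (\<Sum>x\<in>B. if x = b then (if b = b' then 1 else 0) else 0)"
    unfolding op_trace_def unit_op_def by (intro sum.cong refl) auto
  ultimately show ?thesis unfolding op_trace_sum using fB b by (simp add: op_trace_def)
qed

lemma finite_basis: "finite R \<Longrightarrow> finite (basis R d)"
  unfolding basis_def by (intro finite_PiE) auto

lemma restrict_basis: "u \<in> basis R d \<Longrightarrow> S \<subseteq> R \<Longrightarrow> restrict u S \<in> basis S d"
  unfolding basis_def by (auto simp: PiE_iff)

text \<open>A Gram form of the input combined with Kraus operators of the local maps gives a Gram
  form of the output, indexed by an input vector and one Kraus index per player. Positivity of the
  output blocks rests on it.\<close>

lemma apply_maps_gram:
  fixes X :: "('r \<Rightarrow> nat) op" and E :: "'r set"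
  assumes fJ: "finite J" and fK: "\<And>j. j \<in> J \<Longrightarrow> finite (Kp j)"
    and X: "\<And>u v. u \<in> basis R d \<Longrightarrow> v \<in> basis R d \<Longrightarrow> X u v = (\<Sum>i\<in>I. r i u * cnj (r i v))"
    and Phi: "\<And>j u v. j \<in> J \<Longrightarrow> u \<in> basis R d \<Longrightarrow> v \<in> basis R d \<Longrightarrow>
       Phi j (unit_op (restrict u (P j)) (restrict v (P j))) (ou j) (ou' j) = (\<Sum>k\<in>Kp j. g j k (restrict u (P j)) (ou j) * cnj (g j k (restrict v (P j)) (ou' j)))"
  defines "psi \<equiv> \<lambda>p ou e. \<Sum>u\<in>basis R d. if restrict u E = e then r (fst p) u * (\<Prod>j\<in>J. g j (snd p j) (restrict u (P j)) (ou j)) else 0"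
  shows "apply_maps R d P J E Phi X ou e ou' e' = (\<Sum>p\<in>I \<times> PiE J Kp. psi p ou e * cnj (psi p ou' e'))"
proof -
  let ?B = "basis R d"
  define A where "A = (\<lambda>p ou e u. if restrict u E = e then r (fst p) u * (\<Prod>j\<in>J. g j (snd p j) (restrict u (P j)) (ou j)) else 0)"
  have t: "(if restrict u E = e \<and> restrict v E = e' then X u v * (\<Prod>j\<in>J. Phi j (unit_op (restrict u (P j)) (restrict v (P j))) (ou j) (ou' j)) else 0)
     = (\<Sum>p\<in>I \<times> PiE J Kp. A p ou e u * cnj (A p ou' e' v))" if uv: "u\<in>?B" "v\<in>?B" for u v
  proof (cases "restrict u E = e \<and> restrict v E = e'")
    case True
    have "(\<Prod>j\<in>J. Phi j (unit_op (restrict u (P j)) (restrict v (P j))) (ou j) (ou' j))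
      = (\<Prod>j\<in>J. \<Sum>k\<in>Kp j. g j k (restrict u (P j)) (ou j) * cnj (g j k (restrict v (P j)) (ou' j)))"
      using Phi uv by (intro prod.cong refl) auto
    also have "\<dots> = (\<Sum>k\<in>PiE J Kp. \<Prod>j\<in>J. g j (k j) (restrict u (P j)) (ou j) * cnj (g j (k j) (restrict v (P j)) (ou' j)))"
      by (rule sum_PiE_prod[OF fJ fK, symmetric])
    finally show ?thesis using True unfolding X[OF uv] A_def
      by (simp add: sum_product sum.cartesian_product' prod.distrib cnj_prod mult_ac)
  next
    case False then show ?thesis by (auto simp: A_def)
  qed
  have "apply_maps R d P J E Phi X ou e ou' e' = (\<Sum>u\<in>?B. \<Sum>v\<in>?B. \<Sum>p\<in>I \<times> PiE J Kp. A p ou e u * cnj (A p ou' e' v))"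
    unfolding apply_maps_def using t by (intro sum.cong refl) auto
  also have "\<dots> = (\<Sum>p\<in>I \<times> PiE J Kp. \<Sum>u\<in>?B. \<Sum>v\<in>?B. A p ou e u * cnj (A p ou' e' v))"
    by (rule sum_swap2[symmetric])
  finally show ?thesis unfolding psi_def cnj_sum sum_product A_def .
qed

section \<open>Sums over register labels\<close>

lemma basis_sing: "basis {i} d = (\<lambda>k. \<lambda>_\<in>{i}. k) ` {..<d i}"
proof
  show "basis {i} d \<subseteq> (\<lambda>k. \<lambda>_\<in>{i}. k) ` {..<d i}"
  proof
    fix u assume u: "u \<in> basis {i} d"
    then have "u i < d i" by (auto simp: basis_def)
    moreover have "u = (\<lambda>_\<in>{i}. u i)" using u by (auto simp: basis_def fun_eq_iff restrict_def PiE_def extensional_def)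
    ultimately show "u \<in> (\<lambda>k. \<lambda>_\<in>{i}. k) ` {..<d i}" by blast
  qed
qed (auto simp: basis_def split: if_splits)

lemma sum_basis_sing: "(\<Sum>e\<in>basis {i} d. F e) = (\<Sum>k<d i. F (\<lambda>_\<in>{i}. k))"
  unfolding basis_sing by (subst sum.reindex) (auto simp: inj_on_def fun_eq_iff restrict_def comp_def)

lemma tups_sing: "(\<Sum>y\<in>tups {j} N. F y) = (\<Sum>k<N j. F (\<lambda>_\<in>{j}. k))"
  using sum_basis_sing[of F j N] by (simp add: tups_def basis_def)

lemma sum_tups_fix:
  assumes U: "U \<subseteq> M" and y0: "y0 \<in> tups U N"
  shows "(\<Sum>y\<in>{y\<in>tups M N. restrict y U = y0}. F y) = (\<Sum>y'\<in>tups (M - U) N. F (\<lambda>i. if i \<in> U then y0 i else y' i))"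
proof (rule sum.reindex_bij_witness[where i="\<lambda>y' i. if i \<in> U then y0 i else y' i" and j="\<lambda>y. restrict y (M - U)"])
  fix y assume "y \<in> {y\<in>tups M N. restrict y U = y0}"
  then have y: "y \<in> tups M N" "restrict y U = y0" by auto
  show eq: "(\<lambda>i. if i \<in> U then y0 i else restrict y (M - U) i) = y"
  proof (rule ext)
    fix i show "(if i \<in> U then y0 i else restrict y (M - U) i) = y i"
      using fun_cong[OF y(2), of i] y(1) PiE_arb[of y M] U by (auto simp: tups_def)
  qed
  show "restrict y (M - U) \<in> tups (M - U) N" using y(1) by (auto simp: tups_def PiE_iff)
  show "F (\<lambda>i. if i \<in> U then y0 i else restrict y (M - U) i) = F y" unfolding eq ..
next
  fix y' assume y': "y' \<in> tups (M - U) N"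
  show "restrict (\<lambda>i. if i \<in> U then y0 i else y' i) (M - U) = y'"
    using y' by (auto simp: tups_def fun_eq_iff restrict_def PiE_def extensional_def)
  have "restrict (\<lambda>i. if i \<in> U then y0 i else y' i) U = y0"
    using y0 by (auto simp: tups_def fun_eq_iff restrict_def PiE_def extensional_def)
  then show "(\<lambda>i. if i \<in> U then y0 i else y' i) \<in> {y\<in>tups M N. restrict y U = y0}"
    using y' y0 U by (auto simp: tups_def PiE_iff extensional_def)
qed

definition mkw :: "(nat \<Rightarrow> nat) \<Rightarrow> (nat \<Rightarrow> nat) \<Rightarrow> nat \<Rightarrow> wreg \<Rightarrow> nat" where
  "mkw y a e = (\<lambda>q. case q of RX i \<Rightarrow> y i | RA i \<Rightarrow> a i | RE \<Rightarrow> e)"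

lemma mkw_simps [simp]: "mkw y a e (RX i) = y i" "mkw y a e (RA i) = a i" "mkw y a e RE = e"
  by (simp_all add: mkw_def)

text \<open>Splits a register assignment into classical labels, quantum outputs and E. The flag
  \<open>bE\<close> says whether E is present; if not, the assignment has the single value
  \<open>undefined\<close> there, and the sum over e runs over that dummy.\<close>

lemma sum_wreg:
  "(\<Sum>g\<in>basis (RX ` UX \<union> RA ` UA \<union> (if bE then {RE} else {})) (w_dims dA dA' N). F g)
   = (\<Sum>y\<in>tups UX N. \<Sum>a\<in>tups UA dA'. \<Sum>e\<in>(if bE then {..<dA 0} else {undefined}). F (mkw y a e))"
proof -
  let ?S = "RX ` UX \<union> RA ` UA \<union> (if bE then {RE} else {})" and ?E = "if bE then {..<dA 0} else {undefined}"
  have "(\<Sum>g\<in>basis ?S (w_dims dA dA' N). F g) = (\<Sum>p\<in>tups UX N \<times> tups UA dA' \<times> ?E. F (mkw (fst p) (fst (snd p)) (snd (snd p))))"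
  proof (rule sum.reindex_bij_witness[where i="\<lambda>p. mkw (fst p) (fst (snd p)) (snd (snd p))" and j="\<lambda>g. (\<lambda>i. g (RX i), \<lambda>i. g (RA i), g RE)"])
    fix g assume g: "g \<in> basis ?S (w_dims dA dA' N)"
    show ij: "mkw (fst (\<lambda>i. g (RX i), \<lambda>i. g (RA i), g RE)) (fst (snd (\<lambda>i. g (RX i), \<lambda>i. g (RA i), g RE))) (snd (snd (\<lambda>i. g (RX i), \<lambda>i. g (RA i), g RE))) = g"
      by (auto simp: mkw_def fun_eq_iff split: wreg.split)
    have gx: "\<And>q. q \<in> ?S \<Longrightarrow> g q < w_dims dA dA' N q" and ge: "\<And>q. q \<notin> ?S \<Longrightarrow> g q = undefined"
      using g by (auto simp: basis_def PiE_iff extensional_def)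
    have "(\<lambda>i. g (RX i)) \<in> tups UX N" unfolding tups_def
    proof (rule PiE_I)
      fix i assume "i \<in> UX" then show "g (RX i) \<in> {..<N i}" using gx[of "RX i"] by (auto simp: w_dims_def)
    next
      fix i assume "i \<notin> UX" then show "g (RX i) = undefined" by (intro ge) auto
    qed
    moreover have "(\<lambda>i. g (RA i)) \<in> tups UA dA'" unfolding tups_def
    proof (rule PiE_I)
      fix i assume "i \<in> UA" then show "g (RA i) \<in> {..<dA' i}" using gx[of "RA i"] by (auto simp: w_dims_def)
    next
      fix i assume "i \<notin> UA" then show "g (RA i) = undefined" by (intro ge) auto
    qed
    moreover have "g RE \<in> ?E" using gx[of RE] ge[of RE] by (cases bE) (auto simp: w_dims_def image_iff)
    ultimately show "(\<lambda>i. g (RX i), \<lambda>i. g (RA i), g RE) \<in> tups UX N \<times> tups UA dA' \<times> ?E" by simp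
    show "F (mkw (fst (\<lambda>i. g (RX i), \<lambda>i. g (RA i), g RE)) (fst (snd (\<lambda>i. g (RX i), \<lambda>i. g (RA i), g RE))) (snd (snd (\<lambda>i. g (RX i), \<lambda>i. g (RA i), g RE)))) = F g"
      unfolding ij ..
  next
    fix p assume p: "p \<in> tups UX N \<times> tups UA dA' \<times> ?E"
    show "((\<lambda>i. mkw (fst p) (fst (snd p)) (snd (snd p)) (RX i)), (\<lambda>i. mkw (fst p) (fst (snd p)) (snd (snd p)) (RA i)), mkw (fst p) (fst (snd p)) (snd (snd p)) RE) = p"
      by (cases p) simp
    show "mkw (fst p) (fst (snd p)) (snd (snd p)) \<in> basis ?S (w_dims dA dA' N)"
      unfolding basis_def
    proof (rule PiE_I)
      fix q assume "q \<in> ?S" then show "mkw (fst p) (fst (snd p)) (snd (snd p)) q \<in> {..<w_dims dA dA' N q}"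
        using p by (auto simp: w_dims_def tups_def split: if_splits)
    next
      fix q assume q: "q \<notin> ?S"
      show "mkw (fst p) (fst (snd p)) (snd (snd p)) q = undefined"
      proof (cases q)
        case (RX i) then show ?thesis using q p PiE_arb[of "fst p" UX _ i] by (auto simp: tups_def)
      next
        case (RA i) then show ?thesis using q p PiE_arb[of "fst (snd p)" UA _ i] by (auto simp: tups_def)
      next
        case RE then show ?thesis using q p by (auto split: if_splits)
      qed
    qed
  qed
  also have "\<dots> = (\<Sum>y\<in>tups UX N. \<Sum>a\<in>tups UA dA'. \<Sum>e\<in>?E. F (mkw y a e))" by (simp add: sum.cartesian_product')
  finally show ?thesis .
qed

lemma basis_RX: assumes x: "x \<in> basis S (w_dims dA dA' N)" and U: "RX ` U \<subseteq> S" shows "(\<lambda>u\<in>U. x (RX u)) \<in> tups U N"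
proof -
  have "x (RX u) < N u" if "u \<in> U" for u
    using PiE_mem[OF x[unfolded basis_def], of "RX u"] U that by (auto simp: w_dims_def)
  then show ?thesis by (simp add: tups_def)
qed

text \<open>The classical registers contribute orthogonal blocks, so the von Neumann entropy of the reduced
  state is the Shannon entropy of the joint distribution of block label and eigenvalue index.\<close>

lemma entropy_cq:
  fixes N dA dA' :: "nat \<Rightarrow> nat" and lam :: "(nat \<Rightarrow> nat) \<Rightarrow> nat \<Rightarrow> real"
  assumes fU: "finite U" and r: "(UA = {} \<and> bE \<and> r = RE) \<or> (\<exists>j. UA = {j} \<and> \<not> bE \<and> r = RA j)"
  defines "d \<equiv> w_dims dA dA' N r" and "S \<equiv> RX ` U \<union> RA ` UA \<union> (if bE then {RE} else {})"
  assumes sp: "\<And>y. y \<in> tups U N \<Longrightarrow> spectral {..<d} (w y) (lam y) (e y)"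
    and X: "\<And>x x'. x \<in> basis S (w_dims dA dA' N) \<Longrightarrow> x' \<in> basis S (w_dims dA dA' N) \<Longrightarrow>
       X x x' = (if \<forall>u\<in>U. x (RX u) = x' (RX u) then w (\<lambda>u\<in>U. x (RX u)) (x r) (x' r) else 0)"
  shows "vn_entropy (basis S (w_dims dA dA' N)) X = shannon (tups U N \<times> {..<d}) (case_prod lam)"
proof -
  let ?B = "basis S (w_dims dA dA' N)"
  have fB: "finite ?B" unfolding S_def using fU r by (intro finite_basis) auto
  define cx where "cx = (\<lambda>x :: wreg \<Rightarrow> nat. \<lambda>u\<in>U. x (RX u))"
  have cxm: "cx x \<in> tups U N" if "x \<in> ?B" for x
    unfolding cx_def by (rule basis_RX[OF that]) (auto simp: S_def)
  have rm: "x r < d" if "x \<in> ?B" for x using that r by (auto simp: basis_def S_def d_def PiE_iff)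
  have cxeq: "cx x = cx x' \<longleftrightarrow> (\<forall>u\<in>U. x (RX u) = x' (RX u))" for x x' by (auto simp: cx_def fun_eq_iff restrict_def)
  have sumB: "(\<Sum>g\<in>?B. F (cx g) (g r)) = (\<Sum>y\<in>tups U N. \<Sum>k<d. F y k)" for F :: "_ \<Rightarrow> _ \<Rightarrow> 'v::comm_monoid_add"
  proof -
    have cm: "cx (mkw y a k) = y" if "y \<in> tups U N" for y a k
      using that by (auto simp: cx_def tups_def fun_eq_iff restrict_def PiE_def extensional_def)
    show ?thesis
    proof (cases bE)
      case True
      then have rr: "UA = {}" "r = RE" using r by auto
      have "(\<Sum>g\<in>?B. F (cx g) (g r)) = (\<Sum>y\<in>tups U N. \<Sum>a\<in>tups {} dA'. \<Sum>k<dA 0. F (cx (mkw y a k)) k)"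
        unfolding S_def sum_wreg rr using True by simp
      also have "\<dots> = (\<Sum>y\<in>tups U N. \<Sum>k<dA 0. F y k)" using cm by (intro sum.cong refl) (simp add: tups_def)
      finally show ?thesis by (simp add: d_def rr w_dims_def)
    next
      case False
      then obtain j where rr: "UA = {j}" "r = RA j" using r by auto
      have "(\<Sum>g\<in>?B. F (cx g) (g r)) = (\<Sum>y\<in>tups U N. \<Sum>a\<in>tups {j} dA'. F (cx (mkw y a undefined)) (a j))"
        unfolding S_def sum_wreg rr using False by simp
      also have "\<dots> = (\<Sum>y\<in>tups U N. \<Sum>k<dA' j. F y k)" unfolding tups_sing using cm by (intro sum.cong refl) simp
      finally show ?thesis by (simp add: d_def rr w_dims_def)
    qed
  qed
  have inj: "x = x'" if "x\<in>?B" "x'\<in>?B" "cx x = cx x'" "x r = x' r" for x x'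
  proof (rule PiE_ext[OF that(1,2)[unfolded basis_def]])
    fix q assume "q \<in> S"
    then show "x q = x' q" using that(3,4) r by (auto simp: S_def cxeq split: if_splits)
  qed
  \<comment> \<open>Eigenvectors must be labelled by basis elements: i names its block through the
    classical labels \<open>cx i\<close> and, within the block, the eigenvector number
    \<open>i r\<close>.\<close>
  define L where "L = (\<lambda>i. lam (cx i) (i r))"
  define V where "V = (\<lambda>i x. if cx i = cx x then e (cx i) (i r) (x r) else 0)"
  have sp2: "spectral ?B X L V"
    unfolding spectral_def
  proof (intro conjI ballI)
    fix i j assume i: "i\<in>?B" and j: "j\<in>?B"
    have "(\<Sum>x\<in>?B. cnj (V i x) * V j x) = (\<Sum>x\<in>?B. (\<lambda>y k. if cx i = y \<and> cx j = y then cnj (e (cx i) (i r) k) * e (cx j) (j r) k else 0) (cx x) (x r))"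
      by (intro sum.cong refl) (auto simp: V_def)
    also have "\<dots> = (\<Sum>y\<in>tups U N. \<Sum>k<d. if cx i = y \<and> cx j = y then cnj (e (cx i) (i r) k) * e (cx j) (j r) k else 0)" by (rule sumB)
    also have "\<dots> = (\<Sum>y\<in>tups U N. if y = cx i then (if cx i = cx j then ip {..<d} (e (cx i) (i r)) (e (cx j) (j r)) else 0) else 0)"
      by (intro sum.cong refl) (auto simp: ip_def)
    also have "\<dots> = (if cx i = cx j then ip {..<d} (e (cx i) (i r)) (e (cx j) (j r)) else 0)"
      using cxm[OF i] fU by (subst sum.delta) (auto simp: tups_def intro!: finite_PiE)
    also have "\<dots> = (if i = j then 1 else 0)"
    proof (cases "cx i = cx j")
      case True
      then show ?thesis using onfD[OF spectral_onf[OF _ sp[OF cxm[OF i]]], of "i r" "j r"] rm[OF i] rm[OF j] inj[OF i j] by auto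
    qed auto
    finally show "(\<Sum>x\<in>?B. cnj (V i x) * V j x) = (if i = j then 1 else 0)" .
  next
    fix x y assume x: "x\<in>?B" and y: "y\<in>?B"
    have "(\<Sum>i\<in>?B. complex_of_real (L i) * V i x * cnj (V i y))
       = (\<Sum>i\<in>?B. (\<lambda>z k. if z = cx x \<and> z = cx y then complex_of_real (lam z k) * e z k (x r) * cnj (e z k (y r)) else 0) (cx i) (i r))"
      by (intro sum.cong refl) (auto simp: L_def V_def)
    also have "\<dots> = (\<Sum>z\<in>tups U N. \<Sum>k<d. if z = cx x \<and> z = cx y then complex_of_real (lam z k) * e z k (x r) * cnj (e z k (y r)) else 0)" by (rule sumB)
    also have "\<dots> = (\<Sum>z\<in>tups U N. if z = cx x then (if cx x = cx y then \<Sum>k<d. complex_of_real (lam (cx x) k) * e (cx x) k (x r) * cnj (e (cx x) k (y r)) else 0) else 0)"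
      by (intro sum.cong refl) auto
    also have "\<dots> = (if cx x = cx y then \<Sum>k<d. complex_of_real (lam (cx x) k) * e (cx x) k (x r) * cnj (e (cx x) k (y r)) else 0)"
      using cxm[OF x] fU by (subst sum.delta) (auto simp: tups_def intro!: finite_PiE)
    also have "\<dots> = (if cx x = cx y then w (cx x) (x r) (y r) else 0)"
    proof -
      have "w (cx x) (x r) (y r) = (\<Sum>k<d. complex_of_real (lam (cx x) k) * e (cx x) k (x r) * cnj (e (cx x) k (y r)))"
        by (rule spectral_eq[OF sp[OF cxm[OF x]]]) (use rm[OF x] rm[OF y] in auto)
      then show ?thesis by (simp only:)
    qed
    also have "\<dots> = X x y" unfolding X[OF x y] cxeq by (simp add: cx_def)
    finally show "X x y = (\<Sum>i\<in>?B. complex_of_real (L i) * V i x * cnj (V i y))" by simp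
  qed
  have "vn_entropy ?B X = - (\<Sum>i\<in>?B. if L i = 0 then 0 else L i * log 2 (L i))" by (rule vn_entropy_eq[OF fB sp2])
  also have "(\<Sum>i\<in>?B. if L i = 0 then 0 else L i * log 2 (L i)) = (\<Sum>y\<in>tups U N. \<Sum>k<d. if lam y k = 0 then 0 else lam y k * log 2 (lam y k))"
    unfolding L_def by (rule sumB)
  finally show ?thesis by (simp add: shannon_def sum.cartesian_product' cong: if_cong)
qed

section \<open>Marginals of the single-letter state\<close>

locale cq_setup =
  fixes m :: nat and dA dA' N :: "nat \<Rightarrow> nat" and rho :: "(nat \<Rightarrow> nat) op"
    and Phi :: "nat \<Rightarrow> nat \<Rightarrow> (nat \<Rightarrow> nat) op \<Rightarrow> nat op"
  assumes rho: "density (basis {0..m} dA) rho"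
    and ins: "\<forall>j\<in>{1..m}. instrument (basis {j} dA) {..<dA' j} {..<N j} (Phi j)"
begin

text \<open>Matrix elements of the block of \<omega> with instrument outcomes y. It is not
  normalised: its trace is the probability of y.\<close>

definition Wl :: "(nat \<Rightarrow> nat) \<Rightarrow> (nat \<Rightarrow> nat) \<Rightarrow> nat \<Rightarrow> (nat \<Rightarrow> nat) \<Rightarrow> nat \<Rightarrow> complex" where
  "Wl y a e a' e' = apply_maps {0..m} dA (\<lambda>j. {j}) {1..m} {0} (\<lambda>j. Phi j (y j)) rho a (\<lambda>_\<in>{0}. e) a' (\<lambda>_\<in>{0}. e')"

definition wA :: "nat \<Rightarrow> (nat \<Rightarrow> nat) \<Rightarrow> nat op" where
  "wA j y = (\<lambda>b b'. \<Sum>a\<in>tups ({1..m} - {j}) dA'. \<Sum>e<dA 0. Wl y (a(j := b)) e (a(j := b')) e)"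

definition wE :: "(nat \<Rightarrow> nat) \<Rightarrow> nat op" where
  "wE y = (\<lambda>e e'. \<Sum>a\<in>tups {1..m} dA'. Wl y a e a e')"

lemma Wl_cong: assumes "\<And>j. j \<in> {1..m} \<Longrightarrow> y j = y' j" "\<And>j. j \<in> {1..m} \<Longrightarrow> a j = b j" "\<And>j. j \<in> {1..m} \<Longrightarrow> a' j = b' j"
  shows "Wl y a e a' e' = Wl y' b e b' e'"
  unfolding Wl_def apply_maps_def using assms by (intro sum.cong refl if_cong arg_cong2[of _ _ _ _ "(*)"] prod.cong) auto

lemma Wl_gram:
  assumes y: "y \<in> tups {1..m} N"
  shows "\<exists>I :: ((nat \<Rightarrow> nat) \<times> (nat \<Rightarrow> nat \<times> nat)) set. \<exists>psi. finite I \<and> (\<forall>a e a' e'. a \<in> tups {1..m} dA' \<longrightarrow> a' \<in> tups {1..m} dA' \<longrightarrow>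
     Wl y a e a' e' = (\<Sum>i\<in>I. psi i a e * cnj (psi i a' e')))"
proof -
  have fb: "finite (basis {0..m} dA)" by (rule finite_basis) simp
  have "psd (basis {0..m} dA) rho" using rho by (simp add: density_def)
  then obtain r where r: "\<And>u v. u \<in> basis {0..m} dA \<Longrightarrow> v \<in> basis {0..m} dA \<Longrightarrow> rho u v = (\<Sum>i\<in>basis {0..m} dA. r i u * cnj (r i v))"
    using psd_gramE[OF fb] by blast
  define Q where "Q = (\<lambda>j (g :: (nat \<times> nat) \<Rightarrow> (nat \<Rightarrow> nat) \<Rightarrow> nat \<Rightarrow> complex). \<forall>a\<in>basis {j} dA. \<forall>a'\<in>basis {j} dA. \<forall>x\<in>{..<dA' j}. \<forall>x'\<in>{..<dA' j}.
     Phi j (y j) (unit_op a a') x x' = (\<Sum>i\<in>{..<card (basis {j} dA)} \<times> {..<dA' j}. g i a x * cnj (g i a' x')))"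
  have "\<exists>g. Q j g" if j: "j\<in>{1..m}" for j
    unfolding Q_def
  proof (rule cp_kraus)
    have "y j \<in> {..<N j}" using y j by (auto simp: tups_def)
    then show "completely_positive (basis {j} dA) {..<dA' j} (Phi j (y j))"
      using bspec[OF ins j] unfolding instrument_def by blast
  qed (auto intro: finite_basis)
  then have "\<forall>j\<in>{1..m}. \<exists>g. Q j g" by blast
  from bchoice[OF this] obtain g where "\<forall>j\<in>{1..m}. Q j (g j)" by blast
  then have g: "\<And>j a a' x x'. j\<in>{1..m} \<Longrightarrow> a\<in>basis {j} dA \<Longrightarrow> a'\<in>basis {j} dA \<Longrightarrow> x\<in>{..<dA' j} \<Longrightarrow> x'\<in>{..<dA' j} \<Longrightarrow>
     Phi j (y j) (unit_op a a') x x' = (\<Sum>i\<in>{..<card (basis {j} dA)} \<times> {..<dA' j}. g j i a x * cnj (g j i a' x'))" unfolding Q_def by blast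
  let ?I = "basis {0..m} dA \<times> PiE {1..m} (\<lambda>j. {..<card (basis {j} dA)} \<times> {..<dA' j})"
  define psi where "psi = (\<lambda>p (a :: nat \<Rightarrow> nat) e. \<Sum>u\<in>basis {0..m} dA. if restrict u {0} = (\<lambda>_\<in>{0}. e) then r (fst p) u * (\<Prod>j\<in>{1..m}. g j (snd p j) (restrict u {j}) (a j)) else 0)"
  show ?thesis
  proof (rule exI[of _ ?I], rule exI[of _ psi], intro conjI allI impI)
    show "finite ?I" using fb by (intro finite_cartesian_product finite_PiE) auto
    fix a e a' e' assume a: "a \<in> tups {1..m} dA'" "a' \<in> tups {1..m} dA'"
    show "Wl y a e a' e' = (\<Sum>i\<in>?I. psi i a e * cnj (psi i a' e'))"
      unfolding Wl_def psi_def
    proof (rule apply_maps_gram)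
      fix j u v assume j: "j\<in>{1..m}" and uv: "u \<in> basis {0..m} dA" "v \<in> basis {0..m} dA"
      show "Phi j (y j) (unit_op (restrict u {j}) (restrict v {j})) (a j) (a' j)
        = (\<Sum>k\<in>{..<card (basis {j} dA)} \<times> {..<dA' j}. g j k (restrict u {j}) (a j) * cnj (g j k (restrict v {j}) (a' j)))"
        by (rule g[OF j]) (use uv a j in \<open>auto intro!: restrict_basis simp: tups_def\<close>)
    qed (use r in auto)
  qed
qed

lemma psd_gramI:
  assumes "\<And>b b'. b\<in>B \<Longrightarrow> b'\<in>B \<Longrightarrow> X b b' = (\<Sum>p\<in>P. g p b * cnj (g p b'))" shows "psd B X"
  by (rule gram_psd[where I=P and g=g]) (rule assms)

lemma psd_wA: assumes y: "y \<in> tups {1..m} N" and j: "j \<in> {1..m}" shows "psd {..<dA' j} (wA j y)"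
proof -
  obtain I :: "((nat \<Rightarrow> nat) \<times> (nat \<Rightarrow> nat \<times> nat)) set" and psi where
    W: "\<forall>a e a' e'. a \<in> tups {1..m} dA' \<longrightarrow> a' \<in> tups {1..m} dA' \<longrightarrow> Wl y a e a' e' = (\<Sum>i\<in>I. psi i a e * cnj (psi i a' e'))"
    using Wl_gram[OF y] by blast
  show ?thesis
  proof (rule psd_gramI[where P="tups ({1..m} - {j}) dA' \<times> {..<dA 0} \<times> I" and g="\<lambda>p b. psi (snd (snd p)) ((fst p)(j := b)) (fst (snd p))"])
    fix b b' assume b: "b \<in> {..<dA' j}" "b' \<in> {..<dA' j}"
    have "a(j := c) \<in> tups {1..m} dA'" if "a \<in> tups ({1..m} - {j}) dA'" "c < dA' j" for a c
      using that j by (auto simp: tups_def PiE_iff extensional_def)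
    then have "wA j y b b' = (\<Sum>a\<in>tups ({1..m} - {j}) dA'. \<Sum>e<dA 0. \<Sum>i\<in>I. psi i (a(j := b)) e * cnj (psi i (a(j := b')) e))"
      unfolding wA_def using W b by (intro sum.cong refl) auto
    then show "wA j y b b' = (\<Sum>p\<in>tups ({1..m} - {j}) dA' \<times> {..<dA 0} \<times> I. psi (snd (snd p)) ((fst p)(j := b)) (fst (snd p)) * cnj (psi (snd (snd p)) ((fst p)(j := b')) (fst (snd p))))"
      by (simp add: sum.cartesian_product')
  qed
qed

lemma psd_wE: assumes y: "y \<in> tups {1..m} N" shows "psd {..<dA 0} (wE y)"
proof -
  obtain I :: "((nat \<Rightarrow> nat) \<times> (nat \<Rightarrow> nat \<times> nat)) set" and psi where
    W: "\<forall>a e a' e'. a \<in> tups {1..m} dA' \<longrightarrow> a' \<in> tups {1..m} dA' \<longrightarrow> Wl y a e a' e' = (\<Sum>i\<in>I. psi i a e * cnj (psi i a' e'))"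
    using Wl_gram[OF y] by blast
  show ?thesis
  proof (rule psd_gramI[where P="tups {1..m} dA' \<times> I" and g="\<lambda>p e. psi (snd p) (fst p) e"])
    fix e e'
    have "wE y e e' = (\<Sum>a\<in>tups {1..m} dA'. \<Sum>i\<in>I. psi i a e * cnj (psi i a e'))"
      unfolding wE_def using W by (intro sum.cong refl) auto
    then show "wE y e e' = (\<Sum>p\<in>tups {1..m} dA' \<times> I. psi (snd p) (fst p) e * cnj (psi (snd p) (fst p) e'))"
      by (simp add: sum.cartesian_product')
  qed
qed

text \<open>Trace preservation of the summed instrument of player j forces the two labels of
  register j to agree, and the trace over E does the same for register 0. What remains is the trace
  of rho.\<close>

lemma Wl_total: "(\<Sum>y\<in>tups {1..m} N. \<Sum>a\<in>tups {1..m} dA'. \<Sum>e<dA 0. Wl y a e a e) = 1"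
proof -
  let ?B = "basis {0..m} dA" and ?M = "{1..m}"
  let ?ph = "\<lambda>u v j x o1. Phi j x (unit_op (restrict u {j}) (restrict v {j})) o1 o1"
  have eq: "restrict u {0} = restrict v {0} \<and> (\<forall>j\<in>?M. restrict u {j} = restrict v {j}) \<longleftrightarrow> u = v" if "u\<in>?B" "v\<in>?B" for u v
  proof
    assume h: "restrict u {0} = restrict v {0} \<and> (\<forall>j\<in>?M. restrict u {j} = restrict v {j})"
    show "u = v"
    proof (rule PiE_ext[OF that[unfolded basis_def]])
      fix i assume "i \<in> {0..m}"
      then have "restrict u {i} = restrict v {i}" using h by (cases "i = 0") auto
      then show "u i = v i" by (metis restrict_apply' singletonI)
    qed
  qed simp
  have "(\<Sum>y\<in>tups ?M N. \<Sum>a\<in>tups ?M dA'. \<Sum>e<dA 0. Wl y a e a e) = (\<Sum>y\<in>tups ?M N. \<Sum>a\<in>tups ?M dA'. \<Sum>e\<in>basis {0} dA. \<Sum>u\<in>?B. \<Sum>v\<in>?B.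
     if restrict u {0} = e \<and> restrict v {0} = e then rho u v * (\<Prod>j\<in>?M. ?ph u v j (y j) (a j)) else 0)"
    unfolding sum_basis_sing Wl_def apply_maps_def ..
  also have "\<dots> = (\<Sum>u\<in>?B. \<Sum>v\<in>?B. \<Sum>y\<in>tups ?M N. \<Sum>a\<in>tups ?M dA'. \<Sum>e\<in>basis {0} dA.
     if restrict u {0} = e \<and> restrict v {0} = e then rho u v * (\<Prod>j\<in>?M. ?ph u v j (y j) (a j)) else 0)"
    unfolding sum_swap2[where A="basis {0} dA" and D="?B" and D'="?B"] sum_swap2[where A="tups ?M dA'" and D="?B" and D'="?B"]
      sum_swap2[where A="tups ?M N" and D="?B" and D'="?B"] ..
  also have "\<dots> = (\<Sum>u\<in>?B. \<Sum>v\<in>?B. if u = v then rho u u else 0)"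
  proof (intro sum.cong refl)
    fix u v assume uv: "u\<in>?B" "v\<in>?B"
    have re: "restrict u {0} \<in> basis {0} dA" by (rule restrict_basis[OF uv(1)]) simp
    have fE: "finite (basis {0} dA)" by (rule finite_basis) simp
    have "(\<Sum>y\<in>tups ?M N. \<Sum>a\<in>tups ?M dA'. \<Sum>e\<in>basis {0} dA.
       if restrict u {0} = e \<and> restrict v {0} = e then rho u v * (\<Prod>j\<in>?M. ?ph u v j (y j) (a j)) else 0)
      = (\<Sum>y\<in>tups ?M N. \<Sum>a\<in>tups ?M dA'. \<Sum>e\<in>basis {0} dA. if e = restrict u {0} then (if restrict u {0} = restrict v {0} then rho u v * (\<Prod>j\<in>?M. ?ph u v j (y j) (a j)) else 0) else 0)"
      by (intro sum.cong refl) auto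
    also have "\<dots> = (\<Sum>y\<in>tups ?M N. \<Sum>a\<in>tups ?M dA'. if restrict u {0} = restrict v {0} then rho u v * (\<Prod>j\<in>?M. ?ph u v j (y j) (a j)) else 0)"
      using fE re by (simp add: sum.delta)
    also have "\<dots> = (if restrict u {0} = restrict v {0} then rho u v * (\<Sum>y\<in>tups ?M N. \<Sum>a\<in>tups ?M dA'. \<Prod>j\<in>?M. ?ph u v j (y j) (a j)) else 0)"
      by (simp add: sum_distrib_left)
    also have "(\<Sum>y\<in>tups ?M N. \<Sum>a\<in>tups ?M dA'. \<Prod>j\<in>?M. ?ph u v j (y j) (a j)) = (\<Sum>y\<in>tups ?M N. \<Prod>j\<in>?M. \<Sum>x<dA' j. ?ph u v j (y j) x)"
      unfolding tups_def by (intro sum.cong refl sum_PiE_prod) auto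
    also have "\<dots> = (\<Prod>j\<in>?M. \<Sum>l<N j. \<Sum>x<dA' j. ?ph u v j l x)"
      unfolding tups_def by (rule sum_PiE_prod) auto
    also have "\<dots> = (\<Prod>j\<in>?M. if restrict u {j} = restrict v {j} then 1 else 0)"
    proof (rule prod.cong[OF refl])
      fix j assume j: "j \<in> ?M"
      show "(\<Sum>l<N j. \<Sum>x<dA' j. ?ph u v j l x) = (if restrict u {j} = restrict v {j} then 1 else 0)"
        by (rule instrument_trace[OF bspec[OF ins j]]) (use uv j in \<open>auto intro!: finite_basis restrict_basis\<close>)
    qed
    also have "\<dots> = (if \<forall>j\<in>?M. restrict u {j} = restrict v {j} then 1 else 0)" by (auto intro!: prod_zero)
    also have "(if restrict u {0} = restrict v {0} then rho u v * (if \<forall>j\<in>?M. restrict u {j} = restrict v {j} then 1 else 0) else 0) = (if u = v then rho u u else 0)"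
    proof -
      have F: "(if A then c * (if C then 1 else 0) else 0) = (if A \<and> C then c else 0)" for A C and c :: complex by simp
      show ?thesis unfolding F eq[OF uv] by simp
    qed
    finally show "(\<Sum>y\<in>tups ?M N. \<Sum>a\<in>tups ?M dA'. \<Sum>e\<in>basis {0} dA.
       if restrict u {0} = e \<and> restrict v {0} = e then rho u v * (\<Prod>j\<in>?M. ?ph u v j (y j) (a j)) else 0) = (if u = v then rho u u else 0)" .
  qed
  also have "\<dots> = op_trace ?B rho" unfolding op_trace_def using finite_basis[of "{0..m}" dA] by (simp add: sum.delta')
  finally show ?thesis using rho by (simp add: density_def)
qed

lemma wE_total: "(\<Sum>y\<in>tups {1..m} N. op_trace {..<dA 0} (wE y)) = 1"
  unfolding Wl_total[symmetric] op_trace_def wE_def by (intro sum.cong refl sum.swap)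

lemma sum_tups_upd: assumes "j \<in> M" shows "(\<Sum>b<D j. \<Sum>a\<in>tups (M - {j}) D. F (a(j := b))) = (\<Sum>a\<in>tups M D. F a)"
proof -
  have "insert j (M - {j}) = M" using assms by auto
  then show ?thesis using sum_PiE_insert[of j "M - {j}" F "\<lambda>i. {..<D i}"] unfolding tups_def by simp
qed

lemma wA_total: assumes "j \<in> {1..m}" shows "(\<Sum>y\<in>tups {1..m} N. op_trace {..<dA' j} (wA j y)) = 1"
  unfolding Wl_total[symmetric] op_trace_def wA_def
  using sum_tups_upd[OF assms, of "\<lambda>a. \<Sum>e<dA 0. Wl _ a e a e" dA'] by simp

lemma omega_mkw: assumes "\<And>i. i\<in>{1..m} \<Longrightarrow> y i = y' i"
  shows "omega_cq m dA Phi rho (mkw y a e) (mkw y' a' e') = Wl y a e a' e'"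
  using assms unfolding omega_cq_def Wl_def by simp

lemma omega_mkw0: assumes "i\<in>{1..m}" "y i \<noteq> y' i"
  shows "omega_cq m dA Phi rho (mkw y a e) (mkw y' a' e') = 0"
  using assms unfolding omega_cq_def by auto

lemma merge_mkw: "merge (RX ` U \<union> RA ` UA \<union> (if bE then {RE} else {})) x (mkw y a e)
   = mkw (\<lambda>i. if i \<in> U then x (RX i) else y i) (\<lambda>i. if i \<in> UA then x (RA i) else a i) (if bE then x RE else e)"
  by (auto simp: merge_def mkw_def fun_eq_iff split: wreg.split)

text \<open>S is written with a trivial conditional to fit the shape of \<open>sum_wreg\<close> and
  \<open>entropy_cq\<close>. The traced-out classical labels are summed, and differing labels that
  are kept give zero.\<close>

lemma ptrace_A:
  assumes U: "U \<subseteq> {1..m}" and j: "j \<in> {1..m}"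
  defines "S \<equiv> RX ` U \<union> RA ` {j} \<union> (if False then {RE} else {})"
  assumes x: "x \<in> basis S (w_dims dA dA' N)" and x': "x' \<in> basis S (w_dims dA dA' N)"
  shows "ptrace (w_regs m) (w_dims dA dA' N) S (omega_cq m dA Phi rho) x x'
    = (if \<forall>u\<in>U. x (RX u) = x' (RX u) then marg_op (tups {1..m} N) U (wA j) (\<lambda>u\<in>U. x (RX u)) (x (RA j)) (x' (RA j)) else 0)"
proof -
  have c: "w_regs m - S = RX ` ({1..m} - U) \<union> RA ` ({1..m} - {j}) \<union> (if True then {RE} else {})"
    using U j by (auto simp: w_regs_def S_def)
  have pt: "ptrace (w_regs m) (w_dims dA dA' N) S (omega_cq m dA Phi rho) x x' = (\<Sum>y\<in>tups ({1..m} - U) N. \<Sum>a\<in>tups ({1..m} - {j}) dA'. \<Sum>e<dA 0.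
     omega_cq m dA Phi rho (merge S x (mkw y a e)) (merge S x' (mkw y a e)))"
    unfolding ptrace_def c sum_wreg by simp
  show ?thesis
  proof (cases "\<forall>u\<in>U. x (RX u) = x' (RX u)")
    case False
    then obtain u where u: "u\<in>U" "x (RX u) \<noteq> x' (RX u)" by blast
    have "omega_cq m dA Phi rho (merge S x (mkw y a e)) (merge S x' (mkw y a e)) = 0" for y a e
      unfolding S_def merge_mkw by (rule omega_mkw0[of u]) (use u U in auto)
    then show ?thesis unfolding pt by (simp only: False if_False) simp
  next
    case True
    let ?y0 = "\<lambda>u\<in>U. x (RX u)"
    have y0: "?y0 \<in> tups U N" by (rule basis_RX[OF x]) (auto simp: S_def)
    have "omega_cq m dA Phi rho (merge S x (mkw y a e)) (merge S x' (mkw y a e))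
      = Wl (\<lambda>i. if i \<in> U then ?y0 i else y i) (a(j := x (RA j))) e (a(j := x' (RA j))) e" for y a e
    proof -
      have "omega_cq m dA Phi rho (merge S x (mkw y a e)) (merge S x' (mkw y a e))
        = Wl (\<lambda>i. if i \<in> U then x (RX i) else y i) (\<lambda>i. if i \<in> {j} then x (RA i) else a i) e (\<lambda>i. if i \<in> {j} then x' (RA i) else a i) e"
        unfolding S_def merge_mkw using True by (subst omega_mkw) auto
      also have "\<dots> = Wl (\<lambda>i. if i \<in> U then ?y0 i else y i) (a(j := x (RA j))) e (a(j := x' (RA j))) e"
        by (rule Wl_cong) auto
      finally show ?thesis .
    qed
    then show ?thesis unfolding pt marg_op_def sum_tups_fix[OF U y0] wA_def using True by simp
  qed
qed

lemma ptrace_E: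
  assumes U: "U \<subseteq> {1..m}"
  defines "S \<equiv> RX ` U \<union> RA ` {} \<union> (if True then {RE} else {})"
  assumes x: "x \<in> basis S (w_dims dA dA' N)" and x': "x' \<in> basis S (w_dims dA dA' N)"
  shows "ptrace (w_regs m) (w_dims dA dA' N) S (omega_cq m dA Phi rho) x x'
    = (if \<forall>u\<in>U. x (RX u) = x' (RX u) then marg_op (tups {1..m} N) U wE (\<lambda>u\<in>U. x (RX u)) (x RE) (x' RE) else 0)"
proof -
  have c: "w_regs m - S = RX ` ({1..m} - U) \<union> RA ` {1..m} \<union> (if False then {RE} else {})"
    using U by (auto simp: w_regs_def S_def)
  have pt: "ptrace (w_regs m) (w_dims dA dA' N) S (omega_cq m dA Phi rho) x x' = (\<Sum>y\<in>tups ({1..m} - U) N. \<Sum>a\<in>tups {1..m} dA'.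
     omega_cq m dA Phi rho (merge S x (mkw y a undefined)) (merge S x' (mkw y a undefined)))"
    unfolding ptrace_def c sum_wreg by simp
  show ?thesis
  proof (cases "\<forall>u\<in>U. x (RX u) = x' (RX u)")
    case False
    then obtain u where u: "u\<in>U" "x (RX u) \<noteq> x' (RX u)" by blast
    have "omega_cq m dA Phi rho (merge S x (mkw y a e)) (merge S x' (mkw y a e)) = 0" for y a e
      unfolding S_def merge_mkw by (rule omega_mkw0[of u]) (use u U in auto)
    then show ?thesis unfolding pt by (simp only: False if_False) simp
  next
    case True
    let ?y0 = "\<lambda>u\<in>U. x (RX u)"
    have y0: "?y0 \<in> tups U N" by (rule basis_RX[OF x]) (auto simp: S_def)
    have "omega_cq m dA Phi rho (merge S x (mkw y a e)) (merge S x' (mkw y a e))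
      = Wl (\<lambda>i. if i \<in> U then ?y0 i else y i) a (x RE) a (x' RE)" for y a e
    proof -
      have "omega_cq m dA Phi rho (merge S x (mkw y a e)) (merge S x' (mkw y a e))
        = Wl (\<lambda>i. if i \<in> U then x (RX i) else y i) a (x RE) a (x' RE)"
        unfolding S_def merge_mkw using True by (subst omega_mkw) auto
      also have "\<dots> = Wl (\<lambda>i. if i \<in> U then ?y0 i else y i) a (x RE) a (x' RE)" by (rule Wl_cong) auto
      finally show ?thesis .
    qed
    then show ?thesis unfolding pt marg_op_def sum_tups_fix[OF U y0] wE_def using True by simp
  qed
qed

lemma entropy_A:
  assumes U: "U \<subseteq> {1..m}" and j: "j \<in> {1..m}"
    and sp: "\<And>y. y \<in> tups U N \<Longrightarrow> spectral {..<dA' j} (marg_op (tups {1..m} N) U (wA j) y) (lam y) (e y)"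
  shows "subsys_entropy (w_regs m) (w_dims dA dA' N) (omega_cq m dA Phi rho) (RX ` U \<union> {RA j}) = shannon (tups U N \<times> {..<dA' j}) (case_prod lam)"
proof -
  have S: "RX ` U \<union> {RA j} = RX ` U \<union> RA ` {j} \<union> (if False then {RE} else {})" by simp
  have d: "w_dims dA dA' N (RA j) = dA' j" by (simp add: w_dims_def)
  show ?thesis unfolding subsys_entropy_def S
    by (rule entropy_cq[where r="RA j" and dA=dA and dA'=dA' and N=N, unfolded d, OF _ _ sp ptrace_A[OF U j]]) (use U finite_subset in auto)
qed

lemma entropy_E:
  assumes U: "U \<subseteq> {1..m}"
    and sp: "\<And>y. y \<in> tups U N \<Longrightarrow> spectral {..<dA 0} (marg_op (tups {1..m} N) U wE y) (lam y) (e y)"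
  shows "subsys_entropy (w_regs m) (w_dims dA dA' N) (omega_cq m dA Phi rho) (RX ` U \<union> {RE}) = shannon (tups U N \<times> {..<dA 0}) (case_prod lam)"
proof -
  have S: "RX ` U \<union> {RE} = RX ` U \<union> RA ` {} \<union> (if True then {RE} else {})" by simp
  have d: "w_dims dA dA' N RE = dA 0" by (simp add: w_dims_def)
  show ?thesis unfolding subsys_entropy_def S
    by (rule entropy_cq[where r=RE and dA=dA and dA'=dA' and N=N, unfolded d, OF _ _ sp ptrace_E[OF U]]) (use U finite_subset in auto)
qed

end

section \<open>Block-length structure of the protocol state\<close>

lemma sum_PiE_rename:
  "(\<Sum>e\<in>PiE ({0::nat} \<times> {..<n}) (\<lambda>_. B). G (\<lambda>t\<in>{..<n}. e (0, t))) = (\<Sum>s\<in>PiE {..<n} (\<lambda>_. B). G s)"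
proof (rule sum.reindex_bij_witness[where i="\<lambda>s. \<lambda>p\<in>{0} \<times> {..<n}. s (snd p)" and j="\<lambda>e. \<lambda>t\<in>{..<n}. e (0, t)"])
  fix e assume e: "e \<in> PiE ({0::nat} \<times> {..<n}) (\<lambda>_. B)"
  show "(\<lambda>p\<in>{0} \<times> {..<n}. (\<lambda>t\<in>{..<n}. e (0, t)) (snd p)) = e"
  proof (rule ext)
    fix p show "(\<lambda>p\<in>{0} \<times> {..<n}. (\<lambda>t\<in>{..<n}. e (0, t)) (snd p)) p = e p"
      using PiE_arb[OF e, of p] by (cases p; cases "p \<in> {0} \<times> {..<n}") auto
  qed
  show "(\<lambda>t\<in>{..<n}. e (0, t)) \<in> PiE {..<n} (\<lambda>_. B)" using e by (auto simp: PiE_iff)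
next
  fix s assume s: "s \<in> PiE {..<n} (\<lambda>_. B)"
  show "(\<lambda>t\<in>{..<n}. (\<lambda>p\<in>{0} \<times> {..<n}. s (snd p)) (0, t)) = s"
  proof (rule ext)
    fix t show "(\<lambda>t\<in>{..<n}. (\<lambda>p\<in>{0} \<times> {..<n}. s (snd p)) (0, t)) t = s t" using PiE_arb[OF s, of t] by (cases "t < n") auto
  qed
  show "(\<lambda>p\<in>{0} \<times> {..<n}. s (snd p)) \<in> PiE ({0} \<times> {..<n}) (\<lambda>_. B)" using s by (auto simp: PiE_iff)
qed simp

lemma eve_basis_eq: "eve_basis dA n = PiE ({0} \<times> {..<n}) (\<lambda>_. {..<dA 0})"
  unfolding eve_basis_def basis_def dims_n_def by (rule PiE_cong) auto

lemma sum_srcs_split: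
  assumes "i \<in> M"
  shows "(\<Sum>a\<in>srcs M D n. F a) = (\<Sum>b\<in>PiE {..<n} (\<lambda>_. {..<D i}). \<Sum>a\<in>srcs (M - {i}) D n. F (a(i := b)))"
proof -
  have "insert i (M - {i}) = M" using assms by auto
  then show ?thesis unfolding srcs_def using sum_PiE_insert[of i "M - {i}" F] by simp
qed

context cq_setup
begin

abbreviation "M \<equiv> {1..m}"

definition Wn :: "nat \<Rightarrow> (nat \<Rightarrow> nat \<Rightarrow> nat) \<Rightarrow> (nat \<Rightarrow> nat \<Rightarrow> nat) \<Rightarrow> (nat \<times> nat \<Rightarrow> nat) \<Rightarrow> (nat \<Rightarrow> nat \<Rightarrow> nat) \<Rightarrow> (nat \<times> nat \<Rightarrow> nat) \<Rightarrow> complex" where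
  "Wn n x a e a' e' = (\<Prod>t<n. Wl (colm n M x t) (colm n M a t) (e (0, t)) (colm n M a' t) (e' (0, t)))"

lemma Wn_gram:
  assumes x: "x \<in> srcs M N n"
  shows "\<exists>I :: (nat \<Rightarrow> (nat \<Rightarrow> nat) \<times> (nat \<Rightarrow> nat \<times> nat)) set. \<exists>psi. finite I \<and> (\<forall>a e a' e'. a \<in> srcs M dA' n \<longrightarrow> a' \<in> srcs M dA' n \<longrightarrow>
     Wn n x a e a' e' = (\<Sum>i\<in>I. psi i a e * cnj (psi i a' e')))"
proof -
  define Q where "Q = (\<lambda>t (q :: ((nat \<Rightarrow> nat) \<times> (nat \<Rightarrow> nat \<times> nat)) set \<times> (((nat \<Rightarrow> nat) \<times> (nat \<Rightarrow> nat \<times> nat)) \<Rightarrow> (nat \<Rightarrow> nat) \<Rightarrow> nat \<Rightarrow> complex)). finite (fst q) \<and> (\<forall>a e a' e'. a \<in> tups M dA' \<longrightarrow> a' \<in> tups M dA' \<longrightarrow>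
     Wl (colm n M x t) a e a' e' = (\<Sum>i\<in>fst q. snd q i a e * cnj (snd q i a' e'))))"
  have "\<exists>q. Q t q" if t: "t < n" for t
  proof -
    have "colm n M x t \<in> tups M N" using colm_mem[OF x subset_refl] t by auto
    from Wl_gram[OF this] obtain I psi where "Q t (I, psi)" unfolding Q_def fst_conv snd_conv by blast
    then show ?thesis by blast
  qed
  then have "\<forall>t\<in>{..<n}. \<exists>q. Q t q" by simp
  from bchoice[OF this] obtain q where q: "\<forall>t\<in>{..<n}. Q t (q t)" by blast
  let ?I = "PiE {..<n} (\<lambda>t. fst (q t))"
  show ?thesis
  proof (rule exI[of _ ?I], rule exI[of _ "\<lambda>i a e. \<Prod>t<n. snd (q t) (i t) (colm n M a t) (e (0, t))"], intro conjI allI impI)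
    show "finite ?I" using q by (intro finite_PiE) (auto simp: Q_def)
    fix a e a' e' assume a: "a \<in> srcs M dA' n" "a' \<in> srcs M dA' n"
    have "Wn n x a e a' e' = (\<Prod>t<n. \<Sum>i\<in>fst (q t). snd (q t) i (colm n M a t) (e (0,t)) * cnj (snd (q t) i (colm n M a' t) (e' (0,t))))"
      unfolding Wn_def
    proof (rule prod.cong[OF refl])
      fix t assume t: "t \<in> {..<n}"
      have "colm n M a t \<in> tups M dA'" "colm n M a' t \<in> tups M dA'"
        using PiE_mem[OF colm_mem[OF a(1) subset_refl] t] PiE_mem[OF colm_mem[OF a(2) subset_refl] t] by auto
      then show "Wl (colm n M x t) (colm n M a t) (e (0,t)) (colm n M a' t) (e' (0,t))
        = (\<Sum>i\<in>fst (q t). snd (q t) i (colm n M a t) (e (0,t)) * cnj (snd (q t) i (colm n M a' t) (e' (0,t))))"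
        using bspec[OF q t] unfolding Q_def by blast
    qed
    also have "\<dots> = (\<Sum>i\<in>?I. \<Prod>t<n. snd (q t) (i t) (colm n M a t) (e (0,t)) * cnj (snd (q t) (i t) (colm n M a' t) (e' (0,t))))"
      by (rule sum_PiE_prod[symmetric]) (use q in \<open>auto simp: Q_def\<close>)
    finally show "Wn n x a e a' e' = (\<Sum>i\<in>?I. (\<Prod>t<n. snd (q t) (i t) (colm n M a t) (e (0, t))) * cnj (\<Prod>t<n. snd (q t) (i t) (colm n M a' t) (e' (0, t))))"
      unfolding prod.distrib cnj_prod .
  qed
qed

text \<open>The sum over the other players' outputs and E is a sum over independent letters, so it
  passes through the product over time.\<close>

lemma Wn_marg_A:
  assumes i: "i \<in> M"
  shows "(\<Sum>a\<in>srcs (M - {i}) dA' n. \<Sum>e\<in>eve_basis dA n. Wn n x (a(i := b)) e (a(i := b')) e) = prod_op n (wA i) x M b b'"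
proof -
  let ?T = "{..<n}"
  define h where "h = (\<lambda>t (p :: (nat \<Rightarrow> nat) \<times> nat). Wl (\<lambda>i\<in>M. x i t) ((fst p)(i := b t)) (snd p) ((fst p)(i := b' t)) (snd p))"
  have W: "Wn n x (a(i := b)) e (a(i := b')) e = (\<Prod>t<n. h t (colm n (M - {i}) a t, (\<lambda>t\<in>?T. e (0,t)) t))" for a e
    unfolding Wn_def
  proof (rule prod.cong[OF refl])
    fix t assume t: "t \<in> ?T"
    show "Wl (colm n M x t) (colm n M (a(i := b)) t) (e (0,t)) (colm n M (a(i := b')) t) (e (0,t)) = h t (colm n (M - {i}) a t, (\<lambda>t\<in>?T. e (0,t)) t)"
    proof -
      have "h t (colm n (M - {i}) a t, (\<lambda>t\<in>?T. e (0,t)) t) = Wl (\<lambda>i\<in>M. x i t) ((colm n (M - {i}) a t)(i := b t)) (e (0,t)) ((colm n (M - {i}) a t)(i := b' t)) (e (0,t))"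
        using t by (simp add: h_def)
      also have "\<dots> = Wl (colm n M x t) (colm n M (a(i := b)) t) (e (0,t)) (colm n M (a(i := b')) t) (e (0,t))"
        using t by (intro Wl_cong) (auto simp: colm_def)
      finally show ?thesis by simp
    qed
  qed
  have "(\<Sum>a\<in>srcs (M - {i}) dA' n. \<Sum>e\<in>eve_basis dA n. Wn n x (a(i := b)) e (a(i := b')) e)
    = (\<Sum>s\<in>PiE ?T (\<lambda>_. tups (M - {i}) dA'). \<Sum>r\<in>PiE ?T (\<lambda>_. {..<dA 0}). \<Prod>t<n. h t (s t, r t))"
    unfolding W eve_basis_eq sum_colm
    by (intro sum.cong refl) (rule sum_PiE_rename[where G="\<lambda>r. \<Prod>t<n. h t (colm n (M - {i}) _ t, r t)"])
  also have "\<dots> = (\<Sum>s\<in>PiE ?T (\<lambda>_. tups (M - {i}) dA' \<times> {..<dA 0}). \<Prod>t<n. h t (s t))"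
    unfolding sum_PiE_Times by (intro sum.cong refl prod.cong) auto
  also have "\<dots> = (\<Prod>t<n. \<Sum>p\<in>tups (M - {i}) dA' \<times> {..<dA 0}. h t p)"
    by (rule sum_PiE_prod) (auto simp: tups_def intro!: finite_PiE)
  also have "\<dots> = prod_op n (wA i) x M b b'"
    unfolding prod_op_def wA_def h_def sum.cartesian_product' by simp
  finally show ?thesis .
qed

lemma Wn_marg_E:
  "(\<Sum>a\<in>srcs M dA' n. Wn n x a e a e') = prod_opE n wE x M e e'"
proof -
  have "(\<Sum>a\<in>srcs M dA' n. Wn n x a e a e') = (\<Sum>s\<in>PiE {..<n} (\<lambda>_. tups M dA'). \<Prod>t<n. Wl (colm n M x t) (s t) (e (0,t)) (s t) (e' (0,t)))"
    unfolding Wn_def by (rule sum_colm[symmetric])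
  also have "\<dots> = (\<Prod>t<n. \<Sum>a\<in>tups M dA'. Wl (colm n M x t) a (e (0,t)) a (e' (0,t)))"
    by (rule sum_PiE_prod) (auto simp: tups_def intro!: finite_PiE)
  also have "\<dots> = (\<Prod>t<n. wE (\<lambda>i\<in>M. x i t) (e (0,t)) (e' (0,t)))"
    unfolding wE_def by (intro prod.cong refl) (simp add: colm_apply)
  also have "\<dots> = prod_opE n wE x M e e'" unfolding prod_opE_def
    by (rule prod.reindex_bij_witness[where j="\<lambda>t. (0,t)" and i=snd]) auto
  finally show ?thesis .
qed

abbreviation "An n j \<equiv> PiE {..<n} (\<lambda>_. {..<dA' j})"

text \<open>The unnormalised state of E^n when the words are x and the measurements
  \<open>DD j\<close> yield the keys kk: the trace of the n-letter state against the tensor product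
  of the POVM elements.\<close>

definition Zx :: "nat \<Rightarrow> (nat \<Rightarrow> nat \<Rightarrow> nat) \<Rightarrow> (nat \<Rightarrow> nat \<Rightarrow> (nat \<Rightarrow> nat) op) \<Rightarrow> (nat \<Rightarrow> nat) \<Rightarrow> (nat \<times> nat \<Rightarrow> nat) op" where
  "Zx n x DD kk = (\<lambda>e e'. \<Sum>a\<in>srcs M dA' n. \<Sum>a'\<in>srcs M dA' n. Wn n x a e a' e' * (\<Prod>j\<in>M. DD j (kk j) (a' j) (a j)))"

lemma Zx_psd:
  assumes x: "x \<in> srcs M N n" and DD: "\<And>j. j \<in> M \<Longrightarrow> psd (An n j) (DD j (kk j))"
  shows "psd E (Zx n x DD kk)"
proof -
  obtain I :: "(nat \<Rightarrow> (nat \<Rightarrow> nat) \<times> (nat \<Rightarrow> nat \<times> nat)) set" and psi where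
    W: "\<forall>a e a' e'. a \<in> srcs M dA' n \<longrightarrow> a' \<in> srcs M dA' n \<longrightarrow> Wn n x a e a' e' = (\<Sum>i\<in>I. psi i a e * cnj (psi i a' e'))"
    using Wn_gram[OF x] by blast
  have fAn: "finite (An n j)" for j by (intro finite_PiE) auto
  define Q where "Q = (\<lambda>j (g :: (nat \<Rightarrow> nat) \<Rightarrow> (nat \<Rightarrow> nat) \<Rightarrow> complex). \<forall>b\<in>An n j. \<forall>b'\<in>An n j. DD j (kk j) b b' = (\<Sum>i\<in>An n j. g i b * cnj (g i b')))"
  have "\<exists>g. Q j g" if j: "j \<in> M" for j
    by (rule psd_gramE[OF fAn DD[OF j]]) (unfold Q_def, blast)
  then have "\<forall>j\<in>M. \<exists>g. Q j g" by blast
  from bchoice[OF this] obtain g where g: "\<forall>j\<in>M. Q j (g j)" by blast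
  have am: "a j \<in> An n j" if "a \<in> srcs M dA' n" "j \<in> M" for a j using that unfolding srcs_def by auto
  let ?K = "PiE M (\<lambda>j. An n j)"
  define h where "h = (\<lambda>p e. \<Sum>a\<in>srcs M dA' n. psi (fst p) a e * (\<Prod>j\<in>M. cnj (g j (snd p j) (a j))))"
  show ?thesis
  proof (rule psd_gramI[where P="I \<times> ?K" and g=h])
    fix e e'
    have D: "(\<Prod>j\<in>M. DD j (kk j) (a' j) (a j)) = (\<Sum>p\<in>?K. (\<Prod>j\<in>M. cnj (g j (p j) (a j))) * cnj (\<Prod>j\<in>M. cnj (g j (p j) (a' j))))"
      if a: "a \<in> srcs M dA' n" "a' \<in> srcs M dA' n" for a a'
    proof -
      have "(\<Prod>j\<in>M. DD j (kk j) (a' j) (a j)) = (\<Prod>j\<in>M. \<Sum>i\<in>An n j. cnj (g j i (a j)) * g j i (a' j))"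
        using g am[OF a(1)] am[OF a(2)] unfolding Q_def by (intro prod.cong refl) (simp add: mult.commute)
      also have "\<dots> = (\<Sum>p\<in>?K. \<Prod>j\<in>M. cnj (g j (p j) (a j)) * g j (p j) (a' j))"
        by (rule sum_PiE_prod[symmetric]) (use fAn in auto)
      finally show ?thesis by (simp add: prod.distrib cnj_prod)
    qed
    have "Zx n x DD kk e e' = (\<Sum>a\<in>srcs M dA' n. \<Sum>a'\<in>srcs M dA' n. \<Sum>q\<in>I \<times> ?K.
        (psi (fst q) a e * (\<Prod>j\<in>M. cnj (g j (snd q j) (a j)))) * cnj (psi (fst q) a' e' * (\<Prod>j\<in>M. cnj (g j (snd q j) (a' j)))))"
      unfolding Zx_def
    proof (intro sum.cong refl)
      fix a a' assume a: "a \<in> srcs M dA' n" "a' \<in> srcs M dA' n"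
      have "Wn n x a e a' e' * (\<Prod>j\<in>M. DD j (kk j) (a' j) (a j)) = (\<Sum>i\<in>I. psi i a e * cnj (psi i a' e')) * (\<Sum>p\<in>?K. (\<Prod>j\<in>M. cnj (g j (p j) (a j))) * cnj (\<Prod>j\<in>M. cnj (g j (p j) (a' j))))"
        using W a D[OF a] by simp
      then show "Wn n x a e a' e' * (\<Prod>j\<in>M. DD j (kk j) (a' j) (a j)) = (\<Sum>q\<in>I \<times> ?K.
        (psi (fst q) a e * (\<Prod>j\<in>M. cnj (g j (snd q j) (a j)))) * cnj (psi (fst q) a' e' * (\<Prod>j\<in>M. cnj (g j (snd q j) (a' j)))))"
        unfolding sum_product sum.cartesian_product' by (simp add: mult_ac)
    qed
    also have "\<dots> = (\<Sum>q\<in>I \<times> ?K. h q e * cnj (h q e'))"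
      unfolding sum_swap2[where A="I \<times> ?K", symmetric] h_def cnj_sum sum_product ..
    finally show "Zx n x DD kk e e' = (\<Sum>q\<in>I \<times> ?K. h q e * cnj (h q e'))" .
  qed
qed

lemma sum_Zx:
  assumes fK: "finite A" and K: "A = PiE M C" and fC: "\<And>j. j\<in>M \<Longrightarrow> finite (C j)"
  shows "(\<Sum>kk\<in>A. Zx n x DD kk e e') = (\<Sum>a\<in>srcs M dA' n. \<Sum>a'\<in>srcs M dA' n. Wn n x a e a' e' * (\<Prod>j\<in>M. \<Sum>k\<in>C j. DD j k (a' j) (a j)))"
proof -
  have "(\<Sum>kk\<in>A. Zx n x DD kk e e') = (\<Sum>a\<in>srcs M dA' n. \<Sum>a'\<in>srcs M dA' n. \<Sum>kk\<in>PiE M C. Wn n x a e a' e' * (\<Prod>j\<in>M. DD j (kk j) (a' j) (a j)))"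
    unfolding Zx_def K by (rule sum_swap2)
  also have "\<dots> = (\<Sum>a\<in>srcs M dA' n. \<Sum>a'\<in>srcs M dA' n. Wn n x a e a' e' * (\<Prod>j\<in>M. \<Sum>k\<in>C j. DD j k (a' j) (a j)))"
    unfolding sum_distrib_left[symmetric] by (intro sum.cong refl arg_cong2[of _ _ _ _ "(*)"] sum_PiE_prod) (use fC in auto)
  finally show ?thesis .
qed

lemma prod_indicator: "finite A \<Longrightarrow> (\<Prod>j\<in>A. if P j then 1 else 0 :: complex) = (if \<forall>j\<in>A. P j then 1 else 0)"
  by (induction A rule: finite_induct) auto

text \<open>Forgetting all keys replaces every POVM by the identity, so the measurements do not
  disturb the state of E.\<close>

lemma Zx_total:
  assumes comp: "\<And>j b b'. j \<in> M \<Longrightarrow> b \<in> An n j \<Longrightarrow> b' \<in> An n j \<Longrightarrow> (\<Sum>k<Kc. DD j k b b') = (if b = b' then 1 else 0)"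
  shows "(\<Sum>kk\<in>PiE M (\<lambda>_. {..<Kc::nat}). Zx n x DD kk e e') = prod_opE n wE x M e e'"
proof -
  have fs: "finite (srcs M dA' n)" by (rule finite_srcs) simp
  have "(\<Sum>kk\<in>PiE M (\<lambda>_. {..<Kc}). Zx n x DD kk e e') = (\<Sum>a\<in>srcs M dA' n. \<Sum>a'\<in>srcs M dA' n. Wn n x a e a' e' * (\<Prod>j\<in>M. \<Sum>k<Kc. DD j k (a' j) (a j)))"
    by (rule sum_Zx) (auto intro!: finite_PiE)
  also have "\<dots> = (\<Sum>a\<in>srcs M dA' n. \<Sum>a'\<in>srcs M dA' n. if a' = a then Wn n x a e a e' else 0)"
  proof (intro sum.cong refl)
    fix a a' assume a: "a \<in> srcs M dA' n" "a' \<in> srcs M dA' n"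
    have "(\<Prod>j\<in>M. \<Sum>k<Kc. DD j k (a' j) (a j)) = (\<Prod>j\<in>M. if a' j = a j then 1 else 0)"
      using a unfolding srcs_def by (intro prod.cong refl comp) auto
    also have "\<dots> = (if \<forall>j\<in>M. a' j = a j then 1 else 0)" by (rule prod_indicator) simp
    also have "(\<forall>j\<in>M. a' j = a j) \<longleftrightarrow> a' = a"
    proof
      assume "\<forall>j\<in>M. a' j = a j"
      then show "a' = a" by (intro PiE_ext[OF a(2)[unfolded srcs_def] a(1)[unfolded srcs_def]]) auto
    qed simp
    finally show "Wn n x a e a' e' * (\<Prod>j\<in>M. \<Sum>k<Kc. DD j k (a' j) (a j)) = (if a' = a then Wn n x a e a e' else 0)" by simp
  qed
  also have "\<dots> = (\<Sum>a\<in>srcs M dA' n. Wn n x a e a e')" using fs by simp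
  finally show ?thesis unfolding Wn_marg_E .
qed

text \<open>Completeness of the other players' POVMs and the trace over E leave a single-player
  expression: the success statistics of player i depend only on its own marginal.\<close>

lemma Zx_marginal:
  assumes comp: "\<And>j b b'. j \<in> M \<Longrightarrow> b \<in> An n j \<Longrightarrow> b' \<in> An n j \<Longrightarrow> (\<Sum>k<Kc. DD j k b b') = (if b = b' then 1 else 0)"
    and i: "i \<in> M" and \<kappa>: "\<kappa> < Kc"
  shows "(\<Sum>kk\<in>{kk \<in> PiE M (\<lambda>_. {..<Kc::nat}). kk i = \<kappa>}. op_trace (eve_basis dA n) (Zx n x DD kk))
    = (\<Sum>b\<in>An n i. \<Sum>b'\<in>An n i. prod_op n (wA i) x M b b' * DD i \<kappa> b' b)"
proof -
  let ?E = "eve_basis dA n" and ?S = "srcs (M - {i}) dA' n"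
  let ?C = "\<lambda>j. if j = i then {\<kappa>} else {..<Kc}"
  have fS: "finite ?S" by (rule finite_srcs) simp
  have K: "{kk \<in> PiE M (\<lambda>_. {..<Kc}). kk i = \<kappa>} = PiE M ?C"
  proof (intro set_eqI iffI)
    fix kk assume kk: "kk \<in> PiE M ?C"
    have c: "kk j \<in> ?C j" if "j \<in> M" for j by (rule PiE_mem[OF kk that])
    have "kk i = \<kappa>" using c[OF i] by simp
    moreover have "kk \<in> PiE M (\<lambda>_. {..<Kc})"
    proof (rule PiE_I)
      fix j assume "j \<in> M" then show "kk j \<in> {..<Kc}" using c[of j] \<kappa> by (cases "j = i") auto
    next
      fix j assume "j \<notin> M" then show "kk j = undefined" by (rule PiE_arb[OF kk])
    qed
    ultimately show "kk \<in> {kk \<in> PiE M (\<lambda>_. {..<Kc}). kk i = \<kappa>}" by simp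
  qed (auto simp: PiE_iff)
  have finA: "finite {kk \<in> PiE M (\<lambda>_. {..<Kc}). kk i = \<kappa>}" unfolding K by (intro finite_PiE) auto
  have "(\<Sum>kk\<in>{kk \<in> PiE M (\<lambda>_. {..<Kc}). kk i = \<kappa>}. op_trace ?E (Zx n x DD kk))
     = (\<Sum>e\<in>?E. \<Sum>a\<in>srcs M dA' n. \<Sum>a'\<in>srcs M dA' n. Wn n x a e a' e * (\<Prod>j\<in>M. \<Sum>k\<in>?C j. DD j k (a' j) (a j)))"
    unfolding op_trace_def by (subst sum.swap, rule sum.cong[OF refl], rule sum_Zx[OF finA K]) auto
  \<comment> \<open>Summing over the other players' keys makes their factors Kronecker deltas, so
    the outputs a and a' coincide away from i.\<close>
  also have "\<dots> = (\<Sum>e\<in>?E. \<Sum>b\<in>An n i. \<Sum>a\<in>?S. \<Sum>b'\<in>An n i. \<Sum>a'\<in>?S. if a' = a then Wn n x (a(i := b)) e (a(i := b')) e * DD i \<kappa> b' b else 0)"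
    unfolding sum_srcs_split[OF i]
  proof (intro sum.cong refl)
    fix e b a b' a' assume b: "b \<in> An n i" "b' \<in> An n i" and a: "a \<in> ?S" "a' \<in> ?S"
    have "(\<Prod>j\<in>M. \<Sum>k\<in>?C j. DD j k ((a'(i := b')) j) ((a(i := b)) j))
      = (\<Sum>k\<in>?C i. DD i k ((a'(i := b')) i) ((a(i := b)) i)) * (\<Prod>j\<in>M - {i}. \<Sum>k\<in>?C j. DD j k ((a'(i := b')) j) ((a(i := b)) j))"
      by (rule prod.remove) (use i in auto)
    also have "(\<Prod>j\<in>M - {i}. \<Sum>k\<in>?C j. DD j k ((a'(i := b')) j) ((a(i := b)) j)) = (\<Prod>j\<in>M - {i}. if a' j = a j then 1 else 0)"
    proof (rule prod.cong[OF refl])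
      fix j assume j: "j \<in> M - {i}"
      have "a' j \<in> An n j" "a j \<in> An n j"
        by (rule PiE_mem[OF a(2)[unfolded srcs_def] j], rule PiE_mem[OF a(1)[unfolded srcs_def] j])
      then show "(\<Sum>k\<in>?C j. DD j k ((a'(i := b')) j) ((a(i := b)) j)) = (if a' j = a j then 1 else 0)"
        using j comp[of j "a' j" "a j"] by simp
    qed
    also have "\<dots> = (if \<forall>j\<in>M - {i}. a' j = a j then 1 else 0)" by (rule prod_indicator) simp
    also have "(\<forall>j\<in>M - {i}. a' j = a j) \<longleftrightarrow> a' = a"
    proof
      assume "\<forall>j\<in>M - {i}. a' j = a j"
      then show "a' = a" by (intro PiE_ext[OF a(2)[unfolded srcs_def] a(1)[unfolded srcs_def]]) auto
    qed simp
    finally show "Wn n x (a(i := b)) e (a'(i := b')) e * (\<Prod>j\<in>M. \<Sum>k\<in>?C j. DD j k ((a'(i := b')) j) ((a(i := b)) j))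
      = (if a' = a then Wn n x (a(i := b)) e (a(i := b')) e * DD i \<kappa> b' b else 0)" by auto
  qed
  also have "\<dots> = (\<Sum>e\<in>?E. \<Sum>b\<in>An n i. \<Sum>a\<in>?S. \<Sum>b'\<in>An n i. Wn n x (a(i := b)) e (a(i := b')) e * DD i \<kappa> b' b)"
    using fS by simp
  also have "\<dots> = (\<Sum>e\<in>?E. \<Sum>b\<in>An n i. \<Sum>b'\<in>An n i. \<Sum>a\<in>?S. Wn n x (a(i := b)) e (a(i := b')) e * DD i \<kappa> b' b)"
    by (rule sum.cong[OF refl], rule sum.cong[OF refl], rule sum.swap)
  also have "\<dots> = (\<Sum>b\<in>An n i. \<Sum>b'\<in>An n i. \<Sum>e\<in>?E. \<Sum>a\<in>?S. Wn n x (a(i := b)) e (a(i := b')) e * DD i \<kappa> b' b)"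
    by (rule sum_swap2)
  also have "\<dots> = (\<Sum>b\<in>An n i. \<Sum>b'\<in>An n i. (\<Sum>a\<in>?S. \<Sum>e\<in>?E. Wn n x (a(i := b)) e (a(i := b')) e) * DD i \<kappa> b' b)"
    unfolding sum_distrib_right by (rule sum.cong[OF refl], rule sum.cong[OF refl], rule sum.swap)
  finally show ?thesis unfolding Wn_marg_A[OF i] .
qed

end

section \<open>The n-letter instruments\<close>

lemma sum_basis_pow:
  fixes R :: "nat set"
  shows "(\<Sum>u\<in>basis (R \<times> {..<n}) (dims_n dA). F (\<lambda>t\<in>{..<n}. restrict (\<lambda>i. u (i, t)) R)) = (\<Sum>s\<in>PiE {..<n} (\<lambda>_. basis R dA). F s)"
proof (rule sum.reindex_bij_witness[where i="\<lambda>s. \<lambda>p\<in>R \<times> {..<n}. s (snd p) (fst p)" and j="\<lambda>u. \<lambda>t\<in>{..<n}. restrict (\<lambda>i. u (i, t)) R"])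
  fix u assume u: "u \<in> basis (R \<times> {..<n}) (dims_n dA)"
  show "(\<lambda>p\<in>R \<times> {..<n}. (\<lambda>t\<in>{..<n}. restrict (\<lambda>i. u (i, t)) R) (snd p) (fst p)) = u"
  proof (rule ext)
    fix p show "(\<lambda>p\<in>R \<times> {..<n}. (\<lambda>t\<in>{..<n}. restrict (\<lambda>i. u (i, t)) R) (snd p) (fst p)) p = u p"
      using PiE_arb[OF u[unfolded basis_def], of p] by (cases p; cases "p \<in> R \<times> {..<n}") auto
  qed
  show "(\<lambda>t\<in>{..<n}. restrict (\<lambda>i. u (i, t)) R) \<in> PiE {..<n} (\<lambda>_. basis R dA)"
    using PiE_mem[OF u[unfolded basis_def]] unfolding basis_def by (fastforce simp: dims_n_def)
next
  fix s assume s: "s \<in> PiE {..<n} (\<lambda>_. basis R dA)"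
  show "(\<lambda>t\<in>{..<n}. restrict (\<lambda>i. (\<lambda>p\<in>R \<times> {..<n}. s (snd p) (fst p)) (i, t)) R) = s"
  proof (rule ext)
    fix t
    have "restrict (s t) R = s t" if "t < n" using PiE_mem[OF s, of t] that unfolding basis_def by (simp add: PiE_restrict)
    moreover have "restrict (\<lambda>i. (\<lambda>p\<in>R \<times> {..<n}. s (snd p) (fst p)) (i, t)) R = restrict (s t) R" if "t < n" using that by auto
    ultimately show "(\<lambda>t\<in>{..<n}. restrict (\<lambda>i. (\<lambda>p\<in>R \<times> {..<n}. s (snd p) (fst p)) (i, t)) R) t = s t"
      using PiE_arb[OF s, of t] by (cases "t < n") simp_all
  qed
  show "(\<lambda>p\<in>R \<times> {..<n}. s (snd p) (fst p)) \<in> basis (R \<times> {..<n}) (dims_n dA)"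
    unfolding basis_def
  proof (rule PiE_I)
    fix p assume "p \<in> R \<times> {..<n}"
    then show "(\<lambda>p\<in>R \<times> {..<n}. s (snd p) (fst p)) p \<in> {..<dims_n dA p}"
      using PiE_mem[OF PiE_mem[OF s, unfolded basis_def], of "snd p" "fst p"] by (auto simp: dims_n_def)
  qed simp
qed simp

text \<open>The protocol numbers a player's output basis by naturals; the bijections
  \<open>bt j\<close> decode such a number into the player's own word and its quantum
  output.\<close>

lemma sum_PiE_split:
  assumes bt: "\<And>j. j \<in> M \<Longrightarrow> bij_betw (bt j) {..<dout j} (X j \<times> A j)"
  shows "(\<Sum>ou\<in>PiE M (\<lambda>j. {..<dout j}). G (\<lambda>j\<in>M. fst (bt j (ou j))) (\<lambda>j\<in>M. snd (bt j (ou j)))) = (\<Sum>x\<in>PiE M X. \<Sum>a\<in>PiE M A. G x a)"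
proof -
  let ?iv = "\<lambda>j. inv_into {..<dout j} (bt j)"
  have iv: "?iv j p \<in> {..<dout j}" "bt j (?iv j p) = p" if "j\<in>M" "p \<in> X j \<times> A j" for j p
    using bij_betw_apply[OF bij_betw_inv_into[OF bt[OF that(1)]] that(2)] bij_betw_inv_into_right[OF bt[OF that(1)] that(2)] by auto
  have "(\<Sum>ou\<in>PiE M (\<lambda>j. {..<dout j}). G (\<lambda>j\<in>M. fst (bt j (ou j))) (\<lambda>j\<in>M. snd (bt j (ou j))))
    = (\<Sum>p\<in>PiE M X \<times> PiE M A. G (fst p) (snd p))"
  proof (rule sum.reindex_bij_witness[where i="\<lambda>p. \<lambda>j\<in>M. ?iv j (fst p j, snd p j)" and j="\<lambda>ou. (\<lambda>j\<in>M. fst (bt j (ou j)), \<lambda>j\<in>M. snd (bt j (ou j)))"])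
    fix ou assume ou: "ou \<in> PiE M (\<lambda>j. {..<dout j})"
    show "(\<lambda>j\<in>M. ?iv j (fst (\<lambda>j\<in>M. fst (bt j (ou j)), \<lambda>j\<in>M. snd (bt j (ou j))) j, snd (\<lambda>j\<in>M. fst (bt j (ou j)), \<lambda>j\<in>M. snd (bt j (ou j))) j)) = ou"
    proof (rule ext)
      fix j show "(\<lambda>j\<in>M. ?iv j (fst (\<lambda>j\<in>M. fst (bt j (ou j)), \<lambda>j\<in>M. snd (bt j (ou j))) j, snd (\<lambda>j\<in>M. fst (bt j (ou j)), \<lambda>j\<in>M. snd (bt j (ou j))) j)) j = ou j"
        using PiE_arb[OF ou, of j] bij_betw_inv_into_left[OF bt, of j "ou j"] PiE_mem[OF ou, of j] by (cases "j \<in> M") auto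
    qed
    have "bt j (ou j) \<in> X j \<times> A j" if "j \<in> M" for j using bij_betw_apply[OF bt[OF that] PiE_mem[OF ou that]] .
    then show "(\<lambda>j\<in>M. fst (bt j (ou j)), \<lambda>j\<in>M. snd (bt j (ou j))) \<in> PiE M X \<times> PiE M A" by (auto simp: mem_Times_iff)
  next
    fix p assume p: "p \<in> PiE M X \<times> PiE M A"
    have pj: "(fst p j, snd p j) \<in> X j \<times> A j" if "j\<in>M" for j using p that by (auto simp: mem_Times_iff)
    show "(\<lambda>j\<in>M. fst (bt j ((\<lambda>j\<in>M. ?iv j (fst p j, snd p j)) j)), \<lambda>j\<in>M. snd (bt j ((\<lambda>j\<in>M. ?iv j (fst p j, snd p j)) j))) = p"
    proof -
      have "(\<lambda>j\<in>M. fst (bt j ((\<lambda>j\<in>M. ?iv j (fst p j, snd p j)) j))) = fst p"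
      proof (rule ext)
        fix j show "(\<lambda>j\<in>M. fst (bt j ((\<lambda>j\<in>M. ?iv j (fst p j, snd p j)) j))) j = fst p j"
          using iv(2)[OF _ pj] PiE_arb[of "fst p" M X j] p by (cases "j\<in>M") (auto simp: mem_Times_iff)
      qed
      moreover have "(\<lambda>j\<in>M. snd (bt j ((\<lambda>j\<in>M. ?iv j (fst p j, snd p j)) j))) = snd p"
      proof (rule ext)
        fix j show "(\<lambda>j\<in>M. snd (bt j ((\<lambda>j\<in>M. ?iv j (fst p j, snd p j)) j))) j = snd p j"
          using iv(2)[OF _ pj] PiE_arb[of "snd p" M A j] p by (cases "j\<in>M") (auto simp: mem_Times_iff)
      qed
      ultimately show ?thesis by (simp add: prod_eq_iff)
    qed
    show "(\<lambda>j\<in>M. ?iv j (fst p j, snd p j)) \<in> PiE M (\<lambda>j. {..<dout j})" using iv(1)[OF _ pj] by auto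
  qed simp
  then show ?thesis by (simp add: sum.cartesian_product')
qed

lemma linear_map_sum:
  "linear_map B C (\<lambda>X x y. if P x y then \<Sum>u\<in>B. \<Sum>v\<in>B. X u v * T u v x y else 0)"
  unfolding linear_map_def
proof (intro conjI allI ballI impI)
  fix X Y :: "'a op" and c x y
  show "(if P x y then \<Sum>u\<in>B. \<Sum>v\<in>B. (c * X u v + Y u v) * T u v x y else 0)
    = c * (if P x y then \<Sum>u\<in>B. \<Sum>v\<in>B. X u v * T u v x y else 0) + (if P x y then \<Sum>u\<in>B. \<Sum>v\<in>B. Y u v * T u v x y else 0)"
    by (simp add: distrib_right sum.distrib sum_distrib_left mult.assoc)
next
  fix X Y :: "'a op" and x y
  assume "\<forall>a\<in>B. \<forall>b\<in>B. X a b = Y a b"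
  then have "(\<Sum>u\<in>B. \<Sum>v\<in>B. X u v * T u v x y) = (\<Sum>u\<in>B. \<Sum>v\<in>B. Y u v * T u v x y)" by (intro sum.cong refl) auto
  then show "(if P x y then \<Sum>u\<in>B. \<Sum>v\<in>B. X u v * T u v x y else 0) = (if P x y then \<Sum>u\<in>B. \<Sum>v\<in>B. Y u v * T u v x y else 0)" by simp
qed

context cq_setup
begin

abbreviation "Xn n j \<equiv> PiE {..<n} (\<lambda>_. {..<N j})"
abbreviation "Bj n j \<equiv> basis ({j} \<times> {..<n}) (dims_n dA)"

definition kerN :: "nat \<Rightarrow> nat \<Rightarrow> (nat \<Rightarrow> nat) \<Rightarrow> (nat \<times> nat \<Rightarrow> nat) \<Rightarrow> (nat \<times> nat \<Rightarrow> nat) \<Rightarrow> (nat \<Rightarrow> nat) \<Rightarrow> (nat \<Rightarrow> nat) \<Rightarrow> complex" where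
  "kerN n j x u v a a' = (\<Prod>t<n. Phi j (x t) (unit_op (\<lambda>i\<in>{j}. u (i, t)) (\<lambda>i\<in>{j}. v (i, t))) (a t) (a' t))"

text \<open>The letterwise instrument whose broadcast outcome is only the bin of the word. The word
  itself stays in the output, block diagonally, because the player decodes with it.\<close>

definition PhiN :: "nat \<Rightarrow> (nat \<Rightarrow> nat \<Rightarrow> (nat \<Rightarrow> nat) \<times> (nat \<Rightarrow> nat)) \<Rightarrow> (nat \<Rightarrow> (nat \<Rightarrow> nat) \<Rightarrow> nat) \<Rightarrow> nat \<Rightarrow> nat \<Rightarrow> (nat \<times> nat \<Rightarrow> nat) op \<Rightarrow> nat op" where
  "PhiN n bt f j l X p q = (if fst (bt j p) = fst (bt j q) \<and> f j (fst (bt j p)) = l then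
     \<Sum>u\<in>Bj n j. \<Sum>v\<in>Bj n j. X u v * kerN n j (fst (bt j p)) u v (snd (bt j p)) (snd (bt j q)) else 0)"

lemma finite_Bj: "finite (Bj n j)" by (rule finite_basis) simp

lemma PhiN_unit:
  assumes u: "u \<in> Bj n j" and v: "v \<in> Bj n j"
  shows "PhiN n bt f j l (unit_op u v) p q = (if fst (bt j p) = fst (bt j q) \<and> f j (fst (bt j p)) = l then kerN n j (fst (bt j p)) u v (snd (bt j p)) (snd (bt j q)) else 0)"
proof -
  let ?k = "\<lambda>u v. kerN n j (fst (bt j p)) u v (snd (bt j p)) (snd (bt j q))"
  have "(\<Sum>a\<in>Bj n j. \<Sum>b\<in>Bj n j. unit_op u v a b * ?k a b) = (\<Sum>a\<in>Bj n j. if a = u then (\<Sum>b\<in>Bj n j. if b = v then ?k u v else 0) else 0)"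
    unfolding unit_op_def by (intro sum.cong refl) (auto intro!: sum.cong)
  also have "\<dots> = ?k u v" using u v finite_Bj by simp
  finally show ?thesis unfolding PhiN_def by (simp only:)
qed

lemma kerN_gram:
  assumes x: "x \<in> Xn n j" and j: "j \<in> M"
  shows "\<exists>K :: (nat \<Rightarrow> nat \<times> nat) set. \<exists>g. finite K \<and> (\<forall>u\<in>Bj n j. \<forall>v\<in>Bj n j. \<forall>a\<in>An n j. \<forall>a'\<in>An n j.
     kerN n j x u v a a' = (\<Sum>k\<in>K. g k u a * cnj (g k v a')))"
proof -
  let ?K1 = "{..<card (basis {j} dA)} \<times> {..<dA' j}"
  define Q where "Q = (\<lambda>t (g :: (nat \<times> nat) \<Rightarrow> (nat \<Rightarrow> nat) \<Rightarrow> nat \<Rightarrow> complex). \<forall>a\<in>basis {j} dA. \<forall>a'\<in>basis {j} dA. \<forall>y\<in>{..<dA' j}. \<forall>y'\<in>{..<dA' j}.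
     Phi j (x t) (unit_op a a') y y' = (\<Sum>i\<in>?K1. g i a y * cnj (g i a' y')))"
  have "\<exists>g. Q t g" if t: "t \<in> {..<n}" for t
    unfolding Q_def
  proof (rule cp_kraus)
    show "completely_positive (basis {j} dA) {..<dA' j} (Phi j (x t))"
      using bspec[OF ins j] PiE_mem[OF x t] unfolding instrument_def by blast
  qed (auto intro: finite_basis)
  then have "\<forall>t\<in>{..<n}. \<exists>g. Q t g" by blast
  from bchoice[OF this] obtain g where g: "\<forall>t\<in>{..<n}. Q t (g t)" by blast
  let ?K = "PiE {..<n} (\<lambda>_. ?K1)"
  show ?thesis
  proof (rule exI[of _ ?K], rule exI[of _ "\<lambda>k u a. \<Prod>t<n. g t (k t) (\<lambda>i\<in>{j}. u (i, t)) (a t)"], intro conjI ballI)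
    show "finite ?K" by (intro finite_PiE) auto
    fix u v a a' assume uv: "u\<in>Bj n j" "v\<in>Bj n j" and a: "a\<in>An n j" "a'\<in>An n j"
    have ub: "(\<lambda>i\<in>{j}. w (i, t)) \<in> basis {j} dA" if "w \<in> Bj n j" "t \<in> {..<n}" for w t
      using PiE_mem[OF that(1)[unfolded basis_def], of "(j, t)"] that(2) by (auto simp: basis_def dims_n_def)
    have "kerN n j x u v a a' = (\<Prod>t<n. \<Sum>i\<in>?K1. g t i (\<lambda>i\<in>{j}. u (i, t)) (a t) * cnj (g t i (\<lambda>i\<in>{j}. v (i, t)) (a' t)))"
      unfolding kerN_def
    proof (rule prod.cong[OF refl])
      fix t assume t: "t \<in> {..<n}"
      show "Phi j (x t) (unit_op (\<lambda>i\<in>{j}. u (i, t)) (\<lambda>i\<in>{j}. v (i, t))) (a t) (a' t) = (\<Sum>i\<in>?K1. g t i (\<lambda>i\<in>{j}. u (i, t)) (a t) * cnj (g t i (\<lambda>i\<in>{j}. v (i, t)) (a' t)))"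
        using bspec[OF g t] ub[OF uv(1) t] ub[OF uv(2) t] PiE_mem[OF a(1) t] PiE_mem[OF a(2) t] unfolding Q_def by blast
    qed
    also have "\<dots> = (\<Sum>k\<in>?K. \<Prod>t<n. g t (k t) (\<lambda>i\<in>{j}. u (i, t)) (a t) * cnj (g t (k t) (\<lambda>i\<in>{j}. v (i, t)) (a' t)))"
      by (rule sum_PiE_prod[symmetric]) auto
    finally show "kerN n j x u v a a' = (\<Sum>k\<in>?K. (\<Prod>t<n. g t (k t) (\<lambda>i\<in>{j}. u (i, t)) (a t)) * cnj (\<Prod>t<n. g t (k t) (\<lambda>i\<in>{j}. v (i, t)) (a' t)))"
      unfolding prod.distrib cnj_prod .
  qed
qed

lemma kerN_trace:
  assumes j: "j \<in> M" and u: "u \<in> Bj n j" and v: "v \<in> Bj n j"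
  shows "(\<Sum>x\<in>Xn n j. \<Sum>a\<in>An n j. kerN n j x u v a a) = (if u = v then 1 else 0)"
proof -
  have "(\<Sum>x\<in>Xn n j. \<Sum>a\<in>An n j. kerN n j x u v a a) = (\<Sum>x\<in>Xn n j. \<Prod>t<n. \<Sum>b<dA' j. Phi j (x t) (unit_op (\<lambda>i\<in>{j}. u (i, t)) (\<lambda>i\<in>{j}. v (i, t))) b b)"
    unfolding kerN_def by (intro sum.cong refl sum_PiE_prod) auto
  also have "\<dots> = (\<Prod>t<n. \<Sum>y<N j. \<Sum>b<dA' j. Phi j y (unit_op (\<lambda>i\<in>{j}. u (i, t)) (\<lambda>i\<in>{j}. v (i, t))) b b)"
    by (rule sum_PiE_prod) auto
  also have "\<dots> = (\<Prod>t<n. if (\<lambda>i\<in>{j}. u (i, t)) = (\<lambda>i\<in>{j}. v (i, t)) then 1 else 0)"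
  proof (rule prod.cong[OF refl])
    fix t assume t: "t \<in> {..<n}"
    show "(\<Sum>y<N j. \<Sum>b<dA' j. Phi j y (unit_op (\<lambda>i\<in>{j}. u (i, t)) (\<lambda>i\<in>{j}. v (i, t))) b b) = (if (\<lambda>i\<in>{j}. u (i, t)) = (\<lambda>i\<in>{j}. v (i, t)) then 1 else 0)"
    proof (rule instrument_trace[OF bspec[OF ins j]])
      show "finite (basis {j} dA)" by (rule finite_basis) simp
      show "(\<lambda>i\<in>{j}. u (i, t)) \<in> basis {j} dA"
        using PiE_mem[OF u[unfolded basis_def], of "(j, t)"] t by (auto simp: basis_def dims_n_def)
    qed
  qed
  also have "\<dots> = (if \<forall>t\<in>{..<n}. (\<lambda>i\<in>{j}. u (i, t)) = (\<lambda>i\<in>{j}. v (i, t)) then 1 else 0)" by (rule prod_indicator) simp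
  also have "(\<forall>t\<in>{..<n}. (\<lambda>i\<in>{j}. u (i, t)) = (\<lambda>i\<in>{j}. v (i, t))) \<longleftrightarrow> u = v"
  proof
    assume h: "\<forall>t\<in>{..<n}. (\<lambda>i\<in>{j}. u (i, t)) = (\<lambda>i\<in>{j}. v (i, t))"
    show "u = v"
    proof (rule PiE_ext[OF u[unfolded basis_def] v[unfolded basis_def]])
      fix p assume "p \<in> {j} \<times> {..<n}"
      then have "snd p \<in> {..<n}" "p = (j, snd p)" by auto
      then show "u p = v p" using fun_cong[OF bspec[OF h, of "snd p"], of j] by (metis restrict_apply' singletonI)
    qed
  qed simp
  finally show ?thesis .
qed

text \<open>For a fixed word the map is a product of completely positive maps; message l adds up the
  words of one bin, each in its own output block. Over all messages every word occurs once, and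
  \<open>kerN_trace\<close> gives trace preservation.\<close>

lemma PhiN_instrument:
  assumes j: "j \<in> M" and bt: "bij_betw (bt j) {..<dout j} (Xn n j \<times> An n j)"
    and f: "f j \<in> PiE (Xn n j) (\<lambda>_. {..<Mb j})"
  shows "instrument (Bj n j) {..<dout j} {..<Mb j} (PhiN n bt f j)"
  unfolding instrument_def
proof (intro conjI ballI)
  fix l
  show "completely_positive (Bj n j) {..<dout j} (PhiN n bt f j l)"
    unfolding completely_positive_def
  proof (intro conjI allI impI)
    show "linear_map (Bj n j) {..<dout j} (PhiN n bt f j l)" unfolding PhiN_def[abs_def] by (rule linear_map_sum)
    fix k :: nat and X :: "(nat \<times> (nat \<times> nat \<Rightarrow> nat)) op" assume "psd ({..<k} \<times> Bj n j) X"
    then obtain G where G: "\<And>p q. p \<in> {..<k} \<times> Bj n j \<Longrightarrow> q \<in> {..<k} \<times> Bj n j \<Longrightarrow> X p q = (\<Sum>i\<in>{..<k} \<times> Bj n j. G i p * cnj (G i q))"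
      using psd_gramE[of "{..<k} \<times> Bj n j" X] finite_Bj by blast
    define Q where "Q = (\<lambda>x (q :: (nat \<Rightarrow> nat \<times> nat) set \<times> ((nat \<Rightarrow> nat \<times> nat) \<Rightarrow> (nat \<times> nat \<Rightarrow> nat) \<Rightarrow> (nat \<Rightarrow> nat) \<Rightarrow> complex)). finite (fst q) \<and> (\<forall>u\<in>Bj n j. \<forall>v\<in>Bj n j. \<forall>a\<in>An n j. \<forall>a'\<in>An n j.
       kerN n j x u v a a' = (\<Sum>i\<in>fst q. snd q i u a * cnj (snd q i v a'))))"
    have "\<exists>q. Q x q" if x: "x \<in> Xn n j" for x
    proof -
      from kerN_gram[OF x j] obtain K g where "Q x (K, g)" unfolding Q_def fst_conv snd_conv by blast
      then show ?thesis by blast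
    qed
    then have "\<forall>x\<in>Xn n j. \<exists>q. Q x q" by blast
    from bchoice[OF this] obtain q where q: "\<forall>x\<in>Xn n j. Q x (q x)" by blast
    let ?X = "{x\<in>Xn n j. f j x = l}"
    have fX: "finite ?X" by (rule finite_subset[of _ "Xn n j"]) (auto intro!: finite_PiE)
    let ?P = "\<lambda>x. ({..<k} \<times> Bj n j) \<times> fst (q x)"
    \<comment> \<open>Gram vectors of the input pushed through the Kraus operators of word
      x.\<close>
    define h where "h = (\<lambda>x r p. \<Sum>u\<in>Bj n j. G (fst r) (fst p, u) * snd (q x) (snd r) u (snd (bt j (snd p))))"
    show "psd ({..<k} \<times> {..<dout j}) (ext_anc (PhiN n bt f j l) X)"
    proof (rule psd_cong[THEN iffD2])
      show "psd ({..<k} \<times> {..<dout j}) (\<lambda>p p'. \<Sum>x\<in>?X. \<Sum>r\<in>?P x. (if fst (bt j (snd p)) = x then h x r p else 0) * cnj (if fst (bt j (snd p')) = x then h x r p' else 0))"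
        by (intro psd_sum[OF fX] psd_gramI) (rule refl)
      fix p p' assume p: "p \<in> {..<k} \<times> {..<dout j}" "p' \<in> {..<k} \<times> {..<dout j}"
      have btp: "bt j (snd p) \<in> Xn n j \<times> An n j" "bt j (snd p') \<in> Xn n j \<times> An n j"
        using bij_betw_apply[OF bt, of "snd p"] bij_betw_apply[OF bt, of "snd p'"] p by auto
      let ?x = "fst (bt j (snd p))" and ?a = "snd (bt j (snd p))" and ?x' = "fst (bt j (snd p'))" and ?a' = "snd (bt j (snd p'))"
      have ext: "ext_anc (PhiN n bt f j l) X p p' = (if ?x = ?x' \<and> f j ?x = l then \<Sum>u\<in>Bj n j. \<Sum>v\<in>Bj n j. X (fst p, u) (fst p', v) * kerN n j ?x u v ?a ?a' else 0)"
        by (simp only: ext_anc_def PhiN_def case_prod_beta)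
      have ker: "(\<Sum>u\<in>Bj n j. \<Sum>v\<in>Bj n j. X (fst p, u) (fst p', v) * kerN n j ?x u v ?a ?a') = (\<Sum>r\<in>?P ?x. h ?x r p * cnj (h ?x r p'))" if e: "?x = ?x'"
      proof -
        have "(\<Sum>u\<in>Bj n j. \<Sum>v\<in>Bj n j. X (fst p, u) (fst p', v) * kerN n j ?x u v ?a ?a')
          = (\<Sum>u\<in>Bj n j. \<Sum>v\<in>Bj n j. \<Sum>r\<in>?P ?x. (G (fst r) (fst p, u) * snd (q ?x) (snd r) u ?a) * cnj (G (fst r) (fst p', v) * snd (q ?x) (snd r) v ?a'))"
        proof (intro sum.cong refl)
          fix u v assume uv: "u \<in> Bj n j" "v \<in> Bj n j"
          have "X (fst p, u) (fst p', v) = (\<Sum>i\<in>{..<k} \<times> Bj n j. G i (fst p, u) * cnj (G i (fst p', v)))"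
            by (rule G) (use p uv in auto)
          moreover have "kerN n j ?x u v ?a ?a' = (\<Sum>i\<in>fst (q ?x). snd (q ?x) i u ?a * cnj (snd (q ?x) i v ?a'))"
          proof -
            have "?x \<in> Xn n j" "?a \<in> An n j" "?a' \<in> An n j" using btp by (auto simp: mem_Times_iff)
            then show ?thesis using q uv unfolding Q_def by blast
          qed
          ultimately show "X (fst p, u) (fst p', v) * kerN n j ?x u v ?a ?a'
             = (\<Sum>r\<in>?P ?x. (G (fst r) (fst p, u) * snd (q ?x) (snd r) u ?a) * cnj (G (fst r) (fst p', v) * snd (q ?x) (snd r) v ?a'))"
            by (simp add: sum_product sum.cartesian_product mult_ac case_prod_unfold)
        qed
        also have "\<dots> = (\<Sum>r\<in>?P ?x. h ?x r p * cnj (h ?x r p'))"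
          unfolding sum_swap2[where A="?P ?x", symmetric] h_def cnj_sum sum_product using e by simp
        finally show ?thesis .
      qed
      have "(\<Sum>x\<in>?X. \<Sum>r\<in>?P x. (if ?x = x then h x r p else 0) * cnj (if ?x' = x then h x r p' else 0))
        = (\<Sum>x\<in>?X. if x = ?x then (if ?x = ?x' then \<Sum>r\<in>?P ?x. h ?x r p * cnj (h ?x r p') else 0) else 0)"
        by (intro sum.cong refl) auto
      also have "\<dots> = (if ?x = ?x' \<and> f j ?x = l then \<Sum>r\<in>?P ?x. h ?x r p * cnj (h ?x r p') else 0)"
        using fX btp by (subst sum.delta) (auto simp: mem_Times_iff)
      finally have fin: "(\<Sum>x\<in>?X. \<Sum>r\<in>?P x. (if ?x = x then h x r p else 0) * cnj (if ?x' = x then h x r p' else 0))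
        = (if ?x = ?x' \<and> f j ?x = l then \<Sum>r\<in>?P ?x. h ?x r p * cnj (h ?x r p') else 0)" .
      show "ext_anc (PhiN n bt f j l) X p p' = (\<Sum>x\<in>?X. \<Sum>r\<in>?P x. (if ?x = x then h x r p else 0) * cnj (if ?x' = x then h x r p' else 0))"
        unfolding ext fin by (rule if_cong[OF refl ker refl]) (elim conjE)
    qed
  qed
next
  show "trace_preserving (Bj n j) {..<dout j} (\<lambda>X x y. \<Sum>l<Mb j. PhiN n bt f j l X x y)"
    unfolding trace_preserving_def
  proof
    fix X :: "(nat \<times> nat \<Rightarrow> nat) op"
    have "op_trace {..<dout j} (\<lambda>x y. \<Sum>l<Mb j. PhiN n bt f j l X x y) = (\<Sum>p<dout j. (\<lambda>(x,a). \<Sum>u\<in>Bj n j. \<Sum>v\<in>Bj n j. X u v * kerN n j x u v a a) (bt j p))"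
      unfolding op_trace_def
    proof (rule sum.cong[OF refl])
      fix p assume p: "p \<in> {..<dout j}"
      have "fst (bt j p) \<in> Xn n j" using bij_betw_apply[OF bt p] by (auto simp: mem_Times_iff)
      then have fl: "f j (fst (bt j p)) \<in> {..<Mb j}" using f by auto
      let ?s = "\<Sum>u\<in>Bj n j. \<Sum>v\<in>Bj n j. X u v * kerN n j (fst (bt j p)) u v (snd (bt j p)) (snd (bt j p))"
      have "(\<Sum>l<Mb j. PhiN n bt f j l X p p) = (\<Sum>l<Mb j. if l = f j (fst (bt j p)) then ?s else 0)"
        by (intro sum.cong refl) (auto simp: PhiN_def)
      also have "\<dots> = ?s" using fl by simp
      finally show "(\<Sum>l<Mb j. PhiN n bt f j l X p p) = (\<lambda>(x,a). \<Sum>u\<in>Bj n j. \<Sum>v\<in>Bj n j. X u v * kerN n j x u v a a) (bt j p)"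
        by (simp add: case_prod_unfold)
    qed
    also have "\<dots> = (\<Sum>(x,a)\<in>Xn n j \<times> An n j. \<Sum>u\<in>Bj n j. \<Sum>v\<in>Bj n j. X u v * kerN n j x u v a a)"
      by (rule sum.reindex_bij_betw[OF bt])
    also have "\<dots> = (\<Sum>u\<in>Bj n j. \<Sum>v\<in>Bj n j. X u v * (\<Sum>x\<in>Xn n j. \<Sum>a\<in>An n j. kerN n j x u v a a))"
      unfolding sum.cartesian_product[symmetric] sum_distrib_left
      unfolding sum_swap2[where A="An n j" and D="Bj n j" and D'="Bj n j"]
      by (rule sum_swap2)
    also have "\<dots> = (\<Sum>u\<in>Bj n j. \<Sum>v\<in>Bj n j. if v = u then X u u else 0)"
      using kerN_trace[OF j] by (intro sum.cong refl) auto
    also have "\<dots> = op_trace (Bj n j) X" unfolding op_trace_def using finite_Bj by simp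
    finally show "op_trace {..<dout j} (\<lambda>x y. \<Sum>l<Mb j. PhiN n bt f j l X x y) = op_trace (Bj n j) X" .
  qed
qed simp

text \<open>Both the input and the kernels are products over the copies, so the sum over register
  labels factorises once these are regrouped by time. Different words on the two sides, or a word
  outside the announced bin, give zero.\<close>

lemma apply_maps_pow:
  fixes bt :: "nat \<Rightarrow> nat \<Rightarrow> (nat \<Rightarrow> nat) \<times> (nat \<Rightarrow> nat)" and ou ou' :: "nat \<Rightarrow> nat"
  assumes e: "e \<in> eve_basis dA n" "e' \<in> eve_basis dA n"
  defines "x \<equiv> \<lambda>j. fst (bt j (ou j))" and "a \<equiv> \<lambda>j. snd (bt j (ou j))" and "x' \<equiv> \<lambda>j. fst (bt j (ou' j))" and "a' \<equiv> \<lambda>j. snd (bt j (ou' j))"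
  shows "apply_maps ({0..m} \<times> {..<n}) (dims_n dA) (\<lambda>j. {j} \<times> {..<n}) M ({0} \<times> {..<n}) (\<lambda>j. PhiN n bt f j (l j)) (tensor_pow {0..m} n rho) ou e ou' e'
    = (if \<forall>j\<in>M. x j = x' j \<and> f j (x j) = l j then Wn n x a e a' e' else 0)"
proof -
  let ?R = "{0..m}" and ?T = "{..<n}"
  let ?B = "basis (?R \<times> ?T) (dims_n dA)"
  define sl where "sl = (\<lambda>u :: nat \<times> nat \<Rightarrow> nat. \<lambda>t\<in>?T. restrict (\<lambda>i. u (i, t)) ?R)"
  define C where "C \<longleftrightarrow> (\<forall>j\<in>M. x j = x' j \<and> f j (x j) = l j)"
  define F where "F = (\<lambda>t (p :: (nat \<Rightarrow> nat) \<times> (nat \<Rightarrow> nat)). if restrict (fst p) {0} = (\<lambda>_\<in>{0}. e (0, t)) \<and> restrict (snd p) {0} = (\<lambda>_\<in>{0}. e' (0, t))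
     then rho (fst p) (snd p) * (\<Prod>j\<in>M. Phi j (x j t) (unit_op (restrict (fst p) {j}) (restrict (snd p) {j})) (a j t) (a' j t)) else 0)"
  have eq: "restrict u ({0} \<times> ?T) = e \<longleftrightarrow> (\<forall>t\<in>?T. restrict (sl u t) {0} = (\<lambda>_\<in>{0}. e (0, t)))" if e: "e \<in> eve_basis dA n" for u e
  proof
    assume "restrict u ({0} \<times> ?T) = e"
    then have "e (0,t) = u (0,t)" if "t\<in>?T" for t using that by auto
    then show "\<forall>t\<in>?T. restrict (sl u t) {0} = (\<lambda>_\<in>{0}. e (0, t))" by (auto simp: sl_def fun_eq_iff restrict_def)
  next
    assume h: "\<forall>t\<in>?T. restrict (sl u t) {0} = (\<lambda>_\<in>{0}. e (0, t))"
    show "restrict u ({0} \<times> ?T) = e"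
    proof (rule ext)
      fix p show "restrict u ({0} \<times> ?T) p = e p"
      proof (cases "p \<in> {0} \<times> ?T")
        case True
        then have t: "snd p \<in> ?T" "p = (0, snd p)" by auto
        have "restrict (sl u (snd p)) {0} 0 = (\<lambda>_\<in>{0}. e (0, snd p)) (0::nat)" using bspec[OF h t(1)] by simp
        then have "u (0, snd p) = e (0, snd p)" using t(1) by (simp add: sl_def)
        then show ?thesis using True t(2) by (metis restrict_apply')
      next
        case False
        then show ?thesis using PiE_arb[OF e[unfolded eve_basis_eq] False] by (simp add: restrict_def)
      qed
    qed
  qed
  have prodif: "(\<Prod>t\<in>A. if P t then y t else 0) = (if \<forall>t\<in>A. P t then \<Prod>t\<in>A. y t else 0 :: complex)" if "finite A" for A :: "nat set" and P y
    using that by (induction A rule: finite_induct) auto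
  have summand: "(if restrict u ({0} \<times> ?T) = e \<and> restrict v ({0} \<times> ?T) = e'
      then tensor_pow ?R n rho u v * (\<Prod>j\<in>M. PhiN n bt f j (l j) (unit_op (restrict u ({j} \<times> ?T)) (restrict v ({j} \<times> ?T))) (ou j) (ou' j)) else 0)
    = (if C then \<Prod>t\<in>?T. F t (sl u t, sl v t) else 0)" if uv: "u \<in> ?B" "v \<in> ?B" for u v
  proof -
    have Fp: "(\<Prod>t\<in>?T. F t (sl u t, sl v t)) = (if restrict u ({0} \<times> ?T) = e \<and> restrict v ({0} \<times> ?T) = e' then
      (\<Prod>t\<in>?T. rho (sl u t) (sl v t) * (\<Prod>j\<in>M. Phi j (x j t) (unit_op (restrict (sl u t) {j}) (restrict (sl v t) {j})) (a j t) (a' j t))) else 0)"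
      unfolding F_def fst_conv snd_conv prodif[OF finite_lessThan] eq[OF assms(1)] eq[OF assms(2)] by (simp add: ball_conj_distrib)
    have tp: "tensor_pow ?R n rho u v = (\<Prod>t\<in>?T. rho (sl u t) (sl v t))"
      unfolding tensor_pow_def by (intro prod.cong refl) (simp add: sl_def)
    have "PhiN n bt f j (l j) (unit_op (restrict u ({j} \<times> ?T)) (restrict v ({j} \<times> ?T))) (ou j) (ou' j)
      = (if x j = x' j \<and> f j (x j) = l j then \<Prod>t\<in>?T. Phi j (x j t) (unit_op (restrict (sl u t) {j}) (restrict (sl v t) {j})) (a j t) (a' j t) else 0)" if j: "j\<in>M" for j
    proof -
      have rb: "restrict w ({j} \<times> ?T) \<in> Bj n j" if "w \<in> ?B" for w by (rule restrict_basis[OF that]) (use j in auto)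
      have rs: "(\<lambda>i\<in>{j}. restrict w ({j} \<times> ?T) (i, t)) = restrict (sl w t) {j}" if "t \<in> ?T" for w t
        using that j by (auto simp: sl_def fun_eq_iff restrict_def)
      have "kerN n j (x j) (restrict u ({j} \<times> ?T)) (restrict v ({j} \<times> ?T)) (a j) (a' j)
        = (\<Prod>t\<in>?T. Phi j (x j t) (unit_op (restrict (sl u t) {j}) (restrict (sl v t) {j})) (a j t) (a' j t))"
        unfolding kerN_def by (rule prod.cong[OF refl]) (simp only: rs)
      then show ?thesis unfolding PhiN_unit[OF rb[OF uv(1)] rb[OF uv(2)]] unfolding x_def x'_def a_def a'_def by (simp only:)
    qed
    then have "(\<Prod>j\<in>M. PhiN n bt f j (l j) (unit_op (restrict u ({j} \<times> ?T)) (restrict v ({j} \<times> ?T))) (ou j) (ou' j))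
      = (if C then \<Prod>j\<in>M. \<Prod>t\<in>?T. Phi j (x j t) (unit_op (restrict (sl u t) {j}) (restrict (sl v t) {j})) (a j t) (a' j t) else 0)"
      unfolding C_def using prodif[of M] by simp
    then show ?thesis unfolding Fp tp prod.distrib prod.swap[where A=M and B="?T"] by (simp only: if_split_eq1 if_split_eq2) auto
  qed
  have "apply_maps (?R \<times> ?T) (dims_n dA) (\<lambda>j. {j} \<times> ?T) M ({0} \<times> ?T) (\<lambda>j. PhiN n bt f j (l j)) (tensor_pow ?R n rho) ou e ou' e'
    = (\<Sum>u\<in>?B. \<Sum>v\<in>?B. if C then \<Prod>t\<in>?T. F t (sl u t, sl v t) else 0)"
    unfolding apply_maps_def using summand by (intro sum.cong refl) auto
  also have "\<dots> = (if C then \<Sum>u\<in>?B. \<Sum>v\<in>?B. \<Prod>t\<in>?T. F t (sl u t, sl v t) else 0)" by simp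
  also have "(\<Sum>u\<in>?B. \<Sum>v\<in>?B. \<Prod>t\<in>?T. F t (sl u t, sl v t)) = (\<Sum>s\<in>PiE ?T (\<lambda>_. basis ?R dA). \<Sum>r\<in>PiE ?T (\<lambda>_. basis ?R dA). \<Prod>t\<in>?T. F t (s t, r t))"
  proof -
    have "(\<Sum>u\<in>?B. \<Sum>v\<in>?B. \<Prod>t\<in>?T. F t (sl u t, sl v t)) = (\<Sum>u\<in>?B. \<Sum>r\<in>PiE ?T (\<lambda>_. basis ?R dA). \<Prod>t\<in>?T. F t (sl u t, r t))"
      unfolding sl_def by (rule sum.cong[OF refl], rule sum_basis_pow)
    also have "\<dots> = (\<Sum>s\<in>PiE ?T (\<lambda>_. basis ?R dA). \<Sum>r\<in>PiE ?T (\<lambda>_. basis ?R dA). \<Prod>t\<in>?T. F t (s t, r t))"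
      unfolding sl_def by (rule sum_basis_pow)
    finally show ?thesis .
  qed
  also have "\<dots> = (\<Sum>s\<in>PiE ?T (\<lambda>_. basis ?R dA \<times> basis ?R dA). \<Prod>t\<in>?T. F t (s t))"
    unfolding sum_PiE_Times by (intro sum.cong refl prod.cong) auto
  also have "\<dots> = (\<Prod>t\<in>?T. \<Sum>p\<in>basis ?R dA \<times> basis ?R dA. F t p)" by (rule sum_PiE_prod) (auto intro!: finite_basis)
  also have "\<dots> = Wn n x a e a' e'"
    unfolding Wn_def
  proof (rule prod.cong[OF refl])
    fix t assume t: "t \<in> ?T"
    have "(\<Sum>p\<in>basis ?R dA \<times> basis ?R dA. F t p) = Wl (\<lambda>j. x j t) (\<lambda>j. a j t) (e (0,t)) (\<lambda>j. a' j t) (e' (0,t))"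
      unfolding sum.cartesian_product' Wl_def apply_maps_def F_def fst_conv snd_conv ..
    also have "\<dots> = Wl (colm n M x t) (colm n M a t) (e (0, t)) (colm n M a' t) (e' (0, t))"
      by (rule Wl_cong) (use t in \<open>auto simp: colm_def\<close>)
    finally show "(\<Sum>p\<in>basis ?R dA \<times> basis ?R dA. F t p) = Wl (colm n M x t) (colm n M a t) (e (0, t)) (colm n M a' t) (e' (0, t))" .
  qed
  finally show ?thesis unfolding C_def .
qed

text \<open>The measurement reads the stored word and then applies the POVM chosen by word and
  messages, hence the block form.\<close>

definition DN :: "(nat \<Rightarrow> nat \<Rightarrow> (nat \<Rightarrow> nat) \<times> (nat \<Rightarrow> nat)) \<Rightarrow> (nat \<Rightarrow> (nat \<Rightarrow> nat) \<Rightarrow> (nat \<Rightarrow> nat) \<Rightarrow> nat \<Rightarrow> (nat \<Rightarrow> nat) op) \<Rightarrow> nat \<Rightarrow> (nat \<Rightarrow> nat) \<Rightarrow> nat \<Rightarrow> nat op" where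
  "DN bt DL j l k p q = (if fst (bt j p) = fst (bt j q) then DL j (fst (bt j p)) l k (snd (bt j p)) (snd (bt j q)) else 0)"

lemma colm_restrict: "colm n L (restrict x L) = colm n L x"
  by (auto simp: colm_def restrict_def fun_eq_iff)

lemma Wn_restrict: "Wn n (restrict x M) (restrict a M) e (restrict a' M) e' = Wn n x a e a' e'"
  unfolding Wn_def colm_restrict ..

text \<open>Since words are kept block diagonally, coherences between different words disappear. The
  eavesdropper's operator is the plain sum over the words in the announced bins.\<close>

lemma eve_op_formula:
  assumes bt: "\<And>j. j \<in> M \<Longrightarrow> bij_betw (bt j) {..<dout j} (Xn n j \<times> An n j)"
    and e: "e \<in> eve_basis dA n" "e' \<in> eve_basis dA n" and l: "l \<in> PiE M (\<lambda>j. {..<Mb j})"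
  shows "eve_op m dA rho n dout (PhiN n bt f) (DN bt DL) l kk e e'
    = (\<Sum>x\<in>{x\<in>srcs M N n. bins M f x = l}. Zx n x (\<lambda>j. DL j (x j) l) kk e e')"
proof -
  let ?X = "srcs M N n" and ?A = "srcs M dA' n"
  define G where "G = (\<lambda>x a x' a'. if x = x' \<and> bins M f x = l then Wn n x a e a' e' * (\<Prod>j\<in>M. DL j (x j) l (kk j) (a' j) (a j)) else 0)"
  have "eve_op m dA rho n dout (PhiN n bt f) (DN bt DL) l kk e e'
    = (\<Sum>ou\<in>PiE M (\<lambda>j. {..<dout j}). \<Sum>ou'\<in>PiE M (\<lambda>j. {..<dout j}). G (\<lambda>j\<in>M. fst (bt j (ou j))) (\<lambda>j\<in>M. snd (bt j (ou j))) (\<lambda>j\<in>M. fst (bt j (ou' j))) (\<lambda>j\<in>M. snd (bt j (ou' j))))"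
    unfolding eve_op_def
  proof (intro sum.cong refl)
    fix ou ou'
    let ?x = "\<lambda>j. fst (bt j (ou j))" and ?x' = "\<lambda>j. fst (bt j (ou' j))" and ?a = "\<lambda>j. snd (bt j (ou j))" and ?a' = "\<lambda>j. snd (bt j (ou' j))"
    have c: "(\<forall>j\<in>M. ?x j = ?x' j \<and> f j (?x j) = l j) \<longleftrightarrow> restrict ?x M = restrict ?x' M \<and> bins M f (restrict ?x M) = l"
    proof -
      have "restrict ?x M = restrict ?x' M \<longleftrightarrow> (\<forall>j\<in>M. ?x j = ?x' j)" by (auto simp: fun_eq_iff restrict_def)
      moreover have "bins M f (restrict ?x M) = l \<longleftrightarrow> (\<forall>j\<in>M. f j (?x j) = l j)"
      proof
        assume "\<forall>j\<in>M. f j (?x j) = l j"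
        then show "bins M f (restrict ?x M) = l" using PiE_arb[OF l] by (auto simp: bins_def restrict_def fun_eq_iff)
      qed (auto simp: bins_def)
      ultimately show ?thesis by blast
    qed
    show "apply_maps ({0..m} \<times> {..<n}) (dims_n dA) (\<lambda>j. {j} \<times> {..<n}) M ({0} \<times> {..<n}) (\<lambda>j. PhiN n bt f j (l j)) (tensor_pow {0..m} n rho) ou e ou' e'
        * (\<Prod>j\<in>M. DN bt DL j l (kk j) (ou' j) (ou j)) = G (restrict ?x M) (restrict ?a M) (restrict ?x' M) (restrict ?a' M)"
    proof (cases "\<forall>j\<in>M. ?x j = ?x' j \<and> f j (?x j) = l j")
      case False
      then show ?thesis unfolding apply_maps_pow[OF e] G_def c[symmetric] if_not_P[OF False] by (simp only: mult_zero_left)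
    next
      case True
      have "(\<Prod>j\<in>M. DN bt DL j l (kk j) (ou' j) (ou j)) = (\<Prod>j\<in>M. DL j (restrict ?x M j) l (kk j) (restrict ?a' M j) (restrict ?a M j))"
        using True by (intro prod.cong refl) (simp add: DN_def)
      then show ?thesis unfolding apply_maps_pow[OF e] G_def c[symmetric] Wn_restrict if_P[OF True] by (simp only:)
    qed
  qed
  also have "\<dots> = (\<Sum>x\<in>?X. \<Sum>a\<in>?A. \<Sum>x'\<in>?X. \<Sum>a'\<in>?A. G x a x' a')"
  proof -
    have "(\<Sum>ou\<in>PiE M (\<lambda>j. {..<dout j}). \<Sum>ou'\<in>PiE M (\<lambda>j. {..<dout j}). G (\<lambda>j\<in>M. fst (bt j (ou j))) (\<lambda>j\<in>M. snd (bt j (ou j))) (\<lambda>j\<in>M. fst (bt j (ou' j))) (\<lambda>j\<in>M. snd (bt j (ou' j))))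
      = (\<Sum>ou\<in>PiE M (\<lambda>j. {..<dout j}). \<Sum>x'\<in>?X. \<Sum>a'\<in>?A. G (\<lambda>j\<in>M. fst (bt j (ou j))) (\<lambda>j\<in>M. snd (bt j (ou j))) x' a')"
      unfolding srcs_def by (rule sum.cong[OF refl], rule sum_PiE_split[OF bt])
    also have "\<dots> = (\<Sum>x\<in>?X. \<Sum>a\<in>?A. \<Sum>x'\<in>?X. \<Sum>a'\<in>?A. G x a x' a')"
      unfolding srcs_def by (rule sum_PiE_split[OF bt])
    finally show ?thesis .
  qed
  also have "\<dots> = (\<Sum>x\<in>?X. \<Sum>a\<in>?A. \<Sum>x'\<in>?X. if x' = x then (\<Sum>a'\<in>?A. G x a x a') else 0)"
    by (intro sum.cong refl) (auto simp: G_def)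
  also have "\<dots> = (\<Sum>x\<in>?X. \<Sum>a\<in>?A. \<Sum>a'\<in>?A. G x a x a')" using finite_srcs[of M N n] by simp
  also have "\<dots> = (\<Sum>x\<in>?X. if bins M f x = l then Zx n x (\<lambda>j. DL j (x j) l) kk e e' else 0)"
    unfolding G_def Zx_def by (intro sum.cong refl) auto
  also have "\<dots> = (\<Sum>x\<in>{x\<in>?X. bins M f x = l}. Zx n x (\<lambda>j. DL j (x j) l) kk e e')"
    by (rule sum.inter_filter[symmetric]) (rule finite_srcs, simp)
  finally show ?thesis .
qed

lemma DN_povm:
  assumes bt: "bij_betw (bt j) {..<dout j} (Xn n j \<times> An n j)"
    and psd: "\<And>x k. x \<in> Xn n j \<Longrightarrow> k < Kc \<Longrightarrow> psd (An n j) (DL j x l k)"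
    and comp: "\<And>x b b'. x \<in> Xn n j \<Longrightarrow> b \<in> An n j \<Longrightarrow> b' \<in> An n j \<Longrightarrow> (\<Sum>k<Kc. DL j x l k b b') = (if b = b' then 1 else 0)"
  shows "povm {..<dout j} {..<Kc} (DN bt DL j l)"
  unfolding povm_def
proof (intro conjI ballI)
  have fX: "finite (Xn n j)" by (intro finite_PiE) auto
  have fA: "finite (An n j)" by (intro finite_PiE) auto
  have btm: "fst (bt j p) \<in> Xn n j" "snd (bt j p) \<in> An n j" if "p \<in> {..<dout j}" for p using bij_betw_apply[OF bt that] by (auto simp: mem_Times_iff)
  fix k assume k: "k \<in> {..<Kc}"
  define Q where "Q = (\<lambda>x (g :: (nat \<Rightarrow> nat) \<Rightarrow> (nat \<Rightarrow> nat) \<Rightarrow> complex). \<forall>b\<in>An n j. \<forall>b'\<in>An n j. DL j x l k b b' = (\<Sum>i\<in>An n j. g i b * cnj (g i b')))"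
  have "\<exists>g. Q x g" if x: "x \<in> Xn n j" for x
    by (rule psd_gramE[OF fA psd[OF x]]) (use k in simp, unfold Q_def, blast)
  then have "\<forall>x\<in>Xn n j. \<exists>g. Q x g" by blast
  from bchoice[OF this] obtain g where g: "\<forall>x\<in>Xn n j. Q x (g x)" by blast
  show "psd {..<dout j} (DN bt DL j l k)"
  proof (rule psd_cong[THEN iffD2])
    show "psd {..<dout j} (\<lambda>p p'. \<Sum>x\<in>Xn n j. \<Sum>r\<in>An n j. (if fst (bt j p) = x then g x r (snd (bt j p)) else 0) * cnj (if fst (bt j p') = x then g x r (snd (bt j p')) else 0))"
      by (intro psd_sum[OF fX] psd_gramI) (rule refl)
    fix p p' assume p: "p \<in> {..<dout j}" "p' \<in> {..<dout j}"
    let ?x = "fst (bt j p)"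
    have "(\<Sum>x\<in>Xn n j. \<Sum>r\<in>An n j. (if fst (bt j p) = x then g x r (snd (bt j p)) else 0) * cnj (if fst (bt j p') = x then g x r (snd (bt j p')) else 0))
      = (\<Sum>x\<in>Xn n j. if x = ?x then (if ?x = fst (bt j p') then \<Sum>r\<in>An n j. g ?x r (snd (bt j p)) * cnj (g ?x r (snd (bt j p'))) else 0) else 0)"
      by (intro sum.cong refl) auto
    also have "\<dots> = (if ?x = fst (bt j p') then \<Sum>r\<in>An n j. g ?x r (snd (bt j p)) * cnj (g ?x r (snd (bt j p'))) else 0)"
      using fX btm(1)[OF p(1)] by simp
    also have "\<dots> = DN bt DL j l k p p'"
    proof -
      have "DL j ?x l k (snd (bt j p)) (snd (bt j p')) = (\<Sum>r\<in>An n j. g ?x r (snd (bt j p)) * cnj (g ?x r (snd (bt j p'))))"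
        using bspec[OF g btm(1)[OF p(1)]] btm(2)[OF p(1)] btm(2)[OF p(2)] unfolding Q_def by blast
      then show ?thesis by (simp only: DN_def)
    qed
    finally show "DN bt DL j l k p p' = (\<Sum>x\<in>Xn n j. \<Sum>r\<in>An n j. (if fst (bt j p) = x then g x r (snd (bt j p)) else 0) * cnj (if fst (bt j p') = x then g x r (snd (bt j p')) else 0))" by simp
  qed
next
  have btm: "fst (bt j p) \<in> Xn n j" "snd (bt j p) \<in> An n j" if "p \<in> {..<dout j}" for p using bij_betw_apply[OF bt that] by (auto simp: mem_Times_iff)
  fix p q assume p: "p \<in> {..<dout j}" "q \<in> {..<dout j}"
  have "p = q \<longleftrightarrow> bt j p = bt j q" using bij_betw_imp_inj_on[OF bt] p by (auto dest: inj_onD)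
  then show "(\<Sum>k<Kc. DN bt DL j l k p q) = (if p = q then 1 else 0)"
    using comp[OF btm(1)[OF p(1)] btm(2)[OF p(1)] btm(2)[OF p(2)]]
    by (cases "fst (bt j p) = fst (bt j q)") (simp_all only: DN_def prod_eq_iff if_True if_False sum.neutral_const simp_thms)
qed

end

section \<open>The protocol at fixed block length\<close>

lemma psd_prod:
  fixes X :: "'t \<Rightarrow> 'b op"
  assumes fT: "finite T" and fB: "finite B" and X: "\<And>t. t \<in> T \<Longrightarrow> psd B (X t)"
  shows "psd (PiE T (\<lambda>_. B)) (\<lambda>b b'. \<Prod>t\<in>T. X t (b t) (b' t))"
proof -
  define Q where "Q = (\<lambda>t (g :: 'b \<Rightarrow> 'b \<Rightarrow> complex). \<forall>b\<in>B. \<forall>b'\<in>B. X t b b' = (\<Sum>i\<in>B. g i b * cnj (g i b')))"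
  have "\<exists>g. Q t g" if "t \<in> T" for t
    by (rule psd_gramE[OF fB X[OF that]]) (unfold Q_def, blast)
  then have "\<forall>t\<in>T. \<exists>g. Q t g" by blast
  from bchoice[OF this] obtain g where g: "\<forall>t\<in>T. Q t (g t)" by blast
  show ?thesis
  proof (rule gram_psd[where I="PiE T (\<lambda>_. B)" and g="\<lambda>i b. \<Prod>t\<in>T. g t (i t) (b t)"])
    fix b b' assume b: "b \<in> PiE T (\<lambda>_. B)" "b' \<in> PiE T (\<lambda>_. B)"
    have "(\<Prod>t\<in>T. X t (b t) (b' t)) = (\<Prod>t\<in>T. \<Sum>i\<in>B. g t i (b t) * cnj (g t i (b' t)))"
    proof (rule prod.cong[OF refl])
      fix t assume t: "t \<in> T"
      show "X t (b t) (b' t) = (\<Sum>i\<in>B. g t i (b t) * cnj (g t i (b' t)))"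
        using bspec[OF g t] PiE_mem[OF b(1) t] PiE_mem[OF b(2) t] unfolding Q_def by blast
    qed
    also have "\<dots> = (\<Sum>i\<in>PiE T (\<lambda>_. B). \<Prod>t\<in>T. g t (i t) (b t) * cnj (g t (i t) (b' t)))"
      by (rule sum_PiE_prod[symmetric]) (use fT fB in auto)
    finally show "(\<Prod>t\<in>T. X t (b t) (b' t)) = (\<Sum>i\<in>PiE T (\<lambda>_. B). (\<Prod>t\<in>T. g t (i t) (b t)) * cnj (\<Prod>t\<in>T. g t (i t) (b' t)))"
      unfolding prod.distrib cnj_prod .
  qed
qed

lemma psd_trace_mult:
  assumes fB: "finite B" and X: "psd B X" and Y: "psd B Y"
  shows "Re (\<Sum>x\<in>B. \<Sum>y\<in>B. X x y * Y y x) \<ge> 0"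
proof -
  obtain g where g: "\<And>x y. x\<in>B \<Longrightarrow> y\<in>B \<Longrightarrow> X x y = (\<Sum>i\<in>B. g i x * cnj (g i y))" using psd_gramE[OF fB X] by blast
  have "(\<Sum>x\<in>B. \<Sum>y\<in>B. X x y * Y y x) = (\<Sum>x\<in>B. \<Sum>y\<in>B. \<Sum>i\<in>B. cnj (g i y) * Y y x * g i x)"
    using g by (intro sum.cong refl) (simp add: sum_distrib_left sum_distrib_right mult_ac)
  also have "\<dots> = (\<Sum>i\<in>B. \<Sum>x\<in>B. \<Sum>y\<in>B. cnj (g i y) * Y y x * g i x)" by (rule sum_swap2[symmetric])
  also have "\<dots> = (\<Sum>i\<in>B. \<Sum>y\<in>B. \<Sum>x\<in>B. cnj (g i y) * Y y x * g i x)" by (rule sum.cong[OF refl], rule sum.swap)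
  finally show ?thesis using Y unfolding psd_def by (simp add: sum_nonneg)
qed

text \<open>Hashing gives one block on E for each key and message, whereas the reference state lives
  on messages and E together. The messages are moved from the block index into the operator.\<close>

lemma tn_bound_nest:
  fixes I1 :: "'k set" and I2 :: "'l set" and B :: "'b set"
  assumes fI: "finite I2" and fB: "finite B" and t: "tn_bound (I1 \<times> I2) B Y c"
  shows "tn_bound I1 (I2 \<times> B) (\<lambda>k p q. if fst p = fst q then Y (k, fst p) (snd p) (snd q) else 0) c"
proof -
  obtain P N where h: "\<And>i. i\<in>I1 \<times> I2 \<Longrightarrow> psd B (P i)" "\<And>i. i\<in>I1 \<times> I2 \<Longrightarrow> psd B (N i)"
    "\<And>i x y. i\<in>I1 \<times> I2 \<Longrightarrow> x\<in>B \<Longrightarrow> y\<in>B \<Longrightarrow> Y i x y = P i x y - N i x y"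
    "(\<Sum>i\<in>I1 \<times> I2. Re (op_trace B (P i)) + Re (op_trace B (N i))) \<le> c" using tn_boundE[OF t] by blast
  let ?bd = "\<lambda>P k p q. if fst p = fst q then P (k, fst p) (snd p) (snd q) else 0"
  show ?thesis
  proof (rule tn_boundI[where P="?bd P" and N="?bd N"])
    fix i assume i: "i \<in> I1"
    show "psd (I2 \<times> B) (?bd P i)" "psd (I2 \<times> B) (?bd N i)"
      using h(1,2) i by (intro psd_block[OF fI fB]; simp)+
    fix p q assume "p \<in> I2 \<times> B" "q \<in> I2 \<times> B"
    then show "(if fst p = fst q then Y (i, fst p) (snd p) (snd q) else 0) = ?bd P i p q - ?bd N i p q"
      using h(3) i by (auto simp: mem_Times_iff)
  next
    have "Re (op_trace (I2 \<times> B) (?bd P k)) = (\<Sum>l\<in>I2. Re (op_trace B (P (k, l))))" for P :: "'k \<times> 'l \<Rightarrow> 'b op" and k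
      unfolding op_trace_def sum.cartesian_product' by simp
    then show "(\<Sum>k\<in>I1. Re (op_trace (I2 \<times> B) (?bd P k)) + Re (op_trace (I2 \<times> B) (?bd N k))) \<le> c"
      using h(4) unfolding sum.cartesian_product' sum.distrib by (simp only:)
  qed
qed

text \<open>The union bound: a key tuple different from c is wrong at some player.\<close>

lemma sum_union_bound:
  fixes g :: "('i \<Rightarrow> 'k) \<Rightarrow> real"
  assumes fM: "finite M" and fK: "finite (PiE M C)" and g: "\<And>k. k \<in> PiE M C \<Longrightarrow> g k \<ge> 0" and c: "c \<in> PiE M C"
  shows "g c \<ge> sum g (PiE M C) - (\<Sum>i\<in>M. sum g (PiE M C) - (\<Sum>k\<in>{k\<in>PiE M C. k i = c i}. g k))"
proof -
  let ?K = "PiE M C"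
  have "sum g ?K \<le> (\<Sum>k\<in>?K. (if k = c then g k else 0) + (\<Sum>i\<in>M. if k i = c i then 0 else g k))"
  proof (rule sum_mono)
    fix k assume k: "k \<in> ?K"
    have n: "(\<Sum>i\<in>M. if k i = c i then 0 else g k) \<ge> 0" using g[OF k] by (intro sum_nonneg) auto
    show "g k \<le> (if k = c then g k else 0) + (\<Sum>i\<in>M. if k i = c i then 0 else g k)"
    proof (cases "k = c")
      case False
      then obtain i where i: "i \<in> M" "k i \<noteq> c i" using PiE_ext[OF k c] by blast
      have "(if k i = c i then 0 else g k) \<le> (\<Sum>i\<in>M. if k i = c i then 0 else g k)"
        using g[OF k] by (intro member_le_sum i fM) auto
      then show ?thesis using i False by simp
    qed (use n in simp)
  qed
  also have "\<dots> = g c + (\<Sum>i\<in>M. \<Sum>k\<in>?K. if k i = c i then 0 else g k)"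
  proof -
    have "(\<Sum>k\<in>?K. \<Sum>i\<in>M. if k i = c i then 0 else g k) = (\<Sum>i\<in>M. \<Sum>k\<in>?K. if k i = c i then 0 else g k)" by (rule sum.swap)
    moreover have "(\<Sum>k\<in>?K. if k = c then g k else 0) = g c" using fK c by simp
    ultimately show ?thesis by (simp only: sum.distrib)
  qed
  also have "(\<Sum>i\<in>M. \<Sum>k\<in>?K. if k i = c i then 0 else g k) = (\<Sum>i\<in>M. sum g ?K - (\<Sum>k\<in>{k\<in>?K. k i = c i}. g k))"
  proof (rule sum.cong[OF refl])
    fix i
    have "sum g ?K = (\<Sum>k\<in>?K. (if k i = c i then g k else 0) + (if k i = c i then 0 else g k))" by (rule sum.cong) auto
    then show "(\<Sum>k\<in>?K. if k i = c i then 0 else g k) = sum g ?K - (\<Sum>k\<in>{k\<in>?K. k i = c i}. g k)"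
      unfolding sum.distrib sum.inter_filter[OF fK] by simp
  qed
  finally show ?thesis by simp
qed

context cq_setup
begin

lemma col_tups: assumes "x \<in> srcs M N n" "t < n" shows "(\<lambda>i\<in>M. x i t) \<in> tups M N"
  using colm_mem[OF assms(1) subset_refl] assms(2) PiE_mem[of "colm n M x" "{..<n}" "\<lambda>_. tups M N" t] unfolding colm_apply[OF assms(2), of M x] by blast

lemma finite_An: "finite (An (n::nat) j)" by (intro finite_PiE) auto

lemma finite_eve: "finite (eve_basis dA n)" unfolding eve_basis_eq by (intro finite_PiE) auto

lemma psd_prod_op: assumes "x \<in> srcs M N n" "j \<in> M" shows "psd (An n j) (prod_op n (wA j) x M)"
  unfolding prod_op_def by (rule psd_prod[OF finite_lessThan finite_lessThan psd_wA[OF col_tups[OF assms(1)] assms(2)]]) simp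

lemma psd_prod_opE: assumes "x \<in> srcs M N n" shows "psd (eve_basis dA n) (prod_opE n wE x M)"
  unfolding prod_opE_def eve_basis_eq by (rule psd_prod[OF _ finite_lessThan psd_wE[OF col_tups[OF assms]]]) auto

lemma prod_opE_total: "(\<Sum>x\<in>srcs M N n. op_trace (eve_basis dA n) (prod_opE n wE x M)) = 1"
proof -
  let ?T = "{0::nat} \<times> {..<n}"
  have t: "(\<lambda>i\<in>M. x i (snd p)) = tsx n M x p" if "p \<in> ?T" for x p
    using that colm_apply[of "snd p" n M x] by (simp add: tsx_def mem_Times_iff)
  have "prod_opE n wE x M e e = (\<Prod>p\<in>?T. wE (tsx n M x p) (e p) (e p))" for x e
    unfolding prod_opE_def by (rule prod.cong[OF refl]) (simp only: t)
  then have "(\<Sum>x\<in>srcs M N n. op_trace (eve_basis dA n) (prod_opE n wE x M)) = (\<Sum>x\<in>srcs M N n. \<Sum>e\<in>PiE ?T (\<lambda>_. {..<dA 0}). \<Prod>p\<in>?T. wE (tsx n M x p) (e p) (e p))"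
    by (simp only: op_trace_def eve_basis_eq)
  also have "\<dots> = (\<Sum>x\<in>srcs M N n. \<Prod>p\<in>?T. \<Sum>b<dA 0. wE (tsx n M x p) b b)"
    by (rule sum.cong[OF refl], rule sum_PiE_prod) auto
  also have "\<dots> = (\<Sum>s\<in>PiE ?T (\<lambda>_. tups M N). \<Prod>p\<in>?T. \<Sum>b<dA 0. wE (s p) b b)" by (rule sum_tsx[symmetric])
  also have "\<dots> = (\<Prod>p\<in>?T. \<Sum>y\<in>tups M N. \<Sum>b<dA 0. wE y b b)"
    by (rule sum_PiE_prod) (auto simp: tups_def intro!: finite_PiE)
  also have "\<dots> = 1" using wE_total by (simp add: op_trace_def)
  finally show ?thesis .
qed

lemma Zx_cong: "(\<And>j. j \<in> M \<Longrightarrow> kk j = kk' j) \<Longrightarrow> Zx n x DD kk = Zx n x DD kk'"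
  unfolding Zx_def by (intro ext sum.cong refl arg_cong2[of _ _ _ _ "(*)"] prod.cong) auto

text \<open>The guesses are grouped by their hash value. The failure outcome is given to key 0,
  which completes the POVM.\<close>

definition DL :: "nat \<Rightarrow> (nat \<Rightarrow> (nat \<Rightarrow> nat) \<Rightarrow> nat) \<Rightarrow> ((nat \<Rightarrow> nat \<Rightarrow> nat) \<Rightarrow> nat)
   \<Rightarrow> (nat \<Rightarrow> (nat \<Rightarrow> nat) \<times> (nat \<Rightarrow> nat) \<Rightarrow> (nat \<Rightarrow> nat \<Rightarrow> nat) \<Rightarrow> (nat \<Rightarrow> nat) op) \<Rightarrow> (nat \<Rightarrow> (nat \<Rightarrow> nat) \<times> (nat \<Rightarrow> nat) \<Rightarrow> (nat \<Rightarrow> nat) op)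
   \<Rightarrow> nat \<Rightarrow> (nat \<Rightarrow> nat) \<Rightarrow> (nat \<Rightarrow> nat) \<Rightarrow> nat \<Rightarrow> (nat \<Rightarrow> nat) op" where
  "DL n f F Lam Rm j xj l k = (\<lambda>b b'. (\<Sum>x\<in>{x\<in>srcs M N n. (x j, bins M f x) = (xj, l) \<and> F x = k}. Lam j (xj, l) x b b')
      + (if k = 0 then Rm j (xj, l) b b' else 0))"

lemma DL_psd:
  assumes "\<And>cl x. psd (An n j) (Lam j cl x)" "\<And>cl. psd (An n j) (Rm j cl)"
  shows "psd (An n j) (DL n f F Lam Rm j xj l k)"
  unfolding DL_def
proof (rule psd_add)
  show "psd (An n j) (\<lambda>b b'. \<Sum>x\<in>{x\<in>srcs M N n. (x j, bins M f x) = (xj, l) \<and> F x = k}. Lam j (xj, l) x b b')"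
    by (rule psd_sum) (auto intro: finite_subset[OF _ finite_srcs[of M N n]] assms)
  show "psd (An n j) (\<lambda>b b'. if k = 0 then Rm j (xj, l) b b' else 0)"
    using assms(2)[of "(xj, l)"] psd_zero[of "An n j"] by (cases "k = 0") (simp_all only: if_True if_False simp_thms)
qed

lemma DL_complete:
  assumes F: "F \<in> PiE (srcs M N n) (\<lambda>_. {..<Kc})" and K: "Kc \<ge> (1::nat)"
    and comp: "(\<Sum>x\<in>{x\<in>srcs M N n. (x j, bins M f x) = (xj, l)}. Lam j (xj, l) x b b') + Rm j (xj, l) b b' = (if b = b' then 1 else 0)"
  shows "(\<Sum>k<Kc. DL n f F Lam Rm j xj l k b b') = (if b = b' then 1 else 0)"
proof -
  let ?S = "{x\<in>srcs M N n. (x j, bins M f x) = (xj, l)}"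
  have fS: "finite ?S" by (rule finite_subset[OF _ finite_srcs[of M N n]]) auto
  have "(\<Sum>k<Kc. \<Sum>x\<in>{x\<in>srcs M N n. (x j, bins M f x) = (xj, l) \<and> F x = k}. Lam j (xj, l) x b b') = (\<Sum>k<Kc. \<Sum>x\<in>{x\<in>?S. F x = k}. Lam j (xj, l) x b b')"
    by (intro sum.cong refl) auto
  also have "\<dots> = (\<Sum>x\<in>?S. Lam j (xj, l) x b b')"
    by (rule sum.group[OF fS]) (use F in auto)
  finally show ?thesis unfolding DL_def sum.distrib using comp K by simp
qed

text \<open>Guessing the tuple correctly implies the correct key. The other guesses with the same
  hash, and possibly the failure outcome, only add a positive operator.\<close>

lemma DL_lower:
  assumes j: "j \<in> M" and x: "x \<in> srcs M N n" and L: "\<And>cl x. psd (An n j) (Lam j cl x)" and R: "\<And>cl. psd (An n j) (Rm j cl)"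
  shows "Re (\<Sum>b\<in>An n j. \<Sum>b'\<in>An n j. prod_op n (wA j) x M b b' * Lam j (x j, bins M f x) x b' b)
    \<le> Re (\<Sum>b\<in>An n j. \<Sum>b'\<in>An n j. prod_op n (wA j) x M b b' * DL n f F Lam Rm j (x j) (bins M f x) (F x) b' b)"
proof -
  let ?S = "{y\<in>srcs M N n. (y j, bins M f y) = (x j, bins M f x) \<and> F y = F x}"
  define Y where "Y = (\<lambda>b b'. (\<Sum>y\<in>?S - {x}. Lam j (x j, bins M f x) y b b') + (if F x = 0 then Rm j (x j, bins M f x) b b' else 0))"
  have fS: "finite ?S" by (rule finite_subset[OF _ finite_srcs[of M N n]]) auto
  have "psd (An n j) Y" unfolding Y_def
  proof (rule psd_add)
    show "psd (An n j) (\<lambda>b b'. \<Sum>y\<in>?S - {x}. Lam j (x j, bins M f x) y b b')" by (rule psd_sum) (use fS L in auto)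
    show "psd (An n j) (\<lambda>b b'. if F x = 0 then Rm j (x j, bins M f x) b b' else 0)"
      using R[of "(x j, bins M f x)"] psd_zero[of "An n j"] by (cases "F x = 0") (simp_all only: if_True if_False simp_thms)
  qed
  from psd_trace_mult[OF finite_An psd_prod_op[OF x j] this]
  have p: "0 \<le> Re (\<Sum>b\<in>An n j. \<Sum>b'\<in>An n j. prod_op n (wA j) x M b b' * Y b' b)" .
  have "DL n f F Lam Rm j (x j) (bins M f x) (F x) b' b = Lam j (x j, bins M f x) x b' b + Y b' b" for b b'
    unfolding DL_def Y_def using sum.remove[OF fS, of x "\<lambda>y. Lam j (x j, bins M f x) y b' b"] x by simp
  then show ?thesis using p by (simp add: distrib_left sum.distrib)
qed

text \<open>Agreement fails by at most the sum of the decoding errors. For secrecy, the key of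
  player 1 is compared with the hash of the true words; mass moved between keys is counted where it
  leaves and where it arrives, hence 2 \<epsilon> 1, and the halved trace norm accounts for 2
  eps.\<close>

lemma protocol_exists:
  fixes n Kc :: nat and Mb :: "nat \<Rightarrow> nat" and Rs \<epsilon> :: "nat \<Rightarrow> real" and \<eta> eps :: real
  assumes m: "m \<ge> 1" and K: "Kc \<ge> 1" and Mb: "\<And>j. j \<in> M \<Longrightarrow> real (Mb j) \<le> 2 powr (real n * Rs j)"
    and f: "f \<in> binset M N n Mb" and F: "F \<in> PiE (srcs M N n) (\<lambda>_. {..<Kc})"
    and dec: "\<And>j. j \<in> M \<Longrightarrow> bin_decoder M N n j {..<dA' j} (wA j) f (\<epsilon> j) (Lam j) (Rm j)"
    and pa: "tn_bound ({..<Kc} \<times> PiE M (\<lambda>i. {..<Mb i})) (PiE ({0} \<times> {..<n}) (\<lambda>_. {..<dA 0}))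
       (\<lambda>kl b b'. \<Sum>x\<in>{x\<in>srcs M N n. bins M f x = snd kl}. of_real (hcoef Kc F x (fst kl)) * prod_opE n wE x M b b') \<eta>"
    and e1: "(\<Sum>j\<in>M. \<epsilon> j) \<le> eps" and e2: "\<eta> + 2 * \<epsilon> 1 \<le> 2 * eps"
  shows "ni_protocol m dA rho n Rs eps Kc"
proof -
  have L: "psd (An n j) (Lam j cl x)" and R: "psd (An n j) (Rm j cl)" if "j \<in> M" for j cl x
    using dec[OF that] unfolding bin_decoder_def by blast+
  have comp: "(\<Sum>x\<in>{x\<in>srcs M N n. (x j, bins M f x) = cl}. Lam j cl x b b') + Rm j cl b b' = (if b = b' then 1 else 0)"
    if "j \<in> M" "b \<in> An n j" "b' \<in> An n j" for j cl b b'
    using dec[OF that(1)] that(2,3) unfolding bin_decoder_def by blast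
  have err: "1 - (\<Sum>x\<in>srcs M N n. Re (\<Sum>b\<in>An n j. \<Sum>b'\<in>An n j. prod_op n (wA j) x M b' b * Lam j (x j, bins M f x) x b b')) \<le> \<epsilon> j"
    if "j \<in> M" for j using dec[OF that] unfolding bin_decoder_def by blast
  let ?S = "srcs M N n" and ?E = "eve_basis dA n" and ?L = "msg_set m Mb" and ?KK = "PiE M (\<lambda>_. {..<Kc})"
  have fS: "finite ?S" by (rule finite_srcs) simp
  have fL: "finite ?L" unfolding msg_set_def by (intro finite_PiE) auto
  have fK: "finite ?KK" by (intro finite_PiE) auto
  have m1: "1 \<in> M" using m by simp
  define dout where "dout = (\<lambda>j. card (Xn n j \<times> An n j))"
  have "\<exists>h. bij_betw h {..<dout j} (Xn n j \<times> An n j)" for j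
  proof -
    have "finite (Xn n j \<times> An n j)" by (intro finite_cartesian_product finite_PiE) auto
    from ex_bij_betw_nat_finite[OF this] show ?thesis by (simp add: dout_def atLeast0LessThan)
  qed
  then obtain bt where bt: "\<And>j. bij_betw (bt j) {..<dout j} (Xn n j \<times> An n j)" by metis
  define dl where "dl = DL n f F Lam Rm"
  define Z where "Z = (\<lambda>x kk. Zx n x (\<lambda>j. dl j (x j) (bins M f x)) kk)"
  define a where "a = (\<lambda>x kk. Re (op_trace ?E (Z x kk)))"
  \<comment> \<open>The state of E with player 1 obtaining k, the other keys forgotten; its key is
    the one in the secrecy condition.\<close>
  define A where "A = (\<lambda>x k e e'. \<Sum>kk\<in>{kk\<in>?KK. kk 1 = k}. Z x kk e e')"
  define \<alpha> where "\<alpha> = (\<lambda>x k. Re (op_trace ?E (A x k)))"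
  have dlp: "psd (An n j) (dl j xj l k)" if "j \<in> M" for j xj l k
    unfolding dl_def by (rule DL_psd) (auto intro: L R that)
  have dlc: "(\<Sum>k<Kc. dl j xj l k b b') = (if b = b' then 1 else 0)" if "j \<in> M" "b \<in> An n j" "b' \<in> An n j" for j xj l b b'
    unfolding dl_def by (rule DL_complete[OF F K], rule comp[OF that])
  have Zp: "psd ?E (Z x kk)" if "x \<in> ?S" for x kk unfolding Z_def by (rule Zx_psd[OF that], rule dlp)
  have a0: "a x kk \<ge> 0" if "x \<in> ?S" for x kk unfolding a_def by (rule psd_trace(1)[OF finite_eve Zp[OF that]])
  have tot: "(\<Sum>kk\<in>?KK. Z x kk e e') = prod_opE n wE x M e e'" for x e e'
    unfolding Z_def by (rule Zx_total, rule dlc)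
  have Ap: "psd ?E (A x k)" if "x \<in> ?S" for x k
    unfolding A_def by (rule psd_sum[OF finite_subset[OF _ fK]]) (auto intro: Zp[OF that])
  have \<alpha>a: "\<alpha> x k = (\<Sum>kk\<in>{kk\<in>?KK. kk 1 = k}. a x kk)" for x k
    unfolding \<alpha>_def A_def op_trace_sum Re_sum a_def ..
  have groupK: "(\<Sum>k<Kc. \<Sum>kk\<in>{kk\<in>?KK. kk 1 = k}. h kk) = (\<Sum>kk\<in>?KK. h kk)" for h :: "_ \<Rightarrow> 'v::comm_monoid_add"
    by (rule sum.group[OF fK]) (use m1 in auto)
  have Asum: "(\<Sum>k<Kc. A x k e e') = prod_opE n wE x M e e'" for x e e' unfolding A_def groupK tot ..
  have \<alpha>sum: "(\<Sum>k<Kc. \<alpha> x k) = sum (a x) ?KK" for x unfolding \<alpha>a groupK ..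
  have bL: "bins M f x \<in> ?L" if x: "x \<in> ?S" for x
    unfolding msg_set_def bins_def
  proof (rule PiE_I)
    fix j assume j: "j \<in> M"
    show "(\<lambda>i\<in>M. f i (x i)) j \<in> {..<Mb j}"
      using PiE_mem[OF PiE_mem[OF f[unfolded binset_def] j] PiE_mem[OF x[unfolded srcs_def] j]] j by simp
  next
    fix j assume "j \<notin> M" then show "(\<lambda>i\<in>M. f i (x i)) j = undefined" by (simp only: restrict_apply if_False)
  qed
  have groupL: "(\<Sum>l\<in>?L. \<Sum>x\<in>{x\<in>?S. bins M f x = l}. h x) = (\<Sum>x\<in>?S. h x)" for h :: "_ \<Rightarrow> 'v::comm_monoid_add"
    by (rule sum.group[OF fS fL]) (use bL in auto)
  have Fx: "F x < Kc" if "x \<in> ?S" for x using PiE_mem[OF F that] by simp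
  have asum1: "(\<Sum>x\<in>?S. sum (a x) ?KK) = 1"
  proof -
    have "sum (a x) ?KK = Re (op_trace ?E (prod_opE n wE x M))" for x
    proof -
      have "sum (a x) ?KK = Re (op_trace ?E (\<lambda>e e'. \<Sum>kk\<in>?KK. Z x kk e e'))" unfolding op_trace_sum Re_sum a_def ..
      then show ?thesis unfolding tot .
    qed
    then show ?thesis using arg_cong[OF prod_opE_total[of n], of Re] by (simp only: Re_sum one_complex.sel)
  qed
  have correct: "(\<Sum>x\<in>?S. sum (a x) ?KK - (\<Sum>kk\<in>{kk\<in>?KK. kk j = F x}. a x kk)) \<le> \<epsilon> j" if j: "j \<in> M" for j
  proof -
    have "Re (\<Sum>b\<in>An n j. \<Sum>b'\<in>An n j. prod_op n (wA j) x M b' b * Lam j (x j, bins M f x) x b b') \<le> (\<Sum>kk\<in>{kk\<in>?KK. kk j = F x}. a x kk)"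
      if x: "x \<in> ?S" for x
    proof -
      let ?W = "\<lambda>X. \<Sum>b\<in>An n j. \<Sum>b'\<in>An n j. prod_op n (wA j) x M b b' * X b' b"
      have s1: "(\<Sum>b\<in>An n j. \<Sum>b'\<in>An n j. prod_op n (wA j) x M b' b * Lam j (x j, bins M f x) x b b')
        = ?W (Lam j (x j, bins M f x) x)" by (rule sum.swap)
      have s2: "Re (?W (Lam j (x j, bins M f x) x)) \<le> Re (?W (dl j (x j) (bins M f x) (F x)))"
        unfolding dl_def by (rule DL_lower[OF j x], rule L[OF j], rule R[OF j])
      have s3: "?W (dl j (x j) (bins M f x) (F x)) = (\<Sum>kk\<in>{kk\<in>?KK. kk j = F x}. op_trace ?E (Z x kk))"
        unfolding Z_def
      proof (rule Zx_marginal[where DD="\<lambda>j. dl j (x j) (bins M f x)", OF _ j Fx[OF x], symmetric])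
        fix i b b' assume "i \<in> M" "b \<in> An n i" "b' \<in> An n i"
        then show "(\<Sum>k<Kc. dl i (x i) (bins M f x) k b b') = (if b = b' then 1 else 0)" by (rule dlc)
      qed
      show ?thesis unfolding a_def s1 using s2 unfolding s3 Re_sum .
    qed
    then have "(\<Sum>x\<in>?S. Re (\<Sum>b\<in>An n j. \<Sum>b'\<in>An n j. prod_op n (wA j) x M b' b * Lam j (x j, bins M f x) x b b')) \<le> (\<Sum>x\<in>?S. \<Sum>kk\<in>{kk\<in>?KK. kk j = F x}. a x kk)"
      by (rule sum_mono)
    then show ?thesis using err[OF j] asum1 by (simp only: sum_subtractf)
  qed
  \<comment> \<open>The reference state is the actual state of messages and E, which the choice of
    decoders does not affect.\<close>
  define tau where "tau = (\<lambda>p q. if fst p = fst q then \<Sum>x\<in>{x\<in>?S. bins M f x = fst p}. prod_opE n wE x M (snd p) (snd q) else 0)"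
  let ?Phi = "PhiN n bt f" and ?D = "DN bt dl"
  have eo: "eve_op m dA rho n dout ?Phi ?D l kk e e' = (\<Sum>x\<in>{x\<in>?S. bins M f x = l}. Z x kk e e')" if "l \<in> ?L" "e \<in> ?E" "e' \<in> ?E" for l kk e e'
  proof -
    have "eve_op m dA rho n dout ?Phi ?D l kk e e' = (\<Sum>x\<in>{x\<in>?S. bins M f x = l}. Zx n x (\<lambda>j. dl j (x j) l) kk e e')"
      by (rule eve_op_formula[OF bt that(2,3) that(1)[unfolded msg_set_def]])
    also have "\<dots> = (\<Sum>x\<in>{x\<in>?S. bins M f x = l}. Z x kk e e')" unfolding Z_def by (rule sum.cong[OF refl]) auto
    finally show ?thesis .
  qed
  have "ni_protocol_with m dA rho n Rs eps Kc Mb dout ?Phi ?D tau"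
    unfolding ni_protocol_with_def
  proof (intro conjI ballI)
    show "1 \<le> Kc" by (rule K)
    fix j assume j: "j \<in> M"
    show "real (Mb j) \<le> 2 powr (real n * Rs j)" by (rule Mb[OF j])
    show "instrument (Bj n j) {..<dout j} {..<Mb j} (?Phi j)"
      by (rule PhiN_instrument[OF j], rule bt, rule PiE_mem[OF f[unfolded binset_def] j])
  next
    fix j l assume j: "j \<in> M"
    show "povm {..<dout j} {..<Kc} (?D j l)"
      by (rule DN_povm, rule bt, rule dlp[OF j], rule dlc[OF j])
  next
    have fsub: "finite {x\<in>?S. bins M f x = l}" for l using fS by simp
    have "psd (?L \<times> ?E) tau" unfolding tau_def
      by (rule psd_block[OF fL finite_eve, where P="\<lambda>l e e'. \<Sum>x\<in>{x\<in>?S. bins M f x = l}. prod_opE n wE x M e e'"])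
        (rule psd_sum[OF fsub], rule psd_prod_opE, simp)
    moreover have "op_trace (?L \<times> ?E) tau = 1"
    proof -
      have "op_trace (?L \<times> ?E) tau = (\<Sum>l\<in>?L. op_trace ?E (\<lambda>e e'. \<Sum>x\<in>{x\<in>?S. bins M f x = l}. prod_opE n wE x M e e'))"
        unfolding op_trace_def tau_def sum.cartesian_product' by simp
      then show ?thesis unfolding op_trace_sum groupL prod_opE_total .
    qed
    ultimately show "density (?L \<times> ?E) tau" unfolding density_def using fL finite_eve by simp
  next
    have "Re (\<Sum>l\<in>?L. \<Sum>\<kappa><Kc. op_trace ?E (eve_op m dA rho n dout ?Phi ?D l (\<lambda>_. \<kappa>))) = (\<Sum>l\<in>?L. \<Sum>x\<in>{x\<in>?S. bins M f x = l}. \<Sum>\<kappa><Kc. a x (\<lambda>_. \<kappa>))"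
    proof -
      have "Re (\<Sum>l\<in>?L. \<Sum>\<kappa><Kc. op_trace ?E (eve_op m dA rho n dout ?Phi ?D l (\<lambda>_. \<kappa>)))
        = Re (\<Sum>l\<in>?L. \<Sum>\<kappa><Kc. op_trace ?E (\<lambda>e e'. \<Sum>x\<in>{x\<in>?S. bins M f x = l}. Z x (\<lambda>_. \<kappa>) e e'))"
        by (intro arg_cong[of _ _ Re] sum.cong refl op_trace_cong eo)
      also have "\<dots> = (\<Sum>l\<in>?L. \<Sum>x\<in>{x\<in>?S. bins M f x = l}. \<Sum>\<kappa><Kc. a x (\<lambda>_. \<kappa>))"
        unfolding op_trace_sum Re_sum a_def by (rule sum.cong[OF refl], rule sum.swap)
      finally show ?thesis .
    qed
    also have "\<dots> = (\<Sum>x\<in>?S. \<Sum>\<kappa><Kc. a x (\<lambda>_. \<kappa>))" by (rule groupL)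
    also have "\<dots> \<ge> (\<Sum>x\<in>?S. sum (a x) ?KK - (\<Sum>j\<in>M. sum (a x) ?KK - (\<Sum>kk\<in>{kk\<in>?KK. kk j = F x}. a x kk)))"
    proof (rule sum_mono)
      fix x assume x: "x \<in> ?S"
      let ?c = "\<lambda>_\<in>M. F x"
      have c: "?c \<in> ?KK" using Fx[OF x] by auto
      have "sum (a x) ?KK - (\<Sum>j\<in>M. sum (a x) ?KK - (\<Sum>kk\<in>{kk\<in>?KK. kk j = ?c j}. a x kk)) \<le> a x ?c"
        by (rule sum_union_bound[OF _ fK a0[OF x] c]) simp
      also have "(\<Sum>j\<in>M. sum (a x) ?KK - (\<Sum>kk\<in>{kk\<in>?KK. kk j = ?c j}. a x kk)) = (\<Sum>j\<in>M. sum (a x) ?KK - (\<Sum>kk\<in>{kk\<in>?KK. kk j = F x}. a x kk))"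
        by (rule sum.cong[OF refl]) simp
      also have "a x ?c = a x (\<lambda>_. F x)"
      proof -
        have "Z x ?c = Z x (\<lambda>_. F x)" unfolding Z_def by (rule Zx_cong) simp
        then show ?thesis by (simp only: a_def)
      qed
      also have "\<dots> \<le> (\<Sum>\<kappa><Kc. a x (\<lambda>_. \<kappa>))"
        by (rule member_le_sum[where f="\<lambda>\<kappa>. a x (\<lambda>_. \<kappa>)"]) (use Fx[OF x] a0[OF x] in auto)
      finally show "sum (a x) ?KK - (\<Sum>j\<in>M. sum (a x) ?KK - (\<Sum>kk\<in>{kk\<in>?KK. kk j = F x}. a x kk)) \<le> (\<Sum>\<kappa><Kc. a x (\<lambda>_. \<kappa>))" .
    qed
    moreover have "(\<Sum>x\<in>?S. sum (a x) ?KK - (\<Sum>j\<in>M. sum (a x) ?KK - (\<Sum>kk\<in>{kk\<in>?KK. kk j = F x}. a x kk))) \<ge> 1 - eps"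
    proof -
      have "(\<Sum>x\<in>?S. sum (a x) ?KK - (\<Sum>j\<in>M. sum (a x) ?KK - (\<Sum>kk\<in>{kk\<in>?KK. kk j = F x}. a x kk)))
        = 1 - (\<Sum>x\<in>?S. \<Sum>j\<in>M. sum (a x) ?KK - (\<Sum>kk\<in>{kk\<in>?KK. kk j = F x}. a x kk))"
        by (simp only: sum_subtractf[where A="?S"] asum1)
      moreover have "(\<Sum>x\<in>?S. \<Sum>j\<in>M. sum (a x) ?KK - (\<Sum>kk\<in>{kk\<in>?KK. kk j = F x}. a x kk))
        = (\<Sum>j\<in>M. \<Sum>x\<in>?S. sum (a x) ?KK - (\<Sum>kk\<in>{kk\<in>?KK. kk j = F x}. a x kk))" by (rule sum.swap)
      moreover have "\<dots> \<le> (\<Sum>j\<in>M. \<epsilon> j)" by (rule sum_mono[OF correct])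
      ultimately show ?thesis using e1 by linarith
    qed
    ultimately show "1 - eps \<le> Re (\<Sum>l\<in>?L. \<Sum>\<kappa><Kc. op_trace ?E (eve_op m dA rho n dout ?Phi ?D l (\<lambda>_. \<kappa>)))" by linarith
  next
    let ?I = "{..<Kc} \<times> ?L"
    \<comment> \<open>P is mass that arrives at a wrong key, Q is mass missing from the right key F
      x, and H is the deviation of an ideally computed hash from uniform. Actual minus ideal is H +
      P - Q.\<close>
    define P where "P = (\<lambda>kl e e'. \<Sum>x\<in>{x\<in>?S. bins M f x = snd kl}. if F x = fst kl then 0 else A x (fst kl) e e')"
    define Q where "Q = (\<lambda>kl e e'. \<Sum>x\<in>{x\<in>?S. bins M f x = snd kl}. if F x = fst kl then \<Sum>k\<in>{..<Kc} - {F x}. A x k e e' else 0)"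
    define H where "H = (\<lambda>kl e e'. \<Sum>x\<in>{x\<in>?S. bins M f x = snd kl}. of_real (hcoef Kc F x (fst kl)) * prod_opE n wE x M e e')"
    have fsub: "finite {x\<in>?S. bins M f x = l}" for l using fS by simp
    have Pp: "psd ?E (P kl)" for kl
      unfolding P_def
    proof (rule psd_sum[OF fsub])
      fix x assume "x \<in> {x\<in>?S. bins M f x = snd kl}"
      then show "psd ?E (\<lambda>e e'. if F x = fst kl then 0 else A x (fst kl) e e')"
        using Ap[of x "fst kl"] psd_zero[of ?E] by (cases "F x = fst kl") simp_all
    qed
    have Qp: "psd ?E (Q kl)" for kl
      unfolding Q_def
    proof (rule psd_sum[OF fsub])
      fix x assume x: "x \<in> {x\<in>?S. bins M f x = snd kl}"
      have "psd ?E (\<lambda>e e'. \<Sum>k\<in>{..<Kc} - {F x}. A x k e e')" by (rule psd_sum) (use x Ap in auto)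
      then show "psd ?E (\<lambda>e e'. if F x = fst kl then \<Sum>k\<in>{..<Kc} - {F x}. A x k e e' else 0)"
        using psd_zero[of ?E] by (cases "F x = fst kl") simp_all
    qed
    have \<alpha>off: "(\<Sum>x\<in>?S. \<Sum>k\<in>{..<Kc} - {F x}. \<alpha> x k) \<le> \<epsilon> 1"
    proof -
      have "(\<Sum>k\<in>{..<Kc} - {F x}. \<alpha> x k) = sum (a x) ?KK - (\<Sum>kk\<in>{kk\<in>?KK. kk 1 = F x}. a x kk)" if "x \<in> ?S" for x
        using sum.remove[of "{..<Kc}" "F x" "\<alpha> x"] Fx[OF that] \<alpha>sum[of x] \<alpha>a[of x "F x"] by simp
      then show ?thesis using correct[OF m1] by simp
    qed
    have trP: "Re (op_trace ?E (P kl)) = (\<Sum>x\<in>{x\<in>?S. bins M f x = snd kl}. if F x = fst kl then 0 else \<alpha> x (fst kl))" for kl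
      unfolding P_def op_trace_sum Re_sum \<alpha>_def by (intro sum.cong refl) (simp add: op_trace_def)
    have trQ: "Re (op_trace ?E (Q kl)) = (\<Sum>x\<in>{x\<in>?S. bins M f x = snd kl}. if F x = fst kl then \<Sum>k\<in>{..<Kc} - {F x}. \<alpha> x k else 0)" for kl
      unfolding Q_def op_trace_sum Re_sum
    proof (rule sum.cong[OF refl])
      fix x
      have "Re (op_trace ?E (\<lambda>e e'. \<Sum>k\<in>{..<Kc} - {F x}. A x k e e')) = (\<Sum>k\<in>{..<Kc} - {F x}. \<alpha> x k)"
        unfolding op_trace_sum Re_sum \<alpha>_def ..
      then show "Re (op_trace ?E (\<lambda>e e'. if F x = fst kl then \<Sum>k\<in>{..<Kc} - {F x}. A x k e e' else 0)) = (if F x = fst kl then \<Sum>k\<in>{..<Kc} - {F x}. \<alpha> x k else 0)"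
        by (cases "F x = fst kl") (simp_all add: op_trace_def)
    qed
    have "tn_bound ?I ?E (\<lambda>kl e e'. P kl e e' - Q kl e e') (2 * \<epsilon> 1)"
    proof (rule tn_boundI[where P=P and N=Q])
      have p1: "(\<Sum>k<Kc. \<Sum>l\<in>?L. Re (op_trace ?E (P (k, l)))) \<le> \<epsilon> 1"
      proof -
        have "(\<Sum>k<Kc. \<Sum>l\<in>?L. Re (op_trace ?E (P (k, l)))) = (\<Sum>k<Kc. \<Sum>x\<in>?S. if F x = k then 0 else \<alpha> x k)"
          unfolding trP fst_conv snd_conv groupL ..
        also have "\<dots> = (\<Sum>x\<in>?S. \<Sum>k<Kc. if F x = k then 0 else \<alpha> x k)" by (rule sum.swap)
        also have "\<dots> = (\<Sum>x\<in>?S. \<Sum>k\<in>{..<Kc} - {F x}. \<alpha> x k)"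
          by (intro sum.cong refl sum.mono_neutral_cong_right) auto
        finally show ?thesis using \<alpha>off by simp
      qed
      have q1: "(\<Sum>k<Kc. \<Sum>l\<in>?L. Re (op_trace ?E (Q (k, l)))) \<le> \<epsilon> 1"
      proof -
        have "(\<Sum>k<Kc. \<Sum>l\<in>?L. Re (op_trace ?E (Q (k, l)))) = (\<Sum>k<Kc. \<Sum>x\<in>?S. if F x = k then \<Sum>k\<in>{..<Kc} - {F x}. \<alpha> x k else 0)"
          unfolding trQ fst_conv snd_conv groupL ..
        also have "\<dots> = (\<Sum>x\<in>?S. \<Sum>k<Kc. if F x = k then \<Sum>k\<in>{..<Kc} - {F x}. \<alpha> x k else 0)" by (rule sum.swap)
        also have "\<dots> = (\<Sum>x\<in>?S. \<Sum>k\<in>{..<Kc} - {F x}. \<alpha> x k)"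
          by (rule sum.cong[OF refl]) (simp add: Fx)
        finally show ?thesis using \<alpha>off by simp
      qed
      show "(\<Sum>i\<in>?I. Re (op_trace ?E (P i)) + Re (op_trace ?E (Q i))) \<le> 2 * \<epsilon> 1"
        unfolding sum.distrib sum.cartesian_product' using p1 q1 by linarith
    qed (use Pp Qp in auto)
    from tn_bound_add[OF pa[folded msg_set_def eve_basis_eq H_def] this]
    have tn: "tn_bound ?I ?E (\<lambda>kl e e'. H kl e e' + (P kl e e' - Q kl e e')) (\<eta> + 2 * \<epsilon> 1)" .
    have key: "(\<Sum>kk\<in>{kk\<in>?KK. kk 1 = k}. eve_op m dA rho n dout ?Phi ?D l kk e e') - 1 / of_nat Kc * (\<Sum>x\<in>{x\<in>?S. bins M f x = l}. prod_opE n wE x M e e')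
      = H (k, l) e e' + (P (k, l) e e' - Q (k, l) e e')" if k: "k < Kc" and le: "l \<in> ?L" "e \<in> ?E" "e' \<in> ?E" for k l e e'
    proof -
      have "(\<Sum>kk\<in>{kk\<in>?KK. kk 1 = k}. eve_op m dA rho n dout ?Phi ?D l kk e e') = (\<Sum>x\<in>{x\<in>?S. bins M f x = l}. A x k e e')"
        unfolding eo[OF le] A_def by (rule sum.swap)
      moreover have "A x k e e' - 1 / of_nat Kc * prod_opE n wE x M e e' = of_real (hcoef Kc F x k) * prod_opE n wE x M e e'
         + ((if F x = k then 0 else A x k e e') - (if F x = k then \<Sum>k\<in>{..<Kc} - {F x}. A x k e e' else 0))" for x
      proof (cases "F x = k")
        case True
        have "prod_opE n wE x M e e' = A x k e e' + (\<Sum>k\<in>{..<Kc} - {F x}. A x k e e')"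
          using Asum[of x e e'] sum.remove[of "{..<Kc}" k "\<lambda>k. A x k e e'"] k True by simp
        then show ?thesis using True by (simp add: hcoef_def algebra_simps)
      qed (simp add: hcoef_def)
      ultimately show ?thesis unfolding H_def P_def Q_def fst_conv snd_conv
        by (simp only: sum_distrib_left sum_subtractf[symmetric] sum.distrib[symmetric])
    qed
    have "trace_norm_h ({..<Kc} \<times> (?L \<times> ?E)) (\<lambda>(k, l, e) (k', l', e').
           (if k = k' \<and> l = l' then (\<Sum>kk\<in>{kk\<in>?KK. kk 1 = k}. eve_op m dA rho n dout ?Phi ?D l kk e e') else 0)
           - (if k = k' then 1 / of_nat Kc else 0) * tau (l, e) (l', e')) \<le> \<eta> + 2 * \<epsilon> 1"
    proof (rule tn_bound_trace_norm[OF finite_lessThan finite_cartesian_product[OF fL finite_eve] tn_bound_nest[OF fL finite_eve tn]])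
      fix k k' p q assume k: "k \<in> {..<Kc}" and p: "p \<in> ?L \<times> ?E" "q \<in> ?L \<times> ?E"
      obtain l e l' e' where pq: "p = (l, e)" "q = (l', e')" by (metis surj_pair)
      have "l \<in> ?L" "e \<in> ?E" "e' \<in> ?E" using p pq by auto
      from key[OF _ this, of k] k
      show "(case (k, p) of (k, l, e) \<Rightarrow> \<lambda>(k', l', e').
           (if k = k' \<and> l = l' then (\<Sum>kk\<in>{kk\<in>?KK. kk 1 = k}. eve_op m dA rho n dout ?Phi ?D l kk e e') else 0)
           - (if k = k' then 1 / of_nat Kc else 0) * tau (l, e) (l', e')) (k', q)
        = (if k = k' then if fst p = fst q then H (k, fst p) (snd p) (snd q) + (P (k, fst p) (snd p) (snd q) - Q (k, fst p) (snd p) (snd q)) else 0 else 0)"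
        unfolding pq by (cases "k = k'"; cases "l = l'") (simp_all add: tau_def)
    qed
    then show "trace_norm_h ({..<Kc} \<times> ?L \<times> ?E) (\<lambda>(k, l, e) (k', l', e').
           (if k = k' \<and> l = l' then (\<Sum>kk\<in>{kk\<in>?KK. kk 1 = k}. eve_op m dA rho n dout ?Phi ?D l kk e e') else 0)
           - (if k = k' then 1 / of_nat Kc else 0) * tau (l, e) (l', e')) / 2 \<le> eps" using e2 by simp
  qed
  then show ?thesis unfolding ni_protocol_def by blast
qed

end

section \<open>Achievable rates\<close>

lemma spectral_trace:
  assumes fB: "finite B" and s: "spectral B X lam e"
  shows "op_trace B X = of_real (\<Sum>i\<in>B. lam i)"
proof -
  have "op_trace B X = (\<Sum>x\<in>B. \<Sum>i\<in>B. complex_of_real (lam i) * (cnj (e i x) * e i x))"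
    unfolding op_trace_def using s by (intro sum.cong refl) (simp add: spectral_def mult_ac)
  also have "\<dots> = (\<Sum>i\<in>B. complex_of_real (lam i) * (\<Sum>x\<in>B. cnj (e i x) * e i x))"
    unfolding sum_distrib_left by (rule sum.swap)
  also have "\<dots> = (\<Sum>i\<in>B. complex_of_real (lam i))" using s by (intro sum.cong refl) (simp add: spectral_def)
  finally show ?thesis by simp
qed

lemma binset_nonempty: assumes "\<And>i. i \<in> M \<Longrightarrow> Mb i \<ge> (1::nat)" shows "binset M N n Mb \<noteq> {}"
  unfolding binset_def PiE_eq_empty_iff using assms by (fastforce simp: lessThan_empty_iff)

lemma finite_binset: "finite M \<Longrightarrow> finite (binset M N n Mb)"
  unfolding binset_def by (intro finite_PiE) auto

lemma sqrt_budget: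
  fixes c k :: real assumes c: "c > 0" and k: "k > 0"
  shows "\<exists>\<eta>>0. 2 * sqrt (k * \<eta>) + \<eta> \<le> c"
proof (intro exI conjI)
  let ?e = "min (c / 2) (c\<^sup>2 / (16 * k))"
  show "?e > 0" using assms by simp
  have "k * ?e \<le> k * (c\<^sup>2 / (16 * k))" using k by (intro mult_left_mono) auto
  also have "\<dots> = (c / 4)\<^sup>2" using k by (simp add: power2_eq_square)
  finally have "sqrt (k * ?e) \<le> c / 4" using c by (intro real_le_lsqrt) auto
  then show "2 * sqrt (k * ?e) + ?e \<le> c" by linarith
qed

lemma log_floor_pow_tendsto:
  assumes r: "r \<ge> 0"
  shows "(\<lambda>n. log 2 (real (floor_pow (real n * r))) / real n) \<longlonglongrightarrow> r"
proof (rule real_tendsto_sandwich)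
  show "(\<lambda>n. r - 1 / real n) \<longlonglongrightarrow> r" using tendsto_diff[OF tendsto_const over_n_tendsto[of 1]] by simp
  show "(\<lambda>n::nat. r) \<longlonglongrightarrow> r" by simp
  have b: "real n * r - 1 \<le> log 2 (real (floor_pow (real n * r)))" "log 2 (real (floor_pow (real n * r))) \<le> real n * r" for n
  proof -
    have p: "real (floor_pow (real n * r)) \<ge> 1" "real (floor_pow (real n * r)) \<ge> 2 powr (real n * r) / 2"
      using floor_pow_ge[of "real n * r"] r by simp_all
    have "log 2 (2 powr (real n * r) / 2) \<le> log 2 (real (floor_pow (real n * r)))" using p by simp
    then show "real n * r - 1 \<le> log 2 (real (floor_pow (real n * r)))" by (simp add: log_divide)
    show "log 2 (real (floor_pow (real n * r))) \<le> real n * r" using p(1) floor_pow_le[of "real n * r"] by (subst log_le_iff) auto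
  qed
  show "\<forall>\<^sub>F n in sequentially. r - 1 / real n \<le> log 2 (real (floor_pow (real n * r))) / real n"
    using eventually_gt_at_top[of 0]
  proof eventually_elim
    case (elim n) then show ?case using divide_right_mono[OF b(1)[of n], of "real n"] by (simp add: diff_divide_distrib)
  qed
  show "\<forall>\<^sub>F n in sequentially. log 2 (real (floor_pow (real n * r))) / real n \<le> r"
    using eventually_gt_at_top[of 0]
  proof eventually_elim
    case (elim n) then show ?case using divide_right_mono[OF b(2)[of n], of "real n"] by simp
  qed
qed

lemma ni_protocol_mono:
  assumes "ni_protocol m dA rho n Rs eps Kc" "eps \<le> eps'" shows "ni_protocol m dA rho n Rs eps' Kc"
proof -
  obtain N dout Phi D tau0 where p: "ni_protocol_with m dA rho n Rs eps Kc N dout Phi D tau0"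
    using assms(1) unfolding ni_protocol_def by (elim exE) (rule that)
  have "ni_protocol_with m dA rho n Rs eps' Kc N dout Phi D tau0"
    using p assms(2) unfolding ni_protocol_with_def by (elim conjE, intro conjI) (assumption | linarith)+
  then show ?thesis unfolding ni_protocol_def by (intro exI)
qed

text \<open>Achievability asks for a protocol at every n with one error sequence tending to zero.
  Small n are served by any protocol, and the sequence is built from the infima of the possible
  errors.\<close>

lemma achievable_eventually:
  assumes r: "r \<ge> 0" and ev: "\<And>\<eta>. \<eta> > 0 \<Longrightarrow> \<forall>\<^sub>F n in sequentially. ni_protocol m dA rho n Rs \<eta> (floor_pow (real n * r))"
    and ex: "\<And>n. \<exists>eps. ni_protocol m dA rho n Rs eps (floor_pow (real n * r))"
  shows "achievable m dA rho r"
proof -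
  define A where "A = (\<lambda>n. {e. 0 \<le> e \<and> ni_protocol m dA rho n Rs e (floor_pow (real n * r))})"
  \<comment> \<open>An infimum need not be attained, so a vanishing slack is added.\<close>
  define eps where "eps = (\<lambda>n. Inf (A n) + 1 / real (Suc n))"
  have ne: "A n \<noteq> {}" for n
  proof -
    obtain e where "ni_protocol m dA rho n Rs e (floor_pow (real n * r))" using ex by blast
    then have "max e 0 \<in> A n" unfolding A_def by (auto intro: ni_protocol_mono)
    then show ?thesis by blast
  qed
  have bd: "bdd_below (A n)" for n by (rule bdd_belowI[of _ 0]) (simp add: A_def)
  have I0: "0 \<le> Inf (A n)" for n by (rule cInf_greatest[OF ne]) (simp add: A_def)
  have "ni_protocol m dA rho n Rs (eps n) (floor_pow (real n * r))" for n
  proof -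
    have "Inf (A n) < eps n" by (simp add: eps_def)
    from cInf_lessD[OF ne this] obtain e where "e \<in> A n" "e < eps n" by blast
    then show ?thesis unfolding A_def using ni_protocol_mono[of m dA rho n Rs e _ "eps n"] by simp
  qed
  moreover have "eps \<longlonglongrightarrow> 0"
  proof -
    have "(\<lambda>n. Inf (A n)) \<longlonglongrightarrow> 0"
    proof (rule order_tendstoI)
      fix a :: real assume "a < 0" then show "\<forall>\<^sub>F n in sequentially. a < Inf (A n)" using I0 by (intro always_eventually allI) (rule less_le_trans)
    next
      fix a :: real assume a: "0 < a"
      have "\<forall>\<^sub>F n in sequentially. ni_protocol m dA rho n Rs (a / 2) (floor_pow (real n * r))" using a by (intro ev) simp
      then show "\<forall>\<^sub>F n in sequentially. Inf (A n) < a"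
      proof eventually_elim
        case (elim n)
        then have "a / 2 \<in> A n" using a by (simp add: A_def)
        from cInf_lower[OF this bd] show ?case using a by simp
      qed
    qed
    from tendsto_add[OF this LIMSEQ_inverse_real_of_nat] show ?thesis unfolding eps_def by (simp add: inverse_eq_divide)
  qed
  ultimately show ?thesis unfolding achievable_def using log_floor_pow_tendsto[OF r]
    by (intro exI[of _ Rs] exI[of _ eps] exI[of _ "\<lambda>n. floor_pow (real n * r)"] conjI allI)
qed

context cq_setup
begin

abbreviation "dW \<equiv> w_dims dA dA' N"
abbreviation "om \<equiv> omega_cq m dA Phi rho"

lemma finite_tups: "finite L \<Longrightarrow> finite (tups L N)" unfolding tups_def by (intro finite_PiE) auto

lemma marg_op_trace:
  assumes U: "U \<subseteq> M" and t: "(\<Sum>y\<in>tups M N. op_trace B (w y)) = 1"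
  shows "(\<Sum>y\<in>tups U N. op_trace B (marg_op (tups M N) U w y)) = 1"
proof -
  have "(\<Sum>y\<in>tups U N. op_trace B (marg_op (tups M N) U w y)) = (\<Sum>y\<in>tups U N. \<Sum>z\<in>{z\<in>tups M N. restrict z U = y}. op_trace B (w z))"
    unfolding marg_op_def op_trace_sum ..
  also have "\<dots> = (\<Sum>y\<in>tups M N. op_trace B (w y))"
    by (rule sum.group[OF finite_tups finite_tups]) (use U finite_subset[OF U] in \<open>auto simp: tups_def PiE_iff\<close>)
  finally show ?thesis using t by simp
qed

lemma marg_op_spectral:
  assumes fB: "finite B" and w: "\<And>y. y \<in> tups M N \<Longrightarrow> psd B (w y)" and t: "(\<Sum>y\<in>tups M N. op_trace B (w y)) = 1"
  obtains lam e where "\<And>U y. U \<subseteq> M \<Longrightarrow> y \<in> tups U N \<Longrightarrow> spectral B (marg_op (tups M N) U w y) (lam U y) (e U y)"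
    "\<And>U y k. U \<subseteq> M \<Longrightarrow> y \<in> tups U N \<Longrightarrow> k \<in> B \<Longrightarrow> lam U y k \<ge> 0"
    "\<And>U. U \<subseteq> M \<Longrightarrow> (\<Sum>y\<in>tups U N. \<Sum>k\<in>B. lam U y k) = (1::real)"
proof -
  define sp where "sp = (\<lambda>U y. SOME p. spectral B (marg_op (tups M N) U w y) (fst p) (snd p))"
  have p: "psd B (marg_op (tups M N) U w y)" for U y
    unfolding marg_op_def by (rule psd_sum) (use w in \<open>auto intro: finite_subset[OF _ finite_tups[of M]]\<close>)
  have s: "spectral B (marg_op (tups M N) U w y) (fst (sp U y)) (snd (sp U y))" for U y
  proof -
    obtain lam e where "spectral B (marg_op (tups M N) U w y) lam e" using psd_spectral[OF fB p] by metis
    then have "spectral B (marg_op (tups M N) U w y) (fst (lam, e)) (snd (lam, e))" by simp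
    then show ?thesis unfolding sp_def by (rule someI)
  qed
  have "(\<Sum>y\<in>tups U N. \<Sum>k\<in>B. fst (sp U y) k) = 1" if U: "U \<subseteq> M" for U
  proof -
    have "complex_of_real (\<Sum>y\<in>tups U N. \<Sum>k\<in>B. fst (sp U y) k) = (\<Sum>y\<in>tups U N. op_trace B (marg_op (tups M N) U w y))"
      unfolding spectral_trace[OF fB s] by simp
    then have "complex_of_real (\<Sum>y\<in>tups U N. \<Sum>k\<in>B. fst (sp U y) k) = complex_of_real 1" unfolding marg_op_trace[OF U t] by simp
    then show ?thesis by (simp only: of_real_eq_iff)
  qed
  then show ?thesis using s psd_spectral_nonneg[OF fB p s]
    by (intro that[of "\<lambda>U y. fst (sp U y)" "\<lambda>U y. snd (sp U y)"])
qed

lemma decoders_exist: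
  fixes R :: "nat \<Rightarrow> real" and \<eta> :: real
  assumes j: "j \<in> M" and R0: "\<And>i. i \<in> M \<Longrightarrow> R i \<ge> 0" and eta: "\<eta> > 0"
    and R: "\<And>J. J \<subseteq> M - {j} \<Longrightarrow> J \<noteq> {} \<Longrightarrow> (\<Sum>i\<in>J. R i) > cond_entropy (w_regs m) dW om (RX ` J) (RX ` (M - J) \<union> {RA j})"
  shows "\<forall>\<^sub>F n in sequentially. \<exists>G. (\<forall>f. G f \<ge> (0::real))
    \<and> (\<Sum>f\<in>binset M N n (\<lambda>i. floor_pow (n * R i)). G f) \<le> real (card (binset M N n (\<lambda>i. floor_pow (n * R i)))) * \<eta>
    \<and> (\<forall>f. \<exists>Lam Rm. bin_decoder M N n j {..<dA' j} (wA j) f (2 * sqrt (G f) + \<eta>) Lam Rm)"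
proof -
  obtain lam e where sp: "\<And>U y. U \<subseteq> M \<Longrightarrow> y \<in> tups U N \<Longrightarrow> spectral {..<dA' j} (marg_op (tups M N) U (wA j) y) (lam U y) (e U y)"
    and l0: "\<And>U y k. U \<subseteq> M \<Longrightarrow> y \<in> tups U N \<Longrightarrow> k \<in> {..<dA' j} \<Longrightarrow> lam U y k \<ge> 0"
    and l1: "\<And>U. U \<subseteq> M \<Longrightarrow> (\<Sum>y\<in>tups U N. \<Sum>k\<in>{..<dA' j}. lam U y k) = 1"
    by (rule marg_op_spectral[OF finite_lessThan _ wA_total[OF j]], rule psd_wA[OF _ j], assumption, rule that)
  have S: "subsys_entropy (w_regs m) dW om (RX ` U \<union> {RA j}) = shannon (tups U N \<times> {..<dA' j}) (case_prod (lam U))" if "U \<subseteq> M" for U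
    by (rule entropy_A[OF that j sp[OF that]])
  show ?thesis
  proof (rule decoder_asymp[where lam="\<lambda>J. lam (M - J)" and e="\<lambda>J. e (M - J)"])
    fix J assume J: "J \<subseteq> M - {j}" "J \<noteq> {}"
    have "RX ` J \<union> (RX ` (M - J) \<union> {RA j}) = RX ` M \<union> {RA j}" using J(1) by auto
    then show "(\<Sum>i\<in>J. R i) > shannon (tups (M - {}) N \<times> {..<dA' j}) (case_prod (lam (M - {}))) - shannon (tups (M - J) N \<times> {..<dA' j}) (case_prod (lam (M - J)))"
      using R[OF J] S[of M] S[of "M - J"] unfolding cond_entropy_def by simp
  qed (use j sp l0 l1 R0 eta in auto)
qed

text \<open>Rate 0 is treated apart: with a single key value \<open>hcoef\<close> is zero and
  secrecy is automatic, without any entropy gap. This covers the case where the claimed bound is not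
  positive.\<close>

lemma amplification_exists:
  fixes R :: "nat \<Rightarrow> real" and r \<eta> :: real
  assumes r: "r \<ge> 0" and eta: "\<eta> > 0"
    and gap: "r = 0 \<or> r + (\<Sum>i\<in>M. R i) < cond_entropy (w_regs m) dW om (RX ` M) {RE}"
  shows "\<forall>\<^sub>F n in sequentially. \<forall>f\<in>binset M N n (\<lambda>i. floor_pow (n * R i)). \<exists>F\<in>PiE (srcs M N n) (\<lambda>_. {..<floor_pow (n * r)}).
     tn_bound ({..<floor_pow (n * r)} \<times> PiE M (\<lambda>i. {..<floor_pow (n * R i)})) (PiE ({0} \<times> {..<n}) (\<lambda>_. {..<dA 0}))
     (\<lambda>kl b b'. \<Sum>x\<in>{x\<in>srcs M N n. bins M f x = snd kl}. of_real (hcoef (floor_pow (n * r)) F x (fst kl)) * prod_opE n wE x M b b') \<eta>"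
  using gap
proof
  assume "r = 0"
  then have K: "floor_pow (real n * r) = 1" for n :: nat by (simp add: floor_pow_def)
  have "tn_bound ({..<1} \<times> PiE M (\<lambda>i. {..<floor_pow (n * R i)})) (PiE ({0} \<times> {..<n}) (\<lambda>_. {..<dA 0}))
     (\<lambda>kl b b'. \<Sum>x\<in>{x\<in>srcs M N n. bins M f x = snd kl}. of_real (hcoef 1 (\<lambda>x\<in>srcs M N n. 0) x (fst kl)) * prod_opE n wE x M b b') \<eta>" for n :: nat and f
  proof (rule tn_boundI[where P="\<lambda>_ _ _. 0" and N="\<lambda>_ _ _. 0"])
    fix kl b b' assume "kl \<in> {..<1::nat} \<times> PiE M (\<lambda>i. {..<floor_pow (n * R i)})"
    then have "fst kl = 0" by auto
    then show "(\<Sum>x\<in>{x\<in>srcs M N n. bins M f x = snd kl}. of_real (hcoef 1 (\<lambda>x\<in>srcs M N n. 0) x (fst kl)) * prod_opE n wE x M b b') = 0 - 0"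
      by (simp add: hcoef_def)
  qed (use eta psd_zero in \<open>auto simp: op_trace_def\<close>)
  then show ?thesis unfolding K
    by (intro always_eventually allI ballI bexI[where x="\<lambda>x\<in>srcs M N _. 0"]) auto
next
  assume g: "r + (\<Sum>i\<in>M. R i) < cond_entropy (w_regs m) dW om (RX ` M) {RE}"
  let ?B = "{..<dA 0}" and ?u = "\<lambda>_. undefined :: nat"
  obtain lam e where sp: "\<And>U y. U \<subseteq> M \<Longrightarrow> y \<in> tups U N \<Longrightarrow> spectral ?B (marg_op (tups M N) U wE y) (lam U y) (e U y)"
    and l0: "\<And>U y k. U \<subseteq> M \<Longrightarrow> y \<in> tups U N \<Longrightarrow> k \<in> ?B \<Longrightarrow> lam U y k \<ge> 0"
    and l1: "\<And>U. U \<subseteq> M \<Longrightarrow> (\<Sum>y\<in>tups U N. \<Sum>k\<in>?B. lam U y k) = 1"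
    by (rule marg_op_spectral[OF finite_lessThan _ wE_total], rule psd_wE, assumption, rule that)
  have S: "subsys_entropy (w_regs m) dW om (RX ` U \<union> {RE}) = shannon (tups U N \<times> ?B) (case_prod (lam U))" if "U \<subseteq> M" for U
    by (rule entropy_E[OF that sp[OF that]])
  have t0: "tups {} N = {?u}" by (simp add: tups_def)
  have uM: "marg_op (tups M N) M wE y = wE y" if y: "y \<in> tups M N" for y
  proof -
    have "{z\<in>tups M N. restrict z M = y} = {y}" using y PiE_restrict unfolding tups_def by fastforce
    then show ?thesis by (simp add: marg_op_def fun_eq_iff)
  qed
  have u0: "marg_op (tups M N) {} wE ?u = (\<lambda>b b'. \<Sum>y\<in>tups M N. wE y b b')"
    unfolding marg_op_def by (intro ext sum.cong) (auto simp: restrict_def)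
  have SE: "shannon ({()} \<times> ?B) (\<lambda>(y,k). lam {} ?u k) = shannon (tups {} N \<times> ?B) (case_prod (lam {}))"
    unfolding shannon_def t0 sum.cartesian_product' case_prod_conv by simp
  show ?thesis
  proof (rule hash_asymp[where lam="lam M" and e="e M" and lamE="lam {} ?u" and eE="e {} ?u"])
    show "r + (\<Sum>i\<in>M. R i) < shannon (tups M N \<times> ?B) (case_prod (lam M)) - shannon ({()} \<times> ?B) (\<lambda>(y,k). lam {} ?u k)"
      using g S[of M] S[of "{}"] unfolding cond_entropy_def SE by simp
    show "spectral ?B (\<lambda>b b'. \<Sum>y\<in>tups M N. wE y b b') (lam {} ?u) (e {} ?u)"
      using sp[of "{}" ?u] t0 unfolding u0 by simp
    show "spectral ?B (wE y) (lam M y) (e M y)" if "y \<in> tups M N" for y using sp[OF subset_refl that] unfolding uM[OF that] .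
    show "(\<Sum>k\<in>?B. lam {} ?u k) = 1" using l1[of "{}"] t0 by simp
    show "lam {} ?u k \<ge> 0" if "k \<in> ?B" for k using l0[of "{}" ?u k] t0 that by simp
  qed (use l0 l1 r eta in auto)
qed

text \<open>A protocol with no performance guarantee, whose decoders always declare failure. It
  fills the block lengths before the asymptotic ones begin.\<close>

lemma protocol_some:
  fixes n Kc :: nat
  assumes m: "m \<ge> 1" and K: "Kc \<ge> 1" and Rs: "\<And>i. i \<in> M \<Longrightarrow> Rs i \<ge> 0"
  shows "\<exists>eps. ni_protocol m dA rho n Rs eps Kc"
proof -
  define Mb where "Mb = (\<lambda>i. floor_pow (real n * Rs i))"
  have "binset M N n Mb \<noteq> {}" by (rule binset_nonempty) (unfold Mb_def, intro floor_pow_ge mult_nonneg_nonneg Rs, auto)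
  then obtain f where f: "f \<in> binset M N n Mb" by blast
  define F where "F = (\<lambda>x\<in>srcs M N n. 0::nat)"
  define I where "I = {..<Kc} \<times> PiE M (\<lambda>i. {..<Mb i})"
  let ?S = "\<lambda>kl. {x\<in>srcs M N n. bins M f x = snd kl}"
  define P where "P = (\<lambda>(kl :: nat \<times> (nat \<Rightarrow> nat)) b b'. \<Sum>x\<in>?S kl. of_real (if F x = fst kl then 1 else 0) * prod_opE n wE x M b b')"
  define Q where "Q = (\<lambda>(kl :: nat \<times> (nat \<Rightarrow> nat)) b b'. \<Sum>x\<in>?S kl. of_real (1 / real Kc) * prod_opE n wE x M b b')"
  define \<eta> where "\<eta> = (\<Sum>i\<in>I. Re (op_trace (eve_basis dA n) (P i)) + Re (op_trace (eve_basis dA n) (Q i)))"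
  have fS: "finite (?S kl)" for kl :: "nat \<times> (nat \<Rightarrow> nat)" using finite_srcs[of M N n] by simp
  have pa: "tn_bound I (PiE ({0} \<times> {..<n}) (\<lambda>_. {..<dA 0}))
       (\<lambda>kl b b'. \<Sum>x\<in>?S kl. of_real (hcoef Kc F x (fst kl)) * prod_opE n wE x M b b') \<eta>"
    unfolding eve_basis_eq[symmetric]
  proof (rule tn_boundI[where P=P and N=Q])
    show "psd (eve_basis dA n) (P i)" for i unfolding P_def by (rule psd_sum[OF fS], rule psd_scale[OF psd_prod_opE]) auto
    show "psd (eve_basis dA n) (Q i)" for i unfolding Q_def by (rule psd_sum[OF fS], rule psd_scale[OF psd_prod_opE]) auto
    show "(\<Sum>x\<in>?S i. of_real (hcoef Kc F x (fst i)) * prod_opE n wE x M b b') = P i b b' - Q i b b'" for i b b'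
      unfolding P_def Q_def sum_subtractf[symmetric] hcoef_def by (intro sum.cong refl) (simp add: algebra_simps)
  qed (simp add: \<eta>_def)
  \<comment> \<open>Each decoding error is 1, so agreement needs at least m and secrecy half of
    \<eta> + 2.\<close>
  define eps where "eps = max (real m) ((\<eta> + 2) / 2)"
  have "ni_protocol m dA rho n Rs eps Kc"
  proof (rule protocol_exists[OF m K _ f, where F=F and Lam="\<lambda>_ _ _ _ _. 0" and Rm="\<lambda>_ _ b b'. if b = b' then 1 else 0" and \<epsilon>="\<lambda>_. 1" and \<eta>=\<eta>])
    show "real (Mb j) \<le> 2 powr (real n * Rs j)" for j by (simp add: Mb_def floor_pow_le)
    show "F \<in> PiE (srcs M N n) (\<lambda>_. {..<Kc})" using K by (auto simp: F_def)
    have one: "psd (An n j) (\<lambda>b b'. if b = b' then 1 else 0)" for j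
    proof (rule gram_psd[where I="An n j" and g="\<lambda>i b. if b = i then 1 else 0"])
      fix b b' assume b: "b \<in> An n j"
      have "(\<Sum>i\<in>An n j. (if b = i then 1 else 0) * cnj (if b' = i then 1 else 0)) = (\<Sum>i\<in>An n j. if i = b then (if b = b' then 1 else 0) else 0 :: complex)"
        by (intro sum.cong refl) auto
      then show "(if b = b' then 1 else 0) = (\<Sum>i\<in>An n j. (if b = i then 1 else 0) * cnj (if b' = i then 1 else 0 :: complex))"
        using b finite_An by simp
    qed
    show "bin_decoder M N n j {..<dA' j} (wA j) f 1 (\<lambda>_ _ _ _. 0) (\<lambda>_ b b'. if b = b' then 1 else 0)" for j
      unfolding bin_decoder_def using one psd_zero by simp
    show "(\<Sum>j\<in>M. 1) \<le> eps" "\<eta> + 2 * 1 \<le> 2 * eps" by (auto simp: eps_def max_def)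
  qed (use pa in \<open>auto simp: I_def\<close>)
  then show ?thesis by blast
qed

end

context cq_setup
begin

text \<open>The bounds G of all players are added before averaging over bins, so one binning is good
  for everyone, at the cost of a factor m. The key function is then chosen for that binning.\<close>

lemma protocols_eventually:
  fixes R :: "nat \<Rightarrow> real" and r \<eta> :: real
  assumes m: "m \<ge> 1" and r: "r \<ge> 0" and R0: "\<And>i. i \<in> M \<Longrightarrow> R i \<ge> 0" and eta: "\<eta> > 0"
    and R: "\<And>j J. j \<in> M \<Longrightarrow> J \<subseteq> M - {j} \<Longrightarrow> J \<noteq> {} \<Longrightarrow> (\<Sum>i\<in>J. R i) > cond_entropy (w_regs m) dW om (RX ` J) (RX ` (M - J) \<union> {RA j})"
    and gap: "r = 0 \<or> r + (\<Sum>i\<in>M. R i) < cond_entropy (w_regs m) dW om (RX ` M) {RE}"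
  shows "\<forall>\<^sub>F n in sequentially. ni_protocol m dA rho n R \<eta> (floor_pow (real n * r))"
proof -
  \<comment> \<open>Sized for both demands: m such errors stay below \<eta>, and 2 c \<le> \<eta>,
    so that the secrecy total stays below 2 \<eta>.\<close>
  define c where "c = \<eta> / (2 * real m)"
  have c: "c > 0" using eta m by (simp add: c_def)
  obtain \<theta> where th: "\<theta> > 0" "2 * sqrt (real m * \<theta>) + \<theta> \<le> c" using sqrt_budget[OF c, of "real m"] m by auto
  define bs where "bs = (\<lambda>n::nat. binset M N n (\<lambda>i. floor_pow (n * R i)))"
  define ok where "ok = (\<lambda>n j f G. bin_decoder M N n j {..<dA' j} (wA j) f (2 * sqrt (G f) + \<theta>))"
  define good where "good = (\<lambda>n j G. (\<forall>f. G f \<ge> (0::real)) \<and> sum G (bs n) \<le> real (card (bs n)) * \<theta> \<and> (\<forall>f. \<exists>Lam Rm. ok n j f G Lam Rm))"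
  have "\<forall>\<^sub>F n in sequentially. \<forall>j\<in>M. \<exists>G. good n j G"
  proof (rule eventually_ball_finite, simp, rule ballI)
    fix j assume j: "j \<in> M"
    show "\<forall>\<^sub>F n in sequentially. \<exists>G. good n j G"
      unfolding good_def ok_def bs_def by (rule decoders_exist[OF j R0 th(1) R[OF j]])
  qed
  then show ?thesis using amplification_exists[OF r eta gap]
  proof eventually_elim
    case (elim n)
    let ?Mb = "\<lambda>i. floor_pow (n * R i)"
    from bchoice[OF elim(1)] obtain G where G: "\<forall>j\<in>M. good n j (G j)" by blast
    have "(\<Sum>f\<in>bs n. \<Sum>j\<in>M. G j f) = (\<Sum>j\<in>M. sum (G j) (bs n))" by (rule sum.swap)
    also have "\<dots> \<le> (\<Sum>j\<in>M. real (card (bs n)) * \<theta>)" by (rule sum_mono) (use G in \<open>auto simp: good_def\<close>)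
    finally have "(\<Sum>f\<in>bs n. \<Sum>j\<in>M. G j f) \<le> (real m * \<theta>) * card (bs n)" by (simp add: mult_ac)
    moreover have "finite (bs n)" unfolding bs_def by (rule finite_binset) simp
    moreover have "bs n \<noteq> {}" unfolding bs_def by (rule binset_nonempty, intro floor_pow_ge mult_nonneg_nonneg R0) auto
    ultimately obtain f where f: "f \<in> bs n" "(\<Sum>j\<in>M. G j f) \<le> real m * \<theta>"
      using exists_le_average[of "bs n" "\<lambda>f. \<Sum>j\<in>M. G j f" "real m * \<theta>"] by blast
    have Gf: "G j f \<le> real m * \<theta>" if "j \<in> M" for j
    proof -
      have "G j f \<le> (\<Sum>j\<in>M. G j f)" by (rule member_le_sum[OF that]) (use G in \<open>auto simp: good_def\<close>)
      then show ?thesis using f(2) by linarith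
    qed
    have "\<forall>j\<in>M. \<exists>p. ok n j f (G j) (fst p) (snd p)" using G unfolding good_def by fastforce
    from bchoice[OF this] obtain p where p: "\<forall>j\<in>M. ok n j f (G j) (fst (p j)) (snd (p j))" by blast
    from bspec[OF elim(2) f(1)[unfolded bs_def]] obtain F where F: "F \<in> PiE (srcs M N n) (\<lambda>_. {..<floor_pow (n * r)})"
      and pa: "tn_bound ({..<floor_pow (n * r)} \<times> PiE M (\<lambda>i. {..<?Mb i})) (PiE ({0} \<times> {..<n}) (\<lambda>_. {..<dA 0}))
        (\<lambda>kl b b'. \<Sum>x\<in>{x\<in>srcs M N n. bins M f x = snd kl}. of_real (hcoef (floor_pow (n * r)) F x (fst kl)) * prod_opE n wE x M b b') \<eta>" by blast
    show ?case
    proof (rule protocol_exists[OF m _ _ f(1)[unfolded bs_def] F _ pa, where Lam="\<lambda>j. fst (p j)" and Rm="\<lambda>j. snd (p j)" and \<epsilon>="\<lambda>_. c"])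
      show "1 \<le> floor_pow (real n * r)" using r by (intro floor_pow_ge) simp
      show "real (?Mb j) \<le> 2 powr (real n * R j)" for j by (rule floor_pow_le)
      show "bin_decoder M N n j {..<dA' j} (wA j) f c (fst (p j)) (snd (p j))" if j: "j \<in> M" for j
      proof (rule bin_decoder_mono)
        show "bin_decoder M N n j {..<dA' j} (wA j) f (2 * sqrt (G j f) + \<theta>) (fst (p j)) (snd (p j))" using bspec[OF p j] unfolding ok_def .
        have "2 * sqrt (G j f) + \<theta> \<le> 2 * sqrt (real m * \<theta>) + \<theta>" using Gf[OF j] by simp
        then show "2 * sqrt (G j f) + \<theta> \<le> c" using th(2) by linarith
      qed
      show "(\<Sum>j\<in>M. c) \<le> \<eta>" using m eta by (simp add: c_def)
      have "2 * c \<le> \<eta>" using m eta by (simp add: c_def field_simps)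
      then show "\<eta> + 2 * c \<le> 2 * \<eta>" by simp
    qed
  qed
qed

lemma achievable_rate:
  fixes R :: "nat \<Rightarrow> real" and r :: real
  assumes m: "m \<ge> 1" and r: "r \<ge> 0" and R0: "\<And>i. i \<in> M \<Longrightarrow> R i \<ge> 0"
    and R: "\<And>j J. j \<in> M \<Longrightarrow> J \<subseteq> M - {j} \<Longrightarrow> J \<noteq> {} \<Longrightarrow> (\<Sum>i\<in>J. R i) > cond_entropy (w_regs m) dW om (RX ` J) (RX ` (M - J) \<union> {RA j})"
    and gap: "r = 0 \<or> r + (\<Sum>i\<in>M. R i) < cond_entropy (w_regs m) dW om (RX ` M) {RE}"
  shows "achievable m dA rho r"
proof (rule achievable_eventually[OF r])
  show "\<forall>\<^sub>F n in sequentially. ni_protocol m dA rho n R \<eta> (floor_pow (real n * r))" if "\<eta> > 0" for \<eta>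
    by (rule protocols_eventually[OF m r R0 that R gap])
  show "\<exists>eps. ni_protocol m dA rho n R eps (floor_pow (real n * r))" for n
    by (rule protocol_some[OF m _ R0], intro floor_pow_ge mult_nonneg_nonneg r) simp
qed

text \<open>Needed because \<open>R_CO_cq\<close> is an infimum of reals, from which rate tuples are
  to be extracted. A constant tuple above every conditional entropy lies in the region; the
  constraint for J = {} reads 0 \<ge> 0.\<close>

lemma rate_region_nonempty: "rate_region_cq m dW om \<noteq> {}"
proof -
  let ?ce = "\<lambda>j J. cond_entropy (w_regs m) dW om (RX ` J) (RX ` (M - J) \<union> {RA j})"
  define b where "b = (\<Sum>p\<in>M \<times> Pow M. \<bar>?ce (fst p) (snd p)\<bar>)"
  have b0: "b \<ge> 0" unfolding b_def by (rule sum_nonneg) simp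
  have "(\<lambda>_. b) \<in> rate_region_cq m dW om"
    unfolding rate_region_cq_def
  proof (intro CollectI conjI ballI allI impI)
    fix j J assume j: "j \<in> M" and J: "J \<subseteq> M - {j}"
    show "(\<Sum>i\<in>J. b) \<ge> ?ce j J"
    proof (cases "J = {}")
      case True then show ?thesis by (simp add: cond_entropy_def)
    next
      case False
      have "finite J" using J finite_subset[of J "M - {j}"] by blast
      then have "1 \<le> real (card J)" using False by (simp add: Suc_leI card_gt_0_iff)
      then have "b \<le> (\<Sum>i\<in>J. b)" using mult_right_mono[of 1 "real (card J)" b] b0 by simp
      moreover have "\<bar>?ce (fst (j, J)) (snd (j, J))\<bar> \<le> b"
        unfolding b_def by (rule member_le_sum[of "(j, J)" _ "\<lambda>p. \<bar>?ce (fst p) (snd p)\<bar>"]) (use j J in auto)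
      ultimately show ?thesis unfolding fst_conv snd_conv by linarith
    qed
  qed (use b0 in simp)
  then show ?thesis by blast
qed

text \<open>Adding a positive constant to every rate turns the non-strict constraints of the rate region into
  the strict ones needed for decoding; only the constraints for nonempty J matter.\<close>

lemma region_strict:
  assumes Rv: "Rv \<in> rate_region_cq m dW om" and \<delta>: "\<delta> > 0" and j: "j \<in> M" and J: "J \<subseteq> M - {j}" "J \<noteq> {}"
  shows "(\<Sum>i\<in>J. Rv i + \<delta>) > cond_entropy (w_regs m) dW om (RX ` J) (RX ` (M - J) \<union> {RA j})"
proof -
  have "finite J" using J finite_subset[of J "M - {j}"] by blast
  then have "(\<Sum>i\<in>J. \<delta>) > 0" using J(2) \<delta> by (intro sum_pos) auto
  moreover have "(\<Sum>i\<in>J. Rv i) \<ge> cond_entropy (w_regs m) dW om (RX ` J) (RX ` (M - J) \<union> {RA j})"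
    using Rv j J(1) unfolding rate_region_cq_def by blast
  ultimately show ?thesis unfolding sum.distrib by linarith
qed

lemma region_nonneg: "Rv \<in> rate_region_cq m dW om \<Longrightarrow> i \<in> M \<Longrightarrow> Rv i \<ge> 0"
  unfolding rate_region_cq_def by blast

text \<open>It suffices to reach every rate strictly below the bound. Those not above 0 are
  dominated by the achievable rate 0; for the others, a nearly minimal rate tuple is enlarged
  slightly.\<close>

lemma capacity_bound:
  assumes m: "m \<ge> 1"
  shows "ereal (cond_entropy (w_regs m) dW om (RX ` M) {RE} - R_CO_cq m dW om) \<le> K_ni m dA rho"
proof -
  let ?H = "cond_entropy (w_regs m) dW om (RX ` M) {RE}"
  have sup: "ereal r \<le> K_ni m dA rho" if "achievable m dA rho r" for r
    unfolding K_ni_def by (rule Sup_upper) (use that in simp)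
  have zero: "achievable m dA rho 0"
  proof -
    obtain Rv where Rv: "Rv \<in> rate_region_cq m dW om" using rate_region_nonempty by blast
    show ?thesis
    proof (rule achievable_rate[OF m, where R="\<lambda>i. Rv i + 1"])
      show "0 \<le> Rv i + 1" if "i \<in> M" for i using region_nonneg[OF Rv that] by simp
    qed (use region_strict[OF Rv zero_less_one] in auto)
  qed
  have real_case: "ereal r \<le> K_ni m dA rho" if r: "r < ?H - R_CO_cq m dW om" for r
  proof (cases "r > 0")
    case False
    then show ?thesis using sup[OF zero] by (meson ereal_less_eq(3) not_less order_trans)
  next
    case True
    \<comment> \<open>Half of the gap absorbs the distance of a rate tuple from the infimum, the
      other half the increments that make the rate constraints strict.\<close>
    define \<delta> where "\<delta> = (?H - R_CO_cq m dW om - r) / 2"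
    have \<delta>: "\<delta> > 0" using r by (simp add: \<delta>_def)
    let ?s = "(\<lambda>Rv. \<Sum>j\<in>M. Rv j) ` rate_region_cq m dW om"
    have "Inf ?s < R_CO_cq m dW om + \<delta>" using \<delta> by (simp add: R_CO_cq_def)
    moreover have "?s \<noteq> {}" using rate_region_nonempty by blast
    ultimately obtain Rv where Rv: "Rv \<in> rate_region_cq m dW om" and l: "(\<Sum>j\<in>M. Rv j) < R_CO_cq m dW om + \<delta>"
      using cInf_lessD[of ?s] by blast
    have d: "\<delta> / real m > 0" using \<delta> m by simp
    have "(\<Sum>j\<in>M. Rv j + \<delta> / real m) = (\<Sum>j\<in>M. Rv j) + \<delta>" using m by (simp add: sum.distrib)
    then have g: "r + (\<Sum>j\<in>M. Rv j + \<delta> / real m) < ?H" using l by (simp add: \<delta>_def field_simps)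
    show ?thesis
    proof (rule sup, rule achievable_rate[OF m, where R="\<lambda>i. Rv i + \<delta> / real m"])
      show "0 \<le> Rv i + \<delta> / real m" if "i \<in> M" for i using region_nonneg[OF Rv that] d by linarith
      show "r = 0 \<or> r + (\<Sum>j\<in>M. Rv j + \<delta> / real m) < ?H" using g by blast
    qed (use region_strict[OF Rv d] True in auto)
  qed
  show ?thesis
  proof (rule dense_le)
    fix y assume "y < ereal (?H - R_CO_cq m dW om)"
    then show "y \<le> K_ni m dA rho" using real_case by (cases y) auto
  qed
qed

end

theorem theorem1:
  fixes m :: nat and dA dA' N :: "nat \<Rightarrow> nat"
    and rho :: "(nat \<Rightarrow> nat) op"
    and Phi :: "nat \<Rightarrow> nat \<Rightarrow> (nat \<Rightarrow> nat) op \<Rightarrow> nat op"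
  assumes "m \<ge> 1"
    and "density (basis {0..m} dA) rho"
    and "\<forall>j\<in>{1..m}. instrument (basis {j} dA) {..<dA' j} {..<N j} (Phi j)"
  shows "ereal (cond_entropy (w_regs m) (w_dims dA dA' N) (omega_cq m dA Phi rho) (RX ` {1..m}) {RE}
                - R_CO_cq m (w_dims dA dA' N) (omega_cq m dA Phi rho))
         \<le> K_ni m dA rho"
proof -
  interpret cq_setup m dA dA' N rho Phi by unfold_locales (use assms in auto)
  show ?thesis by (rule capacity_bound[OF assms(1)])
qed

end
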